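(* Suppose that $W$ and $U$ are real-valued $L^\infty(\mathbb{R})$-functions of compact support, and that $W$ is nonnegative. Let $\alpha_0$ be the unique non-positive zero of the function $$f(\alpha) = \alpha + 2\int_{\mathbb{R}} W(x)e^{\alpha|x|}\,dx,\qquad \alpha\in(-\infty,0].$$ For $\varepsilon>0$ let $$\mathcal{H}_\varepsilon = -\frac{d^2}{dx^2}+W(x)+\varepsilon^{-1}U(\varepsilon^{-1}x),\qquad \operatorname{dom}\mathcal{H}_\varepsilon = W_2^2(\mathbb{R}).$$ If $\int_{\mathbb{R}}U\,dx<\alpha_0$, then, for all sufficiently small $\varepsilon>0$, the operator $\mathcal{H}_\varepsilon$ has a unique negative eigenvalue $\lambda_\varepsilon$, and it satisfies the asymptotics $$\lambda_\varepsilon = \lambda + \varepsilon\left(\frac12\psi(0)^2\iint_{\mathbb{R}^2}U(t)|t-\tau|U(\tau)\,d\tau\,dt + \psi(0)\big(\psi'(-0)+\psi'(+0)\big)\int_{\mathbb{R}}tU(t)\,dt\right)+O(\varepsilon^2),\quad \varepsilon\to 0.$$ Here $\psi$ is a real-valued, $L^2(\mathbb{R})$-normalized eigenfunction of $S_\alpha$, with $\alpha=\int_{\mathbb{R}}U\,dx$, corresponding to its unique negative eigenvalue $\lambda$. Moreover, the normalized eigenfunctions $\psi_\varepsilon$ of $\mathcal{H}_\varepsilon$ corresponding to $\lambda_\varepsilon$ can be chosen in such a way that $\psi_\varepsilon\to\psi$ in $L^2(\mathbb{R})$ as $\varepsilon\to0$.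
   Context: $W_2^2$ denotes the $L^2$-based Sobolev space of order 2. For $\alpha\in\mathbb{R}$, $S_\alpha$ is the self-adjoint operator in $L^2(\mathbb{R})$ (the Schrödinger operator $-\frac{d^2}{dx^2}+W(x)+\alpha\delta(x)$) acting by $S_\alpha y=-y''+Wy$ on $\mathbb{R}\setminus\{0\}$ with domain $$\operatorname{dom}S_\alpha=\{y\in W_2^2(\mathbb{R}\setminus\{0\}) : y(+0)=y(-0),\ y'(+0)-y'(-0)=\alpha y(0)\}.$$ Here $y(\pm0)$, $y'(\pm0)$ are one-sided limits at the origin. The function $f$ is monotonically increasing on $(-\infty,0]$, so its non-positive zero $\alpha_0$ is well defined, and for $\alpha<\alpha_0$ the operator $S_\alpha$ has exactly one negative eigenvalue. *)

theory Defs
  imports "HOL-Analysis.Analysis" "HOL-Library.Landau_Symbols"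
begin

section \<open>Function spaces\<close>

text \<open>Elements of Lebesgue and Sobolev spaces are represented by functions; all notions below
  are invariant under modification on a null set.\<close>

definition L2 :: "real set \<Rightarrow> (real \<Rightarrow> 'a::{banach,second_countable_topology}) set" where
  "L2 \<Omega> = {f \<in> borel_measurable (lebesgue_on \<Omega>). integrable (lebesgue_on \<Omega>) (\<lambda>x. (norm (f x))\<^sup>2)}"

definition L2_norm :: "(real \<Rightarrow> 'a::{banach,second_countable_topology}) \<Rightarrow> real" where
  "L2_norm f = sqrt (\<integral>x. (norm (f x))\<^sup>2 \<partial>lebesgue)"

definition Linf_compact_support :: "(real \<Rightarrow> real) \<Rightarrow> bool" where
  "Linf_compact_support V \<longleftrightarrow> V \<in> borel_measurable lebesgue \<and>
     (\<exists>C. AE x in lebesgue. \<bar>V x\<bar> \<le> C) \<and>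
     (\<exists>K. compact K \<and> (AE x in lebesgue. x \<notin> K \<longrightarrow> V x = 0))"

definition test_function :: "real set \<Rightarrow> (real \<Rightarrow> real) \<Rightarrow> bool" where
  "test_function \<Omega> \<phi> \<longleftrightarrow>
     (\<forall>k x. (deriv ^^ k) \<phi> differentiable (at x)) \<and>
     (\<exists>K. compact K \<and> K \<subseteq> \<Omega> \<and> (\<forall>x. x \<notin> K \<longrightarrow> \<phi> x = 0))"

definition is_weak_deriv ::
  "real set \<Rightarrow> nat \<Rightarrow> (real \<Rightarrow> 'a::{banach,second_countable_topology}) \<Rightarrow> (real \<Rightarrow> 'a) \<Rightarrow> bool" where
  "is_weak_deriv \<Omega> k y g \<longleftrightarrow> (\<forall>\<phi>. test_function \<Omega> \<phi> \<longrightarrow>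
     (\<integral>x. (deriv ^^ k) \<phi> x *\<^sub>R y x \<partial>lebesgue_on \<Omega>) =
     (-1) ^ k *\<^sub>R (\<integral>x. \<phi> x *\<^sub>R g x \<partial>lebesgue_on \<Omega>))"

definition W22 :: "real set \<Rightarrow> (real \<Rightarrow> 'a::{banach,second_countable_topology}) set" where
  "W22 \<Omega> = {y \<in> L2 \<Omega>. \<forall>k\<in>{1,2}. \<exists>g\<in>L2 \<Omega>. is_weak_deriv \<Omega> k y g}"

text \<open>The weak derivative is determined up to a null set; the choice of representative is
  immaterial.\<close>

definition weak_deriv ::
  "real set \<Rightarrow> nat \<Rightarrow> (real \<Rightarrow> 'a::{banach,second_countable_topology}) \<Rightarrow> real \<Rightarrow> 'a" where
  "weak_deriv \<Omega> k y = (SOME g. g \<in> L2 \<Omega> \<and> is_weak_deriv \<Omega> k y g)"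

text \<open>One-sided limits \<open>y(+0)\<close>, \<open>y(-0)\<close> of an equivalence class: the limit of any representative
  that has one. It does not depend on the representative, since a null set contains no one-sided
  neighbourhood of 0; for elements of \<open>W22 (- {0})\<close> and their first weak derivatives it is
  attained by the continuous representative on the half-line.\<close>

definition right_limit0 :: "(real \<Rightarrow> 'a::{banach,second_countable_topology}) \<Rightarrow> 'a" where
  "right_limit0 y =
     (THE a. \<exists>z. (AE x in lebesgue. z x = y x) \<and> (z \<longlongrightarrow> a) (at_right 0))"

definition left_limit0 :: "(real \<Rightarrow> 'a::{banach,second_countable_topology}) \<Rightarrow> 'a" where
  "left_limit0 y =
     (THE a. \<exists>z. (AE x in lebesgue. z x = y x) \<and> (z \<longlongrightarrow> a) (at_left 0))"


section \<open>Operators in the Hilbert space of square-integrable functions on the line\<close>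

text \<open>An unbounded operator in complex \<open>L2 UNIV\<close> is a pair of its domain and its action.\<close>

type_synonym L2_operator =
  "(real \<Rightarrow> complex) set \<times> ((real \<Rightarrow> complex) \<Rightarrow> real \<Rightarrow> complex)"

definition eigenfunction :: "L2_operator \<Rightarrow> real \<Rightarrow> (real \<Rightarrow> complex) \<Rightarrow> bool" where
  "eigenfunction T \<mu> y \<longleftrightarrow> y \<in> fst T \<and> \<not> (AE x in lebesgue. y x = 0) \<and>
     (AE x in lebesgue. snd T y x = complex_of_real \<mu> * y x)"

definition eigenvalue :: "L2_operator \<Rightarrow> real \<Rightarrow> bool" where
  "eigenvalue T \<mu> \<longleftrightarrow> (\<exists>y. eigenfunction T \<mu> y)"

definition S_op :: "(real \<Rightarrow> real) \<Rightarrow> real \<Rightarrow> L2_operator" where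
  "S_op W \<alpha> =
     ({y \<in> W22 (- {0}).
         right_limit0 y = left_limit0 y \<and>
         right_limit0 (weak_deriv (- {0}) 1 y) - left_limit0 (weak_deriv (- {0}) 1 y)
           = complex_of_real \<alpha> * right_limit0 y},
      \<lambda>y x. - weak_deriv (- {0}) 2 y x + complex_of_real (W x) * y x)"

definition H_op :: "(real \<Rightarrow> real) \<Rightarrow> (real \<Rightarrow> real) \<Rightarrow> real \<Rightarrow> L2_operator" where
  "H_op W U \<epsilon> =
     (W22 UNIV,
      \<lambda>y x. - weak_deriv UNIV 2 y x
             + complex_of_real (W x + inverse \<epsilon> * U (inverse \<epsilon> * x)) * y x)"

definition f_fun :: "(real \<Rightarrow> real) \<Rightarrow> real \<Rightarrow> real" where
  "f_fun W \<alpha> = \<alpha> + 2 * (\<integral>x. W x * exp (\<alpha> * \<bar>x\<bar>) \<partial>lebesgue)"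

end

theory Submission
  imports Defs
begin

text \<open>
  Fold the line at the origin. For an energy \<open>- \<kappa>\<^sup>2\<close> each of the two half-lines carries, up to a factor, one decaying
  solution \<open>u\<close>, the Jost solution that equals \<open>exp (- \<kappa> * x)\<close> beyond the support of the potential. Its
  quantity \<open>m = - u'(0) / u(0)\<close> contains all the spectral information: \<open>- \<kappa>\<^sup>2\<close> is an eigenvalue of \<open>S\<^sub>\<beta>\<close> if and
  only if \<open>m\<^sub>+ + m\<^sub>- + \<beta> = 0\<close>, and it is an eigenvalue of an ordinary Schroedinger operator
  if and only if this holds with \<open>\<beta> = 0\<close> (\<open>folded_eigenfunction_secular\<close>, \<open>eigenfunction_of_secular\<close>). The passage from
  the Sobolev definitions to this ordinary differential equation is the lemma of du Bois-Reymond (\<open>W22_representative\<close>).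

  The left-hand side is strictly increasing in \<open>\<kappa>\<close> by the Wronskian identity (\<open>mfun_difference\<close>), provided that
  Jost solutions have no zeros. For nonnegative \<open>W\<close> this is clear, and a scaled well of depth \<open>C / \<epsilon>\<close> and width \<open>\<epsilon> * R\<close> is
  too narrow to create a zero when \<open>\<epsilon>\<close> is small (\<open>jost_positive\<close>). So there is at most one negative
  eigenvalue. For \<open>S\<^sub>\<alpha>\<close> one exists because the secular function is at most \<open>f(\<alpha>) / 2 + O(\<kappa>)\<close> near \<open>\<kappa> = 0\<close>
  (\<open>mfun_upper_bound\<close>), which is negative for \<open>\<alpha> < \<alpha>\<^sub>0\<close>, and it is positive for large \<open>\<kappa>\<close> (\<open>mfun_lower_bound\<close>).

  The asymptotics come from the Riccati equation \<open>m' = m\<^sup>2 - q\<close> on the short interval \<open>[0, \<epsilon> R]\<close>. It yields, on each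
  half-line and uniformly for \<open>\<kappa>\<close> in a compact interval,
  \<open>m\<^sub>\<epsilon> = m + \<integral>U - \<epsilon> (\<integral>D\<^sup>2 + 2 m \<integral>D) + O(\<epsilon>\<^sup>2)\<close> with \<open>D(t) = \<integral>\<^sub>t\<^sup>R U\<close> (\<open>half_line_expansion\<close>). The
  perturbed secular function therefore changes sign near the unperturbed root. The
  zeroth-order terms of the two sides add up to the secular function of \<open>S\<^sub>\<alpha>\<close> with \<open>\<alpha> = \<integral>U\<close>. Its derivative with
  respect to \<open>\<kappa>\<^sup>2\<close> at the root is the squared norm of the eigenfunction normalized to \<open>1\<close> at the origin, that is, \<open>1 / \<psi>(0)\<^sup>2\<close>; this gives the shift of the
  root (\<open>perturbed_root_asymptotics\<close>), and the integrals of \<open>D\<close> and \<open>D\<^sup>2\<close> reassemble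
  into the moments of \<open>U\<close> over the line (\<open>full_line_moments\<close>). Finally, the normalized eigenfunctions converge pointwise
  with an exponential majorant, hence in \<open>L2\<close> (\<open>half_ground_convergence\<close>).
\<close>


section \<open>Primitives of integrable functions\<close>

text \<open>Absolute continuity with derivative \<open>f\<close>, expressed by the integrals over subintervals. Solutions of
  \<open>y'' = q y\<close> with a merely bounded \<open>q\<close> are handled through this notion, without
  differentiating \<open>y'\<close> pointwise. Absolute integrability is included because \<open>f\<close> has to stay
  integrable after multiplication by continuous functions.\<close>

definition primitive_on ::
  "real set \<Rightarrow> (real \<Rightarrow> 'a::euclidean_space) \<Rightarrow> (real \<Rightarrow> 'a) \<Rightarrow> bool" where
  "primitive_on S F f \<longleftrightarrow> (\<forall>x\<in>S. \<forall>y\<in>S. x \<le> y \<longrightarrow>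
     f absolutely_integrable_on {x..y} \<and> (f has_integral (F y - F x)) {x..y})"

lemma primitive_onI:
  assumes "\<And>x y. x \<in> S \<Longrightarrow> y \<in> S \<Longrightarrow> x \<le> y \<Longrightarrow> f absolutely_integrable_on {x..y}"
    and "\<And>x y. x \<in> S \<Longrightarrow> y \<in> S \<Longrightarrow> x \<le> y \<Longrightarrow> (f has_integral (F y - F x)) {x..y}"
  shows "primitive_on S F f"
  using assms unfolding primitive_on_def by auto

lemma primitive_onD:
  assumes "primitive_on S F f" "x \<in> S" "y \<in> S" "x \<le> y"
  shows "f absolutely_integrable_on {x..y}" "(f has_integral (F y - F x)) {x..y}"
    "f integrable_on {x..y}" "integral {x..y} f = F y - F x"
  using assms unfolding primitive_on_def by (auto simp: integral_unique has_integral_integrable)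

lemma primitive_on_subset: "primitive_on S F f \<Longrightarrow> T \<subseteq> S \<Longrightarrow> primitive_on T F f"
  unfolding primitive_on_def by (meson subsetD)

lemma primitive_on_const: "primitive_on S (\<lambda>x. c) (\<lambda>x. 0)"
  by (auto simp: primitive_on_def)

lemma primitive_on_add:
  "primitive_on S F f \<Longrightarrow> primitive_on S G g \<Longrightarrow>
    primitive_on S (\<lambda>x. F x + G x) (\<lambda>x. f x + g x)"
  unfolding primitive_on_def
  by (auto simp: add_diff_add intro!: set_integral_add has_integral_add)

lemma primitive_on_linear:
  assumes "bounded_linear h" "primitive_on S F f"
  shows "primitive_on S (\<lambda>x. h (F x)) (\<lambda>x. h (f x))"
proof (rule primitive_onI)
  fix x y assume xy: "x \<in> S" "y \<in> S" "x \<le> y"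
  show "(\<lambda>x. h (f x)) absolutely_integrable_on {x..y}"
    using absolutely_integrable_linear[OF primitive_onD(1)[OF assms(2) xy] assms(1)]
    by (simp add: o_def)
  show "((\<lambda>x. h (f x)) has_integral h (F y) - h (F x)) {x..y}"
    using has_integral_linear[OF primitive_onD(2)[OF assms(2) xy] assms(1)]
    by (simp add: o_def linear_diff bounded_linear.linear assms(1))
qed

lemma primitive_on_scaleR:
  "primitive_on S F f \<Longrightarrow> primitive_on S (\<lambda>x. c *\<^sub>R F x) (\<lambda>x. c *\<^sub>R f x)"
  by (rule primitive_on_linear[OF bounded_linear_scaleR_right])

lemma primitive_on_cmult:
  fixes F f :: "real \<Rightarrow> real"
  shows "primitive_on S F f \<Longrightarrow> primitive_on S (\<lambda>x. c * F x) (\<lambda>x. c * f x)"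
  using primitive_on_scaleR[of S F f c] by simp

lemma primitive_on_minus:
  "primitive_on S F f \<Longrightarrow> primitive_on S (\<lambda>x. - F x) (\<lambda>x. - f x)"
  using primitive_on_scaleR[of S F f "-1"] by simp

lemma primitive_on_diff:
  "primitive_on S F f \<Longrightarrow> primitive_on S G g \<Longrightarrow>
    primitive_on S (\<lambda>x. F x - G x) (\<lambda>x. f x - g x)"
  using primitive_on_add[OF _ primitive_on_minus] by fastforce

lemma primitive_on_cong_AE:
  assumes "primitive_on S F f" "AE x in lebesgue. x \<in> S \<longrightarrow> f x = g x"
    and "is_interval S"
  shows "primitive_on S F g"
proof -
  obtain N where N: "negligible N" "\<And>x. x \<in> S - N \<Longrightarrow> g x = f x"
    using assms(2) unfolding eventually_ae_filter_negligible by fastforce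
  show ?thesis
  proof (rule primitive_onI)
    fix x y assume xy: "x \<in> S" "y \<in> S" "x \<le> y"
    have sub: "{x..y} \<subseteq> S"
      using xy assms(3) by (meson atLeastAtMost_iff mem_is_interval_1_I subsetI)
    show "g absolutely_integrable_on {x..y}"
      by (rule absolutely_integrable_spike[OF primitive_onD(1)[OF assms(1) xy] N(1)])
        (use sub N in auto)
    show "(g has_integral F y - F x) {x..y}"
      by (rule has_integral_spike[OF N(1) _ primitive_onD(2)[OF assms(1) xy]])
        (use sub N in auto)
  qed
qed

lemma primitive_on_cong:
  assumes "primitive_on S F f" "\<And>x. x \<in> S \<Longrightarrow> f x = g x" "\<And>x. x \<in> S \<Longrightarrow> F x = G x"
    and "is_interval S"
  shows "primitive_on S G g"
proof -
  have "primitive_on S F g"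
    using primitive_on_cong_AE[OF assms(1) _ assms(4)] assms(2) by auto
  then show ?thesis
    using assms(3) unfolding primitive_on_def by simp
qed

lemma primitive_on_continuous_cbox:
  assumes "primitive_on {a..b} F f"
  shows "continuous_on {a..b} F"
proof (cases "a \<le> b")
  case True
  have "continuous_on {a..b} (\<lambda>x. F a + integral {a..x} f)"
    by (intro continuous_intros indefinite_integral_continuous_1 primitive_onD(3)[OF assms])
      (use True in auto)
  then show ?thesis
    by (rule continuous_on_eq) (use primitive_onD(4)[OF assms, of a] True in auto)
qed auto

lemma primitive_on_continuous_Ici:
  assumes "primitive_on {a..} F f"
  shows "continuous_on {a..} F"
  unfolding continuous_on_eq_continuous_within
proof
  fix x assume x: "x \<in> {a..}"
  have "continuous_on {a..x+1} F"
    by (rule primitive_on_continuous_cbox[OF primitive_on_subset[OF assms]]) auto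
  then have "continuous (at x within {a..x+1}) F"
    using x by (auto simp: continuous_on_eq_continuous_within)
  moreover have "at x within {a..x+1} = at x within {a..}"
    by (rule at_within_nhd[of _ "{..<x+1}"]) auto
  ultimately show "continuous (at x within {a..}) F" by simp
qed

lemma primitive_on_deriv:
  assumes "primitive_on {a..b} F f" "continuous_on {a..b} f" "x \<in> {a..b}"
  shows "(F has_vector_derivative f x) (at x within {a..b})"
proof -
  have "((\<lambda>x. F a + integral {a..x} f) has_vector_derivative 0 + f x) (at x within {a..b})"
    by (intro derivative_intros integral_has_vector_derivative assms)
  then have "((\<lambda>x. F a + integral {a..x} f) has_vector_derivative f x) (at x within {a..b})"
    by simp
  then show ?thesis
    by (rule has_vector_derivative_transform[rotated 2])
      (use primitive_onD(4)[OF assms(1), of a] assms(3) in auto)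
qed

lemma primitive_on_deriv_at:
  assumes "primitive_on {a..b} F f" "continuous_on {a..b} f" "a < x" "x < b"
  shows "(F has_vector_derivative f x) (at x)"
proof -
  have "at x within {a..b} = at x"
    by (rule at_within_interior) (use assms in auto)
  then show ?thesis
    using primitive_on_deriv[OF assms(1,2), of x] assms(3,4) by auto
qed

lemma primitive_on_of_deriv:
  assumes "\<And>x. x \<in> S \<Longrightarrow> (F has_vector_derivative f x) (at x within S)"
    and "continuous_on S f" and "is_interval S"
  shows "primitive_on S F f"
proof (rule primitive_onI)
  fix x y assume xy: "x \<in> S" "y \<in> S" "x \<le> y"
  have sub: "{x..y} \<subseteq> S"
    using xy assms(3) by (meson atLeastAtMost_iff mem_is_interval_1_I subsetI)
  show "f absolutely_integrable_on {x..y}"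
    by (intro absolutely_integrable_continuous_real continuous_on_subset[OF assms(2) sub])
  show "(f has_integral F y - F x) {x..y}"
    by (intro fundamental_theorem_of_calculus xy has_vector_derivative_within_subset[OF assms(1) sub])
      (use sub in auto)
qed

lemma primitive_on_integral:
  assumes "\<And>x. x \<in> {a..b} \<Longrightarrow> f absolutely_integrable_on {a..b}"
  shows "primitive_on {a..b} (\<lambda>x. integral {a..x} f) f"
proof (rule primitive_onI)
  fix x y assume xy: "x \<in> {a..b}" "y \<in> {a..b}" "x \<le> y"
  have f: "f absolutely_integrable_on {a..b}" using assms xy by blast
  show g: "f absolutely_integrable_on {x..y}"
    by (rule absolutely_integrable_on_subinterval[OF f]) (use xy in auto)
  have "f absolutely_integrable_on {a..y}"
    by (rule absolutely_integrable_on_subinterval[OF f]) (use xy in auto)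
  then have "integral {a..x} f + integral {x..y} f = integral {a..y} f"
    using xy by (intro Henstock_Kurzweil_Integration.integral_combine)
      (auto intro: set_lebesgue_integral_eq_integral)
  then show "(f has_integral integral {a..y} f - integral {a..x} f) {x..y}"
    using g by (metis add_diff_cancel_left' has_integral_integral set_lebesgue_integral_eq_integral(1))
qed

text \<open>Substitution. A negative \<open>c\<close> is admitted because the left half-line is treated by reflection.\<close>

lemma primitive_on_affine:
  assumes "primitive_on S F f" "c \<noteq> 0"
  shows "primitive_on {x. t + c * x \<in> S} (\<lambda>x. F (t + c * x)) (\<lambda>x. c *\<^sub>R f (t + c * x))"
proof (rule primitive_onI)
  fix x y :: real assume xy: "x \<in> {x. t + c * x \<in> S}" "y \<in> {x. t + c * x \<in> S}" "x \<le> y"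
  define l where "l = min (t + c * x) (t + c * y)"
  define r where "r = max (t + c * x) (t + c * y)"
  have lr: "l \<in> S" "r \<in> S" "l \<le> r" using xy by (auto simp: l_def r_def min_def max_def)
  note P = primitive_onD[OF assms(1) lr]
  have iff: "t + c * z \<in> {l..r} \<longleftrightarrow> z \<in> {x..y}" for z
  proof (cases "c > 0")
    case True
    then have "c * x \<le> c * y" using xy by simp
    then show ?thesis using True by (auto simp: l_def r_def min_def max_def)
  next
    case False
    then have c: "c < 0" using assms by simp
    then have "c * x \<ge> c * y" using xy by simp
    then show ?thesis using c by (auto simp: l_def r_def min_def max_def)
  qed
  have ind: "indicat_real {l..r} (t + c * z) = indicat_real {x..y} z" for z
    using iff[of z] by (auto simp: indicator_def)
  have "integrable lebesgue (\<lambda>z. indicator {l..r} z *\<^sub>R f z)"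
    using P(1) by (simp add: set_integrable_def)
  from lebesgue_integrable_real_affine[OF this assms(2), of t]
  have ai: "(\<lambda>z. f (t + c * z)) absolutely_integrable_on {x..y}"
    by (simp add: set_integrable_def ind)
  have "(LINT z:{l..r}|lebesgue. f z) = F r - F l"
    using set_lebesgue_integral_eq_integral[OF P(1)] P(4) by simp
  moreover have "(LINT z:{l..r}|lebesgue. f z)
      = \<bar>c\<bar> *\<^sub>R (LINT z:{x..y}|lebesgue. f (t + c * z))"
    unfolding set_lebesgue_integral_def
    by (subst lebesgue_integral_real_affine[OF assms(2), of _ t]) (simp add: ind)
  ultimately have e: "\<bar>c\<bar> *\<^sub>R integral {x..y} (\<lambda>z. f (t + c * z)) = F r - F l"
    using set_lebesgue_integral_eq_integral[OF ai] by simp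
  have "c *\<^sub>R integral {x..y} (\<lambda>z. f (t + c * z)) = F (t + c * y) - F (t + c * x)"
  proof (cases "c > 0")
    case True
    then have "c * x \<le> c * y" using xy by simp
    then have "l = t + c * x" "r = t + c * y" by (auto simp: l_def r_def)
    then show ?thesis using e True by simp
  next
    case False
    then have c: "c < 0" using assms by simp
    then have "c * x \<ge> c * y" using xy by simp
    then have "r = t + c * x" "l = t + c * y" by (auto simp: l_def r_def)
    then have "- (\<bar>c\<bar> *\<^sub>R integral {x..y} (\<lambda>z. f (t + c * z))) = F (t + c * y) - F (t + c * x)"
      using e by simp
    then show ?thesis using c by simp
  qed
  then show "((\<lambda>z. c *\<^sub>R f (t + c * z)) has_integral F (t + c * y) - F (t + c * x)) {x..y}"
    using has_integral_cmul[OF integrable_integral[OF set_lebesgue_integral_eq_integral(1)[OF ai]], of c]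
    by simp
  show "(\<lambda>z. c *\<^sub>R f (t + c * z)) absolutely_integrable_on {x..y}"
    using ai by (simp add: absolutely_integrable_scaleR_left)
qed

lemma primitive_on_reflect:
  assumes "primitive_on S F f"
  shows "primitive_on {x. - x \<in> S} (\<lambda>x. F (- x)) (\<lambda>x. - f (- x))"
  using primitive_on_affine[OF assms, of "-1" 0] by simp

lemma primitive_on_norm_bound:
  assumes "primitive_on S F f" "x \<in> S" "y \<in> S" "x \<le> y"
    and "\<And>z. z \<in> {x..y} \<Longrightarrow> norm (f z) \<le> B"
  shows "norm (F y - F x) \<le> B * (y - x)"
proof -
  have "0 \<le> B" using order_trans[OF norm_ge_zero assms(5)[of x]] assms(4) by simp
  from has_integral_bound_real[OF this finite.emptyI primitive_onD(2)[OF assms(1-4)]]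
  show ?thesis using assms(4,5) by auto
qed

lemma primitive_on_mono:
  fixes F :: "real \<Rightarrow> real"
  assumes "primitive_on S F f" "x \<in> S" "y \<in> S" "x \<le> y"
    and "\<And>z. z \<in> {x..y} \<Longrightarrow> 0 \<le> f z"
  shows "F x \<le> F y"
  using has_integral_nonneg[OF primitive_onD(2)[OF assms(1-4)]] assms(5) by auto

lemma primitive_on_le:
  fixes F G :: "real \<Rightarrow> real"
  assumes "primitive_on S F f" "primitive_on S G g" "x \<in> S" "y \<in> S" "x \<le> y"
    and "\<And>z. z \<in> {x..y} \<Longrightarrow> f z \<le> g z"
  shows "F y - F x \<le> G y - G x"
  using has_integral_le[OF primitive_onD(2)[OF assms(1,3,4,5)] primitive_onD(2)[OF assms(2,3,4,5)]] 
    assms(6) by auto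


text \<open>The difference \<open>P\<close> between the product and the integral of the expected derivative satisfies
  \<open>norm (P y - P x) \<le> 2 * B * \<bar>\<Gamma> y - \<Gamma> x\<bar> * \<bar>y - x\<bar>\<close> with the continuous primitive \<open>\<Gamma>\<close> of \<open>norm \<circ> g\<close>. So \<open>P\<close> has
  derivative zero everywhere, although neither factor need be differentiable.\<close>

lemma primitive_on_prod:
  fixes F :: "real \<Rightarrow> real" and G :: "real \<Rightarrow> 'a::euclidean_space"
  assumes F: "primitive_on {a..b} F f" and G: "primitive_on {a..b} G g"
    and B: "\<And>x. x \<in> {a..b} \<Longrightarrow> \<bar>f x\<bar> \<le> B"
  shows "primitive_on {a..b} (\<lambda>x. F x *\<^sub>R G x) (\<lambda>x. f x *\<^sub>R G x + F x *\<^sub>R g x)"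
proof (cases "a \<le> b")
  case True
  define h where "h = (\<lambda>x. f x *\<^sub>R G x + F x *\<^sub>R g x)"
  have bil: "bilinear ((*\<^sub>R) :: real \<Rightarrow> 'a \<Rightarrow> 'a)"
    by (simp add: bilinear_conv_bounded_bilinear bounded_bilinear_scaleR)
  have cF: "continuous_on {a..b} F" and cG: "continuous_on {a..b} G"
    using primitive_on_continuous_cbox F G by auto
  have af: "f absolutely_integrable_on {a..b}" and ag: "g absolutely_integrable_on {a..b}"
    using primitive_onD(1)[OF F, of a b] primitive_onD(1)[OF G, of a b] True by auto
  have "(\<lambda>x. f x *\<^sub>R G x) absolutely_integrable_on {a..b}"
    by (intro absolutely_integrable_bounded_measurable_product[OF bil]
        absolutely_integrable_imp_borel_measurable[OF af] absolutely_integrable_continuous_real cG)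
      (use B in \<open>auto simp: bounded_iff intro!: exI[of _ B]\<close>)
  moreover have "(\<lambda>x. F x *\<^sub>R g x) absolutely_integrable_on {a..b}"
    by (intro absolutely_integrable_bounded_measurable_product[OF bil] ag
        compact_imp_bounded compact_continuous_image cF
        absolutely_integrable_imp_borel_measurable absolutely_integrable_continuous_real) auto
  ultimately have ah: "h absolutely_integrable_on {a..b}"
    unfolding h_def by (rule set_integral_add)
  define \<Gamma> where "\<Gamma> = (\<lambda>x. integral {a..x} (\<lambda>x. norm (g x)))"
  have \<Gamma>: "primitive_on {a..b} \<Gamma> (\<lambda>x. norm (g x))"
    unfolding \<Gamma>_def by (intro primitive_on_integral set_integrable_norm ag)
  define H where "H = (\<lambda>x. integral {a..x} h)"
  have H: "primitive_on {a..b} H h"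
    unfolding H_def by (intro primitive_on_integral ah)
  \<comment> \<open>The error of the product rule on a subinterval is its length times an increment that becomes small with it.\<close>
  have key: "norm ((H y - H x) - (F y *\<^sub>R G y - F x *\<^sub>R G x)) \<le> 2 * B * (y - x) * (\<Gamma> y - \<Gamma> x)"
    if xy: "x \<in> {a..b}" "y \<in> {a..b}" "x \<le> y" for x y
  proof -
    note Fx = primitive_onD[OF F xy] and Gx = primitive_onD[OF G xy]
      and Hx = primitive_onD[OF H xy] and \<Gamma>x = primitive_onD[OF \<Gamma> xy]
    let ?e = "\<lambda>s. h s - (f s *\<^sub>R G y + F x *\<^sub>R g s)"
    have "((\<lambda>s. f s *\<^sub>R G y + F x *\<^sub>R g s) has_integral
        (F y - F x) *\<^sub>R G y + F x *\<^sub>R (G y - G x)) {x..y}"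
      by (intro has_integral_add has_integral_scaleR_left has_integral_cmul Fx Gx)
    from has_integral_diff[OF Hx(2) this]
    have e: "(?e has_integral (H y - H x) - (F y *\<^sub>R G y - F x *\<^sub>R G x)) {x..y}"
      by (simp add: algebra_simps)
    have b: "((\<lambda>s. B * (\<Gamma> y - \<Gamma> x) + B * (y - x) * norm (g s)) has_integral
        B * (\<Gamma> y - \<Gamma> x) * (y - x) + B * (y - x) * (\<Gamma> y - \<Gamma> x)) {x..y}"
      using has_integral_const_real[of "B * (\<Gamma> y - \<Gamma> x)" x y] xy
      by (intro has_integral_add has_integral_mult_right \<Gamma>x) (auto simp: mult_ac)
    have B0: "0 \<le> B" using B[of x] xy by fastforce
    have "norm (?e s) \<le> B * (\<Gamma> y - \<Gamma> x) + B * (y - x) * norm (g s)" if s: "s \<in> {x..y}" for s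
    proof -
      have s': "s \<in> {a..b}" using s xy by auto
      have 1: "norm (G y - G s) \<le> \<Gamma> y - \<Gamma> x"
      proof -
        have "norm (integral {s..y} g) \<le> integral {s..y} (\<lambda>s. norm (g s))"
          using primitive_onD(3)[OF G s' xy(2)] primitive_onD(3)[OF \<Gamma> s' xy(2)] s
          by (intro integral_norm_bound_integral) auto
        also have "\<dots> = \<Gamma> y - \<Gamma> s" using primitive_onD(4)[OF \<Gamma> s' xy(2)] s by auto
        also have "\<dots> \<le> \<Gamma> y - \<Gamma> x"
          using primitive_on_mono[OF \<Gamma> xy(1) s'] s by auto
        finally show ?thesis using primitive_onD(4)[OF G s' xy(2)] s by auto
      qed
      have "norm (F s - F x) \<le> B * (s - x)"
        by (rule primitive_on_norm_bound[OF F xy(1) s']) (use B s xy in auto)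
      also have "\<dots> \<le> B * (y - x)"
        using s B0 by (intro mult_left_mono) auto
      finally have 2: "\<bar>F s - F x\<bar> \<le> B * (y - x)" by simp
      have "?e s = f s *\<^sub>R (G s - G y) + (F s - F x) *\<^sub>R g s"
        by (simp add: h_def algebra_simps)
      also have "norm \<dots> \<le> \<bar>f s\<bar> * norm (G s - G y) + \<bar>F s - F x\<bar> * norm (g s)"
        by (rule order_trans[OF norm_triangle_ineq]) simp
      also have "\<dots> \<le> B * (\<Gamma> y - \<Gamma> x) + B * (y - x) * norm (g s)"
        by (intro add_mono mult_mono B[OF s'] 2)
          (use 1 B0 xy in \<open>auto simp: norm_minus_commute\<close>)
      finally show ?thesis .
    qed
    then have "norm ((H y - H x) - (F y *\<^sub>R G y - F x *\<^sub>R G x))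
        \<le> B * (\<Gamma> y - \<Gamma> x) * (y - x) + B * (y - x) * (\<Gamma> y - \<Gamma> x)"
      using integral_norm_bound_integral[of ?e "{x..y}"] e b
      by (metis (no_types, lifting) has_integral_integrable integral_unique)
    then show ?thesis by (simp add: algebra_simps)
  qed
  define P where "P = (\<lambda>x. F x *\<^sub>R G x - H x)"
  have key2: "norm (P y - P x) \<le> 2 * B * \<bar>\<Gamma> y - \<Gamma> x\<bar> * \<bar>y - x\<bar>"
    if xy: "x \<in> {a..b}" "y \<in> {a..b}" for x y
  proof (cases "x \<le> y")
    case True
    have "norm (P y - P x) = norm ((H y - H x) - (F y *\<^sub>R G y - F x *\<^sub>R G x))"
      by (subst norm_minus_commute) (simp add: P_def algebra_simps)
    also have "\<dots> \<le> 2 * B * (y - x) * (\<Gamma> y - \<Gamma> x)" by (rule key[OF xy True])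
    finally show ?thesis
      using True primitive_on_mono[OF \<Gamma> xy True] by (simp add: algebra_simps)
  next
    case False
    have "norm (P y - P x) = norm ((H x - H y) - (F x *\<^sub>R G x - F y *\<^sub>R G y))"
      by (simp add: P_def algebra_simps)
    also have "\<dots> \<le> 2 * B * (x - y) * (\<Gamma> x - \<Gamma> y)" by (rule key) (use xy False in auto)
    finally show ?thesis
      using False primitive_on_mono[OF \<Gamma> xy(2,1)] by (simp add: algebra_simps)
  qed
  have "(P has_derivative (\<lambda>_. 0)) (at x within {a..b})" if x: "x \<in> {a..b}" for x
    unfolding has_derivative_within
  proof
    have "((\<lambda>y. 2 * B * \<bar>\<Gamma> y - \<Gamma> x\<bar>) \<longlongrightarrow> 2 * B * \<bar>\<Gamma> x - \<Gamma> x\<bar>) (at x within {a..b})"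
      using primitive_on_continuous_cbox[OF \<Gamma>] x
      by (intro tendsto_intros) (simp add: continuous_on_def)
    then have "((\<lambda>y. 2 * B * \<bar>\<Gamma> y - \<Gamma> x\<bar>) \<longlongrightarrow> 0) (at x within {a..b})" by simp
    then show "((\<lambda>y. (1 / norm (y - x)) *\<^sub>R (P y - (P x + 0))) \<longlongrightarrow> 0) (at x within {a..b})"
    proof (rule Lim_null_comparison[rotated])
      show "\<forall>\<^sub>F y in at x within {a..b}. norm ((1 / norm (y - x)) *\<^sub>R (P y - (P x + 0)))
          \<le> 2 * B * \<bar>\<Gamma> y - \<Gamma> x\<bar>"
        unfolding eventually_at_filter
        by (intro always_eventually) (use key2[OF x] in \<open>auto simp: divide_simps\<close>)
    qed
  qed auto
  then obtain c where c: "\<And>x. x \<in> {a..b} \<Longrightarrow> P x = c"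
    using has_derivative_zero_constant[of "{a..b}" P] by (auto intro: convex_real_interval)
  have "primitive_on {a..b} (\<lambda>x. H x + c) (\<lambda>x. h x + 0)"
    by (intro primitive_on_add H primitive_on_const)
  then have "primitive_on {a..b} (\<lambda>x. F x *\<^sub>R G x) h"
    by (rule primitive_on_cong) (use c in \<open>auto simp: P_def algebra_simps is_interval_cc\<close>)
  then show ?thesis by (simp add: h_def)
qed (auto simp: primitive_on_def)

lemma primitive_on_mult:
  fixes F G :: "real \<Rightarrow> real"
  assumes F: "primitive_on {a..b} F f" and G: "primitive_on {a..b} G g"
    and f: "continuous_on {a..b} f"
  shows "primitive_on {a..b} (\<lambda>x. F x * G x) (\<lambda>x. f x * G x + F x * g x)"
proof -
  have "bounded (f ` {a..b})"
    by (intro compact_imp_bounded compact_continuous_image f) auto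
  then obtain B where "\<And>x. x \<in> {a..b} \<Longrightarrow> \<bar>f x\<bar> \<le> B"
    unfolding bounded_iff by (metis imageI real_norm_def)
  from primitive_on_prod[OF F G this] show ?thesis by simp
qed

text \<open>The function \<open>exp (K * x) * (A + K * integral {x..b} h)\<close> is nondecreasing in \<open>x\<close>, because its derivative
  is \<open>K * exp (K * x)\<close> times the slack in the hypothesis. Initial data sit at the right end point, where
  the decaying solutions are known explicitly.\<close>

lemma gronwall_backward:
  fixes h :: "real \<Rightarrow> real"
  assumes h: "continuous_on {a..b} h" and K: "0 \<le> K"
    and le: "\<And>x. x \<in> {a..b} \<Longrightarrow> h x \<le> A + K * integral {x..b} h"
    and x: "x \<in> {a..b}"
  shows "h x \<le> A * exp (K * (b - x))"
proof -
  define H where "H = (\<lambda>x. A + K * integral {x..b} h)"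
  have ih: "h integrable_on {a..b}" by (rule integrable_continuous_real[OF h])
  have H: "primitive_on {a..b} H (\<lambda>x. - K * h x)"
  proof -
    have "primitive_on {a..b} (\<lambda>x. integral {a..b} h - integral {a..x} h) (\<lambda>x. 0 - h x)"
      by (intro primitive_on_diff primitive_on_const primitive_on_integral
          absolutely_integrable_continuous_real h)
    then have "primitive_on {a..b} (\<lambda>x. A + K * (integral {a..b} h - integral {a..x} h))
        (\<lambda>x. 0 + K * (0 - h x))"
      by (intro primitive_on_add primitive_on_const primitive_on_cmult)
    then show ?thesis
    proof (rule primitive_on_cong)
      show "A + K * (integral {a..b} h - integral {a..y} h) = H y" if "y \<in> {a..b}" for y
        using Henstock_Kurzweil_Integration.integral_combine[of a y b h] that ih
        by (simp add: H_def)
    qed (auto simp: is_interval_cc)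
  qed
  have "primitive_on {a..b} (\<lambda>x. exp (K * x)) (\<lambda>x. K * exp (K * x))"
    by (rule primitive_on_of_deriv)
      (auto intro!: derivative_eq_intros continuous_intros
        simp: is_interval_cc simp flip: has_real_derivative_iff_has_vector_derivative)
  from primitive_on_mult[OF this H continuous_on_mult[OF continuous_on_const]]
  have P: "primitive_on {a..b} (\<lambda>x. exp (K * x) * H x)
      (\<lambda>x. K * exp (K * x) * H x + exp (K * x) * (- K * h x))"
    by (simp add: continuous_intros)
  have "exp (K * x) * H x \<le> exp (K * b) * H b"
  proof (rule primitive_on_mono[OF P])
    fix z assume z: "z \<in> {x..b}"
    then have "h z \<le> H z" using le[of z] x by (auto simp: H_def)
    then have "0 \<le> K * exp (K * z) * (H z - h z)" using K by simp
    then show "0 \<le> K * exp (K * z) * H z + exp (K * z) * (- K * h z)"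
      by (simp add: algebra_simps)
  qed (use x in auto)
  moreover have "H b = A" by (simp add: H_def)
  ultimately have "H x \<le> A * exp (K * (b - x))"
    by (simp add: algebra_simps exp_diff field_simps)
  then show ?thesis using le[OF x] by (simp add: H_def)
qed

section \<open>Smooth functions of compact support\<close>

definition smooth :: "(real \<Rightarrow> real) \<Rightarrow> bool" where
  "smooth f \<longleftrightarrow> (\<forall>k x. (deriv ^^ k) f differentiable (at x))"

lemma smooth_coinduct:
  assumes "f \<in> F" "\<And>g x. g \<in> F \<Longrightarrow> g differentiable (at x)" "\<And>g. g \<in> F \<Longrightarrow> deriv g \<in> F"
  shows "smooth f"
proof -
  have "(deriv ^^ k) f \<in> F" for k
    by (induction k) (use assms in auto)
  then show ?thesis using assms(2) by (auto simp: smooth_def)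
qed

lemma smooth_differentiable: "smooth f \<Longrightarrow> f differentiable (at x)"
  unfolding smooth_def by (metis funpow_0)

lemma smooth_deriv: "smooth f \<Longrightarrow> smooth (deriv f)"
  unfolding smooth_def by (metis comp_apply funpow_Suc_right)

lemma smooth_has_derivative: "smooth f \<Longrightarrow> (f has_real_derivative deriv f x) (at x)"
  using smooth_differentiable[of f x] by (simp add: DERIV_deriv_iff_real_differentiable)

lemma smooth_continuous: "smooth f \<Longrightarrow> continuous_on S f"
  by (meson DERIV_continuous_on DERIV_subset smooth_has_derivative subset_UNIV)

lemma smooth_primitive:
  assumes "smooth f" "\<And>x. (F has_real_derivative f x) (at x)"
  shows "smooth F"
proof -
  have "deriv F = f" using assms(2) by (auto intro: DERIV_imp_deriv)
  moreover have "F differentiable (at x)" for x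
    using assms(2) real_differentiable_def by blast
  ultimately show ?thesis
    using assms(1) by (intro smooth_coinduct[of F "insert F {g. smooth g}"])
      (auto intro: smooth_deriv smooth_differentiable)
qed

text \<open>For \<open>p = 1\<close> this is the classical function that is smooth at \<open>0\<close> without being analytic there. The
  polynomial factor makes the family stable under differentiation.\<close>

definition flat :: "real poly \<Rightarrow> real \<Rightarrow> real" where
  "flat p x = (if 0 < x then poly p (1 / x) * exp (- (1 / x)) else 0)"

lemma flat_tendsto_0: "(flat p \<longlongrightarrow> 0) (at 0)"
proof -
  have "((\<lambda>t. \<Sum>i\<le>degree p. coeff p i * (t ^ i / exp t)) \<longlongrightarrow> (\<Sum>i\<le>degree p. coeff p i * 0)) at_top"
    by (intro tendsto_intros tendsto_power_div_exp_0)
  moreover have "(\<lambda>t. \<Sum>i\<le>degree p. coeff p i * (t ^ i / exp t)) = (\<lambda>t. poly p t * exp (- t))"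
    by (rule ext) (simp add: poly_altdef sum_distrib_right exp_minus divide_inverse mult.assoc)
  ultimately have "((\<lambda>t. poly p t * exp (- t)) \<longlongrightarrow> 0) at_top" by simp
  from filterlim_compose[OF this filterlim_inverse_at_top_right]
  have "((\<lambda>x. poly p (inverse x) * exp (- inverse x)) \<longlongrightarrow> 0) (at_right 0)" .
  then have R: "(flat p \<longlongrightarrow> 0) (at_right 0)"
    by (rule Lim_transform_eventually)
      (auto simp: eventually_at_filter flat_def inverse_eq_divide)
  have L: "(flat p \<longlongrightarrow> 0) (at_left 0)"
    by (rule tendsto_eventually) (auto simp: eventually_at_filter flat_def)
  show ?thesis using L R by (simp add: filterlim_split_at)
qed

lemma flat_has_derivative:
  "(flat p has_real_derivative flat ([:0, 0, 1:] * (p - pderiv p)) x) (at x)"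
proof -
  consider "x < 0" | "x = 0" | "0 < x" by linarith
  then show ?thesis
  proof cases
    case 1
    have "((\<lambda>x. 0) has_real_derivative 0) (at x)" by simp
    then have "(flat p has_real_derivative 0) (at x)"
      by (rule has_field_derivative_transform_within_open[of _ _ _ "{..<0}"])
        (use 1 in \<open>auto simp: flat_def\<close>)
    then show ?thesis using 1 by (simp add: flat_def)
  next
    case 2
    have "((\<lambda>h. (flat p (0 + h) - flat p 0) / h) \<longlongrightarrow> 0) (at 0)"
      by (rule Lim_transform_eventually[OF flat_tendsto_0[of "pCons 0 p"]])
        (auto simp: eventually_at_filter flat_def)
    then show ?thesis using 2 by (simp add: DERIV_def flat_def)
  next
    case 3
    have "((\<lambda>x. poly p (1 / x) * exp (- (1 / x))) has_real_derivative
        flat ([:0, 0, 1:] * (p - pderiv p)) x) (at x)"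
      by (rule derivative_eq_intros refl poly_DERIV DERIV_chain2[of "poly p"] | use 3 in \<open>simp; fail\<close>)+
        (use 3 in \<open>simp add: flat_def field_simps power2_eq_square\<close>)
    then show ?thesis
      by (rule has_field_derivative_transform_within_open[of _ _ _ "{0<..}"])
        (use 3 in \<open>auto simp: flat_def\<close>)
  qed
qed

inductive_set flat_algebra :: "(real \<Rightarrow> real) set" where
  base: "(\<lambda>x. c * flat p (s * x + t)) \<in> flat_algebra"
| add: "f \<in> flat_algebra \<Longrightarrow> g \<in> flat_algebra \<Longrightarrow> (\<lambda>x. f x + g x) \<in> flat_algebra"
| mult: "f \<in> flat_algebra \<Longrightarrow> g \<in> flat_algebra \<Longrightarrow> (\<lambda>x. f x * g x) \<in> flat_algebra"

lemma flat_algebra_deriv: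
  "f \<in> flat_algebra \<Longrightarrow> \<exists>f'\<in>flat_algebra. \<forall>x. (f has_real_derivative f' x) (at x)"
proof (induction rule: flat_algebra.induct)
  case (base c p s t)
  have "((\<lambda>x. c * flat p (s * x + t)) has_real_derivative
      (c * s) * flat ([:0, 0, 1:] * (p - pderiv p)) (s * x + t)) (at x)" for x
    by (rule derivative_eq_intros refl DERIV_chain2[OF flat_has_derivative])+ simp
  then show ?case
    by (intro bexI[of _ "\<lambda>x. (c * s) * flat ([:0, 0, 1:] * (p - pderiv p)) (s * x + t)"] allI
        flat_algebra.base)
next
  case (add f g)
  then obtain f' g' where "f' \<in> flat_algebra" "g' \<in> flat_algebra"
    "\<And>x. (f has_real_derivative f' x) (at x)" "\<And>x. (g has_real_derivative g' x) (at x)" by blast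
  then show ?case
    by (intro bexI[of _ "\<lambda>x. f' x + g' x"]) (auto intro!: derivative_intros flat_algebra.add)
next
  case (mult f g)
  then obtain f' g' where "f' \<in> flat_algebra" "g' \<in> flat_algebra"
    "\<And>x. (f has_real_derivative f' x) (at x)" "\<And>x. (g has_real_derivative g' x) (at x)" by blast
  then show ?case using mult.hyps
    by (intro bexI[of _ "\<lambda>x. f' x * g x + g' x * f x"])
      (auto intro!: DERIV_mult flat_algebra.add flat_algebra.mult)
qed

text \<open>The algebra is closed under derivatives, hence every element is differentiable arbitrarily often; no
  explicit formula for higher derivatives is required.\<close>

lemma flat_algebra_smooth:
  assumes "f \<in> flat_algebra"
  shows "smooth f"
proof (rule smooth_coinduct[OF assms])
  fix g x assume "g \<in> flat_algebra"
  then obtain g' where g': "g' \<in> flat_algebra" "\<And>x. (g has_real_derivative g' x) (at x)"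
    using flat_algebra_deriv by blast
  then show "g differentiable (at x)" using real_differentiable_def by blast
  have "deriv g = g'" using g'(2) by (auto intro: DERIV_imp_deriv)
  with g'(1) show "deriv g \<in> flat_algebra" by simp
qed

text \<open>Positive exactly on the open interval between \<open>a\<close> and \<open>b\<close>. As the steepness \<open>n\<close> grows, it increases to the
  indicator function of that interval.\<close>

definition bump :: "real \<Rightarrow> real \<Rightarrow> real \<Rightarrow> real \<Rightarrow> real" where
  "bump a b n x = flat 1 (n * (x - a)) * flat 1 (n * (b - x))"

lemma bump_in_flat_algebra: "(\<lambda>x. c * bump a b n x) \<in> flat_algebra"
proof -
  have "(\<lambda>x. (c * flat 1 (n * x + (- n * a))) * (1 * flat 1 ((- n) * x + n * b))) \<in> flat_algebra"
    by (intro flat_algebra.intros)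
  also have "(\<lambda>x. (c * flat 1 (n * x + (- n * a))) * (1 * flat 1 ((- n) * x + n * b)))
      = (\<lambda>x. c * bump a b n x)"
    by (auto simp: bump_def algebra_simps)
  finally show ?thesis .
qed

lemma flat1_bounds: "0 \<le> flat 1 x" "flat 1 x \<le> 1"
  by (auto simp: flat_def)

lemma bump_bounds: "0 \<le> bump a b n x" "bump a b n x \<le> 1"
  using flat1_bounds mult_le_one[of "flat 1 (n * (x - a))" "flat 1 (n * (b - x))"]
  by (auto simp: bump_def)

lemma bump_eq_0: "0 < n \<Longrightarrow> x \<notin> {a<..<b} \<Longrightarrow> bump a b n x = 0"
  by (auto simp: bump_def flat_def zero_less_mult_iff)

lemma bump_eq_0': "0 < n \<Longrightarrow> x \<notin> {a..b} \<Longrightarrow> bump a b n x = 0"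
  by (rule bump_eq_0) auto

lemma bump_pos: "0 < n \<Longrightarrow> x \<in> {a<..<b} \<Longrightarrow> 0 < bump a b n x"
  by (auto simp: bump_def flat_def)

lemma bump_smooth: "smooth (bump a b n)"
  using flat_algebra_smooth[OF bump_in_flat_algebra[of 1 a b n]] by simp

lemma bump_test_function: "0 < n \<Longrightarrow> {a..b} \<subseteq> \<Omega> \<Longrightarrow> test_function \<Omega> (bump a b n)"
  using bump_smooth[of a b n] unfolding test_function_def smooth_def
  by (auto intro!: exI[of _ "{a..b}"] bump_eq_0)

lemma bump_tendsto_indicator:
  "(\<lambda>n. bump a b (real (Suc n)) x) \<longlonglongrightarrow> indicator {a<..<b} x"
proof (cases "x \<in> {a<..<b}")
  case True
  have *: "(\<lambda>n. flat 1 (real (Suc n) * y)) \<longlonglongrightarrow> 1" if "0 < y" for y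
  proof -
    have "(\<lambda>n. exp (- ((1 / y) * (1 / real (Suc n))))) \<longlonglongrightarrow> exp (- ((1 / y) * 0))"
      by (intro tendsto_intros) (use LIMSEQ_inverse_real_of_nat in \<open>simp add: inverse_eq_divide\<close>)
    then show ?thesis using that by (simp add: flat_def mult.commute)
  qed
  have "(\<lambda>n. flat 1 (real (Suc n) * (x - a)) * flat 1 (real (Suc n) * (b - x))) \<longlonglongrightarrow> 1 * 1"
    by (intro tendsto_mult *) (use True in auto)
  then show ?thesis using True by (simp add: bump_def)
next
  case False
  have "bump a b (real (Suc n)) x = 0" for n using False by (intro bump_eq_0) auto
  then show ?thesis using False by simp
qed

section \<open>The lemma of du Bois-Reymond\<close>

definition locally_integrable :: "real set \<Rightarrow> (real \<Rightarrow> 'a::euclidean_space) \<Rightarrow> bool" where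
  "locally_integrable I f \<longleftrightarrow> (\<forall>a b. {a..b} \<subseteq> I \<longrightarrow> f absolutely_integrable_on {a..b})"

lemma integral_compact_support:
  fixes f :: "real \<Rightarrow> 'a::euclidean_space"
  assumes "f absolutely_integrable_on {a..b}" "\<And>x. x \<notin> {a..b} \<Longrightarrow> f x = 0"
  shows "integrable lebesgue f" "(\<integral>x. f x \<partial>lebesgue) = integral {a..b} f"
proof -
  have "(\<lambda>x. indicator {a..b} x *\<^sub>R f x) = f"
    using assms(2) by (force simp: indicator_def)
  then show "integrable lebesgue f" "(\<integral>x. f x \<partial>lebesgue) = integral {a..b} f"
    using assms(1) set_lebesgue_integral_eq_integral(2)[OF assms(1)]
    by (auto simp: set_integrable_def set_lebesgue_integral_def)
qed

lemma absolutely_integrable_continuous_scaleR: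
  fixes f :: "real \<Rightarrow> real" and g :: "real \<Rightarrow> 'a::euclidean_space"
  assumes "continuous_on {a..b} f" "g absolutely_integrable_on {a..b}"
  shows "(\<lambda>x. f x *\<^sub>R g x) absolutely_integrable_on {a..b}"
proof -
  have "bilinear ((*\<^sub>R) :: real \<Rightarrow> 'a \<Rightarrow> 'a)"
    by (simp add: bilinear_conv_bounded_bilinear bounded_bilinear_scaleR)
  then show ?thesis
    by (rule absolutely_integrable_bounded_measurable_product)
      (auto intro!: assms compact_imp_bounded compact_continuous_image
        absolutely_integrable_imp_borel_measurable absolutely_integrable_continuous_real)
qed

text \<open>By Lebesgue differentiation, almost every value of \<open>k\<close> is a limit of averages over shrinking intervals, and
  all of these averages are zero.\<close>

lemma zero_AE_of_integral_Icc:
  fixes k :: "real \<Rightarrow> 'a::euclidean_space"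
  assumes k: "k absolutely_integrable_on {a..b}"
    and 0: "\<And>x y. a \<le> x \<Longrightarrow> x \<le> y \<Longrightarrow> y \<le> b \<Longrightarrow> integral {x..y} k = 0"
  shows "AE x in lebesgue. x \<in> {a<..<b} \<longrightarrow> k x = 0"
proof -
  define f where "f = (\<lambda>x. if x \<in> {a..b} then k x else 0)"
  have "f absolutely_integrable_on UNIV"
    using k unfolding f_def absolutely_integrable_restrict_UNIV .
  then have "f integrable_on cbox c d" for c d
    using set_lebesgue_integral_eq_integral(1) integrable_on_subcbox by blast
  then obtain N where N: "negligible N" "\<And>x e. x \<notin> N \<Longrightarrow> 0 < e \<Longrightarrow>
      \<exists>d>0. \<forall>h. 0 < h \<and> h < d \<longrightarrow> norm (integral (cbox x (x + h *\<^sub>R One)) f /\<^sub>R h ^ DIM(real) - f x) < e"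
    using integrable_ccontinuous_explicit by blast
  have "k x = 0" if x: "x \<notin> N" "x \<in> {a<..<b}" for x
  proof (rule ccontr)
    assume "k x \<noteq> 0"
    then obtain d where d: "d > 0" "\<And>h. 0 < h \<Longrightarrow> h < d \<Longrightarrow>
        norm (integral {x..x + h} f /\<^sub>R h - f x) < norm (k x)"
      using N(2)[OF x(1), of "norm (k x)"] by auto
    define h where "h = min (d / 2) (b - x)"
    have h: "0 < h" "h < d" "x + h \<le> b" using d(1) x by (auto simp: h_def min_def)
    have "integral {x..x + h} f = integral {x..x + h} k"
      by (rule Henstock_Kurzweil_Integration.integral_cong) (use h x in \<open>auto simp: f_def\<close>)
    also have "\<dots> = 0" using 0[of x "x + h"] h x by auto
    finally show False using d(2)[OF h(1,2)] x by (simp add: f_def)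
  qed
  then show ?thesis
    unfolding eventually_ae_filter_negligible using N(1) by (intro exI[of _ N]) auto
qed

lemma AE_open_of_AE_Icc:
  fixes P :: "real \<Rightarrow> bool"
  assumes I: "open I" and P: "\<And>a b. {a..b} \<subseteq> I \<Longrightarrow> AE x in lebesgue. x \<in> {a<..<b} \<longrightarrow> P x"
  shows "AE x in lebesgue. x \<in> I \<longrightarrow> P x"
proof -
  define \<Q> where "\<Q> = {(a, b) \<in> \<rat> \<times> \<rat>. {a..b} \<subseteq> I}"
  have "countable \<Q>"
    by (rule countable_subset[OF _ countable_SIGMA[OF countable_rat countable_rat]])
      (auto simp: \<Q>_def)
  then have "AE x in lebesgue. \<forall>q\<in>\<Q>. x \<in> {fst q<..<snd q} \<longrightarrow> P x"
    by (subst AE_ball_countable) (auto simp: \<Q>_def intro!: P[simplified])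
  then show ?thesis
  proof eventually_elim
    case (elim x)
    show ?case
    proof
      assume "x \<in> I"
      then obtain e where e: "e > 0" "ball x e \<subseteq> I" using I openE by blast
      obtain a where a: "a \<in> \<rat>" "x - e < a" "a < x"
        using Rats_dense_in_real[of "x - e" x] e by auto
      obtain b where b: "b \<in> \<rat>" "x < b" "b < x + e"
        using Rats_dense_in_real[of x "x + e"] e by auto
      have "{a..b} \<subseteq> ball x e" using a b by (auto simp: dist_real_def)
      then have "(a, b) \<in> \<Q>" using a b e by (auto simp: \<Q>_def)
      then show "P x" using elim a b by fastforce
    qed
  qed
qed

text \<open>Testing with steeper and steeper bumps gives, by dominated convergence, that all integrals over intervals
  vanish.\<close>

lemma fundamental_lemma:
  fixes k :: "real \<Rightarrow> 'a::euclidean_space"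
  assumes I: "open I" and k: "locally_integrable I k"
    and 0: "\<And>a b n. {a..b} \<subseteq> I \<Longrightarrow> 0 < n \<Longrightarrow> (\<integral>x. bump a b n x *\<^sub>R k x \<partial>lebesgue) = 0"
  shows "AE x in lebesgue. x \<in> I \<longrightarrow> k x = 0"
proof (rule AE_open_of_AE_Icc[OF I])
  fix a b assume ab: "{a..b} \<subseteq> I"
  have ki: "k absolutely_integrable_on {x..y}" if "{x..y} \<subseteq> I" for x y
    using k that by (auto simp: locally_integrable_def)
  show "AE x in lebesgue. x \<in> {a<..<b} \<longrightarrow> k x = 0"
  proof (rule zero_AE_of_integral_Icc[OF ki[OF ab]])
    fix x y assume xy: "a \<le> x" "x \<le> y" "y \<le> b"
    then have sub: "{x..y} \<subseteq> I" using ab by auto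
    have kxy: "integrable lebesgue (\<lambda>z. indicator {x..y} z *\<^sub>R k z)"
      using ki[OF sub] by (simp add: set_integrable_def)
    have m: "(\<lambda>z. bump x y n z) \<in> borel_measurable lebesgue" for n
      using borel_measurable_continuous_onI[OF smooth_continuous[OF bump_smooth, of UNIV x y n]]
      by (intro measurable_completion) simp
    have lim: "(\<lambda>n. \<integral>z. bump x y (real (Suc n)) z *\<^sub>R (indicator {x..y} z *\<^sub>R k z) \<partial>lebesgue)
        \<longlonglongrightarrow> (\<integral>z. indicator {x<..<y} z *\<^sub>R (indicator {x..y} z *\<^sub>R k z) \<partial>lebesgue)"
    proof (rule integral_dominated_convergence[where w = "\<lambda>z. norm (indicator {x..y} z *\<^sub>R k z)"])
      show "(\<lambda>z. indicat_real {x<..<y} z *\<^sub>R (indicat_real {x..y} z *\<^sub>R k z)) \<in> borel_measurable lebesgue"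
        by (rule borel_measurable_scaleR[OF borel_measurable_indicator borel_measurable_integrable[OF kxy]]) auto
      show "AE z in lebesgue. (\<lambda>n. bump x y (real (Suc n)) z *\<^sub>R (indicat_real {x..y} z *\<^sub>R k z))
          \<longlonglongrightarrow> indicat_real {x<..<y} z *\<^sub>R (indicat_real {x..y} z *\<^sub>R k z)"
        by (intro AE_I2 tendsto_scaleR tendsto_const bump_tendsto_indicator)
      show "AE z in lebesgue. norm (bump x y (real (Suc n)) z *\<^sub>R (indicat_real {x..y} z *\<^sub>R k z))
          \<le> norm (indicat_real {x..y} z *\<^sub>R k z)" for n
        by (rule AE_I2, unfold norm_scaleR, rule mult_left_le_one_le)
          (use bump_bounds[of x y "real (Suc n)"] in auto)
      show "(\<lambda>z. bump x y (real (Suc n)) z *\<^sub>R (indicat_real {x..y} z *\<^sub>R k z))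
          \<in> borel_measurable lebesgue" for n
        by (rule borel_measurable_scaleR[OF m borel_measurable_integrable[OF kxy]])
    qed (rule integrable_norm[OF kxy])
    have e: "bump x y (real (Suc n)) z *\<^sub>R (indicat_real {x..y} z *\<^sub>R k z)
        = bump x y (real (Suc n)) z *\<^sub>R k z" for n z
      using bump_eq_0[of "real (Suc n)" z x y] by (cases "z \<in> {x..y}") auto
    have "(\<integral>z. bump x y (real (Suc n)) z *\<^sub>R k z \<partial>lebesgue) = 0" for n
      by (rule 0[OF sub]) auto
    from lim[unfolded e this]
    have 1: "(\<integral>z. indicat_real {x<..<y} z *\<^sub>R (indicat_real {x..y} z *\<^sub>R k z) \<partial>lebesgue) = 0"
      by (rule LIMSEQ_unique[OF _ tendsto_const])
    have 2: "indicat_real {x<..<y} z *\<^sub>R (indicat_real {x..y} z *\<^sub>R k z)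
        = indicat_real {x<..<y} z *\<^sub>R k z" for z
      by (auto simp: indicator_def)
    have "(LINT z:{x<..<y}|lebesgue. k z) = 0"
      unfolding set_lebesgue_integral_def using 1 unfolding 2 .
    moreover have "k absolutely_integrable_on {x<..<y}"
      using ki[OF sub] absolutely_integrable_on_Icc_iff_Ioo by blast
    ultimately have "integral {x<..<y} k = 0"
      using set_lebesgue_integral_eq_integral by metis
    then show "integral {x..y} k = 0"
      using integral_open_interval_real[of x y k] by simp
  qed
qed


lemma compact_subset_open_interval:
  fixes I :: "real set"
  assumes "open I" "is_interval I" "I \<noteq> {}" "compact K" "K \<subseteq> I"
  obtains a b where "a < b" "{a..b} \<subseteq> I" "K \<subseteq> {a<..<b}"
proof -
  obtain l u where lu: "l \<in> I" "u \<in> I" "K \<subseteq> {l..u}" "l \<le> u"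
  proof (cases "K = {}")
    case True
    then show ?thesis using that assms(3) by auto
  next
    case False
    obtain l where "l \<in> K" "\<And>t. t \<in> K \<Longrightarrow> l \<le> t"
      using compact_attains_inf[OF assms(4) False] by blast
    moreover obtain u where "u \<in> K" "\<And>t. t \<in> K \<Longrightarrow> t \<le> u"
      using compact_attains_sup[OF assms(4) False] by blast
    ultimately show ?thesis using that[of l u] assms(5) by (auto simp: subset_iff)
  qed
  obtain d where d: "d > 0" "cball l d \<subseteq> I"
    using assms(1) lu(1) open_contains_cball by blast
  obtain e where e: "e > 0" "cball u e \<subseteq> I"
    using assms(1) lu(2) open_contains_cball by blast
  have "l - d \<in> I" "u + e \<in> I" using d e by (auto simp: dist_real_def subset_iff)
  then have "{l - d..u + e} \<subseteq> I"
    using assms(2) by (meson atLeastAtMost_iff mem_is_interval_1_I subsetI)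
  moreover have "K \<subseteq> {l - d<..<u + e}" using lu(3) d(1) e(1) by (force simp: subset_iff)
  ultimately show ?thesis using that[of "l - d" "u + e"] d(1) e(1) lu(4) by auto
qed

lemma integral_by_parts_smooth:
  fixes G g :: "real \<Rightarrow> 'a::euclidean_space"
  assumes G: "primitive_on {a..b} G g" and "a \<le> b"
    and \<phi>: "smooth \<phi>"
  shows "integral {a..b} (\<lambda>x. deriv \<phi> x *\<^sub>R G x)
    = \<phi> b *\<^sub>R G b - \<phi> a *\<^sub>R G a - integral {a..b} (\<lambda>x. \<phi> x *\<^sub>R g x)"
proof -
  have c: "continuous_on {a..b} \<phi>" "continuous_on {a..b} (deriv \<phi>)"
    using \<phi> smooth_continuous smooth_deriv by auto
  have P: "primitive_on {a..b} \<phi> (deriv \<phi>)"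
    by (rule primitive_on_of_deriv[OF _ c(2)])
      (use smooth_has_derivative[OF \<phi>] in \<open>auto simp: is_interval_cc
         intro: has_field_derivative_at_within simp flip: has_real_derivative_iff_has_vector_derivative\<close>)
  have "bounded (deriv \<phi> ` {a..b})"
    by (intro compact_imp_bounded compact_continuous_image c) auto
  then obtain B where "\<And>x. x \<in> {a..b} \<Longrightarrow> \<bar>deriv \<phi> x\<bar> \<le> B"
    unfolding bounded_iff by (metis imageI real_norm_def)
  from primitive_on_prod[OF P G this]
  have "integral {a..b} (\<lambda>x. deriv \<phi> x *\<^sub>R G x + \<phi> x *\<^sub>R g x) = \<phi> b *\<^sub>R G b - \<phi> a *\<^sub>R G a"
    using primitive_onD(4)[of "{a..b}" _ _ a b] assms(2) by fastforce
  moreover have "(\<lambda>x. deriv \<phi> x *\<^sub>R G x) integrable_on {a..b}"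
    by (intro integrable_continuous_real continuous_intros c primitive_on_continuous_cbox[OF G])
  moreover have "(\<lambda>x. \<phi> x *\<^sub>R g x) integrable_on {a..b}"
    using absolutely_integrable_continuous_scaleR[OF c(1) primitive_onD(1)[OF G, of a b]] assms(2)
    by (auto intro: set_lebesgue_integral_eq_integral)
  ultimately show ?thesis
    by (simp add: Henstock_Kurzweil_Integration.integral_add eq_diff_eq)
qed

lemma primitive_exists:
  fixes g :: "real \<Rightarrow> 'a::euclidean_space"
  assumes I: "is_interval I" "x0 \<in> I" and g: "locally_integrable I g"
  obtains G where "primitive_on I G g"
proof -
  define G where "G = (\<lambda>x. if x0 \<le> x then integral {x0..x} g else - integral {x..x0} g)"
  have sub: "{x..y} \<subseteq> I" if "x \<in> I" "y \<in> I" for x y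
    using that I(1) by (meson atLeastAtMost_iff mem_is_interval_1_I subsetI)
  have ai: "g absolutely_integrable_on {x..y}" if "x \<in> I" "y \<in> I" for x y
    using g sub[OF that] by (auto simp: locally_integrable_def)
  have "primitive_on I G g"
  proof (rule primitive_onI)
    fix x y assume xy: "x \<in> I" "y \<in> I" "x \<le> y"
    show "g absolutely_integrable_on {x..y}" by (rule ai[OF xy(1,2)])
    define l where "l = min x x0"
    define r where "r = max y x0"
    have lr: "l \<in> I" "r \<in> I" using xy I by (auto simp: l_def r_def min_def max_def)
    define H where "H = (\<lambda>z. integral {l..z} g)"
    have H: "primitive_on {l..r} H g"
      unfolding H_def by (rule primitive_on_integral[OF ai[OF lr]])
    have "G z = H z - H x0" if "z \<in> {l..r}" for z
      using primitive_onD(4)[OF H, of x0 z] primitive_onD(4)[OF H, of z x0] that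
      by (auto simp: G_def l_def r_def)
    then have "G y - G x = H y - H x"
      using xy by (auto simp: l_def r_def)
    then show "(g has_integral G y - G x) {x..y}"
      using primitive_onD(2)[OF H, of x y] xy by (auto simp: l_def r_def)
  qed
  then show ?thesis using that by blast
qed

lemma test_function_smooth: "test_function \<Omega> \<phi> \<Longrightarrow> smooth \<phi>"
  by (auto simp: test_function_def smooth_def)

lemma test_function_deriv:
  assumes "test_function \<Omega> \<phi>"
  shows "test_function \<Omega> (deriv \<phi>)"
proof -
  obtain K where K: "compact K" "K \<subseteq> \<Omega>" "\<And>x. x \<notin> K \<Longrightarrow> \<phi> x = 0"
    using assms by (auto simp: test_function_def)
  have "deriv \<phi> x = 0" if "x \<notin> K" for x
  proof -
    have "((\<lambda>x. 0) has_real_derivative 0) (at x)" by simp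
    then have "(\<phi> has_real_derivative 0) (at x)"
      by (rule has_field_derivative_transform_within_open[of _ _ _ "- K"])
        (use K that in \<open>auto intro: compact_imp_closed\<close>)
    then show ?thesis by (rule DERIV_imp_deriv)
  qed
  then show ?thesis
    using K smooth_deriv[OF test_function_smooth[OF assms]]
    by (auto simp: test_function_def smooth_def)
qed

text \<open>Let \<open>G\<close> be a primitive of \<open>g\<close>. Integration by parts shows that \<open>h - G\<close> is orthogonal to the derivatives
  of all test functions. These derivatives are the test functions of integral zero, so \<open>h - G\<close> is almost
  everywhere equal to a constant.\<close>

lemma du_bois_reymond:
  fixes h g :: "real \<Rightarrow> 'a::euclidean_space"
  assumes I: "open I" "is_interval I" "I \<noteq> {}"
    and h: "locally_integrable I h" and g: "locally_integrable I g"
    and weak: "\<And>\<phi>. test_function I \<phi> \<Longrightarrow>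
      (\<integral>x. deriv \<phi> x *\<^sub>R h x \<partial>lebesgue) = - (\<integral>x. \<phi> x *\<^sub>R g x \<partial>lebesgue)"
  obtains H where "primitive_on I H g" "AE x in lebesgue. x \<in> I \<longrightarrow> h x = H x"
proof -
  obtain x0 where "x0 \<in> I" using I by auto
  then obtain G where G: "primitive_on I G g" using primitive_exists[OF I(2) _ g] by blast
  have G_cont: "continuous_on {a..b} G" if "{a..b} \<subseteq> I" for a b
    by (rule primitive_on_continuous_cbox[OF primitive_on_subset[OF G that]])
  define k where "k = (\<lambda>x. h x - G x)"
  have k: "locally_integrable I k"
    using h G_cont unfolding k_def locally_integrable_def
    by (metis set_integral_diff(1) absolutely_integrable_continuous_real)
  have ai: "f absolutely_integrable_on {a..b}" if "locally_integrable I f" "{a..b} \<subseteq> I"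
    for f :: "real \<Rightarrow> 'a" and a b using that by (auto simp: locally_integrable_def)
  have k0: "(\<integral>x. deriv \<phi> x *\<^sub>R k x \<partial>lebesgue) = 0" if \<phi>: "test_function I \<phi>" for \<phi>
  proof -
    obtain K where K: "compact K" "K \<subseteq> I" "\<And>x. x \<notin> K \<Longrightarrow> \<phi> x = 0"
      using \<phi> by (auto simp: test_function_def)
    obtain K' where K': "compact K'" "K' \<subseteq> I" "\<And>x. x \<notin> K' \<Longrightarrow> deriv \<phi> x = 0"
      using test_function_deriv[OF \<phi>] by (auto simp: test_function_def)
    obtain a b where ab: "a < b" "{a..b} \<subseteq> I" "K \<union> K' \<subseteq> {a<..<b}"
      using compact_subset_open_interval[OF I, of "K \<union> K'"] K K' by (metis compact_Un Un_least)
    note s = test_function_smooth[OF \<phi>]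
    note c = smooth_continuous[OF s] smooth_continuous[OF smooth_deriv[OF s]]
    have z: "\<phi> x = 0" "deriv \<phi> x = 0" if "x \<notin> {a<..<b}" for x
      using K(3)[of x] K'(3)[of x] that ab(3) by blast+
    have 1: "(\<lambda>x. deriv \<phi> x *\<^sub>R h x) absolutely_integrable_on {a..b}"
      by (intro absolutely_integrable_continuous_scaleR c ai h ab)
    have 2: "(\<lambda>x. deriv \<phi> x *\<^sub>R G x) absolutely_integrable_on {a..b}"
      by (intro absolutely_integrable_continuous_real continuous_intros c G_cont ab)
    have 3: "(\<lambda>x. \<phi> x *\<^sub>R g x) absolutely_integrable_on {a..b}"
      by (intro absolutely_integrable_continuous_scaleR c ai g ab)
    have z': "deriv \<phi> x *\<^sub>R v = 0" "\<phi> x *\<^sub>R v = 0" if "x \<notin> {a..b}" for x and v :: 'a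
      using z[of x] that by auto
    note i1 = integral_compact_support[OF 1 z'(1)] and i2 = integral_compact_support[OF 2 z'(1)]
      and i3 = integral_compact_support[OF 3 z'(2)]
    have "(\<integral>x. deriv \<phi> x *\<^sub>R k x \<partial>lebesgue)
        = (\<integral>x. deriv \<phi> x *\<^sub>R h x \<partial>lebesgue) - (\<integral>x. deriv \<phi> x *\<^sub>R G x \<partial>lebesgue)"
      unfolding k_def scaleR_diff_right using z i1 i2 by (intro Bochner_Integration.integral_diff) auto
    also have "(\<integral>x. deriv \<phi> x *\<^sub>R G x \<partial>lebesgue) = integral {a..b} (\<lambda>x. deriv \<phi> x *\<^sub>R G x)"
      using i2 z by auto
    also have "\<dots> = - integral {a..b} (\<lambda>x. \<phi> x *\<^sub>R g x)"
      using integral_by_parts_smooth[OF primitive_on_subset[OF G ab(2)] _ s] ab(1) z[of a] z[of b]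
      by simp
    also have "\<dots> = - (\<integral>x. \<phi> x *\<^sub>R g x \<partial>lebesgue)" using i3 z by auto
    finally show ?thesis using weak[OF \<phi>] by simp
  qed
  obtain p q where pq: "p < q" "{p..q} \<subseteq> I"
    using compact_subset_open_interval[OF I, of "{}"] by auto
  define J where "J = integral {p..q} (bump p q 1)"
  have bc: "continuous_on S (bump a b n)" for S a b n by (rule smooth_continuous[OF bump_smooth])
  have "0 < J"
  proof -
    have "0 \<le> J" unfolding J_def
      by (intro Henstock_Kurzweil_Integration.integral_nonneg integrable_continuous_real bc)
        (auto intro: bump_bounds)
    moreover have "J \<noteq> 0"
      using integral_eq_0_iff[of p q "bump p q 1", OF bc pq(1) bump_bounds(1)]
        bump_pos[of 1 "(p + q) / 2" p q] pq(1)
      unfolding J_def by (auto dest!: bspec[of _ _ "(p + q) / 2"])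
    ultimately show ?thesis by simp
  qed
  define C where "C = (1 / J) *\<^sub>R (\<integral>x. bump p q 1 x *\<^sub>R k x \<partial>lebesgue)"
  \<comment> \<open>A bump minus a multiple of the fixed one has integral zero, so it is the derivative of a
    test function.\<close>
  have kC: "(\<integral>x. bump a b n x *\<^sub>R (k x - C) \<partial>lebesgue) = 0" if ab: "{a..b} \<subseteq> I" "0 < n" for a b n
  proof -
    obtain l u where lu: "l < u" "{l..u} \<subseteq> I" "{a..b} \<union> {p..q} \<subseteq> {l<..<u}"
      using compact_subset_open_interval[OF I, of "{a..b} \<union> {p..q}"] ab pq
      by (metis Un_least compact_Icc compact_Un)
    have z: "bump a b n x = 0" "bump p q 1 x = 0" if "x \<notin> {l<..<u}" for x
    proof -
      have "x \<notin> {a<..<b}" "x \<notin> {p<..<q}"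
        using lu(3) that by (meson UnI1 UnI2 greaterThanLessThan_subseteq_atLeastAtMost_iff
            order_refl subsetD)+
      then show "bump a b n x = 0" "bump p q 1 x = 0"
        using ab(2) by (auto intro: bump_eq_0)
    qed
    have z': "bump a b n x = 0" "bump p q 1 x = 0" if "x \<notin> {l..u}" for x
      using z[of x] that by auto
    define c where "c = integral {l..u} (bump a b n) / J"
    define f where "f = (\<lambda>x. bump a b n x - c * bump p q 1 x)"
    have fz: "f x = 0" if "x \<notin> {l<..<u}" for x using z[OF that] by (simp add: f_def)
    have fc: "continuous_on S f" for S unfolding f_def by (intro continuous_intros bc)
    have "smooth (\<lambda>x. 1 * bump a b n x + (- c) * bump p q 1 x)"
      by (intro flat_algebra_smooth flat_algebra.add bump_in_flat_algebra)
    then have "smooth f" by (simp add: f_def)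
    have f_int: "integral {l..u} f = 0"
    proof -
      have "integral {l..u} (bump p q 1) = J"
      proof -
        have "bump p q 1 absolutely_integrable_on {l..u}" "bump p q 1 absolutely_integrable_on {p..q}"
          by (intro absolutely_integrable_continuous_real bc)+
        from integral_compact_support(2)[OF this(1)] integral_compact_support(2)[OF this(2)]
        show ?thesis using z' bump_eq_0'[of 1 _ p q] by (simp add: J_def)
      qed
      then show ?thesis unfolding f_def c_def using \<open>0 < J\<close>
        by (subst Henstock_Kurzweil_Integration.integral_diff)
          (auto intro!: integrable_continuous_real continuous_intros bc)
    qed
    define \<Phi> where "\<Phi> = (\<lambda>x. integral {l - 1..x} f)"
    have Pr: "primitive_on {l - 1..m} \<Phi> f" for m
      unfolding \<Phi>_def by (intro primitive_on_integral absolutely_integrable_continuous_real fc)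
    have \<Phi>z: "\<Phi> x = 0" if "x \<notin> {l..u}" for x
    proof (cases "x < l")
      case True
      have "integral {l - 1..x} f = integral {l - 1..x} (\<lambda>x. 0)"
        by (rule Henstock_Kurzweil_Integration.integral_cong) (use True fz in auto)
      then show ?thesis by (simp add: \<Phi>_def)
    next
      case False
      then have x: "u < x" using that by auto
      have e: "integral {s..t} f = 0" if "\<And>x. x \<in> {s..t} \<Longrightarrow> x \<notin> {l<..<u}" for s t
      proof -
        have "integral {s..t} f = integral {s..t} (\<lambda>x. 0)"
          by (rule Henstock_Kurzweil_Integration.integral_cong) (use that fz in auto)
        then show ?thesis by simp
      qed
      have "\<Phi> x = integral {l - 1..l} f + integral {l..u} f + integral {u..x} f"
        using x lu(1) unfolding \<Phi>_def
        by (subst Henstock_Kurzweil_Integration.integral_combine;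
            (intro integrable_continuous_real fc)?; simp)+
      then show ?thesis using e[of "l - 1" l] e[of u x] f_int by auto
    qed
    have \<Phi>': "(\<Phi> has_real_derivative f x) (at x)" for x
    proof (cases "x < l")
      case True
      have "((\<lambda>x. 0) has_real_derivative 0) (at x)" by simp
      then have "(\<Phi> has_real_derivative 0) (at x)"
        by (rule has_field_derivative_transform_within_open[of _ _ _ "{..<l}"])
          (use True \<Phi>z in auto)
      then show ?thesis using fz[of x] True by auto
    next
      case False
      then show ?thesis
        using primitive_on_deriv_at[OF Pr fc, of x "x + 1"]
        by (simp add: has_real_derivative_iff_has_vector_derivative)
    qed
    have \<Phi>d: "deriv \<Phi> = f" using \<Phi>' by (auto intro: DERIV_imp_deriv)
    have "test_function I \<Phi>"
      using smooth_primitive[OF \<open>smooth f\<close> \<Phi>'] lu(2) \<Phi>z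
      by (auto simp: test_function_def smooth_def intro!: exI[of _ "{l..u}"])
    from k0[OF this] have f0: "(\<integral>x. f x *\<^sub>R k x \<partial>lebesgue) = 0" unfolding \<Phi>d .
    have bk: "integrable lebesgue (\<lambda>x. bump a' b' m x *\<^sub>R k x)"
      if "{a'..b'} \<subseteq> I" "0 < m" for a' b' m
      by (rule integral_compact_support(1)[OF absolutely_integrable_continuous_scaleR[OF bc ai[OF k that(1)]]])
        (use bump_eq_0'[of m _ a' b'] that in auto)
    have "(\<integral>x. f x *\<^sub>R k x \<partial>lebesgue)
        = (\<integral>x. bump a b n x *\<^sub>R k x \<partial>lebesgue) - c *\<^sub>R (\<integral>x. bump p q 1 x *\<^sub>R k x \<partial>lebesgue)"
      using bk[OF ab] bk[OF pq(2), of 1] by (simp add: f_def scaleR_diff_left flip: scaleR_scaleR)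
    then have 1: "(\<integral>x. bump a b n x *\<^sub>R k x \<partial>lebesgue) = integral {l..u} (bump a b n) *\<^sub>R C"
      using f0 by (simp add: c_def C_def)
    have ib: "bump a b n absolutely_integrable_on {l..u}"
      by (intro absolutely_integrable_continuous_real bc)
    have "integral {l..u} (bump a b n) = (\<integral>x. bump a b n x \<partial>lebesgue)" "integrable lebesgue (bump a b n)"
      using integral_compact_support[OF ib z'(1)] by auto
    then show ?thesis using 1 bk[OF ab] by (simp add: scaleR_diff_right)
  qed
  have "locally_integrable I (\<lambda>x. k x - C)"
    unfolding locally_integrable_def
    by (intro allI impI set_integral_diff ai[OF k] absolutely_integrable_continuous_real continuous_on_const)
  from fundamental_lemma[OF I(1) this kC]
  have "AE x in lebesgue. x \<in> I \<longrightarrow> h x = G x + C"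
    by (auto simp: k_def algebra_simps)
  moreover have "primitive_on I (\<lambda>x. G x + C) g"
    using primitive_on_add[OF G primitive_on_const[of I C]] by simp
  ultimately show ?thesis using that by blast
qed

section \<open>Weak derivatives on the line and on the punctured line\<close>

text \<open>Functions on the line and on the punctured line are the same objects up to a null set. This lets both
  operators be studied with integrals over the whole line.\<close>

lemma integral_punctured:
  fixes f :: "real \<Rightarrow> 'a::euclidean_space"
  shows "(\<integral>x. f x \<partial>lebesgue_on (- {0})) = (\<integral>x. f x \<partial>lebesgue)"
    and "integrable (lebesgue_on (- {0})) f \<longleftrightarrow> integrable lebesgue f"
    and "f \<in> borel_measurable (lebesgue_on (- {0})) \<longleftrightarrow> f \<in> borel_measurable lebesgue"
proof -
  define g where "g = (\<lambda>x. indicat_real (- {0}) x *\<^sub>R f x)"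
  have S: "- {0::real} \<in> sets lebesgue" by auto
  have "AE x in lebesgue. x \<noteq> (0::real)"
    unfolding eventually_ae_filter_negligible by (intro exI[of _ "{0}"]) auto
  then have ae: "AE x in lebesgue. g x = f x"
    by eventually_elim (auto simp: g_def)
  have m: "g \<in> borel_measurable lebesgue \<longleftrightarrow> f \<in> borel_measurable lebesgue"
  proof
    assume "f \<in> borel_measurable lebesgue"
    then show "g \<in> borel_measurable lebesgue"
      unfolding g_def by (intro borel_measurable_scaleR borel_measurable_indicator S)
  qed (rule borel_measurable_AE[OF _ ae])
  show 1: "f \<in> borel_measurable (lebesgue_on (- {0})) \<longleftrightarrow> f \<in> borel_measurable lebesgue"
    using S by (simp add: borel_measurable_restrict_space_iff m[unfolded g_def])
  have i: "integrable lebesgue g \<longleftrightarrow> integrable lebesgue f"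
  proof (cases "f \<in> borel_measurable lebesgue")
    case True
    then show ?thesis using m ae by (intro integrable_cong_AE) auto
  next
    case False
    then show ?thesis using m borel_measurable_integrable by blast
  qed
  then show 2: "integrable (lebesgue_on (- {0})) f \<longleftrightarrow> integrable lebesgue f"
    using S by (simp add: integrable_restrict_space g_def)
  have "(\<integral>x. g x \<partial>lebesgue) = (\<integral>x. f x \<partial>lebesgue)"
  proof (cases "f \<in> borel_measurable lebesgue")
    case True
    then show ?thesis using m ae by (intro integral_cong_AE) auto
  next
    case False
    then show ?thesis using i borel_measurable_integrable not_integrable_integral_eq by metis
  qed
  then show "(\<integral>x. f x \<partial>lebesgue_on (- {0})) = (\<integral>x. f x \<partial>lebesgue)"
    using S by (simp add: integral_restrict_space g_def)
qed

lemma L2_iff: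
  fixes f :: "real \<Rightarrow> 'a::euclidean_space"
  assumes "\<Omega> \<in> {UNIV, - {0}}"
  shows "f \<in> L2 \<Omega> \<longleftrightarrow> f \<in> borel_measurable lebesgue \<and> integrable lebesgue (\<lambda>x. (norm (f x))\<^sup>2)"
  using assms by (auto simp: L2_def integral_punctured lebesgue_on_UNIV_eq)

lemma is_weak_deriv_iff:
  fixes y g :: "real \<Rightarrow> 'a::euclidean_space"
  assumes "\<Omega> \<in> {UNIV, - {0}}"
  shows "is_weak_deriv \<Omega> k y g \<longleftrightarrow> (\<forall>\<phi>. test_function \<Omega> \<phi> \<longrightarrow>
     (\<integral>x. (deriv ^^ k) \<phi> x *\<^sub>R y x \<partial>lebesgue) = (-1) ^ k *\<^sub>R (\<integral>x. \<phi> x *\<^sub>R g x \<partial>lebesgue))"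
  using assms by (auto simp: is_weak_deriv_def integral_punctured lebesgue_on_UNIV_eq)

lemma L2_locally_integrable:
  fixes f :: "real \<Rightarrow> 'a::euclidean_space"
  assumes "f \<in> L2 \<Omega>" "\<Omega> \<in> {UNIV, - {0}}"
  shows "locally_integrable I f"
  unfolding locally_integrable_def
proof (intro allI impI)
  fix a b :: real
  have f: "f \<in> borel_measurable lebesgue" "integrable lebesgue (\<lambda>x. (norm (f x))\<^sup>2)"
    using assms L2_iff by auto
  have "(\<lambda>x. (norm (f x))\<^sup>2) integrable_on {a..b}"
    using integrable_on_lebesgue[OF f(2)] integrable_on_subinterval by blast
  then have "(\<lambda>x. 1 + (norm (f x))\<^sup>2) integrable_on {a..b}"
    by (intro integrable_add) auto
  then show "f absolutely_integrable_on {a..b}"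
  proof (rule measurable_bounded_by_integrable_imp_absolutely_integrable[rotated 2])
    show "norm (f x) \<le> 1 + (norm (f x))\<^sup>2" for x
      using zero_le_power2[of "norm (f x) - 1 / 2"] norm_ge_zero[of "f x"]
      unfolding power2_diff by (simp add: power2_eq_square)
  qed (use f(1) measurable_restrict_space1 in auto)
qed

lemma test_function_mono: "test_function \<Omega> \<phi> \<Longrightarrow> \<Omega> \<subseteq> \<Omega>' \<Longrightarrow> test_function \<Omega>' \<phi>"
  unfolding test_function_def by (meson order_trans)

lemma test_function_scaleR_integrable:
  fixes f :: "real \<Rightarrow> 'a::euclidean_space"
  assumes \<phi>: "test_function \<Omega> \<phi>" and f: "locally_integrable UNIV f"
  shows "integrable lebesgue (\<lambda>x. \<phi> x *\<^sub>R f x)"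
proof -
  obtain K where K: "compact K" "\<And>x. x \<notin> K \<Longrightarrow> \<phi> x = 0"
    using \<phi> by (auto simp: test_function_def)
  obtain a b where ab: "a < b" "K \<subseteq> {a<..<b}"
    using compact_subset_open_interval[of UNIV K] K by auto
  have "(\<lambda>x. \<phi> x *\<^sub>R f x) absolutely_integrable_on {a..b}"
    by (intro absolutely_integrable_continuous_scaleR smooth_continuous test_function_smooth[OF \<phi>])
      (use f in \<open>auto simp: locally_integrable_def\<close>)
  then show ?thesis
    by (rule integral_compact_support(1)) (use K(2) ab(2) in force)
qed

text \<open>Two weak derivatives differ by a function orthogonal to all bumps supported in \<open>\<Omega>\<close>, and the omitted point
  is a null set. Hence the representative selected by \<open>weak_deriv\<close> may be replaced by any explicit one.\<close>

lemma weak_deriv_unique: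
  fixes y g1 g2 :: "real \<Rightarrow> 'a::euclidean_space"
  assumes \<Omega>: "\<Omega> \<in> {UNIV, - {0}}" and g: "g1 \<in> L2 \<Omega>" "g2 \<in> L2 \<Omega>"
    and w: "is_weak_deriv \<Omega> k y g1" "is_weak_deriv \<Omega> k y g2"
  shows "AE x in lebesgue. g1 x = g2 x"
proof -
  have li: "locally_integrable UNIV g1" "locally_integrable UNIV g2"
    using L2_locally_integrable g \<Omega> by auto
  have "AE x in lebesgue. x \<in> \<Omega> \<longrightarrow> g1 x - g2 x = 0"
  proof (rule fundamental_lemma)
    show "open \<Omega>" using \<Omega> by auto
    show "locally_integrable \<Omega> (\<lambda>x. g1 x - g2 x)"
      using li by (auto simp: locally_integrable_def intro!: set_integral_diff)
    fix a b n :: real assume "{a..b} \<subseteq> \<Omega>" "0 < n"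
    then have t: "test_function \<Omega> (bump a b n)" by (simp add: bump_test_function)
    have "(-1) ^ k *\<^sub>R (\<integral>x. bump a b n x *\<^sub>R g1 x \<partial>lebesgue)
        = (-1) ^ k *\<^sub>R (\<integral>x. bump a b n x *\<^sub>R g2 x \<partial>lebesgue)"
      using w t by (simp add: is_weak_deriv_iff[OF \<Omega>])
    then have "(\<integral>x. bump a b n x *\<^sub>R g1 x \<partial>lebesgue) = (\<integral>x. bump a b n x *\<^sub>R g2 x \<partial>lebesgue)"
      by simp
    then show "(\<integral>x. bump a b n x *\<^sub>R (g1 x - g2 x) \<partial>lebesgue) = 0"
      using test_function_scaleR_integrable[OF t li(1)] test_function_scaleR_integrable[OF t li(2)]
      by (simp add: scaleR_diff_right)
  qed
  moreover have "AE x in lebesgue. x \<noteq> (0::real)"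
    unfolding eventually_ae_filter_negligible by (intro exI[of _ "{0}"]) auto
  ultimately show ?thesis
    by eventually_elim (use \<Omega> in auto)
qed

lemma weak_derivI:
  assumes "g \<in> L2 \<Omega>" "is_weak_deriv \<Omega> k y g"
  shows "weak_deriv \<Omega> k y \<in> L2 \<Omega>" "is_weak_deriv \<Omega> k y (weak_deriv \<Omega> k y)"
  using someI[of "\<lambda>g. g \<in> L2 \<Omega> \<and> is_weak_deriv \<Omega> k y g"] assms
  unfolding weak_deriv_def by auto

lemma W22_D:
  assumes "y \<in> W22 \<Omega>" "k \<in> {1, 2}"
  shows "y \<in> L2 \<Omega>" "weak_deriv \<Omega> k y \<in> L2 \<Omega>" "is_weak_deriv \<Omega> k y (weak_deriv \<Omega> k y)"
proof -
  show "y \<in> L2 \<Omega>" using assms by (auto simp: W22_def)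
  obtain g where "g \<in> L2 \<Omega>" "is_weak_deriv \<Omega> k y g"
    using assms unfolding W22_def by blast
  then show "weak_deriv \<Omega> k y \<in> L2 \<Omega>" "is_weak_deriv \<Omega> k y (weak_deriv \<Omega> k y)"
    by (rule weak_derivI)+
qed

lemma weak_deriv_AE_eq:
  fixes y g :: "real \<Rightarrow> 'a::euclidean_space"
  assumes "\<Omega> \<in> {UNIV, - {0}}" "g \<in> L2 \<Omega>" "is_weak_deriv \<Omega> k y g"
  shows "AE x in lebesgue. weak_deriv \<Omega> k y x = g x"
  using weak_deriv_unique[OF assms(1)] weak_derivI[OF assms(2,3)] assms by blast

lemma primitive_on_extend:
  fixes f :: "real \<Rightarrow> 'a::euclidean_space"
  assumes I: "is_interval I" "x0 \<in> I" and F: "primitive_on I F f" and f: "locally_integrable UNIV f"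
  obtains F' where "primitive_on UNIV F' f" "\<And>x. x \<in> I \<Longrightarrow> F' x = F x"
proof -
  obtain G where G: "primitive_on UNIV G f"
    using primitive_exists[of UNIV x0 f] f by auto
  have "primitive_on UNIV (\<lambda>x. G x + (F x0 - G x0)) f"
    using primitive_on_add[OF G primitive_on_const] by simp
  moreover have "G x + (F x0 - G x0) = F x" if "x \<in> I" for x
  proof (cases "x0 \<le> x")
    case True
    then show ?thesis using primitive_onD(4)[OF G, of x0 x] primitive_onD(4)[OF F, of x0 x] that I
      by (auto simp: algebra_simps)
  next
    case False
    then show ?thesis using primitive_onD(4)[OF G, of x x0] primitive_onD(4)[OF F, of x x0] that I
      by (auto simp: algebra_simps)
  qed
  ultimately show ?thesis using that by blast
qed

lemma primitive_on_continuous_UNIV: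
  assumes "primitive_on UNIV F f"
  shows "continuous_on S F"
proof -
  have "isCont F x" for x
  proof -
    have "continuous_on {x - 1..x + 1} F"
      by (rule primitive_on_continuous_cbox[OF primitive_on_subset[OF assms]]) auto
    then show ?thesis
      by (rule continuous_on_interior) auto
  qed
  then show ?thesis by (simp add: continuous_at_imp_continuous_on)
qed

text \<open>Two applications of du Bois-Reymond: the second weak derivative is the weak derivative of the first, which is
  therefore absolutely continuous on each component of \<open>\<Omega>\<close>. The primitives are continued to the whole line
  so that their values at the end point \<open>0\<close> are the one-sided limits.\<close>

lemma W22_representative:
  fixes y :: "real \<Rightarrow> 'a::euclidean_space"
  assumes \<Omega>: "\<Omega> \<in> {UNIV, - {0}}" and y: "y \<in> W22 \<Omega>"
    and I: "open I" "is_interval I" "I \<noteq> {}" "I \<subseteq> \<Omega>"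
  obtains u v where "primitive_on UNIV u v" "primitive_on UNIV v (weak_deriv \<Omega> 2 y)"
    "AE x in lebesgue. x \<in> I \<longrightarrow> y x = u x" "AE x in lebesgue. x \<in> I \<longrightarrow> weak_deriv \<Omega> 1 y x = v x"
proof -
  define g1 where "g1 = weak_deriv \<Omega> 1 y"
  define g2 where "g2 = weak_deriv \<Omega> 2 y"
  have g: "y \<in> L2 \<Omega>" "g1 \<in> L2 \<Omega>" "g2 \<in> L2 \<Omega>" "is_weak_deriv \<Omega> 1 y g1" "is_weak_deriv \<Omega> 2 y g2"
    using W22_D[OF y] by (auto simp: g1_def g2_def)
  note li = L2_locally_integrable[OF _ \<Omega>]
  have 1: "(\<integral>x. deriv \<phi> x *\<^sub>R y x \<partial>lebesgue) = - (\<integral>x. \<phi> x *\<^sub>R g1 x \<partial>lebesgue)"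
    if "test_function \<Omega> \<phi>" for \<phi>
    using g(4) that by (simp add: is_weak_deriv_iff[OF \<Omega>])
  have 2: "(\<integral>x. deriv \<phi> x *\<^sub>R g1 x \<partial>lebesgue) = - (\<integral>x. \<phi> x *\<^sub>R g2 x \<partial>lebesgue)"
    if t: "test_function \<Omega> \<phi>" for \<phi>
  proof -
    have "(\<integral>x. deriv (deriv \<phi>) x *\<^sub>R y x \<partial>lebesgue) = (\<integral>x. \<phi> x *\<^sub>R g2 x \<partial>lebesgue)"
      using g(5) t by (simp add: is_weak_deriv_iff[OF \<Omega>] numeral_2_eq_2)
    then show ?thesis using 1[OF test_function_deriv[OF t]] by (metis add.inverse_inverse)
  qed
  obtain H1 where H1: "primitive_on I H1 g1" "AE x in lebesgue. x \<in> I \<longrightarrow> y x = H1 x"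
    by (rule du_bois_reymond[OF I(1-3) li li, of y g1])
      (use g 1 test_function_mono[OF _ I(4)] in auto)
  obtain H2 where H2: "primitive_on I H2 g2" "AE x in lebesgue. x \<in> I \<longrightarrow> g1 x = H2 x"
    by (rule du_bois_reymond[OF I(1-3) li li, of g1 g2])
      (use g 2 test_function_mono[OF _ I(4)] in auto)
  obtain x0 where x0: "x0 \<in> I" using I by auto
  obtain v where v: "primitive_on UNIV v g2" "\<And>x. x \<in> I \<Longrightarrow> v x = H2 x"
    using primitive_on_extend[OF I(2) x0 H2(1) li[OF g(3)]] by blast
  have "primitive_on I H1 v"
    by (rule primitive_on_cong_AE[OF H1(1) _ I(2)]) (use H2(2) v(2) in \<open>auto elim: eventually_mono\<close>)
  moreover have "locally_integrable UNIV v"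
    using primitive_on_continuous_UNIV[OF v(1)]
    by (auto simp: locally_integrable_def intro!: absolutely_integrable_continuous_real)
  ultimately obtain u where u: "primitive_on UNIV u v" "\<And>x. x \<in> I \<Longrightarrow> u x = H1 x"
    using primitive_on_extend[OF I(2) x0] by blast
  show ?thesis
  proof (rule that)
    show "AE x in lebesgue. x \<in> I \<longrightarrow> y x = u x" using H1(2) u(2) by (auto elim: eventually_mono)
    show "AE x in lebesgue. x \<in> I \<longrightarrow> weak_deriv \<Omega> 1 y x = v x"
      using H2(2) v(2) by (auto elim: eventually_mono simp: g1_def)
  qed (use u v in \<open>auto simp: g2_def\<close>)
qed

text \<open>A null set cannot contain a one-sided neighbourhood of the origin, so functions that agree almost
  everywhere agree at points arbitrarily close to \<open>0\<close>.\<close>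

lemma tendsto_unique_AE:
  fixes z w :: "real \<Rightarrow> 'a::real_normed_vector"
  assumes S: "\<And>e. 0 < e \<Longrightarrow> \<not> negligible (S \<inter> ball 0 e)" "0 \<notin> S"
    and "AE x in lebesgue. z x = w x"
    and z: "(z \<longlongrightarrow> a) (at 0 within S)" and w: "(w \<longlongrightarrow> b) (at 0 within S)"
  shows "a = b"
proof -
  obtain N where N: "negligible N" "\<And>x. x \<notin> N \<Longrightarrow> z x = w x"
    using assms(3) unfolding eventually_ae_filter_negligible by fastforce
  have "0 islimpt (S - N)"
    unfolding islimpt_approachable
  proof (intro allI impI)
    fix e :: real assume "0 < e"
    then have "\<not> S \<inter> ball 0 e \<subseteq> N" using S(1) N(1) negligible_subset by blast
    then obtain x where "x \<in> S" "x \<in> ball 0 e" "x \<notin> N" by blast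
    then show "\<exists>x'\<in>S - N. x' \<noteq> 0 \<and> dist x' 0 < e"
      using S(2) by (intro bexI[of _ x]) (auto simp: dist_commute)
  qed
  then have nb: "at 0 within (S - N) \<noteq> bot" by (simp add: trivial_limit_within)
  have "(z \<longlongrightarrow> a) (at 0 within (S - N))" using z tendsto_within_subset by blast
  moreover have "(z \<longlongrightarrow> b) (at 0 within (S - N))"
    by (rule Lim_transform_within[OF tendsto_within_subset[OF w], of _ 1]) (use N in auto)
  ultimately show ?thesis using tendsto_unique[OF nb] by blast
qed

lemma not_negligible_half_ball:
  assumes e: "0 < (e::real)"
  shows "\<not> negligible ({0::real<..} \<inter> ball 0 e)" "\<not> negligible ({..<0::real} \<inter> ball 0 e)"
proof -
  have *: "\<not> negligible S" if "open S" "x \<in> S" for S and x :: real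
    using that open_not_negligible by blast
  show "\<not> negligible ({0::real<..} \<inter> ball 0 e)"
    by (rule *[of _ "e / 2"]) (use e in \<open>auto simp: dist_real_def intro!: open_Int\<close>)
  show "\<not> negligible ({..<0::real} \<inter> ball 0 e)"
    by (rule *[of _ "- e / 2"]) (use e in \<open>auto simp: dist_real_def intro!: open_Int\<close>)
qed

lemma right_limit0_eq:
  fixes y z :: "real \<Rightarrow> 'a::{banach,second_countable_topology}"
  assumes "AE x in lebesgue. z x = y x" "(z \<longlongrightarrow> a) (at_right 0)"
  shows "right_limit0 y = a"
  unfolding right_limit0_def
proof (rule the_equality)
  fix b assume "\<exists>w. (AE x in lebesgue. w x = y x) \<and> (w \<longlongrightarrow> b) (at_right 0)"
  then obtain w where w: "AE x in lebesgue. w x = y x" "(w \<longlongrightarrow> b) (at_right 0)" by blast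
  have "AE x in lebesgue. w x = z x" using w(1) assms(1) by eventually_elim auto
  from tendsto_unique_AE[OF not_negligible_half_ball(1) _ this w(2) assms(2)]
  show "b = a" by auto
qed (use assms in auto)

lemma left_limit0_eq:
  fixes y z :: "real \<Rightarrow> 'a::{banach,second_countable_topology}"
  assumes "AE x in lebesgue. z x = y x" "(z \<longlongrightarrow> a) (at_left 0)"
  shows "left_limit0 y = a"
  unfolding left_limit0_def
proof (rule the_equality)
  fix b assume "\<exists>w. (AE x in lebesgue. w x = y x) \<and> (w \<longlongrightarrow> b) (at_left 0)"
  then obtain w where w: "AE x in lebesgue. w x = y x" "(w \<longlongrightarrow> b) (at_left 0)" by blast
  have "AE x in lebesgue. w x = z x" using w(1) assms(1) by eventually_elim auto
  from tendsto_unique_AE[OF not_negligible_half_ball(2) _ this w(2) assms(2)]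
  show "b = a" by auto
qed (use assms in auto)

lemma one_sided_limits_of_halves:
  fixes y R L :: "real \<Rightarrow> 'a::{banach,second_countable_topology}"
  assumes y: "AE x in lebesgue. y x = (if 0 < x then R x else L (- x))"
    and R: "continuous_on {0..} R" and L: "continuous_on {0..} L"
  shows "right_limit0 y = R 0" "left_limit0 y = L 0"
proof -
  let ?z = "\<lambda>x. if 0 < x then R x else L (- x)"
  have ae: "AE x in lebesgue. ?z x = y x" using y by eventually_elim simp
  have "(R \<longlongrightarrow> R 0) (at 0 within {0<..})"
    by (rule tendsto_within_subset[of _ _ _ "{0..}"]) (use R in \<open>auto simp: continuous_on_def\<close>)
  then have "(?z \<longlongrightarrow> R 0) (at_right 0)"
    by (rule Lim_transform_within[of _ _ _ _ 1]) auto
  then show "right_limit0 y = R 0" by (rule right_limit0_eq[OF ae])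
  have "(L \<longlongrightarrow> L 0) (at 0 within {0<..})"
    by (rule tendsto_within_subset[of _ _ _ "{0..}"]) (use L in \<open>auto simp: continuous_on_def\<close>)
  then have "((\<lambda>x. L (- x)) \<longlongrightarrow> L 0) (at_left 0)"
    by (simp add: at_left_minus[of 0] filterlim_filtermap)
  then have "(?z \<longlongrightarrow> L 0) (at_left 0)"
    by (rule Lim_transform_within[of _ _ _ _ 1]) auto
  then show "left_limit0 y = L 0" by (rule left_limit0_eq[OF ae])
qed


section \<open>Eigenfunctions folded at the origin\<close>

text \<open>The equation \<open>u'' = q u\<close> on \<open>[0, \<infinity>)\<close> as a first-order system, with \<open>v\<close> in the role of \<open>u'\<close>.\<close>

definition half_line_solution ::
  "(real \<Rightarrow> real) \<Rightarrow> (real \<Rightarrow> 'a::euclidean_space) \<Rightarrow> (real \<Rightarrow> 'a) \<Rightarrow> bool" where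
  "half_line_solution q u v \<longleftrightarrow>
    primitive_on {0..} u v \<and> primitive_on {0..} v (\<lambda>x. q x *\<^sub>R u x)"

text \<open>The line is folded at the origin: \<open>up\<close> is the right half of \<open>y\<close> and \<open>um\<close> the reflected left half.
  Reflection changes the sign of derivatives, so \<open>y'(-0) = - vm 0\<close> and the jump of the derivative
  becomes the sum \<open>vp 0 + vm 0\<close>. The value \<open>\<beta> = \<alpha>\<close> describes the point interaction, and
  \<open>\<beta> = 0\<close> describes an ordinary Schroedinger operator.\<close>

definition folded_eigenfunction where
  "folded_eigenfunction V \<beta> \<mu> y up vp um vm \<longleftrightarrow>
    half_line_solution (\<lambda>x. V x - \<mu>) up vp \<and> half_line_solution (\<lambda>x. V (- x) - \<mu>) um vm \<and>
    up 0 = um 0 \<and> vp 0 + vm 0 = \<beta> *\<^sub>R up 0 \<and>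
    (AE x in lebesgue. y x = (if 0 < x then up x else um (- x)))"

lemma half_line_solution_continuous:
  assumes "half_line_solution q u v"
  shows "continuous_on {0..} u" "continuous_on {0..} v"
  using assms primitive_on_continuous_Ici by (auto simp: half_line_solution_def)

lemma AE_nonzero: "AE x in lebesgue. x \<noteq> (0::real)"
  unfolding eventually_ae_filter_negligible by (intro exI[of _ "{0}"]) auto

lemma AE_reflect:
  assumes "AE x in lebesgue. P (x::real)"
  shows "AE x in lebesgue. P (- x)"
proof -
  obtain N where N: "negligible N" "{x. \<not> P x} \<subseteq> N"
    using assms unfolding eventually_ae_filter_negligible by auto
  have "negligible ((\<lambda>x. - x) ` N)"
    by (rule negligible_differentiable_image_negligible[OF _ N(1)])
      (auto intro!: derivative_intros simp: differentiable_on_def)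
  moreover have "{x. \<not> P (- x)} \<subseteq> (\<lambda>x. - x) ` N"
    using N(2) by (force simp: image_iff)
  ultimately show ?thesis unfolding eventually_ae_filter_negligible by auto
qed

lemma half_line_solutionI:
  fixes u v :: "real \<Rightarrow> 'a::euclidean_space"
  assumes u: "primitive_on UNIV u v" and v: "primitive_on UNIV v g"
    and "AE x in lebesgue. 0 < x \<longrightarrow> g x = q x *\<^sub>R u x"
  shows "half_line_solution q u v"
  unfolding half_line_solution_def
proof
  show "primitive_on {0..} u v" using u by (rule primitive_on_subset) simp
  have "AE x in lebesgue. x \<in> {0..} \<longrightarrow> g x = q x *\<^sub>R u x"
    using assms(3) AE_nonzero by eventually_elim auto
  then show "primitive_on {0..} v (\<lambda>x. q x *\<^sub>R u x)"
    by (rule primitive_on_cong_AE[OF primitive_on_subset[OF v subset_UNIV]]) (auto simp: is_interval_ci)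
qed

lemma folded_of_W22:
  fixes uR vR uL vL g :: "real \<Rightarrow> 'a::euclidean_space"
  assumes R: "primitive_on UNIV uR vR" "primitive_on UNIV vR g"
    and L: "primitive_on UNIV uL vL" "primitive_on UNIV vL g"
    and y: "AE x in lebesgue. 0 < x \<longrightarrow> y x = uR x" "AE x in lebesgue. x < 0 \<longrightarrow> y x = uL x"
    and g: "AE x in lebesgue. g x = (V x - \<mu>) *\<^sub>R y x"
    and match: "uR 0 = uL 0" "vR 0 - vL 0 = \<beta> *\<^sub>R uR 0"
  shows "folded_eigenfunction V \<beta> \<mu> y uR vR (\<lambda>x. uL (- x)) (\<lambda>x. - vL (- x))"
  unfolding folded_eigenfunction_def
proof (intro conjI)
  show "half_line_solution (\<lambda>x. V x - \<mu>) uR vR"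
    by (rule half_line_solutionI[OF R]) (use g y(1) in \<open>eventually_elim, auto\<close>)
  have "AE x in lebesgue. x < 0 \<longrightarrow> g x = (V x - \<mu>) *\<^sub>R uL x"
    using g y(2) by eventually_elim auto
  from AE_reflect[OF this]
  have "AE x in lebesgue. 0 < x \<longrightarrow> g (- x) = (V (- x) - \<mu>) *\<^sub>R uL (- x)" by simp
  then show "half_line_solution (\<lambda>x. V (- x) - \<mu>) (\<lambda>x. uL (- x)) (\<lambda>x. - vL (- x))"
    using primitive_on_reflect[OF L(1)] primitive_on_minus[OF primitive_on_reflect[OF L(2)]]
    by (intro half_line_solutionI) auto
  show "AE x in lebesgue. y x = (if 0 < x then uR x else uL (- (- x)))"
    using y AE_nonzero by eventually_elim auto
qed (use match in auto)

lemma S_op_eigenfunction_folded: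
  assumes e: "eigenfunction (S_op V \<beta>) \<mu> y"
  obtains up vp um vm where "folded_eigenfunction V \<beta> \<mu> y up vp um vm"
    "AE x in lebesgue. weak_deriv (- {0}) 1 y x = (if 0 < x then vp x else - vm (- x))"
proof -
  let ?\<Omega> = "- {0::real}"
  have y: "y \<in> W22 ?\<Omega>" "right_limit0 y = left_limit0 y"
    "right_limit0 (weak_deriv ?\<Omega> 1 y) - left_limit0 (weak_deriv ?\<Omega> 1 y) = complex_of_real \<beta> * right_limit0 y"
    using e by (auto simp: eigenfunction_def S_op_def)
  have ae: "AE x in lebesgue. - weak_deriv ?\<Omega> 2 y x + complex_of_real (V x) * y x = complex_of_real \<mu> * y x"
    using e by (auto simp: eigenfunction_def S_op_def)
  obtain uR vR where R: "primitive_on UNIV uR vR" "primitive_on UNIV vR (weak_deriv ?\<Omega> 2 y)"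
    "AE x in lebesgue. x \<in> {0<..} \<longrightarrow> y x = uR x"
    "AE x in lebesgue. x \<in> {0<..} \<longrightarrow> weak_deriv ?\<Omega> 1 y x = vR x"
    by (rule W22_representative[OF _ y(1), of "{0<..}"]) (auto simp: is_interval_oi)
  obtain uL vL where L: "primitive_on UNIV uL vL" "primitive_on UNIV vL (weak_deriv ?\<Omega> 2 y)"
    "AE x in lebesgue. x \<in> {..<0} \<longrightarrow> y x = uL x"
    "AE x in lebesgue. x \<in> {..<0} \<longrightarrow> weak_deriv ?\<Omega> 1 y x = vL x"
    by (rule W22_representative[OF _ y(1), of "{..<0}"]) (auto simp: is_interval_io)
  have c: "continuous_on {0..} uR" "continuous_on {0..} vR"
    "continuous_on {0..} (\<lambda>x. uL (- x))" "continuous_on {0..} (\<lambda>x. vL (- x))"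
    using primitive_on_continuous_UNIV[OF R(1)] primitive_on_continuous_UNIV[OF R(2)]
      primitive_on_continuous_UNIV[OF L(1)] primitive_on_continuous_UNIV[OF L(2)]
    by (auto intro!: continuous_on_compose2[OF _ continuous_on_minus[OF continuous_on_id]])
  have 0: "AE x in lebesgue. y x = (if 0 < x then uR x else uL (- (- x)))"
    using R(3) L(3) AE_nonzero by eventually_elim auto
  have 1: "AE x in lebesgue. weak_deriv ?\<Omega> 1 y x = (if 0 < x then vR x else vL (- (- x)))"
    using R(4) L(4) AE_nonzero by eventually_elim auto
  note l0 = one_sided_limits_of_halves[OF 0 c(1,3)] and l1 = one_sided_limits_of_halves[OF 1 c(2,4)]
  have "AE x in lebesgue. weak_deriv ?\<Omega> 2 y x = (V x - \<mu>) *\<^sub>R y x"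
    using ae by eventually_elim (auto simp: algebra_simps scaleR_conv_of_real)
  then have "folded_eigenfunction V \<beta> \<mu> y uR vR (\<lambda>x. uL (- x)) (\<lambda>x. - vL (- x))"
    using R L y(2,3) l0 l1 by (intro folded_of_W22) (auto simp: scaleR_conv_of_real)
  then show ?thesis by (rule that) (use 1 in \<open>eventually_elim, auto\<close>)
qed

definition scaled_potential :: "(real \<Rightarrow> real) \<Rightarrow> (real \<Rightarrow> real) \<Rightarrow> real \<Rightarrow> real \<Rightarrow> real" where
  "scaled_potential W U \<epsilon> x = W x + inverse \<epsilon> * U (inverse \<epsilon> * x)"

lemma H_op_eigenfunction_folded:
  assumes e: "eigenfunction (H_op W U \<epsilon>) \<mu> y"
  obtains up vp um vm where "folded_eigenfunction (scaled_potential W U \<epsilon>) 0 \<mu> y up vp um vm"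
proof -
  have y: "y \<in> W22 UNIV"
    using e by (auto simp: eigenfunction_def H_op_def)
  have ae: "AE x in lebesgue. - weak_deriv UNIV 2 y x + complex_of_real (scaled_potential W U \<epsilon> x) * y x
      = complex_of_real \<mu> * y x"
    using e by (auto simp: eigenfunction_def H_op_def scaled_potential_def)
  obtain u v where R: "primitive_on UNIV u v" "primitive_on UNIV v (weak_deriv UNIV 2 y)"
    "AE x in lebesgue. x \<in> UNIV \<longrightarrow> y x = u x"
    by (rule W22_representative[OF _ y, of UNIV]) auto
  have "AE x in lebesgue. weak_deriv UNIV 2 y x = (scaled_potential W U \<epsilon> x - \<mu>) *\<^sub>R y x"
    using ae by eventually_elim (auto simp: algebra_simps scaleR_conv_of_real)
  then have "folded_eigenfunction (scaled_potential W U \<epsilon>) 0 \<mu> y u v (\<lambda>x. u (- x)) (\<lambda>x. - v (- x))"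
    using R by (intro folded_of_W22) auto
  then show ?thesis using that by blast
qed

text \<open>Integrating by parts on both sides of the origin leaves the boundary term \<open>\<phi> 0 *\<^sub>R (L 0 - R 0)\<close>. It vanishes
  on the punctured line because \<open>\<phi>\<close> does, and on the line because the halves match.\<close>

lemma weak_deriv_of_halves:
  fixes R L r l y g :: "real \<Rightarrow> 'a::euclidean_space"
  assumes \<Omega>: "\<Omega> \<in> {UNIV, - {0}}" and match: "\<Omega> = UNIV \<Longrightarrow> R 0 = L 0"
    and R: "primitive_on {0..} R r" and L: "primitive_on {..0} L l"
    and y: "AE x in lebesgue. y x = (if 0 < x then R x else L x)"
    and g: "AE x in lebesgue. g x = (if 0 < x then r x else l x)"
    and L2: "y \<in> L2 \<Omega>" "g \<in> L2 \<Omega>" and t: "test_function \<Omega> \<phi>"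
  shows "(\<integral>x. deriv \<phi> x *\<^sub>R y x \<partial>lebesgue) = - (\<integral>x. \<phi> x *\<^sub>R g x \<partial>lebesgue)"
proof -
  note s = test_function_smooth[OF t]
  obtain K where K: "compact K" "K \<subseteq> \<Omega>" "\<And>x. x \<notin> K \<Longrightarrow> \<phi> x = 0"
    using t by (auto simp: test_function_def)
  obtain K' where K': "compact K'" "\<And>x. x \<notin> K' \<Longrightarrow> deriv \<phi> x = 0"
    using test_function_deriv[OF t] by (auto simp: test_function_def)
  obtain a b where ab: "a < b" "K \<union> K' \<subseteq> {a<..<b}"
    using compact_subset_open_interval[of UNIV "K \<union> K'"] K K' compact_Un by (metis UNIV_I
        empty_iff is_interval_univ open_UNIV subset_UNIV)
  define M where "M = 1 + max \<bar>a\<bar> \<bar>b\<bar>"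
  have M: "0 < M" by (auto simp: M_def)
  have z: "\<phi> x = 0" "deriv \<phi> x = 0" if "x \<notin> {- M<..<M}" for x
  proof -
    have "x \<notin> {a<..<b}" using that by (auto simp: M_def)
    then have "x \<notin> K" "x \<notin> K'" using ab(2) by blast+
    then show "\<phi> x = 0" "deriv \<phi> x = 0" using K K' by auto
  qed
  have li: "locally_integrable UNIV y" "locally_integrable UNIV g"
    using L2_locally_integrable L2 \<Omega> by auto
  have split: "(\<integral>x. \<theta> x *\<^sub>R f x \<partial>lebesgue)
      = integral {-M..0} (\<lambda>x. \<theta> x *\<^sub>R fl x) + integral {0..M} (\<lambda>x. \<theta> x *\<^sub>R fr x)"
    if \<theta>: "test_function \<Omega> \<theta>" "\<And>x. x \<notin> {- M<..<M} \<Longrightarrow> \<theta> x = 0" and f: "locally_integrable UNIV f"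
      "AE x in lebesgue. f x = (if 0 < x then fr x else fl x)" for \<theta> f fl fr
  proof -
    have ai: "(\<lambda>x. \<theta> x *\<^sub>R f x) absolutely_integrable_on {-M..M}"
      by (intro absolutely_integrable_continuous_scaleR smooth_continuous test_function_smooth[OF \<theta>(1)])
        (use f in \<open>auto simp: locally_integrable_def\<close>)
    obtain N where N: "negligible N" "\<And>x. x \<notin> N \<Longrightarrow> f x = (if 0 < x then fr x else fl x)"
      using f(2) unfolding eventually_ae_filter_negligible by fastforce
    have "(\<integral>x. \<theta> x *\<^sub>R f x \<partial>lebesgue) = integral {-M..M} (\<lambda>x. \<theta> x *\<^sub>R f x)"
      by (rule integral_compact_support(2)[OF ai]) (use \<theta>(2) in auto)
    also have "\<dots> = integral {-M..0} (\<lambda>x. \<theta> x *\<^sub>R f x) + integral {0..M} (\<lambda>x. \<theta> x *\<^sub>R f x)"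
      using M set_lebesgue_integral_eq_integral(1)[OF ai]
      by (intro Henstock_Kurzweil_Integration.integral_combine[symmetric]) auto
    also have "integral {-M..0} (\<lambda>x. \<theta> x *\<^sub>R f x) = integral {-M..0} (\<lambda>x. \<theta> x *\<^sub>R fl x)"
      by (rule integral_spike[OF N(1)]) (use N(2) in auto)
    also have "integral {0..M} (\<lambda>x. \<theta> x *\<^sub>R f x) = integral {0..M} (\<lambda>x. \<theta> x *\<^sub>R fr x)"
      by (rule integral_spike[of "insert 0 N"]) (use N in auto)
    finally show ?thesis .
  qed
  have "(\<integral>x. deriv \<phi> x *\<^sub>R y x \<partial>lebesgue)
      = integral {-M..0} (\<lambda>x. deriv \<phi> x *\<^sub>R L x) + integral {0..M} (\<lambda>x. deriv \<phi> x *\<^sub>R R x)"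
    by (rule split[OF test_function_deriv[OF t] z(2) li(1) y])
  also have "integral {-M..0} (\<lambda>x. deriv \<phi> x *\<^sub>R L x)
      = \<phi> 0 *\<^sub>R L 0 - \<phi> (- M) *\<^sub>R L (- M) - integral {-M..0} (\<lambda>x. \<phi> x *\<^sub>R l x)"
    by (rule integral_by_parts_smooth[OF primitive_on_subset[OF L] _ s]) (use M in auto)
  also have "integral {0..M} (\<lambda>x. deriv \<phi> x *\<^sub>R R x)
      = \<phi> M *\<^sub>R R M - \<phi> 0 *\<^sub>R R 0 - integral {0..M} (\<lambda>x. \<phi> x *\<^sub>R r x)"
    by (rule integral_by_parts_smooth[OF primitive_on_subset[OF R] _ s]) (use M in auto)
  also have "\<phi> M = 0" by (rule z) simp
  also have "\<phi> (- M) = 0" by (rule z) simp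
  also have "\<phi> 0 *\<^sub>R L 0 = \<phi> 0 *\<^sub>R R 0"
    using match \<Omega> K(2,3) by (cases "\<Omega> = UNIV") auto
  finally have "(\<integral>x. deriv \<phi> x *\<^sub>R y x \<partial>lebesgue)
      = - (integral {-M..0} (\<lambda>x. \<phi> x *\<^sub>R l x) + integral {0..M} (\<lambda>x. \<phi> x *\<^sub>R r x))"
    by simp
  also have "\<dots> = - (\<integral>x. \<phi> x *\<^sub>R g x \<partial>lebesgue)"
    using split[OF t z(1) li(2) g] by simp
  finally show ?thesis .
qed

lemma W22_of_folded:
  fixes y up vp um vm :: "real \<Rightarrow> 'a::euclidean_space"
  assumes \<Omega>: "\<Omega> \<in> {UNIV, - {0}}" and f: "folded_eigenfunction V \<beta> \<mu> y up vp um vm"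
    and match: "\<Omega> = UNIV \<Longrightarrow> \<beta> = 0"
    and L2': "y \<in> L2 \<Omega>" "(\<lambda>x. if 0 < x then vp x else - vm (- x)) \<in> L2 \<Omega>"
      "(\<lambda>x. (V x - \<mu>) *\<^sub>R y x) \<in> L2 \<Omega>"
  shows "y \<in> W22 \<Omega>"
    "AE x in lebesgue. weak_deriv \<Omega> 1 y x = (if 0 < x then vp x else - vm (- x))"
    "AE x in lebesgue. weak_deriv \<Omega> 2 y x = (V x - \<mu>) *\<^sub>R y x"
proof -
  define y1 where y1: "y1 = (\<lambda>x. if 0 < x then vp x else - vm (- x))"
  define y2 where y2: "y2 = (\<lambda>x. (V x - \<mu>) *\<^sub>R y x)"
  have L2: "y \<in> L2 \<Omega>" "y1 \<in> L2 \<Omega>" "y2 \<in> L2 \<Omega>" using L2' by (auto simp: y1 y2)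
  have p: "primitive_on {0..} up vp" "primitive_on {0..} vp (\<lambda>x. (V x - \<mu>) *\<^sub>R up x)"
    "primitive_on {0..} um vm" "primitive_on {0..} vm (\<lambda>x. (V (- x) - \<mu>) *\<^sub>R um x)"
    and m: "up 0 = um 0" "vp 0 + vm 0 = \<beta> *\<^sub>R up 0"
    and y: "AE x in lebesgue. y x = (if 0 < x then up x else um (- x))"
    using f by (auto simp: folded_eigenfunction_def half_line_solution_def)
  have r: "{x::real. - x \<in> {0..}} = {..0}" by auto
  have q: "primitive_on {..0} (\<lambda>x. um (- x)) (\<lambda>x. - vm (- x))"
    "primitive_on {..0} (\<lambda>x. - vm (- x)) (\<lambda>x. (V x - \<mu>) *\<^sub>R um (- x))"
    using primitive_on_reflect[OF p(3)] primitive_on_minus[OF primitive_on_reflect[OF p(4)]]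
    unfolding r by auto
  have 1: "(\<integral>x. deriv \<phi> x *\<^sub>R y x \<partial>lebesgue) = - (\<integral>x. \<phi> x *\<^sub>R y1 x \<partial>lebesgue)"
    if "test_function \<Omega> \<phi>" for \<phi>
    by (rule weak_deriv_of_halves[OF \<Omega> _ p(1) q(1) y _ L2(1,2) that])
      (use m y1 in auto)
  have 2: "(\<integral>x. deriv \<phi> x *\<^sub>R y1 x \<partial>lebesgue) = - (\<integral>x. \<phi> x *\<^sub>R y2 x \<partial>lebesgue)"
    if "test_function \<Omega> \<phi>" for \<phi>
  proof (rule weak_deriv_of_halves[OF \<Omega> _ p(2) q(2) _ _ L2(2,3) that])
    show "AE x in lebesgue. y2 x = (if 0 < x then (V x - \<mu>) *\<^sub>R up x else (V x - \<mu>) *\<^sub>R um (- x))"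
      using y by eventually_elim (auto simp: y2)
  qed (use m y1 match in \<open>auto simp: eq_neg_iff_add_eq_0\<close>)
  have w1: "is_weak_deriv \<Omega> 1 y y1"
    using 1 by (simp add: is_weak_deriv_iff[OF \<Omega>])
  have w2: "is_weak_deriv \<Omega> 2 y y2"
    unfolding is_weak_deriv_iff[OF \<Omega>]
  proof (intro allI impI)
    fix \<phi> assume t: "test_function \<Omega> \<phi>"
    show "(\<integral>x. (deriv ^^ 2) \<phi> x *\<^sub>R y x \<partial>lebesgue) = (- 1) ^ 2 *\<^sub>R (\<integral>x. \<phi> x *\<^sub>R y2 x \<partial>lebesgue)"
      using 1[OF test_function_deriv[OF t]] 2[OF t] by (simp add: numeral_2_eq_2)
  qed
  show "y \<in> W22 \<Omega>" using w1 w2 L2 by (auto simp: W22_def)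
  show "AE x in lebesgue. weak_deriv \<Omega> 1 y x = (if 0 < x then vp x else - vm (- x))"
    using weak_deriv_AE_eq[OF \<Omega> L2(2) w1] unfolding y1 .
  show "AE x in lebesgue. weak_deriv \<Omega> 2 y x = (V x - \<mu>) *\<^sub>R y x"
    using weak_deriv_AE_eq[OF \<Omega> L2(3) w2] unfolding y2 .
qed

text \<open>Converse of the folding: matching half-line solutions that are square integrable together with
  their first two derivatives glue to an element of the operator domain.\<close>

lemma eigenfunction_of_folded:
  fixes y up vp um vm :: "real \<Rightarrow> complex"
  assumes f: "folded_eigenfunction V \<beta> \<mu> y up vp um vm"
    and L2: "y \<in> L2 UNIV" "(\<lambda>x. if 0 < x then vp x else - vm (- x)) \<in> L2 UNIV"
      "(\<lambda>x. (V x - \<mu>) *\<^sub>R y x) \<in> L2 UNIV"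
    and nz: "\<not> (AE x in lebesgue. y x = 0)"
  shows "eigenfunction (S_op V \<beta>) \<mu> y"
    and "\<beta> = 0 \<Longrightarrow> V = scaled_potential W U \<epsilon> \<Longrightarrow> eigenfunction (H_op W U \<epsilon>) \<mu> y"
proof -
  have L2': "g \<in> L2 (- {0})" if "g \<in> L2 UNIV" for g :: "real \<Rightarrow> complex"
    using that by (simp add: L2_iff)
  have h: "half_line_solution (\<lambda>x. V x - \<mu>) up vp" "half_line_solution (\<lambda>x. V (- x) - \<mu>) um vm"
    and m: "up 0 = um 0" "vp 0 + vm 0 = \<beta> *\<^sub>R up 0"
    and y: "AE x in lebesgue. y x = (if 0 < x then up x else um (- x))"
    using f by (auto simp: folded_eigenfunction_def)
  have W': "y \<in> W22 (- {0})"
    "AE x in lebesgue. weak_deriv (- {0}) 1 y x = (if 0 < x then vp x else - vm (- x))"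
    "AE x in lebesgue. weak_deriv (- {0}) 2 y x = (V x - \<mu>) *\<^sub>R y x"
    by (rule W22_of_folded[OF _ f]; use L2 L2' in auto)+
  have "right_limit0 y = up 0" "left_limit0 y = um 0"
    using one_sided_limits_of_halves[OF y] half_line_solution_continuous[OF h(1)]
      half_line_solution_continuous[OF h(2)] by auto
  moreover have "right_limit0 (weak_deriv (- {0}) 1 y) = vp 0" "left_limit0 (weak_deriv (- {0}) 1 y) = - vm 0"
    using one_sided_limits_of_halves[OF W'(2)] half_line_solution_continuous[OF h(1)]
      half_line_solution_continuous[OF h(2)] by (auto intro: continuous_on_minus)
  moreover have "AE x in lebesgue. - weak_deriv (- {0}) 2 y x + complex_of_real (V x) * y x = complex_of_real \<mu> * y x"
    using W'(3) by eventually_elim (simp add: algebra_simps scaleR_conv_of_real)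
  ultimately show "eigenfunction (S_op V \<beta>) \<mu> y"
    using W'(1) nz m by (simp add: eigenfunction_def S_op_def scaleR_conv_of_real)
  assume b: "\<beta> = 0" "V = scaled_potential W U \<epsilon>"
  have V: "y \<in> W22 UNIV" "AE x in lebesgue. weak_deriv UNIV 2 y x = (V x - \<mu>) *\<^sub>R y x"
    by (rule W22_of_folded[OF _ f]; use L2 b in auto)+
  have "AE x in lebesgue. - weak_deriv UNIV 2 y x + complex_of_real (V x) * y x = complex_of_real \<mu> * y x"
    using V(2) by eventually_elim (simp add: algebra_simps scaleR_conv_of_real)
  then show "eigenfunction (H_op W U \<epsilon>) \<mu> y"
    using V(1) nz by (simp add: eigenfunction_def H_op_def b scaled_potential_def)
qed

section \<open>Jost solutions\<close>

text \<open>The potential is used on the right half-line, where its support ends at \<open>R\<close>. The left half-line is treated by applying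
  the same notion to the reflected potential.\<close>

definition potential :: "real \<Rightarrow> (real \<Rightarrow> real) \<Rightarrow> bool" where
  "potential R V \<longleftrightarrow> V \<in> borel_measurable lebesgue \<and> (\<exists>B. \<forall>x. \<bar>V x\<bar> \<le> B) \<and> (\<forall>x>R. V x = 0)"

lemma potential_bound:
  assumes "potential R V"
  obtains B where "0 \<le> B" "\<And>x. \<bar>V x\<bar> \<le> B"
  using assms unfolding potential_def by (meson abs_ge_zero order_trans)

lemma potential_mult_integrable:
  assumes V: "potential R V" and u: "continuous_on {a..b} u"
  shows "(\<lambda>x. (V x + c) * u x) absolutely_integrable_on {a..b}"
proof -
  obtain B where B: "0 \<le> B" "\<And>x. \<bar>V x\<bar> \<le> B" using potential_bound[OF V] by blast
  have "(\<lambda>x. V x + c) \<in> borel_measurable lebesgue"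
    using V by (auto simp: potential_def)
  then have "(\<lambda>x. V x + c) \<in> borel_measurable (lebesgue_on {a..b})"
    by (rule measurable_restrict_space1)
  moreover have "bounded ((\<lambda>x. V x + c) ` {a..b})"
    unfolding bounded_iff using B(2)
    by (intro exI[of _ "B + \<bar>c\<bar>"]) (auto intro: order_trans[OF abs_triangle_ineq])
  ultimately show ?thesis
    by (intro absolutely_integrable_bounded_measurable_product_real
        absolutely_integrable_continuous_real u) auto
qed

lemma exp_integral_bound:
  fixes f :: "real \<Rightarrow> real"
  assumes f: "f integrable_on {s..R}" and K: "0 < K" and "s \<le> R" and C: "0 \<le> C"
    and le: "\<And>t. t \<in> {s..R} \<Longrightarrow> \<bar>f t\<bar> \<le> C * exp (K * (R - t))"
  shows "\<bar>integral {s..R} f\<bar> \<le> C / K * exp (K * (R - s))"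
proof -
  have "((\<lambda>t. C * exp (K * (R - t))) has_integral
      - (C / K) * exp (K * (R - R)) - - (C / K) * exp (K * (R - s))) {s..R}"
    by (rule fundamental_theorem_of_calculus)
      (use K assms(3) in \<open>auto intro!: derivative_eq_intros
        simp flip: has_real_derivative_iff_has_vector_derivative\<close>)
  then have I: "((\<lambda>t. C * exp (K * (R - t))) has_integral C / K * exp (K * (R - s)) - C / K) {s..R}"
    by (simp add: algebra_simps)
  have "\<bar>integral {s..R} f\<bar> \<le> integral {s..R} (\<lambda>t. C * exp (K * (R - t)))"
    using integral_norm_bound_integral[OF f, of "\<lambda>t. C * exp (K * (R - t))"] I le by auto
  also have "\<dots> = C / K * exp (K * (R - s)) - C / K" by (rule integral_unique[OF I])
  also have "\<dots> \<le> C / K * exp (K * (R - s))" using K C by simp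
  finally show ?thesis .
qed

text \<open>Picard iteration from the right end point. In the norm weighted by \<open>exp (K * (R - x))\<close>, each of the
  two integrations gains a factor \<open>1 / K\<close>, so for large \<open>K\<close> the iteration contracts by one half on the whole
  interval at once.\<close>

lemma backward_solution_exists:
  fixes a b R :: real
  assumes V: "potential R V"
  obtains u v where "primitive_on {0..R} u v" "primitive_on {0..R} v (\<lambda>x. (V x + c) * u x)"
    "u R = a" "v R = b"
proof (cases "0 \<le> R")
  case True
  obtain B where B: "0 \<le> B" "\<And>x. \<bar>V x\<bar> \<le> B" using potential_bound[OF V] by blast
  define Q where "Q = B + \<bar>c\<bar>"
  have Q: "0 \<le> Q" "\<And>x. \<bar>V x + c\<bar> \<le> Q"
    using B by (auto simp: Q_def intro: order_trans[OF abs_triangle_ineq])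
  define K where "K = 1 + Q"
  have K: "0 < K" "Q / K / K \<le> 1 / 2"
  proof -
    have K0: "0 < K" using Q(1) by (simp add: K_def)
    moreover have "2 * Q \<le> K * K" using Q(1) by (simp add: K_def algebra_simps)
    ultimately show "0 < K" "Q / K / K \<le> 1 / 2" by (simp_all add: field_simps)
  qed
  have ee: "exp (K * z) * exp (- K * z) = 1" for z by (simp flip: exp_add)
  define w where "w = (\<lambda>(g :: real \<Rightarrow>\<^sub>C real) x. exp (K * (R - x)) * apply_bcontfun g x)"
  define v where "v = (\<lambda>g x. b - integral {x..R} (\<lambda>t. (V t + c) * w g t))"
  define u where "u = (\<lambda>g x. a - integral {x..R} (v g))"
  have wc: "continuous_on S (w g)" for S g
    unfolding w_def by (intro continuous_intros continuous_on_apply_bcontfun)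
  have bwd: "primitive_on {0..R} (\<lambda>x. d - integral {x..R} f) f"
    if f: "f absolutely_integrable_on {0..R}" for f :: "real \<Rightarrow> real" and d
  proof -
    have "primitive_on {0..R} (\<lambda>x. d - integral {0..R} f + integral {0..x} f) (\<lambda>x. 0 + f x)"
      by (intro primitive_on_add primitive_on_const primitive_on_integral f)
    then show ?thesis
    proof (rule primitive_on_cong)
      show "d - integral {0..R} f + integral {0..x} f = d - integral {x..R} f" if "x \<in> {0..R}" for x
        using Henstock_Kurzweil_Integration.integral_combine[of 0 x R f] that
          set_lebesgue_integral_eq_integral(1)[OF f] by simp
    qed (auto simp: is_interval_cc)
  qed
  have vp: "primitive_on {0..R} (v g) (\<lambda>t. (V t + c) * w g t)" for g
    unfolding v_def by (intro bwd potential_mult_integrable[OF V] wc)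
  have vc: "continuous_on {0..R} (v g)" for g
    by (rule primitive_on_continuous_cbox[OF vp])
  have up: "primitive_on {0..R} (u g) (v g)" for g
    unfolding u_def by (intro bwd absolutely_integrable_continuous_real vc)
  have uc: "continuous_on {0..R} (u g)" for g
    by (rule primitive_on_continuous_cbox[OF up])
  have "\<exists>h :: real \<Rightarrow>\<^sub>C real. \<forall>x. h x = exp (- K * (R - clamp 0 R x)) * u g (clamp 0 R x)" for g
  proof -
    have "continuous_on (cbox 0 R) (\<lambda>x. exp (- K * (R - x)) * u g x)"
      using uc[of g] by (intro continuous_intros) simp
    from continuous_on_cbox_bcontfunE[OF this] show ?thesis by metis
  qed
  then obtain T :: "(real \<Rightarrow>\<^sub>C real) \<Rightarrow> (real \<Rightarrow>\<^sub>C real)"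
    where T: "\<And>g x. T g x = exp (- K * (R - clamp 0 R x)) * u g (clamp 0 R x)" by metis
  have clamp: "clamp 0 R x \<in> {0..R}" for x :: real
    using clamp_in_interval[of 0 R x] True by simp
  have "dist (T g) (T h) \<le> 1 / 2 * dist g h" for g h
  proof (rule dist_bound)
    fix x
    define y where "y = clamp 0 R x"
    have y: "y \<in> {0..R}" using clamp by (simp add: y_def)
    define N where "N = dist g h"
    have 1: "\<bar>(V t + c) * w g t - (V t + c) * w h t\<bar> \<le> Q * N * exp (K * (R - t))" for t
    proof -
      have "\<bar>apply_bcontfun g t - apply_bcontfun h t\<bar> \<le> N"
        using dist_bounded[of g t h] by (simp add: N_def dist_real_def)
      then have "\<bar>V t + c\<bar> * \<bar>apply_bcontfun g t - apply_bcontfun h t\<bar> \<le> Q * N"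
        by (intro mult_mono Q) auto
      moreover have "(V t + c) * w g t - (V t + c) * w h t
          = (V t + c) * (apply_bcontfun g t - apply_bcontfun h t) * exp (K * (R - t))"
        by (simp add: w_def algebra_simps)
      ultimately show ?thesis by (simp add: abs_mult)
    qed
    have 2: "\<bar>v g t - v h t\<bar> \<le> Q * N / K * exp (K * (R - t))" if t: "t \<in> {0..R}" for t
    proof -
      have i: "(\<lambda>t. (V t + c) * w g t) integrable_on {t..R}" for g
        using primitive_onD(3)[OF vp] t by auto
      have "v h t - v g t = integral {t..R} (\<lambda>t. (V t + c) * w g t - (V t + c) * w h t)"
        by (simp add: v_def Henstock_Kurzweil_Integration.integral_diff[OF i i])
      then show ?thesis
        using exp_integral_bound[OF Henstock_Kurzweil_Integration.integrable_diff[OF i i] K(1) _ _ 1] t Q(1)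
        by (auto simp: abs_minus_commute N_def)
    qed
    have "\<bar>u g y - u h y\<bar> \<le> Q * N / K / K * exp (K * (R - y))"
    proof -
      have i: "v g integrable_on {y..R}" for g
        using primitive_onD(3)[OF up] y by auto
      have "u h y - u g y = integral {y..R} (\<lambda>t. v g t - v h t)"
        by (simp add: u_def Henstock_Kurzweil_Integration.integral_diff[OF i i])
      then show ?thesis
        using exp_integral_bound[OF Henstock_Kurzweil_Integration.integrable_diff[OF i i] K(1) _ _ 2] y Q(1) K(1)
        by (auto simp: abs_minus_commute N_def)
    qed
    also have "Q * N / K / K * exp (K * (R - y)) = (Q / K / K) * (N * exp (K * (R - y)))" by simp
    also have "\<dots> \<le> 1 / 2 * (N * exp (K * (R - y)))"
      by (intro mult_right_mono K) (auto simp: N_def)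
    finally have "exp (- K * (R - y)) * \<bar>u g y - u h y\<bar> \<le> exp (- K * (R - y)) * (1 / 2 * (N * exp (K * (R - y))))"
      by (intro mult_left_mono) auto
    also have "\<dots> = (exp (K * (R - y)) * exp (- K * (R - y))) * (1 / 2 * N)" by simp
    also have "\<dots> = 1 / 2 * N" unfolding ee by simp
    finally show "dist (T g x) (T h x) \<le> 1 / 2 * dist g h"
      by (simp add: T dist_real_def y_def N_def abs_mult flip: right_diff_distrib)
  qed
  then have "\<exists>!g. T g = g" by (intro banach_fix_type[of "1 / 2" T]) auto
  then obtain g where g: "T g = g" by blast
  have wu: "w g x = u g x" if "x \<in> {0..R}" for x
  proof -
    have "clamp 0 R x = x" using that by (intro clamp_cancel_cbox) simp
    then have "apply_bcontfun g x = exp (- K * (R - x)) * u g x" using T[of g x] g by simp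
    then have "w g x = (exp (K * (R - x)) * exp (- K * (R - x))) * u g x" by (simp add: w_def)
    then show ?thesis unfolding ee by simp
  qed
  show ?thesis
  proof (rule that)
    show "primitive_on {0..R} (u g) (v g)" by (rule up)
    show "primitive_on {0..R} (v g) (\<lambda>x. (V x + c) * u g x)"
      by (rule primitive_on_cong[OF vp]) (auto simp: wu is_interval_cc)
  qed (auto simp: u_def v_def)
qed (rule that[of "\<lambda>_. a" "\<lambda>_. b"], auto simp: primitive_on_def)

text \<open>Gronwall for \<open>\<bar>u\<bar> + \<bar>v\<bar>\<close>. The source term \<open>E\<close> serves the difference of two solutions with different
  spectral parameters.\<close>

lemma backward_stability:
  fixes u v f :: "real \<Rightarrow> real"
  assumes u: "primitive_on {l..R} u v" and v: "primitive_on {l..R} v f"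
    and f: "\<And>x. x \<in> {l..R} \<Longrightarrow> \<bar>f x\<bar> \<le> Q * \<bar>u x\<bar> + E" and Q: "0 \<le> Q" "0 \<le> E"
    and x: "x \<in> {l..R}"
  shows "\<bar>u x\<bar> + \<bar>v x\<bar> \<le> (\<bar>u R\<bar> + \<bar>v R\<bar> + E * (R - l)) * exp ((1 + Q) * (R - x))"
proof (rule gronwall_backward[of l R])
  have uc: "continuous_on {l..R} u" and vc: "continuous_on {l..R} v"
    using primitive_on_continuous_cbox u v by auto
  show hc: "continuous_on {l..R} (\<lambda>x. \<bar>u x\<bar> + \<bar>v x\<bar>)" by (intro continuous_intros uc vc)
  fix y assume y: "y \<in> {l..R}"
  then have R: "R \<in> {l..R}" "y \<le> R" "{y..R} \<subseteq> {l..R}" by auto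
  have i: "(\<lambda>t. \<bar>u t\<bar>) integrable_on {y..R}" "(\<lambda>t. \<bar>v t\<bar>) integrable_on {y..R}"
    using continuous_on_subset[OF uc R(3)] continuous_on_subset[OF vc R(3)]
    by (auto intro!: integrable_continuous_real continuous_intros)
  have i3: "(\<lambda>t. Q * \<bar>u t\<bar> + E) integrable_on {y..R}"
    using continuous_on_subset[OF uc R(3)]
    by (auto intro!: integrable_continuous_real continuous_intros)
  have "\<bar>u R - u y\<bar> \<le> integral {y..R} (\<lambda>t. \<bar>v t\<bar>)"
    using integral_norm_bound_integral[OF primitive_onD(3)[OF u y R(1,2)] i(2)]
      primitive_onD(4)[OF u y R(1,2)] by auto
  moreover have "\<bar>v R - v y\<bar> \<le> integral {y..R} (\<lambda>t. Q * \<bar>u t\<bar> + E)"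
    using integral_norm_bound_integral[OF primitive_onD(3)[OF v y R(1,2)], of "\<lambda>t. Q * \<bar>u t\<bar> + E"]
      primitive_onD(4)[OF v y R(1,2)] f R(3) i3 by auto
  moreover have "integral {y..R} (\<lambda>t. Q * \<bar>u t\<bar> + E) = Q * integral {y..R} (\<lambda>t. \<bar>u t\<bar>) + E * (R - y)"
    using has_integral_add[OF has_integral_mult_right[OF integrable_integral[OF i(1)], of Q]
        has_integral_const_real[of E y R]] R(2)
    by (simp add: integral_unique mult.commute)
  moreover have "E * (R - y) \<le> E * (R - l)" using y Q by (intro mult_left_mono) auto
  moreover have "integral {y..R} (\<lambda>t. \<bar>v t\<bar>) + Q * integral {y..R} (\<lambda>t. \<bar>u t\<bar>)
      \<le> (1 + Q) * integral {y..R} (\<lambda>t. \<bar>u t\<bar> + \<bar>v t\<bar>)"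
  proof -
    have "0 \<le> integral {y..R} (\<lambda>t. \<bar>u t\<bar>)" "0 \<le> integral {y..R} (\<lambda>t. \<bar>v t\<bar>)"
      by (auto intro!: Henstock_Kurzweil_Integration.integral_nonneg i)
    moreover have "0 \<le> Q * integral {y..R} (\<lambda>t. \<bar>v t\<bar>)" using calculation Q by simp
    ultimately show ?thesis
      using i by (simp add: Henstock_Kurzweil_Integration.integral_add algebra_simps)
  qed
  ultimately show "\<bar>u y\<bar> + \<bar>v y\<bar> \<le> \<bar>u R\<bar> + \<bar>v R\<bar> + E * (R - l)
      + (1 + Q) * integral {y..R} (\<lambda>t. \<bar>u t\<bar> + \<bar>v t\<bar>)"
    by linarith
qed (use Q x in auto)

text \<open>The solution of \<open>- u'' + V u = - \<kappa>\<^sup>2 u\<close> that equals \<open>exp (- \<kappa> * x)\<close> beyond the support of \<open>V\<close>.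
  Up to scalar multiples it is the only solution that decays at infinity.\<close>

definition jost_pair :: "real \<Rightarrow> (real \<Rightarrow> real) \<Rightarrow> real \<Rightarrow> (real \<Rightarrow> real) \<Rightarrow> (real \<Rightarrow> real) \<Rightarrow> bool" where
  "jost_pair R V \<kappa> u v \<longleftrightarrow> half_line_solution (\<lambda>x. V x + \<kappa>\<^sup>2) u v \<and>
    (\<forall>x\<ge>R. u x = exp (- \<kappa> * x) \<and> v x = - \<kappa> * exp (- \<kappa> * x))"

lemma primitive_on_glue:
  fixes F :: "real \<Rightarrow> 'a::euclidean_space"
  assumes a: "primitive_on {a..c} F f" and b: "primitive_on {c..} F f" and "a \<le> c"
  shows "primitive_on {a..} F f"
proof (rule primitive_onI)
  fix x y assume xy: "x \<in> {a..}" "y \<in> {a..}" "x \<le> y"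
  consider "y \<le> c" | "c \<le> x" | "x \<le> c" "c \<le> y" by linarith
  then have "f absolutely_integrable_on {x..y} \<and> (f has_integral F y - F x) {x..y}"
  proof cases
    case 1
    then show ?thesis using primitive_onD(1,2)[OF a, of x y] xy by auto
  next
    case 2
    then show ?thesis using primitive_onD(1,2)[OF b, of x y] xy by auto
  next
    case 3
    have "f absolutely_integrable_on {x..y}"
      by (rule absolutely_integrable_on_combine[OF primitive_onD(1)[OF a, of x c]
            primitive_onD(1)[OF b, of c y]]) (use 3 xy in auto)
    moreover have "(f has_integral (F c - F x) + (F y - F c)) {x..y}"
      by (rule has_integral_combine[OF 3 primitive_onD(2)[OF a, of x c] primitive_onD(2)[OF b, of c y]])
        (use 3 xy in auto)
    ultimately show ?thesis by simp
  qed
  then show "f absolutely_integrable_on {x..y}" "(f has_integral F y - F x) {x..y}" by auto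
qed

lemma exp_decay_primitive:
  "primitive_on S (\<lambda>x::real. c * exp (- \<kappa> * x)) (\<lambda>x. - \<kappa> * (c * exp (- \<kappa> * x)))"
proof -
  have "primitive_on UNIV (\<lambda>x::real. c * exp (- \<kappa> * x)) (\<lambda>x. - \<kappa> * (c * exp (- \<kappa> * x)))"
    by (rule primitive_on_of_deriv)
      (auto intro!: derivative_eq_intros continuous_intros
        simp flip: has_real_derivative_iff_has_vector_derivative)
  then show ?thesis by (rule primitive_on_subset) simp
qed

lemma jost_pair_exists:
  assumes V: "potential R V" and R: "0 \<le> R"
  obtains u v where "jost_pair R V \<kappa> u v"
proof -
  obtain u v where uv: "primitive_on {0..R} u v" "primitive_on {0..R} v (\<lambda>x. (V x + \<kappa>\<^sup>2) * u x)"
    "u R = exp (- \<kappa> * R)" "v R = - \<kappa> * exp (- \<kappa> * R)"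
    by (rule backward_solution_exists[OF V])
  define u' where "u' x = (if x \<le> R then u x else exp (- \<kappa> * x))" for x
  define v' where "v' x = (if x \<le> R then v x else - \<kappa> * exp (- \<kappa> * x))" for x
  have tail: "u' x = exp (- \<kappa> * x)" "v' x = - \<kappa> * exp (- \<kappa> * x)" if "x \<ge> R" for x
    using that uv(3,4) by (auto simp: u'_def v'_def)
  have "primitive_on {0..} u' v'"
  proof (rule primitive_on_glue[OF _ _ R])
    show "primitive_on {0..R} u' v'"
      by (rule primitive_on_cong[of _ u v]) (use uv in \<open>auto simp: u'_def v'_def is_interval_cc\<close>)
    have "primitive_on {R..} (\<lambda>x. 1 * exp (- \<kappa> * x)) (\<lambda>x. - \<kappa> * (1 * exp (- \<kappa> * x)))"
      by (rule exp_decay_primitive)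
    then show "primitive_on {R..} u' v'"
      by (rule primitive_on_cong) (use tail in \<open>auto simp: is_interval_ci\<close>)
  qed
  moreover have "primitive_on {0..} v' (\<lambda>x. (V x + \<kappa>\<^sup>2) * u' x)"
  proof (rule primitive_on_glue[OF _ _ R])
    show "primitive_on {0..R} v' (\<lambda>x. (V x + \<kappa>\<^sup>2) * u' x)"
      by (rule primitive_on_cong[of _ v "\<lambda>x. (V x + \<kappa>\<^sup>2) * u x"])
        (use uv in \<open>auto simp: u'_def v'_def is_interval_cc\<close>)
    have "primitive_on {R..} (\<lambda>x. - \<kappa> * exp (- \<kappa> * x)) (\<lambda>x. - \<kappa> * (- \<kappa> * exp (- \<kappa> * x)))"
      by (rule exp_decay_primitive)
    then have "primitive_on {R..} v' (\<lambda>x. - \<kappa> * (- \<kappa> * exp (- \<kappa> * x)))"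
      by (rule primitive_on_cong) (use tail in \<open>auto simp: is_interval_ci\<close>)
    then show "primitive_on {R..} v' (\<lambda>x. (V x + \<kappa>\<^sup>2) * u' x)"
    proof (rule primitive_on_cong_AE)
      have "AE x in lebesgue. x \<noteq> R"
        unfolding eventually_ae_filter_negligible by (intro exI[of _ "{R}"]) auto
      then show "AE x in lebesgue. x \<in> {R..} \<longrightarrow>
          - \<kappa> * (- \<kappa> * exp (- \<kappa> * x)) = (V x + \<kappa>\<^sup>2) * u' x"
        by eventually_elim (use V tail in \<open>auto simp: potential_def power2_eq_square\<close>)
    qed (auto simp: is_interval_ci)
  qed
  ultimately have "jost_pair R V \<kappa> u' v'"
    using tail by (auto simp: jost_pair_def half_line_solution_def)
  then show ?thesis by (rule that)
qed

definition jost_u :: "real \<Rightarrow> (real \<Rightarrow> real) \<Rightarrow> real \<Rightarrow> real \<Rightarrow> real" where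
  "jost_u R V \<kappa> = fst (SOME p. jost_pair R V \<kappa> (fst p) (snd p))"

definition jost_v :: "real \<Rightarrow> (real \<Rightarrow> real) \<Rightarrow> real \<Rightarrow> real \<Rightarrow> real" where
  "jost_v R V \<kappa> = snd (SOME p. jost_pair R V \<kappa> (fst p) (snd p))"

lemma jost_pair_jost:
  assumes "potential R V" "0 \<le> R"
  shows "jost_pair R V \<kappa> (jost_u R V \<kappa>) (jost_v R V \<kappa>)"
proof -
  obtain u v where "jost_pair R V \<kappa> u v" by (rule jost_pair_exists[OF assms])
  then have "\<exists>p. jost_pair R V \<kappa> (fst p) (snd p)" by auto
  then show ?thesis unfolding jost_u_def jost_v_def by (rule someI_ex)
qed

lemma jost_props:
  assumes "potential R V" "0 \<le> R"
  shows "primitive_on {0..} (jost_u R V \<kappa>) (jost_v R V \<kappa>)"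
    "primitive_on {0..} (jost_v R V \<kappa>) (\<lambda>x. (V x + \<kappa>\<^sup>2) * jost_u R V \<kappa> x)"
    "\<And>x. R \<le> x \<Longrightarrow> jost_u R V \<kappa> x = exp (- \<kappa> * x)"
    "\<And>x. R \<le> x \<Longrightarrow> jost_v R V \<kappa> x = - \<kappa> * exp (- \<kappa> * x)"
    "continuous_on {0..} (jost_u R V \<kappa>)" "continuous_on {0..} (jost_v R V \<kappa>)"
  using jost_pair_jost[OF assms, of \<kappa>]
  by (auto simp: jost_pair_def half_line_solution_def intro: primitive_on_continuous_Ici)

lemma solution_unique_backward:
  assumes V: "potential R V"
    and 1: "primitive_on {l..R} u v" "primitive_on {l..R} v (\<lambda>x. (V x + c) * u x)"
    and 2: "primitive_on {l..R} u' v'" "primitive_on {l..R} v' (\<lambda>x. (V x + c) * u' x)"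
    and R: "u R = u' R" "v R = v' R" and x: "x \<in> {l..R}"
  shows "u x = u' x" "v x = v' x"
proof -
  obtain B where B: "0 \<le> B" "\<And>x. \<bar>V x\<bar> \<le> B" using potential_bound[OF V] by blast
  have "\<bar>u x - u' x\<bar> + \<bar>v x - v' x\<bar> \<le> (\<bar>u R - u' R\<bar> + \<bar>v R - v' R\<bar> + 0 * (R - l))
      * exp ((1 + (B + \<bar>c\<bar>)) * (R - x))"
  proof (rule backward_stability)
    show "primitive_on {l..R} (\<lambda>x. u x - u' x) (\<lambda>x. v x - v' x)"
      by (rule primitive_on_diff[OF 1(1) 2(1)])
    show "primitive_on {l..R} (\<lambda>x. v x - v' x) (\<lambda>x. (V x + c) * u x - (V x + c) * u' x)"
      by (rule primitive_on_diff[OF 1(2) 2(2)])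
    fix y
    have "\<bar>V y + c\<bar> * \<bar>u y - u' y\<bar> \<le> (B + \<bar>c\<bar>) * \<bar>u y - u' y\<bar>"
      using B(2)[of y] by (intro mult_right_mono) auto
    then show "\<bar>(V y + c) * u y - (V y + c) * u' y\<bar> \<le> (B + \<bar>c\<bar>) * \<bar>u y - u' y\<bar> + 0"
      by (simp add: abs_mult flip: right_diff_distrib)
  qed (use B x in auto)
  then show "u x = u' x" "v x = v' x" using R by auto
qed

lemma exp_minus_lipschitz:
  fixes a b x :: real
  assumes "c \<le> a" "c \<le> b" "0 \<le> x"
  shows "\<bar>exp (- a * x) - exp (- b * x)\<bar> \<le> \<bar>a - b\<bar> * (x * exp (- c * x))"
proof -
  have *: "exp (- a * x) - exp (- b * x) \<le> (b - a) * (x * exp (- c * x))"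
    if "a \<le> b" "c \<le> a" for a b
  proof -
    have "exp (- b * x) = exp (- a * x) * exp (- ((b - a) * x))"
      by (simp add: algebra_simps flip: exp_add)
    moreover have "1 - (b - a) * x \<le> exp (- ((b - a) * x))"
      using exp_ge_add_one_self[of "- ((b - a) * x)"] by simp
    ultimately have "exp (- a * x) - exp (- b * x) \<le> exp (- a * x) * ((b - a) * x)"
      using mult_left_mono[of "1 - (b - a) * x" "exp (- ((b - a) * x))" "exp (- a * x)"]
      by (simp add: right_diff_distrib)
    also have "\<dots> \<le> exp (- c * x) * ((b - a) * x)"
      using that assms(3) by (intro mult_right_mono) (auto intro: mult_right_mono)
    finally show ?thesis by (simp add: mult_ac)
  qed
  have m: "exp (- b * x) \<le> exp (- a * x)" if "a \<le> b" for a b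
    using that assms(3) by (auto intro: mult_right_mono)
  show ?thesis
  proof (cases "a \<le> b")
    case True
    then show ?thesis using *[OF True assms(1)] m[OF True] by simp
  next
    case False
    then show ?thesis using *[of b a] m[of b a] assms(2) by simp
  qed
qed


text \<open>Beyond \<open>R\<close> the solution is an explicit exponential, and on \<open>[0, R]\<close> backward stability propagates both the size and the
  dependence on \<open>\<kappa>\<close>. The Lipschitz bounds decay only at the rate \<open>a / 2\<close> because the derivative of
  \<open>exp (- \<kappa> * x)\<close> in \<open>\<kappa>\<close> carries a factor \<open>x\<close>.\<close>

lemma jost_bounds:
  assumes V: "potential R V" and R: "0 \<le> R" and ab: "0 < a" "a \<le> b"
  obtains C where "0 < C"
    "\<And>\<kappa> x. \<kappa> \<in> {a..b} \<Longrightarrow> 0 \<le> x \<Longrightarrow> \<bar>jost_u R V \<kappa> x\<bar> \<le> C * exp (- a * x)"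
    "\<And>\<kappa> x. \<kappa> \<in> {a..b} \<Longrightarrow> 0 \<le> x \<Longrightarrow> \<bar>jost_v R V \<kappa> x\<bar> \<le> C * exp (- a * x)"
    "\<And>\<kappa> \<kappa>' x. \<kappa> \<in> {a..b} \<Longrightarrow> \<kappa>' \<in> {a..b} \<Longrightarrow> 0 \<le> x \<Longrightarrow>
      \<bar>jost_u R V \<kappa> x - jost_u R V \<kappa>' x\<bar> \<le> C * \<bar>\<kappa> - \<kappa>'\<bar> * exp (- (a / 2) * x)"
    "\<And>\<kappa> \<kappa>' x. \<kappa> \<in> {a..b} \<Longrightarrow> \<kappa>' \<in> {a..b} \<Longrightarrow> 0 \<le> x \<Longrightarrow>
      \<bar>jost_v R V \<kappa> x - jost_v R V \<kappa>' x\<bar> \<le> C * \<bar>\<kappa> - \<kappa>'\<bar> * exp (- (a / 2) * x)"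
proof -
  obtain B where B: "0 \<le> B" "\<And>x. \<bar>V x\<bar> \<le> B" using potential_bound[OF V] by blast
  define Q where "Q = B + b\<^sup>2"
  have Q0: "0 \<le> Q" using B(1) by (simp add: Q_def)
  have Q: "\<bar>V x + \<kappa>\<^sup>2\<bar> \<le> Q" if "\<kappa> \<in> {a..b}" for x \<kappa>
  proof -
    have "\<kappa>\<^sup>2 \<le> b\<^sup>2" using that ab by (intro power_mono) auto
    then show ?thesis using B(2)[of x] abs_triangle_ineq[of "V x" "\<kappa>\<^sup>2"] by (simp add: Q_def)
  qed
  note J = jost_props[OF V R]
  have sub: "{0..R} \<subseteq> {0..}" by auto
  note P = primitive_on_subset[OF J(1) sub] primitive_on_subset[OF J(2) sub]
  have e1: "exp (- \<kappa> * R) \<le> 1" if "\<kappa> \<in> {a..b}" for \<kappa> using that ab R by auto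
  define G where "G = exp ((1 + Q) * R)"
  have G: "1 \<le> G" using R Q0 by (simp add: G_def)
  have Ge: "exp ((1 + Q) * (R - x)) \<le> G" if "x \<in> {0..R}" for x
    using that Q0 by (simp add: G_def mult_left_mono)
  define C1 where "C1 = (1 + b) * G"
  have C1: "0 \<le> C1" using ab G by (simp add: C1_def)
  have in1: "\<bar>jost_u R V \<kappa> x\<bar> + \<bar>jost_v R V \<kappa> x\<bar> \<le> C1" if \<kappa>: "\<kappa> \<in> {a..b}" and x: "x \<in> {0..R}" for \<kappa> x
  proof -
    have "\<bar>jost_u R V \<kappa> x\<bar> + \<bar>jost_v R V \<kappa> x\<bar>
        \<le> (\<bar>jost_u R V \<kappa> R\<bar> + \<bar>jost_v R V \<kappa> R\<bar> + 0 * (R - 0)) * exp ((1 + Q) * (R - x))"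
      by (rule backward_stability[OF P _ Q0])
        (use Q[OF \<kappa>] x in \<open>auto simp: abs_mult intro: mult_right_mono\<close>)
    also have "\<dots> \<le> (1 + b) * G"
    proof (rule mult_mono)
      have "\<kappa> * exp (- \<kappa> * R) \<le> b * 1" using \<kappa> ab e1[OF \<kappa>] by (intro mult_mono) auto
      moreover have "\<bar>jost_u R V \<kappa> R\<bar> = exp (- \<kappa> * R)" "\<bar>jost_v R V \<kappa> R\<bar> = \<kappa> * exp (- \<kappa> * R)"
        using J(3,4)[of R \<kappa>] \<kappa> ab by (simp_all add: abs_mult)
      ultimately show "\<bar>jost_u R V \<kappa> R\<bar> + \<bar>jost_v R V \<kappa> R\<bar> + 0 * (R - 0) \<le> 1 + b"
        using e1[OF \<kappa>] by linarith
    qed (use Ge[OF x] ab in auto)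
    finally show ?thesis by (simp add: C1_def)
  qed
  define C2 where "C2 = (R + (1 + b * R) + 2 * b * C1 * R) * G"
  have C2: "0 \<le> C2" using R ab C1 G by (simp add: C2_def)
  have vdiff: "\<bar>\<kappa> * exp (- \<kappa> * x) - \<kappa>' * exp (- \<kappa>' * x)\<bar>
      \<le> \<bar>\<kappa> - \<kappa>'\<bar> * (exp (- a * x) + b * (x * exp (- a * x)))"
    if \<kappa>: "\<kappa> \<in> {a..b}" "\<kappa>' \<in> {a..b}" and x: "0 \<le> x" for \<kappa> \<kappa>' x
  proof -
    have "\<kappa> * exp (- \<kappa> * x) - \<kappa>' * exp (- \<kappa>' * x)
        = (\<kappa> - \<kappa>') * exp (- \<kappa> * x) + \<kappa>' * (exp (- \<kappa> * x) - exp (- \<kappa>' * x))"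
      by (simp add: algebra_simps)
    also have "\<bar>\<dots>\<bar> \<le> \<bar>\<kappa> - \<kappa>'\<bar> * exp (- \<kappa> * x) + \<bar>\<kappa>'\<bar> * \<bar>exp (- \<kappa> * x) - exp (- \<kappa>' * x)\<bar>"
      by (rule order_trans[OF abs_triangle_ineq]) (simp add: abs_mult)
    also have "\<dots> \<le> \<bar>\<kappa> - \<kappa>'\<bar> * exp (- a * x) + b * (\<bar>\<kappa> - \<kappa>'\<bar> * (x * exp (- a * x)))"
      using \<kappa> ab x by (intro add_mono mult_mono exp_minus_lipschitz) (auto intro: mult_right_mono)
    finally show ?thesis by (simp add: algebra_simps)
  qed
  have in2: "\<bar>jost_u R V \<kappa> x - jost_u R V \<kappa>' x\<bar> + \<bar>jost_v R V \<kappa> x - jost_v R V \<kappa>' x\<bar> \<le> C2 * \<bar>\<kappa> - \<kappa>'\<bar>"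
    if \<kappa>: "\<kappa> \<in> {a..b}" "\<kappa>' \<in> {a..b}" and x: "x \<in> {0..R}" for \<kappa> \<kappa>' x
  proof -
    define E where "E = 2 * b * C1 * \<bar>\<kappa> - \<kappa>'\<bar>"
    have E0: "0 \<le> E" using ab C1 by (simp add: E_def)
    let ?d = "\<lambda>x. jost_u R V \<kappa> x - jost_u R V \<kappa>' x"
    let ?e = "\<lambda>x. jost_v R V \<kappa> x - jost_v R V \<kappa>' x"
    have "\<bar>?d x\<bar> + \<bar>?e x\<bar> \<le> (\<bar>?d R\<bar> + \<bar>?e R\<bar> + E * (R - 0)) * exp ((1 + Q) * (R - x))"
    proof (rule backward_stability[OF _ _ _ Q0 E0 x])
      show "primitive_on {0..R} ?d ?e" by (rule primitive_on_diff[OF P(1) P(1)])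
      show "primitive_on {0..R} ?e (\<lambda>x. (V x + \<kappa>\<^sup>2) * jost_u R V \<kappa> x - (V x + \<kappa>'\<^sup>2) * jost_u R V \<kappa>' x)"
        by (rule primitive_on_diff[OF P(2) P(2)])
      fix y assume y: "y \<in> {0..R}"
      have "(V y + \<kappa>\<^sup>2) * jost_u R V \<kappa> y - (V y + \<kappa>'\<^sup>2) * jost_u R V \<kappa>' y
          = (V y + \<kappa>\<^sup>2) * ?d y + (\<kappa> - \<kappa>') * (\<kappa> + \<kappa>') * jost_u R V \<kappa>' y"
        by (simp add: algebra_simps power2_eq_square)
      also have "\<bar>\<dots>\<bar> \<le> \<bar>V y + \<kappa>\<^sup>2\<bar> * \<bar>?d y\<bar> + \<bar>\<kappa> - \<kappa>'\<bar> * \<bar>\<kappa> + \<kappa>'\<bar> * \<bar>jost_u R V \<kappa>' y\<bar>"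
        by (rule order_trans[OF abs_triangle_ineq]) (simp add: abs_mult)
      also have "\<dots> \<le> Q * \<bar>?d y\<bar> + \<bar>\<kappa> - \<kappa>'\<bar> * (2 * b) * C1"
        using Q[OF \<kappa>(1), of y] in1[OF \<kappa>(2) y] \<kappa> ab by (intro add_mono mult_mono) auto
      finally show "\<bar>(V y + \<kappa>\<^sup>2) * jost_u R V \<kappa> y - (V y + \<kappa>'\<^sup>2) * jost_u R V \<kappa>' y\<bar> \<le> Q * \<bar>?d y\<bar> + E"
        by (simp add: E_def mult_ac)
    qed
    also have "\<dots> \<le> (\<bar>\<kappa> - \<kappa>'\<bar> * R + \<bar>\<kappa> - \<kappa>'\<bar> * (1 + b * R) + E * R) * G"
    proof (intro mult_mono add_mono Ge[OF x])
      have "a * R \<ge> 0" using ab R by simp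
      then have x1: "exp (- a * R) \<le> 1" by simp
      then have x2: "R * exp (- a * R) \<le> R * 1" using R by (intro mult_left_mono) auto
      have "\<bar>?d R\<bar> \<le> \<bar>\<kappa> - \<kappa>'\<bar> * (R * exp (- a * R))"
        using exp_minus_lipschitz[of a \<kappa> \<kappa>' R] \<kappa> R J(3)[of R] by auto
      also have "\<dots> \<le> \<bar>\<kappa> - \<kappa>'\<bar> * R" using x2 by (intro mult_left_mono) auto
      finally show "\<bar>?d R\<bar> \<le> \<bar>\<kappa> - \<kappa>'\<bar> * R" .
      have "\<bar>?e R\<bar> \<le> \<bar>\<kappa> - \<kappa>'\<bar> * (exp (- a * R) + b * (R * exp (- a * R)))"
        using vdiff[OF \<kappa> R] J(4)[of R] by (simp add: abs_minus_commute)
      also have "\<dots> \<le> \<bar>\<kappa> - \<kappa>'\<bar> * (1 + b * R)"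
        using x1 x2 ab by (intro mult_left_mono add_mono) auto
      finally show "\<bar>?e R\<bar> \<le> \<bar>\<kappa> - \<kappa>'\<bar> * (1 + b * R)" .
    qed (use E0 R ab in auto)
    also have "\<dots> = C2 * \<bar>\<kappa> - \<kappa>'\<bar>" by (simp add: C2_def E_def algebra_simps)
    finally show ?thesis .
  qed
  define C where "C = C1 * exp (a * R) + C2 * exp (a * R) + 1 + b + 2 / a + 2 * b / a"
  have terms: "0 \<le> C1 * exp (a * R)" "0 \<le> C2 * exp (a * R)" "0 < b" "0 \<le> 2 / a" "0 \<le> 2 * b / a"
    using C1 C2 ab by auto
  have CC: "0 < C" "1 \<le> C" "b \<le> C" "2 / a \<le> C" "1 + 2 * b / a \<le> C"
    "C1 * exp (a * R) \<le> C" "C2 * exp (a * R) \<le> C"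
    using terms unfolding C_def by linarith+
  have in_e: "1 \<le> exp (a * R) * exp (- a * x)" "1 \<le> exp (a * R) * exp (- (a / 2) * x)"
    if "x \<in> {0..R}" for x
  proof -
    have "a * x \<le> a * R" "a / 2 * x \<le> a * R" using that ab R by (auto intro!: mult_mono)
    then show "1 \<le> exp (a * R) * exp (- a * x)" "1 \<le> exp (a * R) * exp (- (a / 2) * x)"
      by (simp_all flip: exp_add)
  qed
  have in_b: "D \<le> C * exp (- a * x)" "D \<le> C * exp (- (a / 2) * x)"
    if x: "x \<in> {0..R}" and D: "D \<le> C1 \<or> D \<le> C2" for x D
  proof -
    have 1: "D \<le> max C1 C2" using D by auto
    have 2: "max C1 C2 * exp (a * R) \<le> C" using CC by (auto simp: max_def)
    have 3: "max C1 C2 \<le> max C1 C2 * (exp (a * R) * exp (- a * x))"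
      "max C1 C2 \<le> max C1 C2 * (exp (a * R) * exp (- (a / 2) * x))"
      using in_e[OF x] C1 by (intro mult_le_cancel_left1[THEN iffD2]; auto)+
    have 4: "max C1 C2 * (exp (a * R) * exp (- a * x)) \<le> C * exp (- a * x)"
      "max C1 C2 * (exp (a * R) * exp (- (a / 2) * x)) \<le> C * exp (- (a / 2) * x)"
      unfolding mult.assoc[symmetric] by (rule mult_right_mono[OF 2 exp_ge_zero])+
    show "D \<le> C * exp (- a * x)" by (rule order_trans[OF 1 order_trans[OF 3(1) 4(1)]])
    show "D \<le> C * exp (- (a / 2) * x)" by (rule order_trans[OF 1 order_trans[OF 3(2) 4(2)]])
  qed
  have tail: "exp (- a * x) \<le> exp (- (a / 2) * x)" "x * exp (- a * x) \<le> 2 / a * exp (- (a / 2) * x)"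
    if x: "0 \<le> x" for x
  proof -
    have "0 \<le> a * x" using ab x by simp
    then show "exp (- a * x) \<le> exp (- (a / 2) * x)" by simp
    have "a / 2 * x \<le> exp (a / 2 * x)" using exp_ge_add_one_self[of "a / 2 * x"] by linarith
    then have "x \<le> 2 / a * exp (a / 2 * x)" using ab by (simp add: field_simps)
    then have "x * exp (- a * x) \<le> 2 / a * exp (a / 2 * x) * exp (- a * x)"
      by (intro mult_right_mono) auto
    also have "\<dots> = 2 / a * (exp (a / 2 * x) * exp (- a * x))" by simp
    also have "exp (a / 2 * x) * exp (- a * x) = exp (- (a / 2) * x)"
      by (simp flip: exp_add add: field_simps)
    finally show "x * exp (- a * x) \<le> 2 / a * exp (- (a / 2) * x)" .
  qed
  have ex: "exp (- \<kappa> * x) \<le> exp (- a * x)" if "\<kappa> \<in> {a..b}" "0 \<le> x" for \<kappa> x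
    using that by (auto intro: mult_right_mono)
  show ?thesis
  proof (rule that[of C])
    show "0 < C" by (rule CC)
    fix \<kappa> x :: real assume \<kappa>: "\<kappa> \<in> {a..b}" and x: "0 \<le> x"
    show "\<bar>jost_u R V \<kappa> x\<bar> \<le> C * exp (- a * x)"
    proof (cases "x \<le> R")
      case True
      then show ?thesis using in1[OF \<kappa>, of x] x by (intro in_b) auto
    next
      case False
      then have "\<bar>jost_u R V \<kappa> x\<bar> \<le> 1 * exp (- a * x)" using J(3)[of x \<kappa>] ex[OF \<kappa> x] by simp
      also have "\<dots> \<le> C * exp (- a * x)" using CC by (intro mult_right_mono) auto
      finally show ?thesis .
    qed
    show "\<bar>jost_v R V \<kappa> x\<bar> \<le> C * exp (- a * x)"
    proof (cases "x \<le> R")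
      case True
      then show ?thesis using in1[OF \<kappa>, of x] x by (intro in_b) auto
    next
      case False
      then have "\<bar>jost_v R V \<kappa> x\<bar> = \<kappa> * exp (- \<kappa> * x)" using J(4)[of x \<kappa>] \<kappa> ab by (simp add: abs_mult)
      also have "\<dots> \<le> b * exp (- a * x)" using \<kappa> ab ex[OF \<kappa> x] by (intro mult_mono) auto
      also have "\<dots> \<le> C * exp (- a * x)" using CC by (intro mult_right_mono) auto
      finally show ?thesis .
    qed
  next
    fix \<kappa> \<kappa>' x :: real assume \<kappa>: "\<kappa> \<in> {a..b}" "\<kappa>' \<in> {a..b}" and x: "0 \<le> x"
    have ar: "C * exp (- (a / 2) * x) * \<bar>\<kappa> - \<kappa>'\<bar> = C * \<bar>\<kappa> - \<kappa>'\<bar> * exp (- (a / 2) * x)" by simp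
    have inn: "D \<le> C * \<bar>\<kappa> - \<kappa>'\<bar> * exp (- (a / 2) * x)" if "D \<le> C2 * \<bar>\<kappa> - \<kappa>'\<bar>" "x \<le> R" for D
    proof -
      have "C2 * \<bar>\<kappa> - \<kappa>'\<bar> \<le> C * exp (- (a / 2) * x) * \<bar>\<kappa> - \<kappa>'\<bar>"
        by (intro mult_right_mono in_b) (use that x in auto)
      then show ?thesis using that(1) unfolding ar by linarith
    qed
    show "\<bar>jost_u R V \<kappa> x - jost_u R V \<kappa>' x\<bar> \<le> C * \<bar>\<kappa> - \<kappa>'\<bar> * exp (- (a / 2) * x)"
    proof (cases "x \<le> R")
      case True
      then show ?thesis using in2[OF \<kappa>, of x] x by (intro inn) auto
    next
      case False
      have "\<bar>jost_u R V \<kappa> x - jost_u R V \<kappa>' x\<bar> \<le> \<bar>\<kappa> - \<kappa>'\<bar> * (x * exp (- a * x))"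
        using False J(3)[of x] exp_minus_lipschitz[of a \<kappa> \<kappa>' x] \<kappa> x by auto
      also have "\<dots> \<le> \<bar>\<kappa> - \<kappa>'\<bar> * (2 / a * exp (- (a / 2) * x))"
        using tail[OF x] by (intro mult_left_mono) auto
      also have "\<dots> \<le> \<bar>\<kappa> - \<kappa>'\<bar> * (C * exp (- (a / 2) * x))"
        using CC by (intro mult_left_mono mult_right_mono) auto
      finally show ?thesis by (simp add: mult_ac)
    qed
    show "\<bar>jost_v R V \<kappa> x - jost_v R V \<kappa>' x\<bar> \<le> C * \<bar>\<kappa> - \<kappa>'\<bar> * exp (- (a / 2) * x)"
    proof (cases "x \<le> R")
      case True
      then show ?thesis using in2[OF \<kappa>, of x] x by (intro inn) auto
    next
      case False
      have "\<bar>jost_v R V \<kappa> x - jost_v R V \<kappa>' x\<bar>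
          \<le> \<bar>\<kappa> - \<kappa>'\<bar> * (exp (- a * x) + b * (x * exp (- a * x)))"
        using False J(4)[of x] vdiff[OF \<kappa> x] by (simp add: abs_minus_commute)
      also have "\<dots> \<le> \<bar>\<kappa> - \<kappa>'\<bar> * (1 * exp (- (a / 2) * x) + b * (2 / a * exp (- (a / 2) * x)))"
        using tail[OF x] ab by (intro mult_left_mono add_mono) auto
      also have "\<dots> = \<bar>\<kappa> - \<kappa>'\<bar> * ((1 + 2 * b / a) * exp (- (a / 2) * x))"
        by (simp add: algebra_simps)
      also have "\<dots> \<le> \<bar>\<kappa> - \<kappa>'\<bar> * (C * exp (- (a / 2) * x))"
        using CC by (intro mult_left_mono mult_right_mono) auto
      finally show ?thesis by (simp add: mult_ac)
    qed
  qed
qed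

text \<open>The derivative of \<open>u * v\<close> is \<open>v\<^sup>2 + (V + \<kappa>\<^sup>2) * u\<^sup>2\<close>, which is nonnegative where \<open>V\<close> is. Hence \<open>u * v\<close> stays below its
  negative value at \<open>R\<close>, and neither factor can change sign.\<close>

lemma jost_sign_outer:
  assumes V: "potential R V" and \<delta>: "0 \<le> \<delta>" "\<delta> \<le> R" and \<kappa>: "0 < \<kappa>"
    and nonneg: "\<And>x. \<delta> \<le> x \<Longrightarrow> 0 \<le> V x" and x: "\<delta> \<le> x"
  shows "0 < jost_u R V \<kappa> x" "jost_v R V \<kappa> x < 0"
proof -
  let ?u = "jost_u R V \<kappa>" and ?v = "jost_v R V \<kappa>"
  have R: "0 \<le> R" using \<delta> by simp
  note J = jost_props[OF V R, where \<kappa> = \<kappa>]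
  have sub: "{\<delta>..R} \<subseteq> {0..}" using \<delta> by auto
  note c = continuous_on_subset[OF J(5) sub] continuous_on_subset[OF J(6) sub]
  note P = primitive_on_mult[OF primitive_on_subset[OF J(1) sub] primitive_on_subset[OF J(2) sub] c(2)]
  have neg: "?u y * ?v y < 0" if y: "y \<in> {\<delta>..R}" for y
  proof -
    have "?u y * ?v y \<le> ?u R * ?v R"
    proof (rule primitive_on_mono[OF P])
      fix z assume z: "z \<in> {y..R}"
      have "?v z * ?v z + ?u z * ((V z + \<kappa>\<^sup>2) * ?u z) = (?v z)\<^sup>2 + (V z + \<kappa>\<^sup>2) * (?u z)\<^sup>2"
        by (simp add: power2_eq_square)
      also have "\<dots> \<ge> 0" using nonneg[of z] z y by auto
      finally show "0 \<le> ?v z * ?v z + ?u z * ((V z + \<kappa>\<^sup>2) * ?u z)" .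
    qed (use y in auto)
    also have "\<dots> < 0" using J(3,4)[of R] \<kappa> by (simp add: mult_pos_neg)
    finally show ?thesis .
  qed
  have pos: "0 < ?u y" if y: "y \<in> {\<delta>..R}" for y
  proof (rule ccontr)
    assume "\<not> 0 < ?u y"
    moreover have "0 < ?u R" using J(3)[of R] by simp
    ultimately have "\<exists>z\<ge>y. z \<le> R \<and> ?u z = 0"
      using y by (intro IVT' continuous_on_subset[OF c(1)]) auto
    then obtain z where "y \<le> z" "z \<le> R" "?u z = 0" by blast
    then show False using neg[of z] y by simp
  qed
  show "0 < ?u x" "?v x < 0"
    using pos[of x] neg[of x] J(3,4)[of x] x \<kappa> by (cases "x \<le> R"; auto simp: mult_less_0_iff)+
qed

text \<open>If \<open>u\<close> fails to be positive, it has a last zero, and this lies in \<open>[0, \<delta>]\<close>. Let \<open>M\<close> be the maximum of \<open>u\<close> between that zero and \<open>\<delta>\<close>. There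
  \<open>u'' \<ge> - B M\<close>, and \<open>u' \<le> 0\<close> at the maximum, so the slope to the left of the maximum is at most \<open>B M \<delta>\<close>. Hence
  \<open>u\<close> climbs from zero by at most \<open>B M \<delta>\<^sup>2 < M\<close>, a contradiction. A well that is narrow enough relative to its
  depth therefore produces no node.\<close>

lemma jost_positive:
  assumes V: "potential R V" and \<delta>: "0 \<le> \<delta>" "\<delta> \<le> R" and \<kappa>: "0 < \<kappa>"
    and nonneg: "\<And>x. \<delta> \<le> x \<Longrightarrow> 0 \<le> V x"
    and lower: "\<And>x. 0 \<le> x \<Longrightarrow> x \<le> \<delta> \<Longrightarrow> - B \<le> V x" "0 \<le> B" "B * \<delta>\<^sup>2 < 1" and x: "0 \<le> x"
  shows "0 < jost_u R V \<kappa> x"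
proof (rule ccontr)
  let ?u = "jost_u R V \<kappa>" and ?v = "jost_v R V \<kappa>"
  have R: "0 \<le> R" using \<delta> by simp
  note J = jost_props[OF V R, where \<kappa> = \<kappa>]
  note out = jost_sign_outer[OF V \<delta> \<kappa> nonneg]
  assume "\<not> 0 < ?u x"
  then have x\<delta>: "x < \<delta>" "?u x \<le> 0" using out[of x] by force+
  have sub: "S \<subseteq> {0..}" if "S \<subseteq> {0..\<delta>}" for S using that by auto
  \<comment> \<open>The last zero before \<open>\<delta>\<close>; to its right the solution is nonnegative up to \<open>\<delta>\<close>.\<close>
  define Z where "Z = {z \<in> {0..\<delta>}. ?u z = 0}"
  have "\<exists>z\<ge>x. z \<le> \<delta> \<and> ?u z = 0"
    using x\<delta> out[of \<delta>] x by (intro IVT' continuous_on_subset[OF J(5)]) auto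
  then obtain z1 where "x \<le> z1" "z1 \<le> \<delta>" "?u z1 = 0" by blast
  then have "z1 \<in> Z" using x by (simp add: Z_def)
  then have Zne: "Z \<noteq> {}" by blast
  have "closed ({0..\<delta>} \<inter> ?u -` {0})"
    by (rule continuous_closed_preimage[OF continuous_on_subset[OF J(5)]]) auto
  moreover have "Z = {0..\<delta>} \<inter> ?u -` {0}" by (auto simp: Z_def)
  ultimately have "compact Z"
    by (metis closed_Int_compact compact_Icc inf.left_idem inf_commute)
  then obtain z0 where z0: "z0 \<in> Z" "\<And>z. z \<in> Z \<Longrightarrow> z \<le> z0"
    using compact_attains_sup[OF _ Zne] by blast
  have z0': "0 \<le> z0" "z0 < \<delta>" "?u z0 = 0"
    using z0(1) out[of \<delta>] by (auto simp: Z_def order.strict_iff_order)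
  have nn: "0 \<le> ?u y" if y: "y \<in> {z0..\<delta>}" for y
  proof (rule ccontr)
    assume *: "\<not> 0 \<le> ?u y"
    have "\<exists>z\<ge>y. z \<le> \<delta> \<and> ?u z = 0"
      using * y z0' out[of \<delta>] by (intro IVT' continuous_on_subset[OF J(5)]) auto
    then obtain z where z: "y \<le> z" "z \<le> \<delta>" "?u z = 0" by blast
    then have "z \<in> Z" using y z0' by (simp add: Z_def)
    with z(1) have "y = z0" using z0(2) y by force
    then show False using * z0' by simp
  qed
  obtain m where m: "m \<in> {z0..\<delta>}" "\<And>y. y \<in> {z0..\<delta>} \<Longrightarrow> ?u y \<le> ?u m"
    using continuous_attains_sup[of "{z0..\<delta>}" ?u] continuous_on_subset[OF J(5), of "{z0..\<delta>}"] z0'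
    by auto
  have M: "0 < ?u m" using m(2)[of \<delta>] out[of \<delta>] z0' by auto
  then have "z0 < m" using m(1) z0' by (cases "m = z0") auto
  have vm: "?v m \<le> 0"
  proof (cases "m = \<delta>")
    case True
    then show ?thesis using out[of \<delta>] by simp
  next
    case False
    then have m\<delta>: "m < \<delta>" using m(1) by simp
    have "(?u has_real_derivative ?v m) (at m)"
      using primitive_on_deriv_at[OF primitive_on_subset[OF J(1)] continuous_on_subset[OF J(6)],
          of 0 \<delta> m] m\<delta> \<open>z0 < m\<close> z0'
      by (simp add: has_real_derivative_iff_has_vector_derivative)
    then have "?v m = 0"
      by (rule DERIV_local_max[of _ _ _ "min (m - z0) (\<delta> - m)"])
        (use m(2) m\<delta> \<open>z0 < m\<close> in \<open>auto simp: abs_real_def split: if_splits\<close>)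
    then show ?thesis by simp
  qed
  have v_le: "?v y \<le> B * ?u m * \<delta>" if y: "y \<in> {z0..m}" for y
  proof -
    have "primitive_on {0..} (\<lambda>x. - (B * ?u m) * x) (\<lambda>x. - (B * ?u m))"
      by (rule primitive_on_of_deriv)
        (auto intro!: derivative_eq_intros simp: is_interval_ci
          simp flip: has_real_derivative_iff_has_vector_derivative)
    from primitive_on_le[OF this J(2), of y m]
    have "- (B * ?u m) * m - - (B * ?u m) * y \<le> ?v m - ?v y"
    proof (rule meta_mp)
      show "- (B * ?u m) \<le> (V z + \<kappa>\<^sup>2) * ?u z" if z: "z \<in> {y..m}" for z
      proof -
        have z': "z \<in> {z0..\<delta>}" using z y m(1) by auto
        have "- (B * ?u m) \<le> - B * ?u z" using m(2)[OF z'] lower(2) by (simp add: mult_left_mono)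
        also have "\<dots> \<le> (V z + \<kappa>\<^sup>2) * ?u z"
          using lower(1)[of z] z' z0' nn[OF z'] by (intro mult_right_mono) (auto intro: add_increasing2)
        finally show ?thesis .
      qed
    qed (use y z0' in auto)
    then have "?v y \<le> (B * ?u m) * (m - y)" using vm by (simp add: algebra_simps)
    also have "\<dots> \<le> (B * ?u m) * \<delta>"
      using y m(1) z0' lower(2) M by (intro mult_left_mono) auto
    finally show ?thesis .
  qed
  have "primitive_on {0..} (\<lambda>x. (B * ?u m * \<delta>) * x) (\<lambda>x. B * ?u m * \<delta>)"
    by (rule primitive_on_of_deriv)
      (auto intro!: derivative_eq_intros simp: is_interval_ci
        simp flip: has_real_derivative_iff_has_vector_derivative)
  from primitive_on_le[OF J(1) this, of z0 m]
  have "?u m \<le> (B * ?u m * \<delta>) * (m - z0)"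
    using v_le z0' \<open>z0 < m\<close> by (simp add: algebra_simps)
  also have "\<dots> \<le> (B * ?u m * \<delta>) * \<delta>"
    using m(1) z0' lower(2) M by (intro mult_left_mono) auto
  also have "\<dots> = (B * \<delta>\<^sup>2) * ?u m" by (simp add: power2_eq_square)
  also have "\<dots> < 1 * ?u m" using lower(3) M by (intro mult_strict_right_mono) auto
  finally show False by simp
qed

section \<open>The m-function\<close>

text \<open>The Weyl m-function of the half-line up to sign: minus the logarithmic derivative of the decaying solution at the
  origin. For \<open>V = 0\<close> it is \<open>\<kappa>\<close>.\<close>

definition mfun :: "real \<Rightarrow> (real \<Rightarrow> real) \<Rightarrow> real \<Rightarrow> real" where
  "mfun R V \<kappa> = - jost_v R V \<kappa> 0 / jost_u R V \<kappa> 0"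

definition overlap :: "real \<Rightarrow> (real \<Rightarrow> real) \<Rightarrow> real \<Rightarrow> real \<Rightarrow> real" where
  "overlap R V \<kappa> \<kappa>' = integral {0..} (\<lambda>x. jost_u R V \<kappa> x * jost_u R V \<kappa>' x)"

text \<open>Without nodes at any negative energy, every m-function is finite. A node of a Jost solution
  would be a pole of the m-function and an obstruction to monotonicity in \<open>\<kappa>\<close>.\<close>

definition oscillation_free :: "real \<Rightarrow> (real \<Rightarrow> real) \<Rightarrow> bool" where
  "oscillation_free R V \<longleftrightarrow> potential R V \<and> 0 \<le> R \<and> (\<forall>\<kappa>>0. \<forall>x\<ge>0. 0 < jost_u R V \<kappa> x)"

lemma oscillation_freeD:
  assumes "oscillation_free R V"
  shows "potential R V" "0 \<le> R" "\<And>\<kappa> x. 0 < \<kappa> \<Longrightarrow> 0 \<le> x \<Longrightarrow> 0 < jost_u R V \<kappa> x"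
  using assms by (auto simp: oscillation_free_def)

lemma overlap_has_integral:
  assumes V: "potential R V" and R: "0 \<le> R" and \<kappa>: "0 < \<kappa>" "0 < \<kappa>'"
  shows "((\<lambda>x. jost_u R V \<kappa> x * jost_u R V \<kappa>' x) has_integral
      integral {0..R} (\<lambda>x. jost_u R V \<kappa> x * jost_u R V \<kappa>' x)
        + exp (- (\<kappa> + \<kappa>') * R) / (\<kappa> + \<kappa>')) {0..}"
    and "(\<lambda>x. jost_u R V \<kappa> x * jost_u R V \<kappa>' x) absolutely_integrable_on {0..}"
proof -
  let ?f = "\<lambda>x. jost_u R V \<kappa> x * jost_u R V \<kappa>' x"
  note J = jost_props[OF V R]
  have c: "continuous_on {0..R} ?f"
    by (intro continuous_intros continuous_on_subset[OF J(5)]) auto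
  have 1: "(?f has_integral integral {0..R} ?f) {0..R}"
    by (rule integrable_integral[OF integrable_continuous_real[OF c]])
  have "((\<lambda>x. exp (- (\<kappa> + \<kappa>') * x)) has_integral exp (- (\<kappa> + \<kappa>') * R) / (\<kappa> + \<kappa>')) {R..}"
    by (rule has_integral_exp_minus_to_infinity) (use \<kappa> in auto)
  moreover have e: "?f x = exp (- (\<kappa> + \<kappa>') * x)" if "x \<in> {R..}" for x
    using J(3)[of x] that by (simp add: algebra_simps flip: exp_add)
  ultimately have 2: "(?f has_integral exp (- (\<kappa> + \<kappa>') * R) / (\<kappa> + \<kappa>')) {R..}"
    using has_integral_cong[of "{R..}" ?f "\<lambda>x. exp (- (\<kappa> + \<kappa>') * x)"] by blast
  have U: "{0..R} \<union> {R..} = {0..}" using R by auto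
  have I: "{0..R} \<inter> {R..} = {R}" using R by auto
  show "(?f has_integral integral {0..R} ?f + exp (- (\<kappa> + \<kappa>') * R) / (\<kappa> + \<kappa>')) {0..}"
    using has_integral_Un[OF 1 2] unfolding U I by simp
  have "?f absolutely_integrable_on {0..R}" by (rule absolutely_integrable_continuous_real[OF c])
  moreover have "?f absolutely_integrable_on {R..}"
    by (rule nonnegative_absolutely_integrable_1) (use 2 e in auto)
  ultimately show "?f absolutely_integrable_on {0..}"
    using absolutely_integrable_Un[where S = "{0..R}" and T = "{R..}" and f = ?f] unfolding U by blast
qed

text \<open>Lagrange's identity: up to sign, the Wronskian of the two solutions has derivative \<open>\<kappa>\<^sup>2 - \<kappa>'\<^sup>2\<close> times their
  product, and it tends to zero at infinity.\<close>

lemma mfun_difference: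
  assumes V: "oscillation_free R V" and \<kappa>: "0 < \<kappa>" "0 < \<kappa>'"
  shows "(mfun R V \<kappa> - mfun R V \<kappa>') * (jost_u R V \<kappa> 0 * jost_u R V \<kappa>' 0)
    = (\<kappa>\<^sup>2 - \<kappa>'\<^sup>2) * overlap R V \<kappa> \<kappa>'"
proof -
  note D = oscillation_freeD[OF V] and J = jost_props[OF oscillation_freeD(1,2)[OF V]]
  let ?u = "jost_u R V \<kappa>" and ?v = "jost_v R V \<kappa>" and ?u' = "jost_u R V \<kappa>'" and ?v' = "jost_v R V \<kappa>'"
  have sub: "{0..R} \<subseteq> {0..}" by auto
  note P = primitive_on_subset[OF J(1) sub] primitive_on_subset[OF J(2) sub]
  note c = continuous_on_subset[OF J(5) sub] continuous_on_subset[OF J(6) sub]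
  have "primitive_on {0..R} (\<lambda>x. ?u x * ?v' x - ?u' x * ?v x)
      (\<lambda>x. (?v x * ?v' x + ?u x * ((V x + \<kappa>'\<^sup>2) * ?u' x)) - (?v' x * ?v x + ?u' x * ((V x + \<kappa>\<^sup>2) * ?u x)))"
    by (intro primitive_on_diff primitive_on_mult P c)
  from primitive_onD(4)[OF this, of 0 R] D(2)
  have *: "integral {0..R} (\<lambda>x. (\<kappa>'\<^sup>2 - \<kappa>\<^sup>2) * (?u x * ?u' x))
      = (?u R * ?v' R - ?u' R * ?v R) - (?u 0 * ?v' 0 - ?u' 0 * ?v 0)"
    by (simp add: algebra_simps)
  have "(\<kappa>'\<^sup>2 - \<kappa>\<^sup>2) * integral {0..R} (\<lambda>x. ?u x * ?u' x)
      = (?u R * ?v' R - ?u' R * ?v R) - (?u 0 * ?v' 0 - ?u' 0 * ?v 0)"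
    using * by simp
  moreover have "?u R * ?v' R - ?u' R * ?v R = (\<kappa> - \<kappa>') * exp (- (\<kappa> + \<kappa>') * R)"
    using J(3)[of R] J(4)[of R] by (simp add: algebra_simps flip: exp_add)
  ultimately have "?u 0 * ?v' 0 - ?u' 0 * ?v 0
      = (\<kappa> - \<kappa>') * exp (- (\<kappa> + \<kappa>') * R) + (\<kappa>\<^sup>2 - \<kappa>'\<^sup>2) * integral {0..R} (\<lambda>x. ?u x * ?u' x)"
    by (simp only: left_diff_distrib)
  also have "(\<kappa> - \<kappa>') * exp (- (\<kappa> + \<kappa>') * R)
      = (\<kappa>\<^sup>2 - \<kappa>'\<^sup>2) * (exp (- (\<kappa> + \<kappa>') * R) / (\<kappa> + \<kappa>'))"
  proof -
    have "(\<kappa>\<^sup>2 - \<kappa>'\<^sup>2) = (\<kappa> - \<kappa>') * (\<kappa> + \<kappa>')" by (simp add: power2_eq_square algebra_simps)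
    then show ?thesis using \<kappa> by simp
  qed
  finally have "?u 0 * ?v' 0 - ?u' 0 * ?v 0 = (\<kappa>\<^sup>2 - \<kappa>'\<^sup>2) * overlap R V \<kappa> \<kappa>'"
    using integral_unique[OF overlap_has_integral(1)[OF D(1,2) \<kappa>]]
    by (simp add: overlap_def distrib_left)
  moreover have "(mfun R V \<kappa> - mfun R V \<kappa>') * (?u 0 * ?u' 0) = ?u 0 * ?v' 0 - ?u' 0 * ?v 0"
    using D(3)[of \<kappa> 0] D(3)[of \<kappa>' 0] \<kappa> by (simp add: mfun_def field_simps)
  ultimately show ?thesis by simp
qed

lemma overlap_pos:
  assumes V: "oscillation_free R V" and \<kappa>: "0 < \<kappa>" "0 < \<kappa>'"
  shows "exp (- (\<kappa> + \<kappa>') * R) / (\<kappa> + \<kappa>') \<le> overlap R V \<kappa> \<kappa>'" "0 < overlap R V \<kappa> \<kappa>'"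
proof -
  note D = oscillation_freeD[OF V] and J = jost_props[OF oscillation_freeD(1,2)[OF V]]
  let ?f = "\<lambda>x. jost_u R V \<kappa> x * jost_u R V \<kappa>' x"
  have "0 \<le> integral {0..R} ?f"
    by (intro Henstock_Kurzweil_Integration.integral_nonneg integrable_continuous_real
        continuous_intros continuous_on_subset[OF J(5)])
      (use D(3) \<kappa> in \<open>auto intro!: mult_nonneg_nonneg less_imp_le\<close>)
  then show 1: "exp (- (\<kappa> + \<kappa>') * R) / (\<kappa> + \<kappa>') \<le> overlap R V \<kappa> \<kappa>'"
    using integral_unique[OF overlap_has_integral(1)[OF D(1,2) \<kappa>]] by (simp add: overlap_def)
  have "0 < exp (- (\<kappa> + \<kappa>') * R) / (\<kappa> + \<kappa>')" using \<kappa> by simp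
  then show "0 < overlap R V \<kappa> \<kappa>'" using 1 by linarith
qed

text \<open>Positive solutions have a positive overlap, so the sign in the Wronskian identity is that of \<open>\<kappa>\<^sup>2 - \<kappa>'\<^sup>2\<close>.\<close>

lemma mfun_strict_mono:
  assumes V: "oscillation_free R V" and \<kappa>: "0 < \<kappa>'" "\<kappa>' < \<kappa>"
  shows "mfun R V \<kappa>' < mfun R V \<kappa>"
proof -
  have \<kappa>0: "0 < \<kappa>" using \<kappa> by simp
  note D = oscillation_freeD[OF V]
  have "\<kappa>'\<^sup>2 < \<kappa>\<^sup>2" using \<kappa> by (intro power_strict_mono) auto
  then have "0 < (\<kappa>\<^sup>2 - \<kappa>'\<^sup>2) * overlap R V \<kappa> \<kappa>'"
    using overlap_pos(2)[OF V \<kappa>0 \<kappa>(1)] by simp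
  then have "0 < (mfun R V \<kappa> - mfun R V \<kappa>') * (jost_u R V \<kappa> 0 * jost_u R V \<kappa>' 0)"
    using mfun_difference[OF V \<kappa>0 \<kappa>(1)] by simp
  moreover have "0 < jost_u R V \<kappa> 0 * jost_u R V \<kappa>' 0" using D(3) \<kappa> \<kappa>0 by simp
  ultimately show ?thesis using zero_less_mult_pos2 by fastforce
qed

lemma continuous_on_of_lipschitz_bound:
  fixes f :: "real \<Rightarrow> real"
  assumes "\<And>x y. x \<in> S \<Longrightarrow> y \<in> S \<Longrightarrow> \<bar>f x - f y\<bar> \<le> C * \<bar>x - y\<bar>"
  shows "continuous_on S f"
proof (rule lipschitz_on_continuous_on)
  show "(max C 0)-lipschitz_on S f"
  proof (rule lipschitz_onI)
    fix x y assume "x \<in> S" "y \<in> S"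
    then have "\<bar>f x - f y\<bar> \<le> C * \<bar>x - y\<bar>" by (rule assms)
    also have "\<dots> \<le> max C 0 * \<bar>x - y\<bar>" by (intro mult_right_mono) auto
    finally show "dist (f x) (f y) \<le> max C 0 * dist x y" by (simp add: dist_real_def)
  qed simp
qed

lemma jost_continuous_in_energy:
  assumes V: "potential R V" and R: "0 \<le> R" and a: "0 < a" "a \<le> b" and x: "0 \<le> x"
  shows "continuous_on {a..b} (\<lambda>\<kappa>. jost_u R V \<kappa> x)" "continuous_on {a..b} (\<lambda>\<kappa>. jost_v R V \<kappa> x)"
proof -
  obtain C where C: "0 < C"
    "\<And>\<kappa> \<kappa>'. \<kappa> \<in> {a..b} \<Longrightarrow> \<kappa>' \<in> {a..b} \<Longrightarrow>
      \<bar>jost_u R V \<kappa> x - jost_u R V \<kappa>' x\<bar> \<le> C * \<bar>\<kappa> - \<kappa>'\<bar> * exp (- (a / 2) * x)"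
    "\<And>\<kappa> \<kappa>'. \<kappa> \<in> {a..b} \<Longrightarrow> \<kappa>' \<in> {a..b} \<Longrightarrow>
      \<bar>jost_v R V \<kappa> x - jost_v R V \<kappa>' x\<bar> \<le> C * \<bar>\<kappa> - \<kappa>'\<bar> * exp (- (a / 2) * x)"
    using jost_bounds[OF V R a] x by metis
  show "continuous_on {a..b} (\<lambda>\<kappa>. jost_u R V \<kappa> x)"
    by (rule continuous_on_of_lipschitz_bound[of _ _ "C * exp (- (a / 2) * x)"])
      (use C(2) in \<open>auto simp: mult_ac\<close>)
  show "continuous_on {a..b} (\<lambda>\<kappa>. jost_v R V \<kappa> x)"
    by (rule continuous_on_of_lipschitz_bound[of _ _ "C * exp (- (a / 2) * x)"])
      (use C(3) in \<open>auto simp: mult_ac\<close>)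
qed

lemma mfun_continuous:
  assumes V: "oscillation_free R V" and a: "0 < a"
  shows "continuous_on {a..b} (mfun R V)"
proof (cases "a \<le> b")
  case True
  note D = oscillation_freeD[OF V]
  have "jost_u R V \<kappa> 0 \<noteq> 0" if "\<kappa> \<in> {a..b}" for \<kappa>
    using D(3)[of \<kappa> 0] that a by auto
  then show ?thesis unfolding mfun_def
    by (intro continuous_intros jost_continuous_in_energy[OF D(1,2) a True]) auto
qed auto

text \<open>Without a well the sign argument beyond the well applies from the origin on.\<close>

lemma nonneg_oscillation_free:
  assumes V: "potential R V" and R: "0 \<le> R" and nn: "\<And>x. 0 \<le> V x"
  shows "oscillation_free R V"
  unfolding oscillation_free_def
  using jost_sign_outer(1)[OF V order_refl R _ nn] V R by blast

text \<open>For nonnegative \<open>V\<close>, the function \<open>exp (- \<kappa> * x) * (u' + \<kappa> * u)\<close> is nondecreasing and vanishes beyond \<open>R\<close>.\<close>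

lemma mfun_lower_bound:
  assumes V: "potential R V" and R: "0 \<le> R" and nn: "\<And>x. 0 \<le> V x" and \<kappa>: "0 < \<kappa>"
  shows "\<kappa> \<le> mfun R V \<kappa>"
proof -
  let ?u = "jost_u R V \<kappa>" and ?v = "jost_v R V \<kappa>"
  note D = oscillation_freeD[OF nonneg_oscillation_free[OF V R nn]]
  note J = jost_props[OF V R, where \<kappa> = \<kappa>]
  have sub: "{0..R} \<subseteq> {0..}" by auto
  note P = primitive_on_subset[OF J(1) sub] primitive_on_subset[OF J(2) sub]
  have E: "primitive_on {0..R} (\<lambda>x. 1 * exp (- \<kappa> * x)) (\<lambda>x. - \<kappa> * (1 * exp (- \<kappa> * x)))"
    by (rule exp_decay_primitive)
  have "primitive_on {0..R} (\<lambda>x. (1 * exp (- \<kappa> * x)) * (?v x + \<kappa> * ?u x))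
      (\<lambda>x. (- \<kappa> * (1 * exp (- \<kappa> * x))) * (?v x + \<kappa> * ?u x)
        + (1 * exp (- \<kappa> * x)) * ((V x + \<kappa>\<^sup>2) * ?u x + \<kappa> * ?v x))"
    by (intro primitive_on_mult E primitive_on_add primitive_on_cmult P continuous_intros)
  then have "(1 * exp (- \<kappa> * 0)) * (?v 0 + \<kappa> * ?u 0) \<le> (1 * exp (- \<kappa> * R)) * (?v R + \<kappa> * ?u R)"
  proof (rule primitive_on_mono)
    fix z assume z: "z \<in> {0..R}"
    have "(- \<kappa> * (1 * exp (- \<kappa> * z))) * (?v z + \<kappa> * ?u z)
        + (1 * exp (- \<kappa> * z)) * ((V z + \<kappa>\<^sup>2) * ?u z + \<kappa> * ?v z) = exp (- \<kappa> * z) * (V z * ?u z)"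
      by (simp add: algebra_simps power2_eq_square)
    then show "0 \<le> (- \<kappa> * (1 * exp (- \<kappa> * z))) * (?v z + \<kappa> * ?u z)
        + (1 * exp (- \<kappa> * z)) * ((V z + \<kappa>\<^sup>2) * ?u z + \<kappa> * ?v z)"
      using nn[of z] D(3)[OF \<kappa>, of z] z by (simp add: less_imp_le)
  qed (use R in auto)
  then have "?v 0 + \<kappa> * ?u 0 \<le> 0" using J(3,4)[of R] by simp
  then show ?thesis using D(3)[OF \<kappa>, of 0] by (simp add: mfun_def field_simps)
qed

text \<open>The trial function \<open>exp (- \<gamma> * x)\<close> bounds the m-function through the energy, in the
  form of a completed square: with \<open>r = u' / u\<close>, the derivative of \<open>exp (- 2 * \<gamma> * x) * r\<close> is
  \<open>exp (- 2 * \<gamma> * x) * (V + \<kappa>\<^sup>2 - r\<^sup>2 - 2 * \<gamma> * r)\<close>, and \<open>- r\<^sup>2 - 2 * \<gamma> * r \<le> \<gamma>\<^sup>2\<close>. With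
  \<open>\<gamma> = - \<alpha> / 2\<close> the weighted integral of \<open>V\<close> is the one that occurs in \<open>f_fun\<close>.\<close>

lemma mfun_upper_bound:
  assumes V: "potential R V" and R: "0 \<le> R" and nn: "\<And>x. 0 \<le> V x" and \<kappa>: "0 < \<kappa>" and \<gamma>: "0 < \<gamma>"
  shows "mfun R V \<kappa> \<le> \<kappa> + \<gamma> / 2 + \<kappa>\<^sup>2 / (2 * \<gamma>) + integral {0..R} (\<lambda>x. V x * exp (- (2 * \<gamma>) * x))"
proof -
  let ?u = "jost_u R V \<kappa>" and ?v = "jost_v R V \<kappa>"
  note D = oscillation_freeD[OF nonneg_oscillation_free[OF V R nn]]
  note J = jost_props[OF V R, where \<kappa> = \<kappa>]
  have sub: "{0..R} \<subseteq> {0..}" by auto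
  note P = primitive_on_subset[OF J(1) sub] primitive_on_subset[OF J(2) sub]
  note c = continuous_on_subset[OF J(5) sub] continuous_on_subset[OF J(6) sub]
  have u0: "?u x \<noteq> 0" if "x \<in> {0..R}" for x using D(3)[OF \<kappa>, of x] that by auto
  define Y where "Y = (\<lambda>x::real. exp (- (2 * \<gamma>) * x))"
  define F where "F = (\<lambda>x. Y x / ?u x)"
  define f where "f = (\<lambda>x. (- (2 * \<gamma>) * Y x * ?u x - Y x * ?v x) / (?u x * ?u x))"
  have fc: "continuous_on {0..R} f"
    unfolding f_def Y_def by (intro continuous_intros c) (use u0 in auto)
  have F: "primitive_on {0..R} F f"
  proof (rule primitive_on_of_deriv[OF _ fc])
    fix x assume x: "x \<in> {0..R}"
    have "(?u has_real_derivative ?v x) (at x within {0..R})"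
      using primitive_on_deriv[OF P(1) c(2) x] by (simp add: has_real_derivative_iff_has_vector_derivative)
    moreover have "(Y has_real_derivative - (2 * \<gamma>) * Y x) (at x within {0..R})"
      unfolding Y_def by (auto intro!: derivative_eq_intros)
    ultimately have "(F has_real_derivative f x) (at x within {0..R})"
      unfolding F_def f_def using u0[OF x] by (intro DERIV_divide) auto
    then show "(F has_vector_derivative f x) (at x within {0..R})"
      by (simp add: has_real_derivative_iff_has_vector_derivative)
  qed (simp add: is_interval_cc)
  note z = primitive_on_mult[OF F P(2) fc]
  have Yc: "continuous_on {0..R} Y" unfolding Y_def by (intro continuous_intros)
  have VY: "(\<lambda>x. (V x + 0) * Y x) absolutely_integrable_on {0..R}"
    by (rule potential_mult_integrable[OF V Yc])
  have Yi: "(Y has_integral (1 - Y R) / (2 * \<gamma>)) {0..R}"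
  proof -
    have "(Y has_integral - Y R / (2 * \<gamma>) - - Y 0 / (2 * \<gamma>)) {0..R}"
      by (rule fundamental_theorem_of_calculus[OF R])
        (use \<gamma> in \<open>auto intro!: derivative_eq_intros simp: Y_def
          simp flip: has_real_derivative_iff_has_vector_derivative\<close>)
    then show ?thesis using \<gamma> by (simp add: Y_def field_simps)
  qed
  have VYi: "((\<lambda>x. V x * Y x) has_integral integral {0..R} (\<lambda>x. V x * Y x)) {0..R}"
    using integrable_integral[OF set_lebesgue_integral_eq_integral(1)[OF VY]] by simp
  have rhs: "((\<lambda>x. (\<gamma>\<^sup>2 + \<kappa>\<^sup>2) * Y x + V x * Y x) has_integral
      (\<gamma>\<^sup>2 + \<kappa>\<^sup>2) * ((1 - Y R) / (2 * \<gamma>)) + integral {0..R} (\<lambda>x. V x * Y x)) {0..R}"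
    by (intro has_integral_add has_integral_mult_right Yi VYi)
  have "F R * ?v R - F 0 * ?v 0 \<le> (\<gamma>\<^sup>2 + \<kappa>\<^sup>2) * ((1 - Y R) / (2 * \<gamma>)) + integral {0..R} (\<lambda>x. V x * Y x)"
  proof (rule has_integral_le[OF primitive_onD(2)[OF z] rhs])
    fix x assume x: "x \<in> {0..R}"
    let ?r = "?v x / ?u x"
    have "f x * ?v x + F x * ((V x + \<kappa>\<^sup>2) * ?u x)
        = Y x * (- 2 * \<gamma> * ?r - ?r\<^sup>2 + (V x + \<kappa>\<^sup>2))"
      using u0[OF x] by (simp add: f_def F_def field_simps power2_eq_square)
    also have "\<dots> \<le> Y x * (\<gamma>\<^sup>2 + (V x + \<kappa>\<^sup>2))"
    proof (intro mult_left_mono add_right_mono)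
      have "0 \<le> (\<gamma> + ?r)\<^sup>2" by simp
      then show "- 2 * \<gamma> * ?r - ?r\<^sup>2 \<le> \<gamma>\<^sup>2" by (simp add: power2_eq_square algebra_simps)
    qed (simp add: Y_def)
    finally show "f x * ?v x + F x * ((V x + \<kappa>\<^sup>2) * ?u x) \<le> (\<gamma>\<^sup>2 + \<kappa>\<^sup>2) * Y x + V x * Y x"
      by (simp add: algebra_simps)
  qed (use R in auto)
  moreover have "F 0 * ?v 0 = - mfun R V \<kappa>" by (simp add: F_def Y_def mfun_def)
  moreover have "F R * ?v R = - \<kappa> * Y R" using J(3,4)[of R] by (simp add: F_def)
  moreover have "\<kappa> * Y R \<le> \<kappa>" using \<kappa> \<gamma> R by (simp add: Y_def mult_le_cancel_left1)
  moreover have Ycomp: "(\<gamma>\<^sup>2 + \<kappa>\<^sup>2) * ((1 - Y R) / (2 * \<gamma>)) \<le> \<gamma> / 2 + \<kappa>\<^sup>2 / (2 * \<gamma>)"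
  proof -
    have "(\<gamma>\<^sup>2 + \<kappa>\<^sup>2) * ((1 - Y R) / (2 * \<gamma>)) \<le> (\<gamma>\<^sup>2 + \<kappa>\<^sup>2) * (1 / (2 * \<gamma>))"
      using \<gamma> by (intro mult_left_mono divide_right_mono) (auto simp: Y_def)
    also have "\<dots> = \<gamma> / 2 + \<kappa>\<^sup>2 / (2 * \<gamma>)" using \<gamma> by (simp add: field_simps power2_eq_square)
    finally show ?thesis .
  qed
  ultimately show ?thesis by (simp add: Y_def)
qed

section \<open>The secular equation\<close>

text \<open>Beyond \<open>R\<close> every solution is a combination of \<open>exp (\<kappa> * x)\<close> and \<open>exp (- \<kappa> * x)\<close>. A growing part would make the integral of
  \<open>u\<^sup>2\<close> unbounded, and a solution without it is determined by its value at \<open>R\<close>.\<close>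

lemma decaying_solution_multiple:
  fixes u v :: "real \<Rightarrow> real"
  assumes V: "potential R V" and R: "0 \<le> R" and \<kappa>: "0 < \<kappa>"
    and s: "half_line_solution (\<lambda>x. V x + \<kappa>\<^sup>2) u v"
    and T: "\<And>X. 0 \<le> X \<Longrightarrow> integral {0..X} (\<lambda>x. (u x)\<^sup>2) \<le> T"
  obtains c where "\<And>x. 0 \<le> x \<Longrightarrow> u x = c * jost_u R V \<kappa> x" "\<And>x. 0 \<le> x \<Longrightarrow> v x = c * jost_v R V \<kappa> x"
proof -
  have uv: "primitive_on {0..} u v" "primitive_on {0..} v (\<lambda>x. (V x + \<kappa>\<^sup>2) * u x)"
    using s by (auto simp: half_line_solution_def)
  have uc: "continuous_on {0..} u" using uv(1) by (rule primitive_on_continuous_Ici)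
  have v2: "primitive_on {R..} v (\<lambda>x. \<kappa>\<^sup>2 * u x)"
  proof (rule primitive_on_cong_AE[OF primitive_on_subset[OF uv(2)]])
    have "AE x in lebesgue. x \<noteq> R"
      unfolding eventually_ae_filter_negligible by (intro exI[of _ "{R}"]) auto
    then show "AE x in lebesgue. x \<in> {R..} \<longrightarrow> (V x + \<kappa>\<^sup>2) * u x = \<kappa>\<^sup>2 * u x"
      by eventually_elim (use V in \<open>auto simp: potential_def\<close>)
  qed (use R in \<open>auto simp: is_interval_ci\<close>)
  have u2: "primitive_on {R..} u v" by (rule primitive_on_subset[OF uv(1)]) (use R in auto)
  have const: "exp (s * \<kappa> * x) * (v x - s * \<kappa> * u x) = exp (s * \<kappa> * R) * (v R - s * \<kappa> * u R)"
    if x: "R \<le> x" and s: "s * s = 1" for s x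
  proof -
    have E: "primitive_on {R..x} (\<lambda>x. 1 * exp (- (- s * \<kappa>) * x)) (\<lambda>x. - (- s * \<kappa>) * (1 * exp (- (- s * \<kappa>) * x)))"
      by (rule exp_decay_primitive)
    have sub: "{R..x} \<subseteq> {R..}" by auto
    have "primitive_on {R..x} (\<lambda>x. (1 * exp (- (- s * \<kappa>) * x)) * (v x + (- s * \<kappa>) * u x))
        (\<lambda>x. (- (- s * \<kappa>) * (1 * exp (- (- s * \<kappa>) * x))) * (v x + (- s * \<kappa>) * u x)
          + (1 * exp (- (- s * \<kappa>) * x)) * (\<kappa>\<^sup>2 * u x + (- s * \<kappa>) * v x))"
      by (intro primitive_on_mult E primitive_on_add primitive_on_cmult
          primitive_on_subset[OF v2 sub] primitive_on_subset[OF u2 sub] continuous_intros)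
    moreover have "(- (- s * \<kappa>) * (1 * exp (- (- s * \<kappa>) * x))) * (v x + (- s * \<kappa>) * u x)
          + (1 * exp (- (- s * \<kappa>) * x)) * (\<kappa>\<^sup>2 * u x + (- s * \<kappa>) * v x) = 0" for x
    proof -
      have "s * (s * z) = z" for z using s by (metis mult.assoc mult_1)
      then show ?thesis by (simp add: algebra_simps power2_eq_square)
    qed
    ultimately have "primitive_on {R..x} (\<lambda>x. (1 * exp (- (- s * \<kappa>) * x)) * (v x + (- s * \<kappa>) * u x)) (\<lambda>x. 0)"
      by simp
    from primitive_onD(4)[OF this, of R x] x show ?thesis by simp
  qed
  define A where "A = exp (- \<kappa> * R) * (v R + \<kappa> * u R)"
  define B where "B = exp (\<kappa> * R) * (v R - \<kappa> * u R)"
  have cA: "v x + \<kappa> * u x = A * exp (\<kappa> * x)" if "R \<le> x" for x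
    using const[OF that, of "-1"] by (simp add: A_def exp_minus field_simps)
  have cB: "v x - \<kappa> * u x = B * exp (- \<kappa> * x)" if "R \<le> x" for x
    using const[OF that, of 1] by (simp add: B_def exp_minus field_simps)
  have u_eq: "2 * \<kappa> * u x = A * exp (\<kappa> * x) - B * exp (- \<kappa> * x)" if "R \<le> x" for x
    using cA[OF that] cB[OF that] by linarith
  have "A = 0"
  proof (rule ccontr)
    assume "A \<noteq> 0"
    define X where "X = max R ((\<bar>B\<bar> + 2 * \<kappa>) / (\<bar>A\<bar> * \<kappa>))"
    have X: "0 \<le> X" "R \<le> X" using R by (auto simp: X_def)
    have big: "1 \<le> (u x)\<^sup>2" if x: "X \<le> x" for x
    proof -
      have xR: "R \<le> x" "0 \<le> x" using X x by auto
      have "(\<bar>B\<bar> + 2 * \<kappa>) / (\<bar>A\<bar> * \<kappa>) \<le> x" using x by (simp add: X_def)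
      then have "\<bar>B\<bar> + 2 * \<kappa> \<le> \<bar>A\<bar> * (\<kappa> * x)"
        using \<open>A \<noteq> 0\<close> \<kappa> by (simp add: divide_le_eq mult_ac)
      also have "\<dots> \<le> \<bar>A\<bar> * exp (\<kappa> * x)"
      proof (rule mult_left_mono)
        show "\<kappa> * x \<le> exp (\<kappa> * x)" using exp_ge_add_one_self[of "\<kappa> * x"] by linarith
      qed simp
      finally have 1: "\<bar>B\<bar> + 2 * \<kappa> \<le> \<bar>A * exp (\<kappa> * x)\<bar>" by (simp add: abs_mult)
      have "\<bar>B * exp (- \<kappa> * x)\<bar> \<le> \<bar>B\<bar> * 1"
        using \<kappa> xR by (simp add: abs_mult mult_left_le)
      then have "2 * \<kappa> \<le> \<bar>2 * \<kappa> * u x\<bar>" using 1 u_eq[OF xR(1)] by linarith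
      then have "1 \<le> \<bar>u x\<bar>" using \<kappa> by (simp add: abs_mult)
      then show ?thesis by (metis abs_le_square_iff abs_one one_power2)
    qed
    define n where "n = \<bar>T\<bar> + 1"
    have i: "(\<lambda>x. (u x)\<^sup>2) integrable_on {a..b}" if "0 \<le> a" for a b
      by (intro integrable_continuous_real continuous_intros continuous_on_subset[OF uc]) (use that in auto)
    have "n = integral {X..X + n} (\<lambda>x. 1)" by (simp add: n_def)
    also have "\<dots> \<le> integral {X..X + n} (\<lambda>x. (u x)\<^sup>2)"
      by (rule integral_le) (use big X i in auto)
    also have "\<dots> \<le> integral {0..X + n} (\<lambda>x. (u x)\<^sup>2)"
      by (rule integral_subset_le) (use X i in auto)
    also have "\<dots> \<le> T" by (rule T) (use X in \<open>auto simp: n_def\<close>)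
    finally show False by (simp add: n_def)
  qed
  define c where "c = - B / (2 * \<kappa>)"
  note J = jost_props[OF V R, where \<kappa> = \<kappa>]
  have tail: "u x = c * jost_u R V \<kappa> x" "v x = c * jost_v R V \<kappa> x" if x: "R \<le> x" for x
  proof -
    have "2 * \<kappa> * u x = - B * exp (- \<kappa> * x)" using u_eq[OF x] \<open>A = 0\<close> by simp
    then show "u x = c * jost_u R V \<kappa> x" using \<kappa> J(3)[OF x] by (simp add: c_def field_simps)
    then have "v x = - \<kappa> * (c * jost_u R V \<kappa> x)" using cA[OF x] \<open>A = 0\<close> by simp
    then show "v x = c * jost_v R V \<kappa> x" using J(3,4)[OF x] by simp
  qed
  have inner: "u x = c * jost_u R V \<kappa> x \<and> v x = c * jost_v R V \<kappa> x" if x: "x \<in> {0..R}" for x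
  proof -
    have sub: "{0..R} \<subseteq> {0..}" by auto
    have "primitive_on {0..R} (\<lambda>x. c * jost_v R V \<kappa> x) (\<lambda>x. c * ((V x + \<kappa>\<^sup>2) * jost_u R V \<kappa> x))"
      by (intro primitive_on_cmult primitive_on_subset[OF J(2) sub])
    then have 2: "primitive_on {0..R} (\<lambda>x. c * jost_v R V \<kappa> x) (\<lambda>x. (V x + \<kappa>\<^sup>2) * (c * jost_u R V \<kappa> x))"
      by (simp add: mult_ac)
    have 1: "primitive_on {0..R} (\<lambda>x. c * jost_u R V \<kappa> x) (\<lambda>x. c * jost_v R V \<kappa> x)"
      by (intro primitive_on_cmult primitive_on_subset[OF J(1) sub])
    show ?thesis
      using solution_unique_backward[OF V primitive_on_subset[OF uv(1) sub]
          primitive_on_subset[OF uv(2) sub] 1 2 tail(1) tail(2) x] by auto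
  qed
  show ?thesis
    by (rule that[of c]) (use tail inner in \<open>metis atLeastAtMost_iff linear\<close>)+
qed

lemma square_integral_bound:
  fixes y :: "real \<Rightarrow> 'a::euclidean_space" and h :: "real \<Rightarrow> real"
  assumes y: "y \<in> L2 UNIV" and h: "continuous_on {0..} h"
    and le: "AE x in lebesgue. 0 < x \<longrightarrow> \<bar>h x\<bar> \<le> norm (y x)" and X: "0 \<le> X"
  shows "integral {0..X} (\<lambda>x. (h x)\<^sup>2) \<le> (\<integral>x. (norm (y x))\<^sup>2 \<partial>lebesgue)"
proof -
  have y2: "integrable lebesgue (\<lambda>x. (norm (y x))\<^sup>2)" using y by (simp add: L2_iff)
  have ai: "(\<lambda>x. (h x)\<^sup>2) absolutely_integrable_on {0..X}"
    by (intro absolutely_integrable_continuous_real continuous_intros continuous_on_subset[OF h]) auto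
  have "integral {0..X} (\<lambda>x. (h x)\<^sup>2) = (\<integral>x. indicator {0..X} x *\<^sub>R (h x)\<^sup>2 \<partial>lebesgue)"
    using set_lebesgue_integral_eq_integral(2)[OF ai] by (simp add: set_lebesgue_integral_def)
  also have "\<dots> \<le> (\<integral>x. (norm (y x))\<^sup>2 \<partial>lebesgue)"
  proof (rule integral_mono_AE)
    show "integrable lebesgue (\<lambda>x. indicat_real {0..X} x *\<^sub>R (h x)\<^sup>2)"
      using ai by (simp add: set_integrable_def)
    show "AE x in lebesgue. indicat_real {0..X} x *\<^sub>R (h x)\<^sup>2 \<le> (norm (y x))\<^sup>2"
      using le AE_nonzero
    proof eventually_elim
      case (elim x)
      show ?case
      proof (cases "x \<in> {0..X}")
        case True
        then have "\<bar>h x\<bar> \<le> norm (y x)" using elim by auto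
        then have "\<bar>h x\<bar>\<^sup>2 \<le> (norm (y x))\<^sup>2" by (intro power_mono) auto
        then show ?thesis using True by simp
      qed auto
    qed
  qed (rule y2)
  finally show ?thesis .
qed

lemma L2_reflect:
  fixes y :: "real \<Rightarrow> 'a::euclidean_space"
  assumes "y \<in> L2 UNIV"
  shows "(\<lambda>x. y (- x)) \<in> L2 UNIV"
  using assms borel_measurable_affine[of y "-1" 0]
    lebesgue_integrable_real_affine[of "\<lambda>x. (norm (y x))\<^sup>2" "-1" 0]
  by (simp add: L2_iff)

lemma half_line_solution_linear:
  assumes "bounded_linear h" "half_line_solution q u v"
  shows "half_line_solution q (\<lambda>x. h (u x)) (\<lambda>x. h (v x))"
  using primitive_on_linear[OF assms(1), of "{0..}" u v]
    primitive_on_linear[OF assms(1), of "{0..}" v "\<lambda>x. q x *\<^sub>R u x"] assms(2)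
  by (simp add: half_line_solution_def linear_cmul[OF bounded_linear.linear[OF assms(1)]])

text \<open>The equation has real coefficients, so real and imaginary part solve it separately.\<close>

lemma decaying_complex_solution_multiple:
  fixes u v y :: "real \<Rightarrow> complex"
  assumes V: "potential R V" and R: "0 \<le> R" and \<kappa>: "0 < \<kappa>"
    and s: "half_line_solution (\<lambda>x. V x + \<kappa>\<^sup>2) u v"
    and y: "y \<in> L2 UNIV" "AE x in lebesgue. 0 < x \<longrightarrow> y x = u x"
  obtains c where "\<And>x. 0 \<le> x \<Longrightarrow> u x = c * of_real (jost_u R V \<kappa> x)"
    "\<And>x. 0 \<le> x \<Longrightarrow> v x = c * of_real (jost_v R V \<kappa> x)"
proof -
  have uc: "continuous_on {0..} u" using half_line_solution_continuous[OF s] by simp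
  define T where "T = (\<integral>x. (norm (y x))\<^sup>2 \<partial>lebesgue)"
  have TR: "integral {0..X} (\<lambda>x. (Re (u x))\<^sup>2) \<le> T" and TI: "integral {0..X} (\<lambda>x. (Im (u x))\<^sup>2) \<le> T"
    if "0 \<le> X" for X
  proof -
    have "AE x in lebesgue. 0 < x \<longrightarrow> \<bar>Re (u x)\<bar> \<le> norm (y x)"
      "AE x in lebesgue. 0 < x \<longrightarrow> \<bar>Im (u x)\<bar> \<le> norm (y x)"
      using y(2) by (eventually_elim; simp add: abs_Re_le_cmod abs_Im_le_cmod)+
    then show "integral {0..X} (\<lambda>x. (Re (u x))\<^sup>2) \<le> T" "integral {0..X} (\<lambda>x. (Im (u x))\<^sup>2) \<le> T"
      unfolding T_def by (intro square_integral_bound[OF y(1)] that continuous_intros uc; simp)+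
  qed
  obtain a where a: "\<And>x. 0 \<le> x \<Longrightarrow> Re (u x) = a * jost_u R V \<kappa> x" "\<And>x. 0 \<le> x \<Longrightarrow> Re (v x) = a * jost_v R V \<kappa> x"
    using decaying_solution_multiple[OF V R \<kappa> half_line_solution_linear[OF bounded_linear_Re s] TR] by blast
  obtain b where b: "\<And>x. 0 \<le> x \<Longrightarrow> Im (u x) = b * jost_u R V \<kappa> x" "\<And>x. 0 \<le> x \<Longrightarrow> Im (v x) = b * jost_v R V \<kappa> x"
    using decaying_solution_multiple[OF V R \<kappa> half_line_solution_linear[OF bounded_linear_Im s] TI] by blast
  show ?thesis
    by (rule that[of "Complex a b"]) (use a b in \<open>auto simp: complex_eq_iff\<close>)
qed

text \<open>The matching condition at the origin: \<open>- \<kappa>\<^sup>2\<close> is an eigenvalue exactly when this vanishes.\<close>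

definition secular :: "real \<Rightarrow> (real \<Rightarrow> real) \<Rightarrow> real \<Rightarrow> real \<Rightarrow> real" where
  "secular R V \<beta> \<kappa> = mfun R V \<kappa> + mfun R (\<lambda>x. V (- x)) \<kappa> + \<beta>"

text \<open>The candidate eigenfunction, normalized to the value \<open>1\<close> at the origin.\<close>

definition ground :: "real \<Rightarrow> (real \<Rightarrow> real) \<Rightarrow> real \<Rightarrow> real \<Rightarrow> real" where
  "ground R V \<kappa> x = (if 0 < x then jost_u R V \<kappa> x / jost_u R V \<kappa> 0
     else jost_u R (\<lambda>x. V (- x)) \<kappa> (- x) / jost_u R (\<lambda>x. V (- x)) \<kappa> 0)"

lemma ground_pos:
  assumes "oscillation_free R V" "oscillation_free R (\<lambda>x. V (- x))" "0 < \<kappa>"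
  shows "0 < ground R V \<kappa> x"
  using oscillation_freeD(3)[OF assms(1)] oscillation_freeD(3)[OF assms(2)] assms(3)
  by (auto simp: ground_def)

text \<open>Both halves are multiples of Jost solutions, and continuity at \<open>0\<close> makes the normalized multiples equal. The jump
  condition then reads \<open>- m\<^sub>+ - m\<^sub>- = \<beta>\<close>, after division by the common value at the origin, which is nonzero
  because the eigenfunction is.\<close>

lemma folded_eigenfunction_secular:
  fixes y up vp um vm :: "real \<Rightarrow> complex"
  assumes V: "oscillation_free R V" "oscillation_free R (\<lambda>x. V (- x))" and \<kappa>: "0 < \<kappa>"
    and f: "folded_eigenfunction V \<beta> (- \<kappa>\<^sup>2) y up vp um vm"
    and y: "y \<in> L2 UNIV" and nz: "\<not> (AE x in lebesgue. y x = 0)"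
  shows "secular R V \<beta> \<kappa> = 0" "AE x in lebesgue. y x = up 0 * of_real (ground R V \<kappa> x)"
    "vp 0 = - (up 0 * of_real (mfun R V \<kappa>))" "vm 0 = - (up 0 * of_real (mfun R (\<lambda>x. V (- x)) \<kappa>))"
proof -
  let ?V' = "\<lambda>x. V (- x)"
  note D = oscillation_freeD[OF V(1)] and D' = oscillation_freeD[OF V(2)]
  have h: "half_line_solution (\<lambda>x. V x + \<kappa>\<^sup>2) up vp" "half_line_solution (\<lambda>x. ?V' x + \<kappa>\<^sup>2) um vm"
    and m: "up 0 = um 0" "vp 0 + vm 0 = \<beta> *\<^sub>R up 0"
    and ae: "AE x in lebesgue. y x = (if 0 < x then up x else um (- x))"
    using f by (auto simp: folded_eigenfunction_def)
  obtain cp where cp: "\<And>x. 0 \<le> x \<Longrightarrow> up x = cp * of_real (jost_u R V \<kappa> x)"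
    "\<And>x. 0 \<le> x \<Longrightarrow> vp x = cp * of_real (jost_v R V \<kappa> x)"
    by (rule decaying_complex_solution_multiple[OF D(1,2) \<kappa> h(1) y])
      (use ae in \<open>auto elim: eventually_mono\<close>)
  have "AE x in lebesgue. 0 < x \<longrightarrow> y (- x) = um x"
    using AE_reflect[OF ae] by eventually_elim auto
  then obtain cm where cm: "\<And>x. 0 \<le> x \<Longrightarrow> um x = cm * of_real (jost_u R ?V' \<kappa> x)"
    "\<And>x. 0 \<le> x \<Longrightarrow> vm x = cm * of_real (jost_v R ?V' \<kappa> x)"
    using decaying_complex_solution_multiple[OF D'(1,2) \<kappa> h(2) L2_reflect[OF y]] by blast
  have j: "0 < jost_u R V \<kappa> 0" "0 < jost_u R ?V' \<kappa> 0" using D(3) D'(3) \<kappa> by auto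
  have c: "cp = up 0 / of_real (jost_u R V \<kappa> 0)" "cm = up 0 / of_real (jost_u R ?V' \<kappa> 0)"
    using cp(1)[of 0] cm(1)[of 0] m(1) j by (auto simp: field_simps)
  show ae2: "AE x in lebesgue. y x = up 0 * of_real (ground R V \<kappa> x)"
  proof -
    have p: "up x = up 0 * of_real (jost_u R V \<kappa> x / jost_u R V \<kappa> 0)" if "0 \<le> x" for x
      using cp(1)[OF that] unfolding c by simp
    have q: "um x = up 0 * of_real (jost_u R ?V' \<kappa> x / jost_u R ?V' \<kappa> 0)" if "0 \<le> x" for x
      using cm(1)[OF that] unfolding c by simp
    show ?thesis
      using ae
    proof eventually_elim
      case (elim x)
      show ?case
      proof (cases "0 < x")
        case True
        then show ?thesis using elim p[of x] by (simp add: ground_def)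
      next
        case False
        then show ?thesis using elim q[of "- x"] by (simp add: ground_def)
      qed
    qed
  qed
  then have "up 0 \<noteq> 0" using nz by auto
  show v: "vp 0 = - (up 0 * of_real (mfun R V \<kappa>))" "vm 0 = - (up 0 * of_real (mfun R ?V' \<kappa>))"
    using cp(2)[of 0] cm(2)[of 0] unfolding c by (simp_all add: mfun_def)
  have "up 0 * of_real (secular R V \<beta> \<kappa>) = \<beta> *\<^sub>R up 0 - (vp 0 + vm 0)"
    unfolding v by (simp add: secular_def scaleR_conv_of_real algebra_simps)
  then have "up 0 * of_real (secular R V \<beta> \<kappa>) = 0" unfolding m(2) by simp
  then show "secular R V \<beta> \<kappa> = 0" using \<open>up 0 \<noteq> 0\<close> by simp
qed

lemma S_op_eigenvalue_secular:
  assumes V: "oscillation_free R V" "oscillation_free R (\<lambda>x. V (- x))" and \<kappa>: "0 < \<kappa>"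
    and e: "eigenvalue (S_op V \<beta>) (- \<kappa>\<^sup>2)"
  shows "secular R V \<beta> \<kappa> = 0"
proof -
  obtain y where y: "eigenfunction (S_op V \<beta>) (- \<kappa>\<^sup>2) y" using e by (auto simp: eigenvalue_def)
  then obtain up vp um vm where f: "folded_eigenfunction V \<beta> (- \<kappa>\<^sup>2) y up vp um vm"
    using S_op_eigenfunction_folded by blast
  have "y \<in> L2 (- {0})" "\<not> (AE x in lebesgue. y x = 0)"
    using y by (auto simp: eigenfunction_def S_op_def W22_def)
  then show ?thesis
    using folded_eigenfunction_secular(1)[OF V \<kappa> f] by (simp add: L2_iff)
qed

lemma H_op_eigenvalue_secular:
  assumes V: "oscillation_free R (scaled_potential W U \<epsilon>)" "oscillation_free R (\<lambda>x. scaled_potential W U \<epsilon> (- x))"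
    and \<kappa>: "0 < \<kappa>" and e: "eigenvalue (H_op W U \<epsilon>) (- \<kappa>\<^sup>2)"
  shows "secular R (scaled_potential W U \<epsilon>) 0 \<kappa> = 0"
proof -
  obtain y where y: "eigenfunction (H_op W U \<epsilon>) (- \<kappa>\<^sup>2) y" using e by (auto simp: eigenvalue_def)
  then obtain up vp um vm where f: "folded_eigenfunction (scaled_potential W U \<epsilon>) 0 (- \<kappa>\<^sup>2) y up vp um vm"
    using H_op_eigenfunction_folded by blast
  have "y \<in> L2 UNIV" "\<not> (AE x in lebesgue. y x = 0)"
    using y by (auto simp: eigenfunction_def H_op_def W22_def)
  then show ?thesis
    using folded_eigenfunction_secular(1)[OF V \<kappa> f] by simp
qed

text \<open>The jump of the derivative is computed for the real function, whereas the operator acts on complex ones;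
  taking real parts under the defining integrals connects the two weak derivatives.\<close>

lemma weak_deriv_of_complexification:
  fixes \<psi> :: "real \<Rightarrow> real"
  assumes y: "(\<lambda>x. complex_of_real (\<psi> x)) \<in> W22 (- {0})"
  shows "AE x in lebesgue. weak_deriv (- {0}) 1 \<psi> x = Re (weak_deriv (- {0}) 1 (\<lambda>x. complex_of_real (\<psi> x)) x)"
proof (rule weak_deriv_AE_eq)
  let ?\<Omega> = "- {0::real}" and ?y = "\<lambda>x. complex_of_real (\<psi> x)"
  define g where "g = weak_deriv ?\<Omega> 1 ?y"
  have L: "?y \<in> L2 ?\<Omega>" "g \<in> L2 ?\<Omega>" and w: "is_weak_deriv ?\<Omega> 1 ?y g"
    using W22_D[OF y, of 1] by (auto simp: g_def)
  have \<Omega>: "?\<Omega> \<in> {UNIV, - {0}}" by simp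
  have g: "g \<in> borel_measurable lebesgue" "integrable lebesgue (\<lambda>x. (norm (g x))\<^sup>2)"
    using L(2) by (auto simp: L2_iff)
  have m: "(\<lambda>x. Re (g x)) \<in> borel_measurable lebesgue" using g(1) by simp
  have "integrable lebesgue (\<lambda>x. (norm (Re (g x)))\<^sup>2)"
    by (rule Bochner_Integration.integrable_bound[OF g(2)])
      (use m in \<open>auto simp: cmod_power2\<close>)
  then show "(\<lambda>x. Re (weak_deriv ?\<Omega> 1 ?y x)) \<in> L2 ?\<Omega>"
    using m unfolding g_def[symmetric] by (simp add: L2_iff)
  show "is_weak_deriv ?\<Omega> 1 \<psi> (\<lambda>x. Re (weak_deriv ?\<Omega> 1 ?y x))"
    unfolding g_def[symmetric] is_weak_deriv_iff[OF \<Omega>]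
  proof (intro allI impI)
    fix \<phi> assume t: "test_function ?\<Omega> \<phi>"
    note i = test_function_scaleR_integrable[OF test_function_deriv[OF t] L2_locally_integrable[OF L(1) \<Omega>]]
      test_function_scaleR_integrable[OF t L2_locally_integrable[OF L(2) \<Omega>]]
    have "Re (\<integral>x. deriv \<phi> x *\<^sub>R ?y x \<partial>lebesgue) = Re (- (\<integral>x. \<phi> x *\<^sub>R g x \<partial>lebesgue))"
      using w t by (simp add: is_weak_deriv_iff[OF \<Omega>])
    then show "(\<integral>x. (deriv ^^ 1) \<phi> x *\<^sub>R \<psi> x \<partial>lebesgue) = (- 1) ^ 1 *\<^sub>R (\<integral>x. \<phi> x *\<^sub>R Re (g x) \<partial>lebesgue)"
      using integral_bounded_linear[OF bounded_linear_Re i(1)] integral_bounded_linear[OF bounded_linear_Re i(2)]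
      by simp
  qed
qed auto

lemma S_op_real_eigenfunction:
  fixes \<psi> :: "real \<Rightarrow> real"
  assumes V: "oscillation_free R V" "oscillation_free R (\<lambda>x. V (- x))" and \<kappa>: "0 < \<kappa>"
    and e: "eigenfunction (S_op V \<beta>) (- \<kappa>\<^sup>2) (\<lambda>x. complex_of_real (\<psi> x))"
  obtains a where "AE x in lebesgue. \<psi> x = a * ground R V \<kappa> x" "right_limit0 \<psi> = a"
    "right_limit0 (weak_deriv (- {0}) 1 \<psi>) = - (a * mfun R V \<kappa>)"
    "left_limit0 (weak_deriv (- {0}) 1 \<psi>) = a * mfun R (\<lambda>x. V (- x)) \<kappa>"
proof -
  let ?y = "\<lambda>x. complex_of_real (\<psi> x)" and ?V' = "\<lambda>x. V (- x)"
  obtain up vp um vm where f: "folded_eigenfunction V \<beta> (- \<kappa>\<^sup>2) ?y up vp um vm"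
    and d: "AE x in lebesgue. weak_deriv (- {0}) 1 ?y x = (if 0 < x then vp x else - vm (- x))"
    using S_op_eigenfunction_folded[OF e] by blast
  have W: "?y \<in> W22 (- {0})" and nz: "\<not> (AE x in lebesgue. ?y x = 0)"
    using e by (auto simp: eigenfunction_def S_op_def)
  then have L: "?y \<in> L2 UNIV" using L2_iff[of "- {0}" ?y] L2_iff[of UNIV ?y] by (simp add: W22_def)
  note S = folded_eigenfunction_secular[OF V \<kappa> f L nz]
  have h: "half_line_solution (\<lambda>x. V x - - \<kappa>\<^sup>2) up vp" "half_line_solution (\<lambda>x. ?V' x - - \<kappa>\<^sup>2) um vm"
    and m: "up 0 = um 0" and ae: "AE x in lebesgue. ?y x = (if 0 < x then up x else um (- x))"
    using f by (auto simp: folded_eigenfunction_def)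
  note c = half_line_solution_continuous[OF h(1)] half_line_solution_continuous[OF h(2)]
  have "AE x in lebesgue. \<psi> x = (if 0 < x then Re (up x) else Re (um (- x)))"
    using ae by eventually_elim (drule arg_cong[where f = Re], simp split: if_splits)
  from one_sided_limits_of_halves(1)[OF this continuous_on_Re[OF c(1)] continuous_on_Re[OF c(3)]]
  have r: "right_limit0 \<psi> = Re (up 0)" .
  have "AE x in lebesgue. weak_deriv (- {0}) 1 \<psi> x = (if 0 < x then Re (vp x) else Re (- vm (- x)))"
    using weak_deriv_of_complexification[OF W] d by eventually_elim auto
  from one_sided_limits_of_halves[OF this continuous_on_Re[OF c(2)] continuous_on_Re[OF continuous_on_minus[OF c(4)]]]
  have "right_limit0 (weak_deriv (- {0}) 1 \<psi>) = Re (vp 0)" "left_limit0 (weak_deriv (- {0}) 1 \<psi>) = - Re (vm 0)"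
    by auto
  then have r1: "right_limit0 (weak_deriv (- {0}) 1 \<psi>) = - (Re (up 0) * mfun R V \<kappa>)"
    "left_limit0 (weak_deriv (- {0}) 1 \<psi>) = Re (up 0) * mfun R ?V' \<kappa>"
    using S(3,4) by auto
  have "AE x in lebesgue. \<psi> x = Re (up 0) * ground R V \<kappa> x"
    using S(2) by eventually_elim (drule arg_cong[where f = Re], simp)
  then show ?thesis using that r r1 by blast
qed

lemma exp_abs_integrable:
  assumes "0 < (a::real)"
  shows "integrable lebesgue (\<lambda>x. exp (- a * \<bar>x\<bar>))"
proof -
  have h: "((\<lambda>x. exp (- a * x)) has_integral exp (- a * 0) / a) {0..}"
    by (rule has_integral_exp_minus_to_infinity[OF assms])
  have "(\<lambda>x. exp (- a * x)) absolutely_integrable_on {0..}"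
    by (rule nonnegative_absolutely_integrable_1) (use h in auto)
  then have 1: "integrable lebesgue (\<lambda>x. indicat_real {0..} x * exp (- a * x))"
    by (simp add: set_integrable_def)
  then have 2: "integrable lebesgue (\<lambda>x. indicat_real {0..} (- x) * exp (a * x))"
    using lebesgue_integrable_real_affine[of "\<lambda>x. indicat_real {0..} x * exp (- a * x)" "-1" 0] by simp
  show ?thesis
  proof (rule Bochner_Integration.integrable_bound[OF Bochner_Integration.integrable_add[OF 1 2]])
    show "(\<lambda>x. exp (- a * \<bar>x\<bar>)) \<in> borel_measurable lebesgue"
      by (intro measurable_completion) simp
    show "AE x in lebesgue. norm (exp (- a * \<bar>x\<bar>))
        \<le> norm (indicat_real {0..} x * exp (- a * x) + indicat_real {0..} (- x) * exp (a * x))"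
      by (rule AE_I2) (auto simp: indicator_def abs_real_def)
  qed
qed

lemma L2_of_exp_bound:
  fixes f :: "real \<Rightarrow> real"
  assumes f: "f \<in> borel_measurable lebesgue" and a: "0 < a" and le: "\<And>x. \<bar>f x\<bar> \<le> C * exp (- a * \<bar>x\<bar>)"
  shows "(\<lambda>x. complex_of_real (f x)) \<in> L2 UNIV" "integrable lebesgue (\<lambda>x. (f x)\<^sup>2)"
proof -
  have "integrable lebesgue (\<lambda>x. C\<^sup>2 * exp (- (2 * a) * \<bar>x\<bar>))"
    using exp_abs_integrable[of "2 * a"] a by simp
  then show 1: "integrable lebesgue (\<lambda>x. (f x)\<^sup>2)"
  proof (rule Bochner_Integration.integrable_bound)
    show "AE x in lebesgue. norm ((f x)\<^sup>2) \<le> norm (C\<^sup>2 * exp (- (2 * a) * \<bar>x\<bar>))"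
    proof (rule AE_I2)
      fix x
      have "\<bar>f x\<bar>\<^sup>2 \<le> (C * exp (- a * \<bar>x\<bar>))\<^sup>2" using le by (intro power_mono) auto
      also have "\<dots> = C\<^sup>2 * exp (- (2 * a) * \<bar>x\<bar>)"
        by (simp add: power_mult_distrib power2_eq_square flip: exp_add)
      finally show "norm ((f x)\<^sup>2) \<le> norm (C\<^sup>2 * exp (- (2 * a) * \<bar>x\<bar>))" by simp
    qed
  qed (use f in auto)
  show "(\<lambda>x. complex_of_real (f x)) \<in> L2 UNIV"
    using f 1 by (simp add: L2_iff)
qed

lemma folded_measurable:
  fixes p q :: "real \<Rightarrow> real"
  assumes p: "continuous_on {0..} p" and q: "continuous_on {0..} q"
  shows "(\<lambda>x. if 0 < x then p x else q (- x)) \<in> borel_measurable lebesgue"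
proof -
  have "continuous_on {..0} (\<lambda>x. q (- x))"
    by (rule continuous_on_compose2[OF q]) (auto intro: continuous_intros)
  then have "(\<lambda>x. indicator {..0} x *\<^sub>R q (- x)) \<in> borel_measurable borel"
    by (intro borel_measurable_continuous_on_indicator) auto
  moreover have "(\<lambda>x. indicator {0<..} x *\<^sub>R p x) \<in> borel_measurable borel"
    by (intro borel_measurable_continuous_on_indicator continuous_on_subset[OF p]) auto
  ultimately have "(\<lambda>x. indicator {0<..} x *\<^sub>R p x + indicator {..0} x *\<^sub>R q (- x)) \<in> borel_measurable borel"
    by (rule borel_measurable_add[rotated])
  also have "(\<lambda>x. indicator {0<..} x *\<^sub>R p x + indicator {..0} x *\<^sub>R q (- x)) = (\<lambda>x. if 0 < x then p x else q (- x))"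
    by (auto simp: indicator_def)
  finally show ?thesis by (intro measurable_completion) simp
qed

lemma folded_integral:
  fixes p q :: "real \<Rightarrow> real"
  assumes p: "p absolutely_integrable_on {0..}" and q: "q absolutely_integrable_on {0..}"
  shows "(\<integral>x. (if 0 < x then p x else q (- x)) \<partial>lebesgue) = integral {0..} p + integral {0..} q"
    and "integrable lebesgue (\<lambda>x. if 0 < x then p x else q (- x))"
proof -
  have 1: "integrable lebesgue (\<lambda>x. indicat_real {0..} x *\<^sub>R p x)"
    using p by (simp add: set_integrable_def)
  have q1: "integrable lebesgue (\<lambda>x. indicat_real {0..} x *\<^sub>R q x)"
    using q by (simp add: set_integrable_def)
  from lebesgue_integrable_real_affine[OF this, of "-1" 0]
  have 2: "integrable lebesgue (\<lambda>x. indicat_real {0..} (- x) *\<^sub>R q (- x))" by simp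
  have e2: "(\<integral>x. indicat_real {0..} (- x) *\<^sub>R q (- x) \<partial>lebesgue) = (\<integral>x. indicat_real {0..} x *\<^sub>R q x \<partial>lebesgue)"
    using lebesgue_integral_real_affine[of "-1" "\<lambda>x. indicat_real {0..} x *\<^sub>R q x" 0] by simp
  let ?s = "\<lambda>x. indicat_real {0..} x *\<^sub>R p x + indicat_real {0..} (- x) *\<^sub>R q (- x)"
  let ?f = "\<lambda>x. if 0 < x then p x else q (- x)"
  have ae: "AE x in lebesgue. ?s x = ?f x"
    using AE_nonzero by eventually_elim (auto simp: indicator_def)
  have s: "integrable lebesgue ?s" using 1 2 by (rule Bochner_Integration.integrable_add)
  have m: "?f \<in> borel_measurable lebesgue"
    using borel_measurable_AE[OF borel_measurable_integrable[OF s] ae] .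
  show "integrable lebesgue ?f" using integrable_cong_AE[OF borel_measurable_integrable[OF s] m ae] s by simp
  have "(\<integral>x. ?f x \<partial>lebesgue) = (\<integral>x. ?s x \<partial>lebesgue)"
    using integral_cong_AE[OF borel_measurable_integrable[OF s] m ae] by simp
  also have "\<dots> = (\<integral>x. indicat_real {0..} x *\<^sub>R p x \<partial>lebesgue) + (\<integral>x. indicat_real {0..} x *\<^sub>R q x \<partial>lebesgue)"
    using Bochner_Integration.integral_add[OF 1 2] e2 by simp
  also have "\<dots> = integral {0..} p + integral {0..} q"
    using set_lebesgue_integral_eq_integral(2)[OF p] set_lebesgue_integral_eq_integral(2)[OF q]
    by (simp add: set_lebesgue_integral_def)
  finally show "(\<integral>x. ?f x \<partial>lebesgue) = integral {0..} p + integral {0..} q" .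
qed

lemma ground_measurable:
  assumes V: "oscillation_free R V" "oscillation_free R (\<lambda>x. V (- x))"
  shows "ground R V \<kappa> \<in> borel_measurable lebesgue"
proof -
  note J = jost_props[OF oscillation_freeD(1,2)[OF V(1)]] and J' = jost_props[OF oscillation_freeD(1,2)[OF V(2)]]
  have "(\<lambda>x. if 0 < x then inverse (jost_u R V \<kappa> 0) * jost_u R V \<kappa> x
      else inverse (jost_u R (\<lambda>x. V (- x)) \<kappa> 0) * jost_u R (\<lambda>x. V (- x)) \<kappa> (- x)) \<in> borel_measurable lebesgue"
    by (rule folded_measurable) (intro continuous_intros J(5) J'(5))+
  also have "(\<lambda>x. if 0 < x then inverse (jost_u R V \<kappa> 0) * jost_u R V \<kappa> x
      else inverse (jost_u R (\<lambda>x. V (- x)) \<kappa> 0) * jost_u R (\<lambda>x. V (- x)) \<kappa> (- x)) = ground R V \<kappa>"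
    by (auto simp: ground_def divide_inverse fun_eq_iff mult.commute)
  finally show ?thesis .
qed

lemma ground_exp_bound:
  assumes V: "oscillation_free R V" "oscillation_free R (\<lambda>x. V (- x))" and a: "0 < a" "a \<le> \<kappa>"
  obtains C where "\<And>x. \<bar>ground R V \<kappa> x\<bar> \<le> C * exp (- a * \<bar>x\<bar>)"
    "\<And>x. 0 \<le> x \<Longrightarrow> \<bar>jost_v R V \<kappa> x / jost_u R V \<kappa> 0\<bar> \<le> C * exp (- a * x)"
    "\<And>x. 0 \<le> x \<Longrightarrow> \<bar>jost_v R (\<lambda>x. V (- x)) \<kappa> x / jost_u R (\<lambda>x. V (- x)) \<kappa> 0\<bar> \<le> C * exp (- a * x)"
proof -
  let ?V' = "\<lambda>x. V (- x)"
  note D = oscillation_freeD[OF V(1)] and D' = oscillation_freeD[OF V(2)]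
  have \<kappa>: "0 < \<kappa>" "\<kappa> \<in> {a..\<kappa>}" using a by auto
  obtain C1 where C1: "0 < C1" "\<And>x. 0 \<le> x \<Longrightarrow> \<bar>jost_u R V \<kappa> x\<bar> \<le> C1 * exp (- a * x)"
    "\<And>x. 0 \<le> x \<Longrightarrow> \<bar>jost_v R V \<kappa> x\<bar> \<le> C1 * exp (- a * x)"
    using jost_bounds[OF D(1,2) a] \<kappa>(2) by metis
  obtain C2 where C2: "0 < C2" "\<And>x. 0 \<le> x \<Longrightarrow> \<bar>jost_u R ?V' \<kappa> x\<bar> \<le> C2 * exp (- a * x)"
    "\<And>x. 0 \<le> x \<Longrightarrow> \<bar>jost_v R ?V' \<kappa> x\<bar> \<le> C2 * exp (- a * x)"
    using jost_bounds[OF D'(1,2) a] \<kappa>(2) by metis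
  let ?j = "jost_u R V \<kappa> 0" and ?j' = "jost_u R ?V' \<kappa> 0"
  have j: "0 < ?j" "0 < ?j'" using D(3) D'(3) \<kappa> by auto
  define C where "C = C1 / ?j + C2 / ?j'"
  have CC: "C1 / ?j \<le> C" "C2 / ?j' \<le> C" using C1(1) C2(1) j by (auto simp: C_def)
  have 1: "\<bar>z / ?j\<bar> \<le> C * exp (- a * x)" if "\<bar>z\<bar> \<le> C1 * exp (- a * x)" for z x
  proof -
    have "\<bar>z / ?j\<bar> \<le> C1 / ?j * exp (- a * x)" using that j by (simp add: abs_mult divide_right_mono)
    also have "\<dots> \<le> C * exp (- a * x)" using CC by (intro mult_right_mono) auto
    finally show ?thesis .
  qed
  have 2: "\<bar>z / ?j'\<bar> \<le> C * exp (- a * x)" if "\<bar>z\<bar> \<le> C2 * exp (- a * x)" for z x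
  proof -
    have "\<bar>z / ?j'\<bar> \<le> C2 / ?j' * exp (- a * x)" using that j by (simp add: abs_mult divide_right_mono)
    also have "\<dots> \<le> C * exp (- a * x)" using CC by (intro mult_right_mono) auto
    finally show ?thesis .
  qed
  show ?thesis
  proof (rule that[of C])
    show "\<bar>ground R V \<kappa> x\<bar> \<le> C * exp (- a * \<bar>x\<bar>)" for x
    proof (cases "0 < x")
      case True
      then show ?thesis using 1[OF C1(2)[of x]] by (simp add: ground_def)
    next
      case False
      then show ?thesis using 2[OF C2(2)[of "- x"]] by (simp add: ground_def)
    qed
  qed (use 1 2 C1 C2 in auto)
qed

lemma ground_norm:
  assumes V: "oscillation_free R V" "oscillation_free R (\<lambda>x. V (- x))" and \<kappa>: "0 < \<kappa>"
  shows "(\<integral>x. (ground R V \<kappa> x)\<^sup>2 \<partial>lebesgue) = overlap R V \<kappa> \<kappa> / (jost_u R V \<kappa> 0)\<^sup>2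
      + overlap R (\<lambda>x. V (- x)) \<kappa> \<kappa> / (jost_u R (\<lambda>x. V (- x)) \<kappa> 0)\<^sup>2"
    and "integrable lebesgue (\<lambda>x. (ground R V \<kappa> x)\<^sup>2)"
proof -
  let ?V' = "\<lambda>x. V (- x)"
  define p where "p = (\<lambda>x. inverse ((jost_u R V \<kappa> 0)\<^sup>2) * (jost_u R V \<kappa> x * jost_u R V \<kappa> x))"
  define q where "q = (\<lambda>x. inverse ((jost_u R ?V' \<kappa> 0)\<^sup>2) * (jost_u R ?V' \<kappa> x * jost_u R ?V' \<kappa> x))"
  have p: "p absolutely_integrable_on {0..}" and q: "q absolutely_integrable_on {0..}"
    using overlap_has_integral(2)[OF oscillation_freeD(1,2)[OF V(1)] \<kappa> \<kappa>]
      overlap_has_integral(2)[OF oscillation_freeD(1,2)[OF V(2)] \<kappa> \<kappa>]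
    by (auto simp: p_def q_def)
  have e: "(\<lambda>x. (ground R V \<kappa> x)\<^sup>2) = (\<lambda>x. if 0 < x then p x else q (- x))"
    by (auto simp: ground_def p_def q_def power_divide power2_eq_square divide_inverse fun_eq_iff)
  show "integrable lebesgue (\<lambda>x. (ground R V \<kappa> x)\<^sup>2)" unfolding e by (rule folded_integral(2)[OF p q])
  show "(\<integral>x. (ground R V \<kappa> x)\<^sup>2 \<partial>lebesgue) = overlap R V \<kappa> \<kappa> / (jost_u R V \<kappa> 0)\<^sup>2
      + overlap R ?V' \<kappa> \<kappa> / (jost_u R ?V' \<kappa> 0)\<^sup>2"
    unfolding e folded_integral(1)[OF p q] by (simp add: p_def q_def overlap_def divide_inverse mult.commute)
qed

text \<open>Jost solutions and their derivatives decay exponentially, so the glued function satisfies all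
  integrability conditions, and the secular equation is the required jump condition.\<close>

lemma eigenfunction_of_secular:
  assumes V: "oscillation_free R V" "oscillation_free R (\<lambda>x. V (- x))" and \<kappa>: "0 < \<kappa>"
    and s: "secular R V \<beta> \<kappa> = 0" and c: "c \<noteq> 0"
  shows "eigenfunction (S_op V \<beta>) (- \<kappa>\<^sup>2) (\<lambda>x. complex_of_real (c * ground R V \<kappa> x))"
    and "\<beta> = 0 \<Longrightarrow> V = scaled_potential W U \<epsilon> \<Longrightarrow>
      eigenfunction (H_op W U \<epsilon>) (- \<kappa>\<^sup>2) (\<lambda>x. complex_of_real (c * ground R V \<kappa> x))"
proof -
  let ?V' = "\<lambda>x. V (- x)" and ?y = "\<lambda>x. complex_of_real (c * ground R V \<kappa> x)"
  note D = oscillation_freeD[OF V(1)] and D' = oscillation_freeD[OF V(2)]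
  note J = jost_props[OF D(1,2), where \<kappa> = \<kappa>] and J' = jost_props[OF D'(1,2), where \<kappa> = \<kappa>]
  let ?j = "jost_u R V \<kappa> 0" and ?j' = "jost_u R ?V' \<kappa> 0"
  have j: "0 < ?j" "0 < ?j'" using D(3) D'(3) \<kappa> by auto
  define up where "up = (\<lambda>x. complex_of_real (c / ?j * jost_u R V \<kappa> x))"
  define vp where "vp = (\<lambda>x. complex_of_real (c / ?j * jost_v R V \<kappa> x))"
  define um where "um = (\<lambda>x. complex_of_real (c / ?j' * jost_u R ?V' \<kappa> x))"
  define vm where "vm = (\<lambda>x. complex_of_real (c / ?j' * jost_v R ?V' \<kappa> x))"
  have bl: "bounded_linear (\<lambda>x. complex_of_real (k * x))" for k
    by (intro bounded_linear_compose[OF bounded_linear_of_real] bounded_linear_mult_right)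
  have hl: "half_line_solution (\<lambda>x. V x - - \<kappa>\<^sup>2) (jost_u R V \<kappa>) (jost_v R V \<kappa>)"
    "half_line_solution (\<lambda>x. ?V' x - - \<kappa>\<^sup>2) (jost_u R ?V' \<kappa>) (jost_v R ?V' \<kappa>)"
    using J(1,2) J'(1,2) by (auto simp: half_line_solution_def)
  have f: "folded_eigenfunction V \<beta> (- \<kappa>\<^sup>2) ?y up vp um vm"
    unfolding folded_eigenfunction_def
  proof (intro conjI)
    show "half_line_solution (\<lambda>x. V x - - \<kappa>\<^sup>2) up vp" "half_line_solution (\<lambda>x. ?V' x - - \<kappa>\<^sup>2) um vm"
      unfolding up_def vp_def um_def vm_def by (intro half_line_solution_linear[OF bl] hl)+
    show "up 0 = um 0" using j by (simp add: up_def um_def)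
    have sum: "c / ?j * jost_v R V \<kappa> 0 + c / ?j' * jost_v R ?V' \<kappa> 0 = \<beta> * c"
    proof -
      have "c / ?j * jost_v R V \<kappa> 0 + c / ?j' * jost_v R ?V' \<kappa> 0 = - c * (mfun R V \<kappa> + mfun R ?V' \<kappa>)"
        by (simp add: mfun_def algebra_simps)
      also have "mfun R V \<kappa> + mfun R ?V' \<kappa> = - \<beta>" using s by (simp add: secular_def)
      finally show ?thesis by simp
    qed
    then show "vp 0 + vm 0 = \<beta> *\<^sub>R up 0"
    proof -
      have "up 0 = complex_of_real c" using j by (simp add: up_def)
      moreover have "vp 0 + vm 0 = complex_of_real (\<beta> * c)"
        unfolding vp_def vm_def sum[symmetric] by (simp only: of_real_add)
      ultimately show ?thesis by (simp add: scaleR_conv_of_real)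
    qed
    show "AE x in lebesgue. ?y x = (if 0 < x then up x else um (- x))"
      by (rule AE_I2) (simp add: ground_def up_def um_def)
  qed
  obtain C where C: "\<And>x. \<bar>ground R V \<kappa> x\<bar> \<le> C * exp (- \<kappa> * \<bar>x\<bar>)"
    "\<And>x. 0 \<le> x \<Longrightarrow> \<bar>jost_v R V \<kappa> x / ?j\<bar> \<le> C * exp (- \<kappa> * x)"
    "\<And>x. 0 \<le> x \<Longrightarrow> \<bar>jost_v R ?V' \<kappa> x / ?j'\<bar> \<le> C * exp (- \<kappa> * x)"
    using ground_exp_bound[OF V \<kappa> order_refl] by blast
  have gm: "ground R V \<kappa> \<in> borel_measurable lebesgue" by (rule ground_measurable[OF V])
  have cb: "\<bar>c * z\<bar> \<le> (\<bar>c\<bar> * C) * exp (- \<kappa> * x)" if "\<bar>z\<bar> \<le> C * exp (- \<kappa> * x)" for z x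
    using mult_left_mono[OF that, of "\<bar>c\<bar>"] by (simp add: abs_mult mult.assoc)
  have L1: "?y \<in> L2 UNIV"
    by (rule L2_of_exp_bound(1)[OF _ \<kappa>, of _ "\<bar>c\<bar> * C"]) (use gm cb C(1) in auto)
  have L2': "(\<lambda>x. if 0 < x then vp x else - vm (- x)) \<in> L2 UNIV"
  proof -
    define d where "d = (\<lambda>x. if 0 < x then c * (jost_v R V \<kappa> x / ?j) else - (c * (jost_v R ?V' \<kappa> (- x) / ?j')))"
    have "continuous_on {0..} (\<lambda>x. c * (jost_v R V \<kappa> x / ?j))"
      "continuous_on {0..} (\<lambda>x. - (c * (jost_v R ?V' \<kappa> x / ?j')))"
      using j by (auto intro!: continuous_intros J(6) J'(6))
    then have "d \<in> borel_measurable lebesgue" unfolding d_def by (rule folded_measurable)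
    moreover have "\<bar>d x\<bar> \<le> (\<bar>c\<bar> * C) * exp (- \<kappa> * \<bar>x\<bar>)" for x
      using cb[OF C(2)[of x]] cb[OF C(3)[of "- x"]] by (auto simp: d_def)
    ultimately have "(\<lambda>x. complex_of_real (d x)) \<in> L2 UNIV" by (rule L2_of_exp_bound(1)[OF _ \<kappa>])
    also have "(\<lambda>x. complex_of_real (d x)) = (\<lambda>x. if 0 < x then vp x else - vm (- x))"
      by (auto simp: d_def vp_def vm_def)
    finally show ?thesis .
  qed
  have L3: "(\<lambda>x. (V x - - \<kappa>\<^sup>2) *\<^sub>R ?y x) \<in> L2 UNIV"
  proof -
    obtain B where B: "0 \<le> B" "\<And>x. \<bar>V x\<bar> \<le> B" using potential_bound[OF D(1)] by blast
    have "V \<in> borel_measurable lebesgue" using D(1) by (simp add: potential_def)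
    then have "(\<lambda>x. (V x + \<kappa>\<^sup>2) * (c * ground R V \<kappa> x)) \<in> borel_measurable lebesgue" using gm by simp
    moreover have "\<bar>(V x + \<kappa>\<^sup>2) * (c * ground R V \<kappa> x)\<bar> \<le> ((B + \<kappa>\<^sup>2) * (\<bar>c\<bar> * C)) * exp (- \<kappa> * \<bar>x\<bar>)" for x
    proof -
      have "\<bar>V x + \<kappa>\<^sup>2\<bar> \<le> B + \<kappa>\<^sup>2" using B(2)[of x] abs_triangle_ineq[of "V x" "\<kappa>\<^sup>2"] by simp
      then have "\<bar>V x + \<kappa>\<^sup>2\<bar> * \<bar>c * ground R V \<kappa> x\<bar> \<le> (B + \<kappa>\<^sup>2) * ((\<bar>c\<bar> * C) * exp (- \<kappa> * \<bar>x\<bar>))"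
        using cb[OF C(1)] B by (intro mult_mono) auto
      then show ?thesis by (simp add: abs_mult mult.assoc)
    qed
    ultimately have "(\<lambda>x. complex_of_real ((V x + \<kappa>\<^sup>2) * (c * ground R V \<kappa> x))) \<in> L2 UNIV"
      by (rule L2_of_exp_bound(1)[OF _ \<kappa>])
    then show ?thesis by (simp add: scaleR_conv_of_real)
  qed
  have nz: "\<not> (AE x in lebesgue. ?y x = 0)"
  proof
    assume "AE x in lebesgue. ?y x = 0"
    then have "AE x in (lebesgue :: real measure). False"
      by eventually_elim (use ground_pos[OF V \<kappa>] c in \<open>simp add: less_imp_neq[symmetric]\<close>)
    then show False by (auto simp: eventually_ae_filter_negligible top.extremum_unique)
  qed
  show "eigenfunction (S_op V \<beta>) (- \<kappa>\<^sup>2) ?y"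
    by (rule eigenfunction_of_folded(1)[OF f L1 L2' L3 nz])
  show "eigenfunction (H_op W U \<epsilon>) (- \<kappa>\<^sup>2) ?y" if "\<beta> = 0" "V = scaled_potential W U \<epsilon>"
    by (rule eigenfunction_of_folded(2)[OF f L1 L2' L3 nz that])
qed

section \<open>Expansion of the m-function for short-range scaling\<close>

lemma scaled_potential_props:
  assumes w: "potential R w" and R: "0 \<le> R" and U: "U \<in> borel_measurable lebesgue"
    and C: "\<And>t. \<bar>U t\<bar> \<le> C" and U0: "\<forall>t\<ge>R. U t = 0" and e: "0 < \<epsilon>" "\<epsilon> \<le> 1"
  shows "potential R (scaled_potential w U \<epsilon>)"
    and "\<And>x. \<epsilon> * R \<le> x \<Longrightarrow> scaled_potential w U \<epsilon> x = w x"
    and "\<And>x. \<bar>scaled_potential w U \<epsilon> x - w x\<bar> \<le> C / \<epsilon>"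
proof -
  show 1: "scaled_potential w U \<epsilon> x = w x" if "\<epsilon> * R \<le> x" for x
  proof -
    have "R \<le> inverse \<epsilon> * x" using that e by (simp add: field_simps)
    then show ?thesis using U0 by (simp add: scaled_potential_def)
  qed
  show 2: "\<bar>scaled_potential w U \<epsilon> x - w x\<bar> \<le> C / \<epsilon>" for x
    using C[of "inverse \<epsilon> * x"] e by (simp add: scaled_potential_def abs_mult divide_inverse mult.commute)
  obtain B where B: "\<And>x. \<bar>w x\<bar> \<le> B" using potential_bound[OF w] by blast
  have "(\<lambda>x. U (inverse \<epsilon> * x)) \<in> borel_measurable lebesgue"
    using borel_measurable_affine[OF U, of "inverse \<epsilon>" 0] e by simp
  then have m: "scaled_potential w U \<epsilon> \<in> borel_measurable lebesgue"
    using w unfolding scaled_potential_def[abs_def] potential_def by auto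
  have "\<bar>scaled_potential w U \<epsilon> x\<bar> \<le> B + C / \<epsilon>" for x
    using 2[of x] B[of x] by linarith
  moreover have "scaled_potential w U \<epsilon> x = 0" if "R < x" for x
  proof -
    have "\<epsilon> * R \<le> 1 * R" using e R by (intro mult_right_mono) auto
    then show ?thesis using 1[of x] that w by (auto simp: potential_def)
  qed
  ultimately show "potential R (scaled_potential w U \<epsilon>)"
    using m unfolding potential_def by blast
qed

text \<open>The well has width \<open>\<epsilon> * R\<close> and depth at most \<open>C / \<epsilon>\<close>, so depth times squared width is at most
  \<open>C * R\<^sup>2 * \<epsilon>\<close>.\<close>

lemma scaled_oscillation_free:
  assumes w: "potential R w" "\<And>x. 0 \<le> w x" and R: "0 \<le> R" and U: "U \<in> borel_measurable lebesgue"
    and C: "\<And>t. \<bar>U t\<bar> \<le> C" and U0: "\<forall>t\<ge>R. U t = 0" and e: "0 < \<epsilon>" "\<epsilon> \<le> 1"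
    and small: "C * R\<^sup>2 * \<epsilon> < 1"
  shows "oscillation_free R (scaled_potential w U \<epsilon>)"
proof -
  note S = scaled_potential_props[OF w(1) R U C U0 e]
  have C0: "0 \<le> C" using C[of 0] by linarith
  have \<delta>: "0 \<le> \<epsilon> * R" "\<epsilon> * R \<le> R" using e R by (auto simp: mult_left_le_one_le)
  have "0 < jost_u R (scaled_potential w U \<epsilon>) \<kappa> x" if "0 < \<kappa>" "0 \<le> x" for \<kappa> x
  proof (rule jost_positive[OF S(1) \<delta> that(1) _ _ _ _ that(2), of "C / \<epsilon>"])
    show "0 \<le> scaled_potential w U \<epsilon> x" if "\<epsilon> * R \<le> x" for x using S(2)[OF that] w(2) by simp
    show "- (C / \<epsilon>) \<le> scaled_potential w U \<epsilon> x" for x using S(3)[of x] w(2)[of x] by linarith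
    show "C / \<epsilon> * (\<epsilon> * R)\<^sup>2 < 1" using small e by (simp add: power2_eq_square mult_ac)
  qed (use C0 e in auto)
  then show ?thesis using S(1) R by (simp add: oscillation_free_def)
qed

text \<open>Beyond \<open>\<epsilon> * R\<close> the two potentials coincide, and both solutions start from the same data at \<open>R\<close>.\<close>

lemma jost_scaled_outer:
  assumes w: "potential R w" and R: "0 \<le> R" and U: "U \<in> borel_measurable lebesgue"
    and C: "\<And>t. \<bar>U t\<bar> \<le> C" and U0: "\<forall>t\<ge>R. U t = 0" and e: "0 < \<epsilon>" "\<epsilon> \<le> 1"
    and x: "\<epsilon> * R \<le> x"
  shows "jost_u R (scaled_potential w U \<epsilon>) \<kappa> x = jost_u R w \<kappa> x"
    "jost_v R (scaled_potential w U \<epsilon>) \<kappa> x = jost_v R w \<kappa> x"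
proof -
  let ?V = "scaled_potential w U \<epsilon>"
  note S = scaled_potential_props[OF w R U C U0 e]
  note J = jost_props[OF S(1) R, where \<kappa> = \<kappa>] and K = jost_props[OF w R, where \<kappa> = \<kappa>]
  have \<delta>: "0 \<le> \<epsilon> * R" "\<epsilon> * R \<le> R" using e R by (auto simp: mult_left_le_one_le)
  have sub: "{\<epsilon> * R..R} \<subseteq> {0..}" using \<delta> by auto
  have V: "primitive_on {\<epsilon> * R..R} (jost_v R ?V \<kappa>) (\<lambda>x. (w x + \<kappa>\<^sup>2) * jost_u R ?V \<kappa> x)"
    by (rule primitive_on_cong[OF primitive_on_subset[OF J(2) sub]])
      (use S(2) in \<open>auto simp: is_interval_cc\<close>)
  have "jost_u R ?V \<kappa> x = jost_u R w \<kappa> x \<and> jost_v R ?V \<kappa> x = jost_v R w \<kappa> x"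
  proof (cases "x \<le> R")
    case True
    then show ?thesis
      using solution_unique_backward[OF w primitive_on_subset[OF J(1) sub] V
          primitive_on_subset[OF K(1) sub] primitive_on_subset[OF K(2) sub], of x]
        J(3,4)[of R] K(3,4)[of R] x by auto
  next
    case False
    then show ?thesis using J(3,4)[of x] K(3,4)[of x] by simp
  qed
  then show "jost_u R ?V \<kappa> x = jost_u R w \<kappa> x" "jost_v R ?V \<kappa> x = jost_v R w \<kappa> x" by auto
qed

lemma jost_lower_bound:
  assumes w: "potential R w" "\<And>x. 0 \<le> w x" and R: "0 \<le> R" and \<kappa>: "0 < \<kappa>" "\<kappa> \<le> b"
    and x: "0 \<le> x" "x \<le> R"
  shows "exp (- b * R) \<le> jost_u R w \<kappa> x"
proof -
  note K = jost_props[OF w(1) R, where \<kappa> = \<kappa>]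
  have "- jost_u R w \<kappa> x \<le> - jost_u R w \<kappa> R"
    by (rule primitive_on_mono[OF primitive_on_minus[OF K(1)]])
      (use x R jost_sign_outer(2)[OF w(1) order_refl R \<kappa>(1) w(2)] in \<open>auto intro: less_imp_le\<close>)
  moreover have "exp (- b * R) \<le> exp (- \<kappa> * R)" using \<kappa> R by (auto intro: mult_right_mono)
  ultimately show ?thesis using K(3)[OF order_refl] by linarith
qed

text \<open>The logarithmic derivative turns the second-order equation into \<open>m' = m\<^sup>2 - q\<close>, in which the singular
  potential enters additively. It can therefore be removed by subtracting a primitive.\<close>

lemma riccati:
  fixes u v q :: "real \<Rightarrow> real"
  assumes u: "primitive_on {a..b} u v" and v: "primitive_on {a..b} v (\<lambda>x. q x * u x)"
    and pos: "\<And>x. x \<in> {a..b} \<Longrightarrow> 0 < u x"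
  shows "primitive_on {a..b} (\<lambda>x. - v x / u x) (\<lambda>x. (v x / u x)\<^sup>2 - q x)"
proof -
  have c: "continuous_on {a..b} u" "continuous_on {a..b} v"
    using primitive_on_continuous_cbox u v by auto
  have nz: "u x \<noteq> 0" if "x \<in> {a..b}" for x using pos[OF that] by simp
  have fc: "continuous_on {a..b} (\<lambda>x. v x / (u x * u x))"
    by (intro continuous_intros c) (use nz in auto)
  have "primitive_on {a..b} (\<lambda>x. - 1 / u x) (\<lambda>x. v x / (u x * u x))"
  proof (rule primitive_on_of_deriv[OF _ fc])
    fix x assume x: "x \<in> {a..b}"
    have "(u has_real_derivative v x) (at x within {a..b})"
      using primitive_on_deriv[OF u c(2) x] by (simp add: has_real_derivative_iff_has_vector_derivative)
    then have "((\<lambda>x. - 1 / u x) has_real_derivative v x / (u x * u x)) (at x within {a..b})"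
      using nz[OF x] by (auto intro!: derivative_eq_intros simp: field_simps)
    then show "((\<lambda>x. - 1 / u x) has_vector_derivative v x / (u x * u x)) (at x within {a..b})"
      by (simp add: has_real_derivative_iff_has_vector_derivative)
  qed (simp add: is_interval_cc)
  from primitive_on_mult[OF this v fc] show ?thesis
    by (rule primitive_on_cong) (use nz in \<open>auto simp: field_simps power2_eq_square is_interval_cc\<close>)
qed

text \<open>The primitive of \<open>- U\<close> that vanishes at \<open>R\<close>. Its integral over \<open>[0, R]\<close> is the first moment of \<open>U\<close>, and the
  integral of its square enters the quadratic form with kernel \<open>\<bar>t - \<tau>\<bar>\<close>.\<close>

definition tail_mass :: "real \<Rightarrow> (real \<Rightarrow> real) \<Rightarrow> real \<Rightarrow> real" where
  "tail_mass R U t = integral {t..R} U"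

definition mass :: "real \<Rightarrow> (real \<Rightarrow> real) \<Rightarrow> real" where
  "mass R U = tail_mass R U 0"

definition moment :: "real \<Rightarrow> (real \<Rightarrow> real) \<Rightarrow> real" where
  "moment R U = integral {0..R} (tail_mass R U)"

definition tail_energy :: "real \<Rightarrow> (real \<Rightarrow> real) \<Rightarrow> real" where
  "tail_energy R U = integral {0..R} (\<lambda>t. (tail_mass R U t)\<^sup>2)"

lemma tail_mass_primitive:
  assumes "U absolutely_integrable_on {0..R}"
  shows "primitive_on {0..R} (tail_mass R U) (\<lambda>t. - U t)"
proof -
  have "primitive_on {0..R} (\<lambda>t. integral {0..R} U - integral {0..t} U) (\<lambda>t. 0 - U t)"
    by (intro primitive_on_diff primitive_on_const primitive_on_integral assms)
  then show ?thesis
  proof (rule primitive_on_cong)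
    show "integral {0..R} U - integral {0..t} U = tail_mass R U t" if "t \<in> {0..R}" for t
      using Henstock_Kurzweil_Integration.integral_combine[of 0 t R U] that
        set_lebesgue_integral_eq_integral(1)[OF assms] by (simp add: tail_mass_def)
  qed (auto simp: is_interval_cc)
qed

lemma bounded_measurable_integrable:
  assumes U: "U \<in> borel_measurable lebesgue" and C: "\<And>t::real. \<bar>U t\<bar> \<le> (C::real)"
  shows "U absolutely_integrable_on {a..b}"
proof (rule measurable_bounded_by_integrable_imp_absolutely_integrable)
  show "U \<in> borel_measurable (lebesgue_on {a..b})" using U by (rule measurable_restrict_space1)
  show "(\<lambda>x. C) integrable_on {a..b}" by (rule integrable_continuous_real[OF continuous_on_const])
qed (use C in auto)

text \<open>The difference \<open>d\<close> between the perturbed and the unperturbed logarithmic derivatives vanishes at \<open>\<epsilon> * R\<close> and satisfies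
  \<open>d' = d * (d + 2 * m) - U (x / \<epsilon>) / \<epsilon>\<close>. To leading order \<open>d\<close> is the tail mass \<open>D (x) = tail_mass R U (x / \<epsilon>)\<close>,
  of order one on an interval of length \<open>\<epsilon> * R\<close>. Inserting \<open>D\<close> for \<open>d\<close> and \<open>m 0\<close> for \<open>m\<close> on the right costs \<open>O(\<epsilon>)\<close> pointwise, so after integration
  the correction at \<open>0\<close> is \<open>- \<epsilon> * (tail_energy + 2 * m 0 * moment)\<close> up to \<open>O(\<epsilon>\<^sup>2)\<close>.

  The bounds on the Jost solution come from the same picture: the coefficient of the equation is of size \<open>1 / \<epsilon>\<close> on an
  interval of length \<open>\<epsilon> * R\<close>, so backward stability gives constants independent of \<open>\<epsilon>\<close>.\<close>

lemma half_line_expansion: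
  assumes w: "potential R w" "\<And>x. 0 \<le> w x" and R: "0 < R" and U: "U \<in> borel_measurable lebesgue"
    and C: "\<And>t. \<bar>U t\<bar> \<le> C" and U0: "\<forall>t\<ge>R. U t = 0" and ab: "0 < a" "a \<le> b"
  obtains E \<epsilon>0 where "0 < \<epsilon>0" "\<epsilon>0 \<le> 1" "0 \<le> E"
    "\<And>\<epsilon>. 0 < \<epsilon> \<Longrightarrow> \<epsilon> < \<epsilon>0 \<Longrightarrow> oscillation_free R (scaled_potential w U \<epsilon>)"
    "\<And>\<epsilon> \<kappa>. 0 < \<epsilon> \<Longrightarrow> \<epsilon> < \<epsilon>0 \<Longrightarrow> \<kappa> \<in> {a..b} \<Longrightarrow>
      \<bar>mfun R (scaled_potential w U \<epsilon>) \<kappa> - mfun R w \<kappa> - mass R U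
        + \<epsilon> * (tail_energy R U + 2 * mfun R w \<kappa> * moment R U)\<bar> \<le> E * \<epsilon>\<^sup>2"
    "\<And>\<epsilon> \<kappa> x. 0 < \<epsilon> \<Longrightarrow> \<epsilon> < \<epsilon>0 \<Longrightarrow> \<kappa> \<in> {a..b} \<Longrightarrow> 0 \<le> x \<Longrightarrow> x \<le> \<epsilon> * R \<Longrightarrow>
      \<bar>jost_u R (scaled_potential w U \<epsilon>) \<kappa> x\<bar> \<le> E"
    "\<And>\<epsilon> \<kappa>. 0 < \<epsilon> \<Longrightarrow> \<epsilon> < \<epsilon>0 \<Longrightarrow> \<kappa> \<in> {a..b} \<Longrightarrow>
      \<bar>jost_u R (scaled_potential w U \<epsilon>) \<kappa> 0 - jost_u R w \<kappa> 0\<bar> \<le> E * \<epsilon>"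
    "\<And>\<epsilon> \<kappa>. 0 < \<epsilon> \<Longrightarrow> \<epsilon> < \<epsilon>0 \<Longrightarrow> \<kappa> \<in> {a..b} \<Longrightarrow>
      exp (- b * R) / 2 \<le> jost_u R (scaled_potential w U \<epsilon>) \<kappa> 0"
proof -
  have R0: "0 \<le> R" using R by simp
  obtain Q where Q: "0 \<le> Q" "\<And>x. \<bar>w x\<bar> \<le> Q" using potential_bound[OF w(1)] by blast
  obtain C0 where C0: "0 < C0"
    "\<And>\<kappa> x. \<kappa> \<in> {a..b} \<Longrightarrow> 0 \<le> x \<Longrightarrow> \<bar>jost_u R w \<kappa> x\<bar> \<le> C0 * exp (- a * x)"
    "\<And>\<kappa> x. \<kappa> \<in> {a..b} \<Longrightarrow> 0 \<le> x \<Longrightarrow> \<bar>jost_v R w \<kappa> x\<bar> \<le> C0 * exp (- a * x)"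
    using jost_bounds[OF w(1) R0 ab] by metis
  have Cn: "0 \<le> C" using C[of 0] by linarith
  have le1: "C0 * exp (- a * x) \<le> C0" if "0 \<le> x" for x
    using that ab C0(1) by (simp add: mult_left_le)
  define l where "l = exp (- b * R)"
  have l: "0 < l" by (simp add: l_def)
  \<comment> \<open>Length of the inner interval times the size of the coefficient there, so \<open>S\<close> bounds the solution for all small \<open>\<epsilon>\<close>.\<close>
  define K where "K = R * (C + Q + b\<^sup>2)"
  define S where "S = 2 * C0 * exp (R + K)"
  have S: "0 < S" using C0 by (simp add: S_def)
  define \<epsilon>0 where "\<epsilon>0 = min 1 (min (1 / (C * R\<^sup>2 + 1)) (l / (2 * R * S)))"
  have CR: "0 < C * R\<^sup>2 + 1" using Cn by (simp add: add_nonneg_pos)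
  have \<epsilon>0: "0 < \<epsilon>0" "\<epsilon>0 \<le> 1" using l R S CR by (auto simp: \<epsilon>0_def)
  define Bm where "Bm = C0 / l"
  define Be where "Be = 2 * S / l"
  define Bd where "Bd = Be + Bm"
  have Bpos: "0 \<le> Bm" "0 \<le> Be" "0 \<le> Bd" using C0 l S by (auto simp: Bm_def Be_def Bd_def)
  define E1 where "E1 = Bd * (Bd + 2 * Bm) * R"
  define E2 where "E2 = (Bm\<^sup>2 + Q + b\<^sup>2) * R"
  define B0 where "B0 = C * R"
  define E3 where "E3 = E1 * (Bd + B0 + 2 * Bm) + 2 * B0 * E2"
  have Epos: "0 \<le> E1" "0 \<le> E2" "0 \<le> B0" using Bpos Q R Cn by (auto simp: E1_def E2_def B0_def)
  then have E3: "0 \<le> E3" using Bpos by (simp add: E3_def)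
  define E where "E = R * E3 + S + R * (S + C0)"
  have E: "0 \<le> E" "R * E3 \<le> E" "S \<le> E" "R * (S + C0) \<le> E"
    using E3 S R C0 by (auto simp: E_def)
  have sm: "C * R\<^sup>2 * \<epsilon> < 1 \<and> \<epsilon> * R * S \<le> l / 2 \<and> \<epsilon> \<le> 1" if "0 < \<epsilon>" "\<epsilon> < \<epsilon>0" for \<epsilon>
  proof -
    have 1: "\<epsilon> < 1 / (C * R\<^sup>2 + 1)" "\<epsilon> < l / (2 * R * S)" "\<epsilon> \<le> 1" using that by (auto simp: \<epsilon>0_def)
    have "\<epsilon> * (C * R\<^sup>2 + 1) < 1" using 1(1) CR by (simp add: pos_less_divide_eq)
    then have "C * R\<^sup>2 * \<epsilon> < 1" using that by (simp add: algebra_simps)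
    moreover have "\<epsilon> * (2 * R * S) < l" using 1(2) R S by (simp add: pos_less_divide_eq)
    ultimately show ?thesis using 1(3) by (simp add: algebra_simps)
  qed
  have osc: "oscillation_free R (scaled_potential w U \<epsilon>)" if "0 < \<epsilon>" "\<epsilon> < \<epsilon>0" for \<epsilon>
    using scaled_oscillation_free[OF w R0 U C U0 that(1)] sm[OF that] by blast
  have inner: "\<bar>jost_u R (scaled_potential w U \<epsilon>) \<kappa> x\<bar> \<le> S \<and> \<bar>jost_v R (scaled_potential w U \<epsilon>) \<kappa> x\<bar> \<le> S
      \<and> \<bar>jost_u R (scaled_potential w U \<epsilon>) \<kappa> x - jost_u R w \<kappa> (\<epsilon> * R)\<bar> \<le> S * (\<epsilon> * R)
      \<and> l / 2 \<le> jost_u R (scaled_potential w U \<epsilon>) \<kappa> x"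
    if e: "0 < \<epsilon>" "\<epsilon> < \<epsilon>0" and \<kappa>: "\<kappa> \<in> {a..b}" and x: "x \<in> {0..\<epsilon> * R}" for \<epsilon> \<kappa> x
  proof -
    let ?V = "scaled_potential w U \<epsilon>"
    let ?u = "jost_u R ?V \<kappa>" and ?v = "jost_v R ?V \<kappa>"
    define \<delta> where "\<delta> = \<epsilon> * R"
    have e1: "\<epsilon> \<le> 1" using sm[OF e] by simp
    note P = scaled_potential_props[OF w(1) R0 U C U0 e(1) e1]
    note J = jost_props[OF P(1) R0, where \<kappa> = \<kappa>]
    note out = jost_scaled_outer[OF w(1) R0 U C U0 e(1) e1, where \<kappa> = \<kappa>]
    have \<delta>: "0 \<le> \<delta>" "\<delta> \<le> R" using e e1 R by (auto simp: \<delta>_def mult_left_le_one_le)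
    have sub: "{0..\<delta>} \<subseteq> {0..}" by auto
    define Q' where "Q' = C / \<epsilon> + Q + b\<^sup>2"
    have Q': "0 \<le> Q'" using Cn e Q by (simp add: Q'_def)
    have q: "\<bar>?V z + \<kappa>\<^sup>2\<bar> \<le> Q'" for z
    proof -
      have "\<kappa>\<^sup>2 \<le> b\<^sup>2" using \<kappa> ab by (intro power_mono) auto
      then show ?thesis using P(3)[of z] Q(2)[of z] zero_le_power2[of \<kappa>] unfolding Q'_def by linarith
    qed
    have bnd: "\<bar>?u z\<bar> + \<bar>?v z\<bar> \<le> S" if z: "z \<in> {0..\<delta>}" for z
    proof -
      have "\<bar>?u z\<bar> + \<bar>?v z\<bar> \<le> (\<bar>?u \<delta>\<bar> + \<bar>?v \<delta>\<bar> + 0 * (\<delta> - 0)) * exp ((1 + Q') * (\<delta> - z))"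
        by (rule backward_stability[OF primitive_on_subset[OF J(1) sub] primitive_on_subset[OF J(2) sub] _ Q'])
          (use q z in \<open>auto simp: abs_mult intro: mult_right_mono\<close>)
      also have "\<dots> \<le> (2 * C0) * exp (R + K)"
      proof (rule mult_mono)
        have "\<bar>jost_u R w \<kappa> \<delta>\<bar> \<le> C0" "\<bar>jost_v R w \<kappa> \<delta>\<bar> \<le> C0"
          using C0(2,3)[OF \<kappa> \<delta>(1)] le1[OF \<delta>(1)] by linarith+
        then show "\<bar>?u \<delta>\<bar> + \<bar>?v \<delta>\<bar> + 0 * (\<delta> - 0) \<le> 2 * C0" using out[of \<delta>] by (simp add: \<delta>_def)
        have "(1 + Q') * (\<delta> - z) \<le> (1 + Q') * \<delta>" using z Q' by (intro mult_left_mono) auto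
        also have "\<dots> = \<delta> + C * R + (Q + b\<^sup>2) * \<delta>" using e by (simp add: Q'_def \<delta>_def field_simps)
        also have "\<dots> \<le> R + C * R + (Q + b\<^sup>2) * R" using \<delta> Q Cn by (intro add_mono mult_left_mono order_refl) auto
        also have "\<dots> = R + K" by (simp add: K_def algebra_simps)
        finally show "exp ((1 + Q') * (\<delta> - z)) \<le> exp (R + K)" by simp
      qed (use C0 in auto)
      finally show ?thesis by (simp add: S_def)
    qed
    have x': "x \<in> {0..\<delta>}" using x by (simp add: \<delta>_def)
    have "norm (?u \<delta> - ?u x) \<le> S * (\<delta> - x)"
    proof (rule primitive_on_norm_bound[OF J(1)])
      fix z assume "z \<in> {x..\<delta>}"
      then have "z \<in> {0..\<delta>}" using x' by auto
      from bnd[OF this] show "norm (?v z) \<le> S" by auto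
    qed (use x' in auto)
    also have "\<dots> \<le> S * \<delta>" using x' S by (intro mult_left_mono) auto
    finally have d: "\<bar>?u \<delta> - ?u x\<bar> \<le> S * \<delta>" by simp
    have d2: "S * \<delta> \<le> l / 2" using sm[OF e] by (simp add: \<delta>_def mult.commute)
    have "?u \<delta> = jost_u R w \<kappa> \<delta>" using out[of \<delta>] by (simp add: \<delta>_def)
    moreover have "l \<le> jost_u R w \<kappa> \<delta>"
      unfolding l_def by (rule jost_lower_bound[OF w R0 _ _ \<delta>]) (use \<kappa> ab in auto)
    ultimately show ?thesis using d d2 bnd[OF x'] unfolding \<delta>_def by linarith
  qed
  have main: "\<bar>mfun R (scaled_potential w U \<epsilon>) \<kappa> - mfun R w \<kappa> - mass R U
        + \<epsilon> * (tail_energy R U + 2 * mfun R w \<kappa> * moment R U)\<bar> \<le> (R * E3) * \<epsilon>\<^sup>2"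
    if e: "0 < \<epsilon>" "\<epsilon> < \<epsilon>0" and \<kappa>: "\<kappa> \<in> {a..b}" for \<epsilon> \<kappa>
  proof -
    let ?V = "scaled_potential w U \<epsilon>"
    let ?u = "jost_u R ?V \<kappa>" and ?v = "jost_v R ?V \<kappa>"
    let ?U = "jost_u R w \<kappa>" and ?W = "jost_v R w \<kappa>"
    define \<delta> where "\<delta> = \<epsilon> * R"
    have e1: "\<epsilon> \<le> 1" using sm[OF e] by simp
    note P = scaled_potential_props[OF w(1) R0 U C U0 e(1) e1]
    note J = jost_props[OF P(1) R0, where \<kappa> = \<kappa>] and JW = jost_props[OF w(1) R0, where \<kappa> = \<kappa>]
    note out = jost_scaled_outer[OF w(1) R0 U C U0 e(1) e1, where \<kappa> = \<kappa>]
    have \<delta>: "0 \<le> \<delta>" "\<delta> \<le> R" using e e1 R by (auto simp: \<delta>_def mult_left_le_one_le)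
    have sub: "{0..\<delta>} \<subseteq> {0..}" by auto
    have in\<delta>: "z \<in> {0..\<epsilon> * R}" if "z \<in> {0..\<delta>}" for z using that by (simp add: \<delta>_def)
    have lw: "l \<le> ?U z" if "z \<in> {0..\<delta>}" for z
      unfolding l_def by (rule jost_lower_bound[OF w R0]) (use \<kappa> ab that \<delta> in auto)
    define m\<^sub>\<epsilon> where "m\<^sub>\<epsilon> = (\<lambda>x. - ?v x / ?u x)"
    define m where "m = (\<lambda>x. - ?W x / ?U x)"
    have me: "primitive_on {0..\<delta>} m\<^sub>\<epsilon> (\<lambda>x. (?v x / ?u x)\<^sup>2 - (?V x + \<kappa>\<^sup>2))"
      unfolding m\<^sub>\<epsilon>_def
      by (rule riccati[OF primitive_on_subset[OF J(1) sub] primitive_on_subset[OF J(2) sub]])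
        (use inner[OF e \<kappa> in\<delta>] l in force)
    have mw: "primitive_on {0..\<delta>} m (\<lambda>x. (?W x / ?U x)\<^sup>2 - (w x + \<kappa>\<^sup>2))"
      unfolding m_def
      by (rule riccati[OF primitive_on_subset[OF JW(1) sub] primitive_on_subset[OF JW(2) sub]])
        (use lw l in force)
    have mb: "\<bar>m z\<bar> \<le> Bm" if z: "z \<in> {0..\<delta>}" for z
    proof -
      have "\<bar>?W z\<bar> \<le> C0" using C0(3)[OF \<kappa>, of z] le1[of z] z by auto
      then have "\<bar>?W z\<bar> / ?U z \<le> C0 / l" using lw[OF z] l C0 by (intro frac_le) auto
      then show ?thesis using lw[OF z] l by (simp add: m_def Bm_def)
    qed
    have meb: "\<bar>m\<^sub>\<epsilon> z\<bar> \<le> Be" if z: "z \<in> {0..\<delta>}" for z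
    proof -
      note i = inner[OF e \<kappa> in\<delta>[OF z]]
      have "\<bar>?v z\<bar> / ?u z \<le> S / (l / 2)" using i l S by (intro frac_le) auto
      moreover have "0 < ?u z" using i l by linarith
      ultimately show ?thesis by (simp add: m\<^sub>\<epsilon>_def Be_def mult.commute)
    qed
    define d where "d = (\<lambda>x. m\<^sub>\<epsilon> x - m x)"
    have db: "\<bar>d z\<bar> \<le> Bd" if "z \<in> {0..\<delta>}" for z
      using mb[OF that] meb[OF that] by (simp add: d_def Bd_def)
    define D where "D = (\<lambda>x. tail_mass R U (inverse \<epsilon> * x))"
    have UI: "U absolutely_integrable_on {0..R}" by (rule bounded_measurable_integrable[OF U C])
    note T = tail_mass_primitive[OF UI]
    have tb: "\<bar>tail_mass R U t\<bar> \<le> B0" if "t \<in> {0..R}" for t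
    proof -
      have "norm (tail_mass R U R - tail_mass R U t) \<le> C * (R - t)"
        by (rule primitive_on_norm_bound[OF T]) (use that C R in auto)
      also have "\<dots> \<le> C * R" using that Cn by (intro mult_left_mono) auto
      finally show ?thesis by (simp add: tail_mass_def B0_def)
    qed
    have in_iff: "inverse \<epsilon> * x \<in> {0..R} \<longleftrightarrow> x \<in> {0..\<delta>}" for x
    proof -
      have "inverse \<epsilon> * x = x / \<epsilon>" by (simp add: divide_inverse)
      moreover have "x / \<epsilon> \<le> R \<longleftrightarrow> x \<le> R * \<epsilon>" using e(1) by (rule pos_divide_le_eq)
      moreover have "0 \<le> x / \<epsilon> \<longleftrightarrow> 0 \<le> x" using e(1) by (simp add: zero_le_divide_iff)
      ultimately show ?thesis by (simp add: \<delta>_def mult.commute[of \<epsilon>])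
    qed
    have pre: "{x. 0 + inverse \<epsilon> * x \<in> {0..R}} = {0..\<delta>}"
      unfolding add_0 in_iff by (rule Collect_mem_eq)
    have in_t: "inverse \<epsilon> * z \<in> {0..R}" if "z \<in> {0..\<delta>}" for z
      using that unfolding in_iff .
    have Dp: "primitive_on {0..\<delta>} D (\<lambda>x. inverse \<epsilon> *\<^sub>R (- U (inverse \<epsilon> * x)))"
      using primitive_on_affine[OF T, of "inverse \<epsilon>" 0] e unfolding pre D_def by simp
    \<comment> \<open>The singular terms of the two derivatives cancel, so \<open>r\<close> has a bounded derivative and is of size \<open>\<epsilon>\<close>.\<close>
  define r where "r = (\<lambda>x. d x - D x)"
    have rp: "primitive_on {0..\<delta>} r (\<lambda>x. d x * (d x + 2 * m x))"
    proof -
      have "primitive_on {0..\<delta>} r (\<lambda>x. (((?v x / ?u x)\<^sup>2 - (?V x + \<kappa>\<^sup>2)) - ((?W x / ?U x)\<^sup>2 - (w x + \<kappa>\<^sup>2)))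
          - inverse \<epsilon> *\<^sub>R (- U (inverse \<epsilon> * x)))"
        unfolding r_def d_def by (intro primitive_on_diff me mw Dp)
      then show ?thesis
        by (rule primitive_on_cong)
          (auto simp: is_interval_cc d_def m\<^sub>\<epsilon>_def m_def scaled_potential_def algebra_simps power2_eq_square)
    qed
    have ei: "\<epsilon> * (inverse \<epsilon> *\<^sub>R z) = z" for z :: real using e(1) by (simp add: field_simps)
    have iR: "inverse \<epsilon> * (\<epsilon> * R) = R" using e(1) by (simp add: field_simps)
    have "D \<delta> = 0" unfolding D_def \<delta>_def iR by (simp add: tail_mass_def)
    then have r\<delta>: "r \<delta> = 0"
      using out[of \<delta>] by (simp add: r_def d_def m\<^sub>\<epsilon>_def m_def \<delta>_def)
    have rb: "\<bar>r z\<bar> \<le> \<epsilon> * E1" if z: "z \<in> {0..\<delta>}" for z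
    proof -
      have "norm (r \<delta> - r z) \<le> (Bd * (Bd + 2 * Bm)) * (\<delta> - z)"
      proof (rule primitive_on_norm_bound[OF rp])
        fix y assume "y \<in> {z..\<delta>}"
        then have y: "y \<in> {0..\<delta>}" using z by auto
        have "\<bar>d y + 2 * m y\<bar> \<le> Bd + 2 * Bm" using db[OF y] mb[OF y] by linarith
        then show "norm (d y * (d y + 2 * m y)) \<le> Bd * (Bd + 2 * Bm)"
          using db[OF y] Bpos unfolding real_norm_def abs_mult by (intro mult_mono) auto
      qed (use z in auto)
      also have "\<dots> \<le> (Bd * (Bd + 2 * Bm)) * \<delta>" using z Bpos by (intro mult_left_mono) auto
      finally show ?thesis using r\<delta> by (simp add: E1_def \<delta>_def mult_ac)
    qed
    have ml: "\<bar>m z - m 0\<bar> \<le> \<epsilon> * E2" if z: "z \<in> {0..\<delta>}" for z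
    proof -
      have "norm (m z - m 0) \<le> (Bm\<^sup>2 + Q + b\<^sup>2) * (z - 0)"
      proof (rule primitive_on_norm_bound[OF mw])
        fix y assume "y \<in> {0..z}"
        then have y: "y \<in> {0..\<delta>}" using z by auto
        have "(?W y / ?U y)\<^sup>2 = (m y)\<^sup>2" by (simp add: m_def)
        moreover have "(m y)\<^sup>2 \<le> Bm\<^sup>2"
          using power_mono[OF mb[OF y], of 2] by simp
        moreover have "\<kappa>\<^sup>2 \<le> b\<^sup>2" using \<kappa> ab by (intro power_mono) auto
        ultimately show "norm ((?W y / ?U y)\<^sup>2 - (w y + \<kappa>\<^sup>2)) \<le> Bm\<^sup>2 + Q + b\<^sup>2"
          using Q(2)[of y] w(2)[of y] zero_le_power2[of "m y"] zero_le_power2[of \<kappa>]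
            zero_le_power2[of Bm] zero_le_power2[of b]
          unfolding real_norm_def by linarith
      qed (use z \<delta> in auto)
      also have "\<dots> \<le> (Bm\<^sup>2 + Q + b\<^sup>2) * \<delta>" using z Q by (intro mult_left_mono) auto
      finally show ?thesis by (simp add: E2_def \<delta>_def mult_ac)
    qed
    define g where "g = (\<lambda>t. (tail_mass R U t)\<^sup>2 + 2 * m 0 * tail_mass R U t)"
    have gc: "continuous_on {0..R} g"
      unfolding g_def by (intro continuous_intros primitive_on_continuous_cbox[OF T])
    define G where "G = (\<lambda>t. integral {0..t} g)"
    have Gp: "primitive_on {0..R} G g"
      unfolding G_def by (intro primitive_on_integral absolutely_integrable_continuous_real gc)
    have GRp: "primitive_on {0..\<delta>} (\<lambda>x. \<epsilon> * G (inverse \<epsilon> * x)) (\<lambda>x. \<epsilon> * (inverse \<epsilon> *\<^sub>R g (inverse \<epsilon> * x)))"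
      using primitive_on_cmult[OF primitive_on_affine[OF Gp, of "inverse \<epsilon>" 0, unfolded pre], of \<epsilon>] e by simp
    have GR: "G R = tail_energy R U + 2 * m 0 * moment R U"
    proof -
      have "(tail_mass R U) integrable_on {0..R}" "(\<lambda>t. (tail_mass R U t)\<^sup>2) integrable_on {0..R}"
        by (intro integrable_continuous_real continuous_intros primitive_on_continuous_cbox[OF T])+
      from has_integral_add[OF integrable_integral[OF this(2)]
          has_integral_mult_right[OF integrable_integral[OF this(1)], of "2 * m 0"]]
      show ?thesis unfolding G_def g_def tail_energy_def moment_def by (rule integral_unique)
    qed
    have "norm ((r \<delta> - \<epsilon> * G (inverse \<epsilon> * \<delta>)) - (r 0 - \<epsilon> * G (inverse \<epsilon> * 0))) \<le> (\<epsilon> * E3) * (\<delta> - 0)"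
    proof (rule primitive_on_norm_bound[OF primitive_on_diff[OF rp GRp]])
      fix z assume z: "z \<in> {0..\<delta>}"
      let ?t = "D z"
      have Db: "\<bar>D z\<bar> \<le> B0" using tb[OF in_t[OF z]] by (simp add: D_def)
      have "d z * (d z + 2 * m z) - \<epsilon> * (inverse \<epsilon> *\<^sub>R g (inverse \<epsilon> * z))
          = r z * (d z + D z + 2 * m z) + 2 * D z * (m z - m 0)"
        unfolding ei by (simp add: g_def r_def D_def algebra_simps power2_eq_square)
      also have "\<bar>\<dots>\<bar> \<le> \<bar>r z\<bar> * \<bar>d z + D z + 2 * m z\<bar> + 2 * \<bar>D z\<bar> * \<bar>m z - m 0\<bar>"
        by (rule order_trans[OF abs_triangle_ineq]) (simp add: abs_mult)
      also have "\<dots> \<le> (\<epsilon> * E1) * (Bd + B0 + 2 * Bm) + 2 * B0 * (\<epsilon> * E2)"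
      proof (intro add_mono mult_mono rb[OF z] ml[OF z])
        show "\<bar>d z + D z + 2 * m z\<bar> \<le> Bd + B0 + 2 * Bm" using db[OF z] Db mb[OF z] by linarith
      qed (use Db Epos Bpos e in auto)
      also have "\<dots> = \<epsilon> * E3" by (simp add: E3_def algebra_simps)
      finally show "norm (d z * (d z + 2 * m z) - \<epsilon> * (inverse \<epsilon> *\<^sub>R g (inverse \<epsilon> * z))) \<le> \<epsilon> * E3"
        by simp
    qed (use \<delta> in auto)
    moreover have i\<delta>: "inverse \<epsilon> * \<delta> = R" using iR unfolding \<delta>_def .
    moreover have "G (inverse \<epsilon> * 0) = 0" by (simp add: G_def)
    ultimately have "norm ((0 - \<epsilon> * G R) - (r 0 - \<epsilon> * 0)) \<le> (\<epsilon> * E3) * (\<delta> - 0)"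
      using r\<delta> by metis
    then have "\<bar>r 0 + \<epsilon> * G R\<bar> \<le> (\<epsilon> * E3) * \<delta>" by (simp add: abs_le_iff)
    moreover have "r 0 = mfun R ?V \<kappa> - mfun R w \<kappa> - mass R U"
      by (simp add: r_def d_def m\<^sub>\<epsilon>_def m_def D_def mfun_def mass_def)
    moreover have "m 0 = mfun R w \<kappa>" by (simp add: m_def mfun_def)
    ultimately show ?thesis by (simp add: GR \<delta>_def power2_eq_square mult_ac)
  qed
  show ?thesis
  proof (rule that[OF \<epsilon>0 E(1)])
    show "oscillation_free R (scaled_potential w U \<epsilon>)" if "0 < \<epsilon>" "\<epsilon> < \<epsilon>0" for \<epsilon>
      by (rule osc[OF that])
  next
    fix \<epsilon> \<kappa> :: real assume e: "0 < \<epsilon>" "\<epsilon> < \<epsilon>0" and \<kappa>: "\<kappa> \<in> {a..b}"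
    have \<delta>: "0 \<in> {0..\<epsilon> * R}" "0 \<le> \<epsilon> * R" using e R by auto
    show "\<bar>mfun R (scaled_potential w U \<epsilon>) \<kappa> - mfun R w \<kappa> - mass R U
        + \<epsilon> * (tail_energy R U + 2 * mfun R w \<kappa> * moment R U)\<bar> \<le> E * \<epsilon>\<^sup>2"
      by (rule order_trans[OF main[OF e \<kappa>]]) (use E in \<open>auto intro: mult_right_mono\<close>)
    show "\<bar>jost_u R (scaled_potential w U \<epsilon>) \<kappa> x\<bar> \<le> E" if "0 \<le> x" "x \<le> \<epsilon> * R" for x
      using inner[OF e \<kappa>, of x] that E by auto
    show "exp (- b * R) / 2 \<le> jost_u R (scaled_potential w U \<epsilon>) \<kappa> 0"
      using inner[OF e \<kappa> \<delta>(1)] by (simp add: l_def)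
    have "norm (jost_u R w \<kappa> (\<epsilon> * R) - jost_u R w \<kappa> 0) \<le> C0 * (\<epsilon> * R - 0)"
    proof (rule primitive_on_norm_bound[OF jost_props(1)[OF w(1) R0]])
      fix z assume "z \<in> {0..\<epsilon> * R}"
      then show "norm (jost_v R w \<kappa> z) \<le> C0" using C0(3)[OF \<kappa>, of z] le1[of z] by auto
    qed (use \<delta> in auto)
    moreover have "\<bar>jost_u R (scaled_potential w U \<epsilon>) \<kappa> 0 - jost_u R w \<kappa> (\<epsilon> * R)\<bar> \<le> S * (\<epsilon> * R)"
      using inner[OF e \<kappa> \<delta>(1)] by simp
    ultimately have "\<bar>jost_u R (scaled_potential w U \<epsilon>) \<kappa> 0 - jost_u R w \<kappa> 0\<bar> \<le> (R * (S + C0)) * \<epsilon>"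
      by (simp add: algebra_simps)
    also have "\<dots> \<le> E * \<epsilon>" using E e by (intro mult_right_mono) auto
    finally show "\<bar>jost_u R (scaled_potential w U \<epsilon>) \<kappa> 0 - jost_u R w \<kappa> 0\<bar> \<le> E * \<epsilon>" .
  qed
qed

section \<open>Moments of the perturbation\<close>

text \<open>Integrate by parts on both sides of \<open>t\<close>, where the kernel is affine. The kernel vanishes at \<open>t\<close> and
  \<open>tail_mass\<close> at \<open>R\<close>, so the only boundary term comes from \<open>s = 0\<close>.\<close>

lemma abs_kernel_integral:
  assumes U: "U absolutely_integrable_on {0..R}" and t: "t \<in> {0..R}"
  shows "((\<lambda>s. \<bar>t - s\<bar> * U s) has_integral
      t * mass R U - moment R U + 2 * integral {t..R} (tail_mass R U)) {0..R}"
proof -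
  note T = tail_mass_primitive[OF U]
  have c: "continuous_on {0..R} (tail_mass R U)" by (rule primitive_on_continuous_cbox[OF T])
  have L: "primitive_on {0..R} (\<lambda>s. s - t) (\<lambda>s. 1)"
    by (rule primitive_on_of_deriv)
      (auto intro!: derivative_eq_intros simp: is_interval_cc
        simp flip: has_real_derivative_iff_has_vector_derivative)
  have P: "primitive_on {0..R} (\<lambda>s. (s - t) * tail_mass R U s) (\<lambda>s. 1 * tail_mass R U s + (s - t) * - U s)"
    by (rule primitive_on_mult[OF L T]) (rule continuous_on_const)
  have TR: "tail_mass R U R = 0" by (simp add: tail_mass_def)
  have i: "(tail_mass R U has_integral integral {x..y} (tail_mass R U)) {x..y}" if "0 \<le> x" "y \<le> R" for x y
    by (intro integrable_integral integrable_continuous_real continuous_on_subset[OF c]) (use that in auto)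
  have "((\<lambda>s. (1 * tail_mass R U s + (s - t) * - U s) - tail_mass R U s) has_integral
      ((t - t) * tail_mass R U t - (0 - t) * tail_mass R U 0) - integral {0..t} (tail_mass R U)) {0..t}"
    by (intro has_integral_diff primitive_onD(2)[OF P] i) (use t in auto)
  then have 1: "((\<lambda>s. \<bar>t - s\<bar> * U s) has_integral t * mass R U - integral {0..t} (tail_mass R U)) {0..t}"
    by (rule has_integral_eq_rhs[OF has_integral_cong[THEN iffD1, rotated]])
      (auto simp: mass_def algebra_simps)
  have "((\<lambda>s. - ((1 * tail_mass R U s + (s - t) * - U s) - tail_mass R U s)) has_integral
      - (((R - t) * tail_mass R U R - (t - t) * tail_mass R U t) - integral {t..R} (tail_mass R U))) {t..R}"
    by (intro has_integral_neg has_integral_diff primitive_onD(2)[OF P] i) (use t in auto)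
  then have 2: "((\<lambda>s. \<bar>t - s\<bar> * U s) has_integral integral {t..R} (tail_mass R U)) {t..R}"
    by (rule has_integral_eq_rhs[OF has_integral_cong[THEN iffD1, rotated]])
      (auto simp: TR algebra_simps)
  have "integral {0..t} (tail_mass R U) + integral {t..R} (tail_mass R U) = moment R U"
    unfolding moment_def using t
    by (intro Henstock_Kurzweil_Integration.integral_combine integrable_continuous_real c) auto
  moreover have "((\<lambda>s. \<bar>t - s\<bar> * U s) has_integral
      (t * mass R U - integral {0..t} (tail_mass R U)) + integral {t..R} (tail_mass R U)) {0..R}"
    by (rule has_integral_combine[OF _ _ 1 2]) (use t in auto)
  ultimately show ?thesis by (elim has_integral_eq_rhs) linarith
qed

lemma moment_has_integral:
  assumes U: "U absolutely_integrable_on {0..R}" and R: "0 \<le> R"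
  shows "((\<lambda>s. s * U s) has_integral moment R U) {0..R}"
proof -
  have "((\<lambda>s. \<bar>0 - s\<bar> * U s) has_integral moment R U) {0..R}"
    using abs_kernel_integral[OF U, of 0] R by (simp add: moment_def)
  then show ?thesis
    by (rule has_integral_cong[THEN iffD1, rotated]) auto
qed

text \<open>Integration by parts, since \<open>tail_mass\<close> and its own tail integral have derivatives \<open>- U\<close> and
  \<open>- tail_mass\<close>.\<close>

lemma tail_energy_has_integral:
  assumes U: "U absolutely_integrable_on {0..R}" and R: "0 \<le> R"
  shows "((\<lambda>t. U t * integral {t..R} (tail_mass R U)) has_integral mass R U * moment R U - tail_energy R U) {0..R}"
proof -
  note T = tail_mass_primitive[OF U]
  have c: "continuous_on {0..R} (tail_mass R U)" by (rule primitive_on_continuous_cbox[OF T])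
  have P: "primitive_on {0..R} (tail_mass R (tail_mass R U)) (\<lambda>t. - tail_mass R U t)"
    by (rule tail_mass_primitive[OF absolutely_integrable_continuous_real[OF c]])
  have "primitive_on {0..R} (\<lambda>t. tail_mass R (tail_mass R U) t * tail_mass R U t)
      (\<lambda>t. - tail_mass R U t * tail_mass R U t + tail_mass R (tail_mass R U) t * - U t)"
    by (rule primitive_on_mult[OF P T]) (intro continuous_intros c)
  from primitive_onD(2)[OF this, of 0 R] R
  have 1: "((\<lambda>t. - tail_mass R U t * tail_mass R U t + tail_mass R (tail_mass R U) t * - U t)
      has_integral - (moment R U * mass R U)) {0..R}"
    by (simp add: moment_def mass_def tail_mass_def)
  have "(\<lambda>t. (tail_mass R U t)\<^sup>2) integrable_on {0..R}"
    by (intro integrable_continuous_real continuous_intros c)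
  then have 2: "((\<lambda>t. (tail_mass R U t)\<^sup>2) has_integral tail_energy R U) {0..R}"
    unfolding tail_energy_def by (rule integrable_integral)
  have "((\<lambda>t. - ((- tail_mass R U t * tail_mass R U t + tail_mass R (tail_mass R U) t * - U t)
      + (tail_mass R U t)\<^sup>2)) has_integral - (- (moment R U * mass R U) + tail_energy R U)) {0..R}"
    by (intro has_integral_neg has_integral_add 1 2)
  then show ?thesis
    by (simp add: power2_eq_square tail_mass_def[of R "tail_mass R U"] mult.commute)
qed

lemma integral_supported_folded:
  fixes p q f :: "real \<Rightarrow> real"
  assumes p: "p absolutely_integrable_on {0..R}" "(p has_integral P) {0..R}" "\<And>x. R < x \<Longrightarrow> p x = 0"
    and q: "q absolutely_integrable_on {0..R}" "(q has_integral Q) {0..R}" "\<And>x. R < x \<Longrightarrow> q x = 0"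
    and f: "\<And>x. f x = (if 0 < x then p x else q (- x))"
  shows "(\<integral>x. f x \<partial>lebesgue) = P + Q"
proof -
  have *: "h absolutely_integrable_on {0..}" "integral {0..} h = H"
    if "h absolutely_integrable_on {0..R}" "(h has_integral H) {0..R}" "\<And>x. R < x \<Longrightarrow> h x = 0"
    for h :: "real \<Rightarrow> real" and H
  proof -
    have e: "(\<lambda>x. if x \<in> {0..R} then h x else 0) = (\<lambda>x. if x \<in> {0..} then h x else 0)"
      using that(3) by (force simp: fun_eq_iff)
    show "h absolutely_integrable_on {0..}"
      using that(1) absolutely_integrable_restrict_UNIV[of "{0..R}" h]
        absolutely_integrable_restrict_UNIV[of "{0..}" h] unfolding e by blast
    show "integral {0..} h = H"
      using that(2) has_integral_restrict_UNIV[of "{0..R}" h H] has_integral_restrict_UNIV[of "{0..}" h H]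
      unfolding e by (simp add: integral_unique)
  qed
  have "f = (\<lambda>x. if 0 < x then p x else q (- x))" using f by auto
  then show ?thesis using folded_integral(1)[OF *(1)[OF p] *(1)[OF q]] *(2)[OF p] *(2)[OF q] by auto
qed

text \<open>For \<open>t\<close> and \<open>\<tau>\<close> on opposite sides of the origin the kernel is additive, \<open>\<bar>t\<bar> + \<bar>\<tau>\<bar>\<close>, which produces mixed products of mass
  and moment; equal sides contribute the half-line integrals. The sum reassembles into total
  mass times total moment minus the two tail energies.\<close>

lemma full_line_moments:
  fixes U :: "real \<Rightarrow> real"
  assumes U: "U \<in> borel_measurable lebesgue" and C: "\<And>t. \<bar>U t\<bar> \<le> C" and R: "0 \<le> R"
    and U0: "\<And>t. R \<le> \<bar>t\<bar> \<Longrightarrow> U t = 0"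
  defines "V \<equiv> \<lambda>t. U (- t)"
  shows "(\<integral>t. U t \<partial>lebesgue) = mass R U + mass R V"
    and "(\<integral>t. t * U t \<partial>lebesgue) = moment R U - moment R V"
    and "(\<integral>t. (\<integral>s. U t * \<bar>t - s\<bar> * U s \<partial>lebesgue) \<partial>lebesgue)
      = 2 * ((mass R U + mass R V) * (moment R U + moment R V) - tail_energy R U - tail_energy R V)"
proof -
  have Vm: "V \<in> borel_measurable lebesgue"
    unfolding V_def using borel_measurable_affine[OF U, of "-1" 0] by simp
  have VC: "\<bar>V t\<bar> \<le> C" for t using C by (simp add: V_def)
  have UR: "U x = 0" and VR: "V x = 0" if "R < x" for x
    using U0[of x] U0[of "- x"] that R by (auto simp: V_def)
  have UI: "U absolutely_integrable_on {a..b}" and VI: "V absolutely_integrable_on {a..b}" for a b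
    by (rule bounded_measurable_integrable[OF U C], rule bounded_measurable_integrable[OF Vm VC])
  have cU: "(\<lambda>t. h t * X t) absolutely_integrable_on {0..R}"
    if "continuous_on {0..R} h" "X absolutely_integrable_on {0..R}" for h X :: "real \<Rightarrow> real"
    using absolutely_integrable_continuous_scaleR[OF that] by simp
  have mass_I: "(X has_integral mass R X) {0..R}" if "X absolutely_integrable_on {0..R}" for X
    unfolding mass_def tail_mass_def
    by (rule integrable_integral) (use that in \<open>rule set_lebesgue_integral_eq_integral(1)\<close>)
  show "(\<integral>t. U t \<partial>lebesgue) = mass R U + mass R V"
    by (rule integral_supported_folded[OF UI mass_I[OF UI] UR VI mass_I[OF VI] VR]) (auto simp: V_def)
  have "(\<integral>t. t * U t \<partial>lebesgue) = moment R U + - moment R V"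
  proof (rule integral_supported_folded)
    show "(\<lambda>t. t * U t) absolutely_integrable_on {0..R}" by (intro cU UI continuous_intros)
    show "((\<lambda>t. t * U t) has_integral moment R U) {0..R}" by (rule moment_has_integral[OF UI R])
    have "(\<lambda>t. - t * V t) absolutely_integrable_on {0..R}" by (intro cU VI continuous_intros)
    then show "(\<lambda>t. - (t * V t)) absolutely_integrable_on {0..R}" by simp
    show "((\<lambda>t. - (t * V t)) has_integral - moment R V) {0..R}"
      by (intro has_integral_neg moment_has_integral[OF VI R])
  qed (use UR VR in \<open>auto simp: V_def\<close>)
  then show "(\<integral>t. t * U t \<partial>lebesgue) = moment R U - moment R V" by simp
  define H where "H = (\<lambda>X Y t. (t * mass R X - moment R X + 2 * integral {t..R} (tail_mass R X)) + (t * mass R Y + moment R Y))"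
  have inner: "(\<integral>s. \<bar>t - s\<bar> * X s \<partial>lebesgue) = H X Y t"
    if t: "t \<in> {0..R}" and XY: "\<And>s. Y s = X (- s)"
      and X: "X absolutely_integrable_on {0..R}" "\<And>x. R < x \<Longrightarrow> X x = 0"
      and Y: "Y absolutely_integrable_on {0..R}" "\<And>x. R < x \<Longrightarrow> Y x = 0" for t X Y
    unfolding H_def
  proof (rule integral_supported_folded)
    show "(\<lambda>s. \<bar>t - s\<bar> * X s) absolutely_integrable_on {0..R}" by (intro cU X continuous_intros)
    show "((\<lambda>s. \<bar>t - s\<bar> * X s) has_integral t * mass R X - moment R X + 2 * integral {t..R} (tail_mass R X)) {0..R}"
      by (rule abs_kernel_integral[OF X(1) t])
    have "(\<lambda>s. (t + s) * Y s) absolutely_integrable_on {0..R}" by (intro cU Y continuous_intros)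
    then show "(\<lambda>s. t * Y s + s * Y s) absolutely_integrable_on {0..R}" by (simp add: algebra_simps)
    show "((\<lambda>s. t * Y s + s * Y s) has_integral t * mass R Y + moment R Y) {0..R}"
      by (intro has_integral_add has_integral_mult_right mass_I Y moment_has_integral R)
    show "\<bar>t - s\<bar> * X s = (if 0 < s then \<bar>t - s\<bar> * X s else t * Y (- s) + - s * Y (- s))" for s
      using t by (auto simp: XY algebra_simps)
  qed (use X Y in auto)
  have "(\<integral>s. U t * \<bar>t - s\<bar> * U s \<partial>lebesgue) = (if 0 < t then U t * H U V t else V (- t) * H V U (- t))" for t
  proof -
    have "(\<integral>s. U t * \<bar>t - s\<bar> * U s \<partial>lebesgue) = U t * (\<integral>s. \<bar>t - s\<bar> * U s \<partial>lebesgue)"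
      by (simp add: mult.assoc)
    also have "\<dots> = (if 0 < t then U t * H U V t else V (- t) * H V U (- t))"
    proof (cases "R \<le> \<bar>t\<bar>")
      case True
      then show ?thesis using U0[of t] by (simp add: V_def)
    next
      case False
      show ?thesis
      proof (cases "0 < t")
        case True
        then show ?thesis using inner[of t V U] False UI VI UR VR by (simp add: V_def)
      next
        case neg: False
        have "(\<integral>s. \<bar>t - s\<bar> * U s \<partial>lebesgue) = (\<integral>s. \<bar>t - (0 + (-1) * s)\<bar> * U (0 + (-1) * s) \<partial>lebesgue)"
          using lebesgue_integral_real_affine[of "-1" "\<lambda>s. \<bar>t - s\<bar> * U s" 0] by simp
        also have "\<dots> = (\<integral>s. \<bar>- t - s\<bar> * V s \<partial>lebesgue)"
          by (rule Bochner_Integration.integral_cong) (auto simp: V_def abs_minus_commute abs_if)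
        also have "\<dots> = H V U (- t)"
          using inner[of "- t" U V] neg False UI VI UR VR by (simp add: V_def)
        finally show ?thesis using neg by (simp add: V_def)
      qed
    qed
    finally show ?thesis .
  qed
  moreover have "(\<integral>t. (if 0 < t then U t * H U V t else V (- t) * H V U (- t)) \<partial>lebesgue)
      = (moment R U * mass R U - moment R U * mass R U + 2 * (mass R U * moment R U - tail_energy R U)
          + (moment R U * mass R V + moment R V * mass R U))
        + (moment R V * mass R V - moment R V * mass R V + 2 * (mass R V * moment R V - tail_energy R V)
          + (moment R V * mass R U + moment R U * mass R V))"
  proof (rule integral_supported_folded)
    have ai: "(\<lambda>t. X t * H X Y t) absolutely_integrable_on {0..R}"
      if X: "X absolutely_integrable_on {0..R}" for X Y
    proof -
      have c: "continuous_on {0..R} (tail_mass R X)"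
        by (rule primitive_on_continuous_cbox[OF tail_mass_primitive[OF X]])
      have "continuous_on {0..R} (tail_mass R (tail_mass R X))"
        by (rule primitive_on_continuous_cbox[OF tail_mass_primitive[OF absolutely_integrable_continuous_real[OF c]]])
      then have "continuous_on {0..R} (H X Y)"
        unfolding H_def tail_mass_def[of R "tail_mass R X", symmetric] by (intro continuous_intros)
      from cU[OF this X] show ?thesis by (simp add: mult.commute)
    qed
    have hi: "((\<lambda>t. X t * H X Y t) has_integral
        moment R X * mass R X - moment R X * mass R X + 2 * (mass R X * moment R X - tail_energy R X)
          + (moment R X * mass R Y + moment R Y * mass R X)) {0..R}"
      if X: "X absolutely_integrable_on {0..R}" for X Y
    proof -
      have "((\<lambda>t. mass R X * (t * X t) - moment R X * X t + 2 * (X t * integral {t..R} (tail_mass R X))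
          + (mass R Y * (t * X t) + moment R Y * X t)) has_integral
        mass R X * moment R X - moment R X * mass R X + 2 * (mass R X * moment R X - tail_energy R X)
          + (mass R Y * moment R X + moment R Y * mass R X)) {0..R}"
        by (intro has_integral_add has_integral_diff has_integral_mult_right
            moment_has_integral[OF X R] mass_I[OF X] tail_energy_has_integral[OF X R])
      then show ?thesis by (simp add: H_def algebra_simps)
    qed
    show "(\<lambda>t. U t * H U V t) absolutely_integrable_on {0..R}" "(\<lambda>t. V t * H V U t) absolutely_integrable_on {0..R}"
      by (intro ai UI VI)+
    show "((\<lambda>t. U t * H U V t) has_integral moment R U * mass R U - moment R U * mass R U
        + 2 * (mass R U * moment R U - tail_energy R U) + (moment R U * mass R V + moment R V * mass R U)) {0..R}"
      by (rule hi[OF UI])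
    show "((\<lambda>t. V t * H V U t) has_integral moment R V * mass R V - moment R V * mass R V
        + 2 * (mass R V * moment R V - tail_energy R V) + (moment R V * mass R U + moment R U * mass R V)) {0..R}"
      by (rule hi[OF VI])
  qed (use UR VR in auto)
  ultimately show "(\<integral>t. (\<integral>s. U t * \<bar>t - s\<bar> * U s \<partial>lebesgue) \<partial>lebesgue)
      = 2 * ((mass R U + mass R V) * (moment R U + moment R V) - tail_energy R U - tail_energy R V)"
    by (simp add: algebra_simps)
qed

section \<open>Perturbation of the root\<close>

text \<open>The difference quotient of the m-function with respect to \<open>\<kappa>\<^sup>2\<close>. On the diagonal it is the squared norm of one half of \<open>ground\<close>,
  which is how the normalization of the eigenfunction enters the asymptotics.\<close>

definition normalized_overlap :: "real \<Rightarrow> (real \<Rightarrow> real) \<Rightarrow> real \<Rightarrow> real \<Rightarrow> real" where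
  "normalized_overlap R w \<kappa> \<kappa>' = overlap R w \<kappa> \<kappa>' / (jost_u R w \<kappa> 0 * jost_u R w \<kappa>' 0)"

lemma normalized_overlap_estimates:
  assumes w: "potential R w" "\<And>x. 0 \<le> w x" and R: "0 \<le> R" and ab: "0 < a" "a \<le> b"
  obtains L n0 where "0 < n0"
    "\<And>\<kappa> \<kappa>'. \<kappa> \<in> {a..b} \<Longrightarrow> \<kappa>' \<in> {a..b} \<Longrightarrow> n0 \<le> normalized_overlap R w \<kappa> \<kappa>'"
    "\<And>\<kappa> \<kappa>'. \<kappa> \<in> {a..b} \<Longrightarrow> \<kappa>' \<in> {a..b} \<Longrightarrow> normalized_overlap R w \<kappa> \<kappa>' \<le> L"
    "\<And>\<kappa> \<kappa>'. \<kappa> \<in> {a..b} \<Longrightarrow> \<kappa>' \<in> {a..b} \<Longrightarrow>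
      \<bar>normalized_overlap R w \<kappa> \<kappa>' - normalized_overlap R w \<kappa>' \<kappa>'\<bar> \<le> L * \<bar>\<kappa> - \<kappa>'\<bar>"
    "\<And>\<kappa> \<kappa>'. \<kappa> \<in> {a..b} \<Longrightarrow> \<kappa>' \<in> {a..b} \<Longrightarrow>
      mfun R w \<kappa> - mfun R w \<kappa>' = (\<kappa>\<^sup>2 - \<kappa>'\<^sup>2) * normalized_overlap R w \<kappa> \<kappa>'"
proof -
  have O: "oscillation_free R w" by (rule nonneg_oscillation_free[OF w(1) R w(2)])
  note D = oscillation_freeD[OF O] and J = jost_props[OF w(1) R]
  obtain C where C: "0 < C"
    "\<And>\<kappa> x. \<kappa> \<in> {a..b} \<Longrightarrow> 0 \<le> x \<Longrightarrow> \<bar>jost_u R w \<kappa> x\<bar> \<le> C * exp (- a * x)"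
    "\<And>\<kappa> \<kappa>' x. \<kappa> \<in> {a..b} \<Longrightarrow> \<kappa>' \<in> {a..b} \<Longrightarrow> 0 \<le> x \<Longrightarrow>
      \<bar>jost_u R w \<kappa> x - jost_u R w \<kappa>' x\<bar> \<le> C * \<bar>\<kappa> - \<kappa>'\<bar> * exp (- (a / 2) * x)"
    using jost_bounds[OF w(1) R ab] by metis
  have pos: "0 < \<kappa>" if "\<kappa> \<in> {a..b}" for \<kappa> using that ab by auto
  define l where "l = exp (- b * R)"
  have l: "0 < l" by (simp add: l_def)
  have lj: "l \<le> jost_u R w \<kappa> 0" if "\<kappa> \<in> {a..b}" for \<kappa>
    unfolding l_def by (rule jost_lower_bound[OF w R pos[OF that]]) (use that R in auto)
  have jC: "jost_u R w \<kappa> 0 \<le> C" if "\<kappa> \<in> {a..b}" for \<kappa> using C(2)[OF that, of 0] by auto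
  have expI: "((\<lambda>x. exp (- a * x)) has_integral 1 / a) {0..}"
    using has_integral_exp_minus_to_infinity[OF ab(1), of 0] by simp
  have e2: "exp (- (2 * a) * x) \<le> exp (- a * x)" "exp (- (a / 2) * x) * exp (- a * x) \<le> exp (- a * x)"
    if "0 \<le> x" for x using that ab by (auto simp: mult_le_cancel_right1)
  have oi: "((\<lambda>x. jost_u R w \<kappa> x * jost_u R w \<kappa>' x) has_integral overlap R w \<kappa> \<kappa>') {0..}"
    if "\<kappa> \<in> {a..b}" "\<kappa>' \<in> {a..b}" for \<kappa> \<kappa>'
    unfolding overlap_def using overlap_has_integral(1)[OF w(1) R pos pos] that
    by (intro integrable_integral) (auto dest: has_integral_integrable)
  have oC: "overlap R w \<kappa> \<kappa>' \<le> C * C * (1 / a)" if \<kappa>: "\<kappa> \<in> {a..b}" "\<kappa>' \<in> {a..b}" for \<kappa> \<kappa>'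
  proof (rule has_integral_le[OF oi[OF \<kappa>] has_integral_mult_right[OF expI]])
    fix x :: real assume "x \<in> {0..}"
    then have x: "0 \<le> x" by simp
    have "jost_u R w \<kappa> x * jost_u R w \<kappa>' x \<le> \<bar>jost_u R w \<kappa> x\<bar> * \<bar>jost_u R w \<kappa>' x\<bar>"
      by (simp flip: abs_mult)
    also have "\<dots> \<le> (C * exp (- a * x)) * (C * exp (- a * x))"
      using C(2)[OF \<kappa>(1) x] C(2)[OF \<kappa>(2) x] C(1) by (intro mult_mono) auto
    also have "\<dots> = C * C * exp (- (2 * a) * x)" by (simp flip: exp_add)
    also have "\<dots> \<le> C * C * exp (- a * x)" using e2(1)[OF x] C(1) by (intro mult_left_mono) auto
    finally show "jost_u R w \<kappa> x * jost_u R w \<kappa>' x \<le> C * C * exp (- a * x)" .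
  qed
  have oL: "\<bar>overlap R w \<kappa> \<kappa>' - overlap R w \<kappa>' \<kappa>'\<bar> \<le> (C * C * \<bar>\<kappa> - \<kappa>'\<bar>) * (1 / a)"
    if \<kappa>: "\<kappa> \<in> {a..b}" "\<kappa>' \<in> {a..b}" for \<kappa> \<kappa>'
  proof -
    let ?g = "\<lambda>x. (C * C * \<bar>\<kappa> - \<kappa>'\<bar>) * exp (- a * x)"
    have d: "\<bar>jost_u R w \<kappa> x * jost_u R w \<kappa>' x - jost_u R w \<kappa>' x * jost_u R w \<kappa>' x\<bar> \<le> ?g x"
      if x: "x \<in> {0..}" for x
    proof -
      have x0: "0 \<le> x" using x by simp
      have "\<bar>jost_u R w \<kappa> x * jost_u R w \<kappa>' x - jost_u R w \<kappa>' x * jost_u R w \<kappa>' x\<bar>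
          = \<bar>jost_u R w \<kappa> x - jost_u R w \<kappa>' x\<bar> * \<bar>jost_u R w \<kappa>' x\<bar>"
        by (simp add: left_diff_distrib flip: abs_mult)
      also have "\<dots> \<le> (C * \<bar>\<kappa> - \<kappa>'\<bar> * exp (- (a / 2) * x)) * (C * exp (- a * x))"
        using C(1) C(2)[OF \<kappa>(2) x0] C(3)[OF \<kappa> x0] by (intro mult_mono) auto
      also have "\<dots> = (C * C * \<bar>\<kappa> - \<kappa>'\<bar>) * (exp (- (a / 2) * x) * exp (- a * x))" by simp
      also have "\<dots> \<le> ?g x" using e2(2)[OF x0] C(1) by (intro mult_left_mono) auto
      finally show ?thesis .
    qed
    have i: "((\<lambda>x. jost_u R w \<kappa> x * jost_u R w \<kappa>' x - jost_u R w \<kappa>' x * jost_u R w \<kappa>' x)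
        has_integral overlap R w \<kappa> \<kappa>' - overlap R w \<kappa>' \<kappa>') {0..}"
      by (intro has_integral_diff oi \<kappa>)
    note g = has_integral_mult_right[OF expI, of "C * C * \<bar>\<kappa> - \<kappa>'\<bar>"]
    have "norm (integral {0..} (\<lambda>x. jost_u R w \<kappa> x * jost_u R w \<kappa>' x - jost_u R w \<kappa>' x * jost_u R w \<kappa>' x))
        \<le> integral {0..} ?g"
      by (rule integral_norm_bound_integral) (use i g d in \<open>auto dest: has_integral_integrable\<close>)
    then show ?thesis using integral_unique[OF i] integral_unique[OF g] by simp
  qed
  define n0 where "n0 = l * l / (2 * b) / (C * C)"
  define L where "L = C * C * (1 / a) / (l * l) + (C * C * (1 / a) / (l * l) + C * C * (1 / a) * C / (l * l * l))"
  have b: "0 < b" using ab by simp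
  show ?thesis
  proof (rule that)
    show "0 < n0" using l b C(1) by (simp add: n0_def)
    fix \<kappa> \<kappa>' assume \<kappa>: "\<kappa> \<in> {a..b}" "\<kappa>' \<in> {a..b}"
    let ?j = "jost_u R w \<kappa> 0" and ?j' = "jost_u R w \<kappa>' 0"
    have j: "l \<le> ?j" "l \<le> ?j'" "?j \<le> C" "?j' \<le> C" "0 < ?j" "0 < ?j'"
      using lj jC \<kappa> l by (auto intro: less_le_trans)
    have ol: "l * l / (2 * b) \<le> overlap R w \<kappa> \<kappa>'"
    proof -
      have "l * l = exp (- (2 * b) * R)" by (simp add: l_def flip: exp_add)
      moreover have "exp (- (2 * b) * R) \<le> exp (- (\<kappa> + \<kappa>') * R)"
      proof -
        have "(\<kappa> + \<kappa>') * R \<le> (2 * b) * R" using \<kappa> R by (intro mult_right_mono) auto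
        then show ?thesis unfolding exp_le_cancel_iff by (simp add: algebra_simps)
      qed
      ultimately have "l * l / (2 * b) \<le> exp (- (\<kappa> + \<kappa>') * R) / (\<kappa> + \<kappa>')"
        using \<kappa> ab by (intro frac_le) auto
      then show ?thesis using overlap_pos(1)[OF O pos[OF \<kappa>(1)] pos[OF \<kappa>(2)]] by linarith
    qed
    have op: "0 < overlap R w \<kappa> \<kappa>'" "0 < overlap R w \<kappa>' \<kappa>'" using overlap_pos(2)[OF O] pos \<kappa> by auto
    show "n0 \<le> normalized_overlap R w \<kappa> \<kappa>'"
      unfolding n0_def normalized_overlap_def
      using ol j l b op by (intro frac_le mult_mono) auto
    have 1: "overlap R w \<kappa> \<kappa>' / (?j * ?j') \<le> C * C * (1 / a) / (l * l)"
      using oC[OF \<kappa>] j l op C(1) ab by (intro frac_le mult_mono) auto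
    have 2: "0 \<le> C * C * (1 / a) / (l * l)" "0 \<le> C * C * (1 / a) * C / (l * l * l)"
      using C(1) ab l by auto
    show "normalized_overlap R w \<kappa> \<kappa>' \<le> L"
      unfolding normalized_overlap_def L_def using 1 2 by linarith
    let ?A = "(overlap R w \<kappa> \<kappa>' - overlap R w \<kappa>' \<kappa>') / (?j * ?j')"
    let ?B = "overlap R w \<kappa>' \<kappa>' * (?j' - ?j) / (?j * ?j' * ?j')"
    have eq: "normalized_overlap R w \<kappa> \<kappa>' - normalized_overlap R w \<kappa>' \<kappa>' = ?A + ?B"
      using j by (simp add: normalized_overlap_def field_simps)
    have "\<bar>normalized_overlap R w \<kappa> \<kappa>' - normalized_overlap R w \<kappa>' \<kappa>'\<bar> = \<bar>?A + ?B\<bar>"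
      unfolding eq ..
    also have "\<dots> \<le> \<bar>overlap R w \<kappa> \<kappa>' - overlap R w \<kappa>' \<kappa>'\<bar> / (?j * ?j')
        + overlap R w \<kappa>' \<kappa>' * \<bar>?j - ?j'\<bar> / (?j * ?j' * ?j')"
    proof -
      have 1: "\<bar>X / (?j * ?j')\<bar> = \<bar>X\<bar> / (?j * ?j')" for X
        unfolding abs_divide abs_mult using j(5,6) by (simp only: abs_of_pos)
      have 2: "\<bar>overlap R w \<kappa>' \<kappa>' * (?j' - ?j) / (?j * ?j' * ?j')\<bar>
          = overlap R w \<kappa>' \<kappa>' * \<bar>?j - ?j'\<bar> / (?j * ?j' * ?j')"
        unfolding abs_divide abs_mult using j(5,6) op(2) by (simp only: abs_of_pos abs_minus_commute[of ?j' ?j])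
      show ?thesis unfolding 1[symmetric] 2[symmetric] by (rule abs_triangle_ineq)
    qed
    also have "\<dots> \<le> (C * C * \<bar>\<kappa> - \<kappa>'\<bar>) * (1 / a) / (l * l) + (C * C * (1 / a)) * (C * \<bar>\<kappa> - \<kappa>'\<bar>) / (l * l * l)"
    proof (rule add_mono)
      have ll: "l * l \<le> ?j * ?j'" using j l by (intro mult_mono) auto
      then have lll: "l * l * l \<le> ?j * ?j' * ?j'" using j l by (intro mult_mono) auto
      have l2: "0 < l * l" "0 < l * l * l" using l by simp_all
      show "\<bar>overlap R w \<kappa> \<kappa>' - overlap R w \<kappa>' \<kappa>'\<bar> / (?j * ?j') \<le> (C * C * \<bar>\<kappa> - \<kappa>'\<bar>) * (1 / a) / (l * l)"
        by (rule frac_le[OF _ oL[OF \<kappa>] l2(1) ll]) (use C(1) ab in simp)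
      have "\<bar>?j - ?j'\<bar> \<le> C * \<bar>\<kappa> - \<kappa>'\<bar>" using C(3)[OF \<kappa>, of 0] by simp
      then have num: "overlap R w \<kappa>' \<kappa>' * \<bar>?j - ?j'\<bar> \<le> (C * C * (1 / a)) * (C * \<bar>\<kappa> - \<kappa>'\<bar>)"
        using oC[OF \<kappa>(2) \<kappa>(2)] op(2) C(1) ab by (intro mult_mono) simp_all
      show "overlap R w \<kappa>' \<kappa>' * \<bar>?j - ?j'\<bar> / (?j * ?j' * ?j')
          \<le> (C * C * (1 / a)) * (C * \<bar>\<kappa> - \<kappa>'\<bar>) / (l * l * l)"
        by (rule frac_le[OF _ num l2(2) lll]) (use C(1) ab in simp)
    qed
    also have "\<dots> = (C * C * (1 / a) / (l * l) + C * C * (1 / a) * C / (l * l * l)) * \<bar>\<kappa> - \<kappa>'\<bar>"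
      by (simp add: distrib_right)
    also have "\<dots> \<le> L * \<bar>\<kappa> - \<kappa>'\<bar>" unfolding L_def using 2 by (intro mult_right_mono) auto
    finally show "\<bar>normalized_overlap R w \<kappa> \<kappa>' - normalized_overlap R w \<kappa>' \<kappa>'\<bar> \<le> L * \<bar>\<kappa> - \<kappa>'\<bar>" .
    show "mfun R w \<kappa> - mfun R w \<kappa>' = (\<kappa>\<^sup>2 - \<kappa>'\<^sup>2) * normalized_overlap R w \<kappa> \<kappa>'"
      using mfun_difference[OF O pos[OF \<kappa>(1)] pos[OF \<kappa>(2)]] j
      by (simp add: normalized_overlap_def field_simps)
  qed
qed

text \<open>At a fixed \<open>x > 0\<close> the solution is unperturbed as soon as \<open>\<epsilon> * R < x\<close>, so only the dependence on the root \<open>k \<epsilon>\<close> and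
  the normalization at \<open>0\<close> remain, and both are Lipschitz. The exponential bound, uniform in
  \<open>\<epsilon>\<close>, is the majorant for dominated convergence.\<close>

lemma half_ground_convergence:
  assumes w: "potential R w" "\<And>x. 0 \<le> w x" and R: "0 < R" and U: "U \<in> borel_measurable lebesgue"
    and C: "\<And>t. \<bar>U t\<bar> \<le> C" and U0: "\<forall>t\<ge>R. U t = 0" and ab: "0 < a" "a \<le> b" and e3: "0 < \<epsilon>3" "\<epsilon>3 \<le> 1"
    and j0: "\<And>\<epsilon> \<kappa>. 0 < \<epsilon> \<Longrightarrow> \<epsilon> < \<epsilon>3 \<Longrightarrow> \<kappa> \<in> {a..b} \<Longrightarrow>
      \<bar>jost_u R (scaled_potential w U \<epsilon>) \<kappa> 0 - jost_u R w \<kappa> 0\<bar> \<le> E * \<epsilon>"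
    and jE: "\<And>\<epsilon> \<kappa> x. 0 < \<epsilon> \<Longrightarrow> \<epsilon> < \<epsilon>3 \<Longrightarrow> \<kappa> \<in> {a..b} \<Longrightarrow> 0 \<le> x \<Longrightarrow> x \<le> \<epsilon> * R \<Longrightarrow>
      \<bar>jost_u R (scaled_potential w U \<epsilon>) \<kappa> x\<bar> \<le> E"
    and jl: "\<And>\<epsilon> \<kappa>. 0 < \<epsilon> \<Longrightarrow> \<epsilon> < \<epsilon>3 \<Longrightarrow> \<kappa> \<in> {a..b} \<Longrightarrow>
      exp (- b * R) / 2 \<le> jost_u R (scaled_potential w U \<epsilon>) \<kappa> 0"
    and k: "\<And>\<epsilon>. 0 < \<epsilon> \<Longrightarrow> \<epsilon> < \<epsilon>3 \<Longrightarrow> k \<epsilon> \<in> {a..b}" "\<kappa>0 \<in> {a..b}"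
    and kl: "\<And>\<epsilon>. 0 < \<epsilon> \<Longrightarrow> \<epsilon> < \<epsilon>3 \<Longrightarrow> \<bar>k \<epsilon> - \<kappa>0\<bar> \<le> Y * \<epsilon>"
  obtains D where
    "\<And>\<epsilon> x. 0 < \<epsilon> \<Longrightarrow> \<epsilon> < \<epsilon>3 \<Longrightarrow> 0 \<le> x \<Longrightarrow>
      \<bar>jost_u R (scaled_potential w U \<epsilon>) (k \<epsilon>) x / jost_u R (scaled_potential w U \<epsilon>) (k \<epsilon>) 0\<bar> \<le> D * exp (- a * x)"
    "\<And>x. 0 < x \<Longrightarrow> ((\<lambda>\<epsilon>. jost_u R (scaled_potential w U \<epsilon>) (k \<epsilon>) x / jost_u R (scaled_potential w U \<epsilon>) (k \<epsilon>) 0)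
      \<longlongrightarrow> jost_u R w \<kappa>0 x / jost_u R w \<kappa>0 0) (at_right 0)"
proof -
  have R0: "0 \<le> R" using R by simp
  obtain C0 where C0: "0 < C0"
    "\<And>\<kappa> x. \<kappa> \<in> {a..b} \<Longrightarrow> 0 \<le> x \<Longrightarrow> \<bar>jost_u R w \<kappa> x\<bar> \<le> C0 * exp (- a * x)"
    "\<And>\<kappa> \<kappa>' x. \<kappa> \<in> {a..b} \<Longrightarrow> \<kappa>' \<in> {a..b} \<Longrightarrow> 0 \<le> x \<Longrightarrow>
      \<bar>jost_u R w \<kappa> x - jost_u R w \<kappa>' x\<bar> \<le> C0 * \<bar>\<kappa> - \<kappa>'\<bar> * exp (- (a / 2) * x)"
    using jost_bounds[OF w(1) R0 ab] by metis
  define l where "l = exp (- b * R) / 2"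
  have l: "0 < l" by (simp add: l_def)
  have E0: "0 \<le> E"
  proof -
    have "\<bar>jost_u R (scaled_potential w U (\<epsilon>3 / 2)) \<kappa>0 0\<bar> \<le> E"
      by (rule jE) (use e3 k(2) R in auto)
    then show ?thesis by linarith
  qed
  have ev: "\<forall>\<^sub>F \<epsilon> in at_right (0::real). 0 < \<epsilon> \<and> \<epsilon> < r" if "0 < r" for r
    using that by (auto simp: eventually_at_right_field)
  have outer: "jost_u R (scaled_potential w U \<epsilon>) \<kappa> x = jost_u R w \<kappa> x"
    if "0 < \<epsilon>" "\<epsilon> < \<epsilon>3" "\<epsilon> * R \<le> x" for \<epsilon> \<kappa> x
    by (rule jost_scaled_outer(1)[OF w(1) R0 U C U0 that(1) _ that(3)]) (use that e3 in auto)
  define D where "D = (C0 + E * exp (a * R)) / l"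
  show ?thesis
  proof (rule that[of D])
    fix \<epsilon> x :: real assume e: "0 < \<epsilon>" "\<epsilon> < \<epsilon>3" and x: "0 \<le> x"
    let ?j = "jost_u R (scaled_potential w U \<epsilon>) (k \<epsilon>)"
    have num: "\<bar>?j x\<bar> \<le> (C0 + E * exp (a * R)) * exp (- a * x)"
    proof (cases "\<epsilon> * R \<le> x")
      case True
      have "\<bar>?j x\<bar> \<le> C0 * exp (- a * x)" using outer[OF e True] C0(2)[OF k(1)[OF e] x] by simp
      also have "\<dots> \<le> (C0 + E * exp (a * R)) * exp (- a * x)" using E0 by (intro mult_right_mono) auto
      finally show ?thesis .
    next
      case False
      have "\<epsilon> * R \<le> 1 * R" using e e3 R by (intro mult_right_mono) auto
      then have "a * x \<le> a * R" using False ab by (intro mult_left_mono) auto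
      then have "1 \<le> exp (a * R) * exp (- a * x)" by (simp flip: exp_add)
      then have "E * 1 \<le> E * (exp (a * R) * exp (- a * x))" using E0 by (intro mult_left_mono)
      then have "\<bar>?j x\<bar> \<le> E * (exp (a * R) * exp (- a * x))"
        using jE[OF e k(1)[OF e] x] False by linarith
      also have "\<dots> = (E * exp (a * R)) * exp (- a * x)" by simp
      also have "\<dots> \<le> (C0 + E * exp (a * R)) * exp (- a * x)" using C0 by (intro mult_right_mono) auto
      finally show ?thesis .
    qed
    have lj: "l \<le> ?j 0" using jl[OF e k(1)[OF e]] by (simp add: l_def)
    have "\<bar>?j x\<bar> / ?j 0 \<le> ((C0 + E * exp (a * R)) * exp (- a * x)) / l"
      by (rule frac_le[OF _ num l lj]) (use C0 E0 in auto)
    then show "\<bar>?j x / ?j 0\<bar> \<le> D * exp (- a * x)" using lj l by (simp add: D_def)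
  next
    fix x :: real assume x: "0 < x"
    have Y: "((\<lambda>\<epsilon>. c * \<epsilon>) \<longlongrightarrow> 0) (at_right (0::real))" for c
      by (rule tendsto_mult_right_zero) (rule tendsto_ident_at)
    have sm: "((\<lambda>\<epsilon>. jost_u R w (k \<epsilon>) z) \<longlongrightarrow> jost_u R w \<kappa>0 z) (at_right 0)" if z: "0 \<le> z" for z
    proof (rule LIM_zero_cancel, rule Lim_null_comparison[OF _ Y])
      have "0 \<le> a * z" using ab z by simp
      then have e1: "exp (- (a / 2) * z) \<le> 1" by simp
      show "\<forall>\<^sub>F \<epsilon> in at_right 0. norm (jost_u R w (k \<epsilon>) z - jost_u R w \<kappa>0 z) \<le> (C0 * Y) * \<epsilon>"
        using ev[OF e3(1)]
      proof eventually_elim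
        case (elim \<epsilon>)
        then have e: "0 < \<epsilon>" "\<epsilon> < \<epsilon>3" by auto
        have "\<bar>jost_u R w (k \<epsilon>) z - jost_u R w \<kappa>0 z\<bar> \<le> (C0 * \<bar>k \<epsilon> - \<kappa>0\<bar>) * exp (- (a / 2) * z)"
          by (rule C0(3)[OF k(1)[OF e] k(2) z])
        also have "\<dots> \<le> (C0 * \<bar>k \<epsilon> - \<kappa>0\<bar>) * 1" using e1 C0(1) by (intro mult_left_mono) auto
        also have "\<dots> \<le> C0 * (Y * \<epsilon>)" using kl[OF e] C0(1) by (simp add: mult_left_mono)
        finally show ?case by (simp add: mult.assoc)
      qed
    qed
    have num: "((\<lambda>\<epsilon>. jost_u R (scaled_potential w U \<epsilon>) (k \<epsilon>) x) \<longlongrightarrow> jost_u R w \<kappa>0 x) (at_right 0)"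
    proof (rule Lim_transform_eventually[OF sm[of x]])
      have "0 < min \<epsilon>3 (x / R)" using e3 x R by simp
      from ev[OF this] show "\<forall>\<^sub>F \<epsilon> in at_right 0. jost_u R w (k \<epsilon>) x = jost_u R (scaled_potential w U \<epsilon>) (k \<epsilon>) x"
      proof eventually_elim
        case (elim \<epsilon>)
        then have "\<epsilon> * R \<le> x" using R by (simp add: pos_less_divide_eq)
        then show ?case using outer[of \<epsilon> x] elim by simp
      qed
    qed (use x in simp)
    have "((\<lambda>\<epsilon>. jost_u R (scaled_potential w U \<epsilon>) (k \<epsilon>) 0 - jost_u R w (k \<epsilon>) 0) \<longlongrightarrow> 0) (at_right 0)"
    proof (rule Lim_null_comparison[OF _ Y])
      show "\<forall>\<^sub>F \<epsilon> in at_right 0. norm (jost_u R (scaled_potential w U \<epsilon>) (k \<epsilon>) 0 - jost_u R w (k \<epsilon>) 0) \<le> E * \<epsilon>"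
        using ev[OF e3(1)] by eventually_elim (use j0 k in auto)
    qed
    from tendsto_add[OF this sm[OF order_refl]]
    have den: "((\<lambda>\<epsilon>. jost_u R (scaled_potential w U \<epsilon>) (k \<epsilon>) 0) \<longlongrightarrow> jost_u R w \<kappa>0 0) (at_right 0)" by simp
    have "jost_u R w \<kappa>0 0 \<noteq> 0"
      using jost_lower_bound[OF w R0, of \<kappa>0 b 0] k(2) ab R0 exp_gt_zero[of "- b * R"] by auto
    then show "((\<lambda>\<epsilon>. jost_u R (scaled_potential w U \<epsilon>) (k \<epsilon>) x / jost_u R (scaled_potential w U \<epsilon>) (k \<epsilon>) 0)
        \<longlongrightarrow> jost_u R w \<kappa>0 x / jost_u R w \<kappa>0 0) (at_right 0)"
      by (rule tendsto_divide[OF num den])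
  qed
qed

text \<open>Here \<open>\<kappa>0\<close> is the zero of \<open>M\<close> and \<open>\<kappa>\<close> a zero of a function within \<open>E * \<epsilon>\<^sup>2\<close> of \<open>M - \<epsilon> * S\<close>. The factorization of
  \<open>M\<close> with \<open>N\<close> bounded below gives \<open>\<kappa> - \<kappa>0 = O(\<epsilon>)\<close>; Lipschitz continuity of \<open>N\<close> and \<open>S\<close> then allows evaluating both at
  \<open>\<kappa>0\<close> with an error \<open>O(\<epsilon>\<^sup>2)\<close>. The constants are explicit because they have to be uniform in \<open>\<epsilon>\<close>.\<close>

lemma perturbed_root_asymptotics:
  fixes M S N :: "real \<Rightarrow> real"
  assumes ab: "0 < a" and \<kappa>: "\<kappa> \<in> {a..b}" "\<kappa>0 \<in> {a..b}" and \<epsilon>: "0 < \<epsilon>" "\<epsilon> \<le> 1"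
    and root: "\<bar>M \<kappa> - \<epsilon> * S \<kappa>\<bar> \<le> E * \<epsilon>\<^sup>2" and M: "M \<kappa> = (\<kappa>\<^sup>2 - \<kappa>0\<^sup>2) * N \<kappa>"
    and N: "0 < n0" "n0 \<le> N \<kappa>" "n0 \<le> N \<kappa>0" "\<bar>N \<kappa> - N \<kappa>0\<bar> \<le> L * \<bar>\<kappa> - \<kappa>0\<bar>"
    and S: "\<bar>S \<kappa> - S \<kappa>0\<bar> \<le> LS * \<bar>\<kappa> - \<kappa>0\<bar>" "\<bar>S \<kappa>\<bar> \<le> Sm" and nn: "0 \<le> L" "0 \<le> LS" "0 \<le> E" "0 \<le> Sm"
  shows "\<bar>\<kappa> - \<kappa>0\<bar> \<le> ((Sm + E) / n0 / a) * \<epsilon>"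
    and "\<bar>(\<kappa>0\<^sup>2 - \<kappa>\<^sup>2) + \<epsilon> * (S \<kappa>0 / N \<kappa>0)\<bar>
      \<le> ((E + (Sm + E) / n0 * L * ((Sm + E) / n0 / a) + LS * ((Sm + E) / n0 / a)) / n0) * \<epsilon>\<^sup>2"
proof -
  define x where "x = \<kappa>0\<^sup>2 - \<kappa>\<^sup>2"
  define X where "X = (Sm + E) / n0"
  have X: "0 \<le> X" using nn N by (simp add: X_def)
  have Mx: "M \<kappa> = - x * N \<kappa>" by (simp add: M x_def algebra_simps)
  have e2: "\<epsilon>\<^sup>2 \<le> \<epsilon>" using \<epsilon> by (simp add: power2_eq_square mult_left_le)
  have "\<bar>M \<kappa>\<bar> \<le> E * \<epsilon>\<^sup>2 + \<epsilon> * \<bar>S \<kappa>\<bar>"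
    using root abs_triangle_ineq[of "M \<kappa> - \<epsilon> * S \<kappa>" "\<epsilon> * S \<kappa>"] \<epsilon> by (simp add: abs_mult)
  also have "\<dots> \<le> E * \<epsilon> + \<epsilon> * Sm" using e2 S(2) nn \<epsilon> by (intro add_mono mult_left_mono) auto
  finally have "\<bar>x\<bar> * N \<kappa> \<le> (Sm + E) * \<epsilon>" using N by (simp add: Mx abs_mult algebra_simps)
  moreover have "\<bar>x\<bar> * n0 \<le> \<bar>x\<bar> * N \<kappa>" using N by (intro mult_left_mono) auto
  ultimately have xb: "\<bar>x\<bar> \<le> X * \<epsilon>" using N(1) by (simp add: X_def field_simps)
  have k: "\<bar>\<kappa> - \<kappa>0\<bar> * a \<le> \<bar>x\<bar>"
  proof -
    have "x = - ((\<kappa> - \<kappa>0) * (\<kappa> + \<kappa>0))" by (simp add: x_def power2_eq_square algebra_simps)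
    then have "\<bar>x\<bar> = \<bar>\<kappa> - \<kappa>0\<bar> * (\<kappa> + \<kappa>0)" using \<kappa> ab by (simp add: abs_mult)
    then show ?thesis using \<kappa> ab by (auto intro: mult_left_mono)
  qed
  then have "\<bar>\<kappa> - \<kappa>0\<bar> * a \<le> X * \<epsilon>" using xb by linarith
  then have kb: "\<bar>\<kappa> - \<kappa>0\<bar> \<le> (X / a) * \<epsilon>" using ab by (simp add: field_simps)
  then show "\<bar>\<kappa> - \<kappa>0\<bar> \<le> ((Sm + E) / n0 / a) * \<epsilon>" by (simp add: X_def)
  have "x * N \<kappa>0 + \<epsilon> * S \<kappa>0 = - (M \<kappa> - \<epsilon> * S \<kappa>) + - (x * (N \<kappa> - N \<kappa>0)) + - (\<epsilon> * (S \<kappa> - S \<kappa>0))"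
    by (simp add: Mx algebra_simps)
  then have "\<bar>x * N \<kappa>0 + \<epsilon> * S \<kappa>0\<bar> \<le> \<bar>M \<kappa> - \<epsilon> * S \<kappa>\<bar> + \<bar>x * (N \<kappa> - N \<kappa>0)\<bar> + \<bar>\<epsilon> * (S \<kappa> - S \<kappa>0)\<bar>" by linarith
  also have "\<dots> \<le> E * \<epsilon>\<^sup>2 + (X * \<epsilon>) * (L * ((X / a) * \<epsilon>)) + \<epsilon> * (LS * ((X / a) * \<epsilon>))"
  proof (intro add_mono root)
    have "\<bar>N \<kappa> - N \<kappa>0\<bar> \<le> L * ((X / a) * \<epsilon>)"
      using N(4) mult_left_mono[OF kb nn(1)] by linarith
    then show "\<bar>x * (N \<kappa> - N \<kappa>0)\<bar> \<le> (X * \<epsilon>) * (L * ((X / a) * \<epsilon>))"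
      unfolding abs_mult using xb X \<epsilon> by (intro mult_mono) auto
    have "\<bar>S \<kappa> - S \<kappa>0\<bar> \<le> LS * ((X / a) * \<epsilon>)"
      using S(1) mult_left_mono[OF kb nn(2)] by linarith
    then show "\<bar>\<epsilon> * (S \<kappa> - S \<kappa>0)\<bar> \<le> \<epsilon> * (LS * ((X / a) * \<epsilon>))"
      unfolding abs_mult using \<epsilon> by (intro mult_mono) auto
  qed
  also have "\<dots> = (E + X * L * (X / a) + LS * (X / a)) * \<epsilon>\<^sup>2" by (simp add: algebra_simps power2_eq_square)
  finally have b: "\<bar>x * N \<kappa>0 + \<epsilon> * S \<kappa>0\<bar> \<le> (E + X * L * (X / a) + LS * (X / a)) * \<epsilon>\<^sup>2" .
  have "x + \<epsilon> * (S \<kappa>0 / N \<kappa>0) = (x * N \<kappa>0 + \<epsilon> * S \<kappa>0) / N \<kappa>0" using N by (simp add: field_simps)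
  then have "\<bar>x + \<epsilon> * (S \<kappa>0 / N \<kappa>0)\<bar> = \<bar>x * N \<kappa>0 + \<epsilon> * S \<kappa>0\<bar> / N \<kappa>0" using N by simp
  also have "\<dots> \<le> ((E + X * L * (X / a) + LS * (X / a)) * \<epsilon>\<^sup>2) / n0"
    by (rule frac_le[OF _ b N(1) N(3)]) (use nn X ab in \<open>auto intro!: mult_nonneg_nonneg add_nonneg_nonneg\<close>)
  finally show "\<bar>(\<kappa>0\<^sup>2 - \<kappa>\<^sup>2) + \<epsilon> * (S \<kappa>0 / N \<kappa>0)\<bar>
      \<le> ((E + (Sm + E) / n0 * L * ((Sm + E) / n0 / a) + LS * ((Sm + E) / n0 / a)) / n0) * \<epsilon>\<^sup>2"
    by (simp add: x_def X_def)
qed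

lemma secular_strict_mono:
  assumes "oscillation_free R V" "oscillation_free R (\<lambda>x. V (- x))" "0 < \<kappa>'" "\<kappa>' < \<kappa>"
  shows "secular R V \<beta> \<kappa>' < secular R V \<beta> \<kappa>"
  using mfun_strict_mono[OF assms(1,3,4)] mfun_strict_mono[OF assms(2,3,4)] by (simp add: secular_def)

lemma secular_root_unique:
  assumes "oscillation_free R V" "oscillation_free R (\<lambda>x. V (- x))" "0 < \<kappa>'" "0 < \<kappa>"
    "secular R V \<beta> \<kappa>' = 0" "secular R V \<beta> \<kappa> = 0"
  shows "\<kappa> = \<kappa>'"
  using secular_strict_mono[OF assms(1,2), of \<kappa> \<kappa>' \<beta>] secular_strict_mono[OF assms(1,2), of \<kappa>' \<kappa> \<beta>] assms(3-)
  by (cases \<kappa> \<kappa>' rule: linorder_cases) auto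

lemma secular_continuous:
  assumes "oscillation_free R V" "oscillation_free R (\<lambda>x. V (- x))" "0 < a"
  shows "continuous_on {a..b} (secular R V \<beta>)"
  unfolding secular_def[abs_def] by (intro continuous_intros mfun_continuous assms)

section \<open>Modification of potentials on null sets\<close>

lemma eigenfunction_S_op_cong:
  assumes "AE x in lebesgue. V x = V' x" "eigenfunction (S_op V \<beta>) \<mu> y"
  shows "eigenfunction (S_op V' \<beta>) \<mu> y"
proof -
  have "AE x in lebesgue. snd (S_op V \<beta>) y x = complex_of_real \<mu> * y x"
    using assms(2) by (simp add: eigenfunction_def)
  with assms(1) have "AE x in lebesgue. snd (S_op V' \<beta>) y x = complex_of_real \<mu> * y x"
    by eventually_elim (simp add: S_op_def)
  then show ?thesis using assms(2) by (simp add: eigenfunction_def S_op_def)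
qed

text \<open>Dilations preserve null sets. Applied to the perturbation, which is rescaled by \<open>inverse \<epsilon>\<close>.\<close>

lemma AE_scale:
  assumes "AE x in lebesgue. P (x::real)" "c \<noteq> 0"
  shows "AE x in lebesgue. P (c * x)"
proof -
  obtain N where N: "negligible N" "{x. \<not> P x} \<subseteq> N"
    using assms unfolding eventually_ae_filter_negligible by auto
  have "negligible ((\<lambda>x. x / c) ` N)"
    by (rule negligible_differentiable_image_negligible[OF _ N(1)])
      (auto intro!: derivative_intros simp: differentiable_on_def \<open>c \<noteq> 0\<close>)
  moreover have "{x. \<not> P (c * x)} \<subseteq> (\<lambda>x. x / c) ` N"
  proof
    fix x assume "x \<in> {x. \<not> P (c * x)}"
    then have "c * x \<in> N" using N(2) by auto
    then have "(c * x) / c \<in> (\<lambda>x. x / c) ` N" by blast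
    then show "x \<in> (\<lambda>x. x / c) ` N" using assms(2) by simp
  qed
  ultimately show ?thesis unfolding eventually_ae_filter_negligible by auto
qed

lemma eigenfunction_H_op_cong:
  assumes "AE x in lebesgue. W x = W' x" "AE x in lebesgue. U x = U' x" "\<epsilon> \<noteq> 0"
    "eigenfunction (H_op W U \<epsilon>) \<mu> y"
  shows "eigenfunction (H_op W' U' \<epsilon>) \<mu> y"
proof -
  have "AE x in lebesgue. snd (H_op W U \<epsilon>) y x = complex_of_real \<mu> * y x"
    using assms(4) by (simp add: eigenfunction_def)
  moreover have "AE x in lebesgue. U (inverse \<epsilon> * x) = U' (inverse \<epsilon> * x)"
    by (rule AE_scale[OF assms(2)]) (use assms(3) in simp)
  ultimately have "AE x in lebesgue. snd (H_op W' U' \<epsilon>) y x = complex_of_real \<mu> * y x"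
    using assms(1) by eventually_elim (simp add: H_op_def)
  then show ?thesis using assms(4) by (simp add: eigenfunction_def H_op_def)
qed

section \<open>Spectral asymptotics\<close>

lemma dominated_convergence_at_right_0:
  fixes s :: "real \<Rightarrow> real \<Rightarrow> real"
  assumes s: "\<And>\<epsilon>. s \<epsilon> \<in> borel_measurable lebesgue" and f: "f \<in> borel_measurable lebesgue"
    and lim: "AE x in lebesgue. ((\<lambda>\<epsilon>. s \<epsilon> x) \<longlongrightarrow> f x) (at_right 0)"
    and bound: "\<forall>\<^sub>F \<epsilon> in at_right 0. \<forall>x. \<bar>s \<epsilon> x\<bar> \<le> w x" and w: "integrable lebesgue w"
  shows "((\<lambda>\<epsilon>. \<integral>x. s \<epsilon> x \<partial>lebesgue) \<longlongrightarrow> (\<integral>x. f x \<partial>lebesgue)) (at_right 0)"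
  unfolding filterlim_at_right_to_top
proof (rule integral_dominated_convergence_at_top[where w = w])
  show "AE x in lebesgue. ((\<lambda>i. s (inverse i) x) \<longlongrightarrow> f x) at_top"
    using lim unfolding filterlim_at_right_to_top .
  have "\<forall>\<^sub>F i in at_top. \<forall>x. \<bar>s (inverse i) x\<bar> \<le> w x"
    using bound unfolding eventually_at_right_to_top .
  then show "\<forall>\<^sub>F i in at_top. AE x in lebesgue. norm (s (inverse i) x) \<le> w x"
    by eventually_elim simp
qed (use s f w in auto)

lemma eigenvalueI: "eigenfunction T \<mu> y \<Longrightarrow> eigenvalue T \<mu>"
  unfolding eigenvalue_def by blast

text \<open>Existence and uniqueness of both eigenvalues come from the strictly increasing secular functions, which change
  sign. The expansions of the two m-functions add up to \<open>M - \<epsilon> * S\<close>, where \<open>M\<close> is the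
  secular function of the point interaction. Hence the eigenvalue moves by \<open>- \<epsilon> * S \<kappa>0 / N \<kappa>0\<close>, and \<open>N \<kappa>0\<close> is the squared norm of the
  limiting eigenfunction normalized at the origin, that is, \<open>1 / \<psi> 0 ^ 2\<close>. The moment identities convert \<open>S\<close> into the integrals over the line, using
  \<open>m\<^sub>+ + m\<^sub>- = - \<alpha>\<close> for the terms that carry the total mass.\<close>

lemma spectral_asymptotics_bounded:
  fixes W U :: "real \<Rightarrow> real"
  assumes R: "0 < R" and W: "W \<in> borel_measurable lebesgue" "\<And>x. \<bar>W x\<bar> \<le> CW" "\<And>x. 0 \<le> W x"
      "\<forall>x. R \<le> \<bar>x\<bar> \<longrightarrow> W x = 0"
    and U: "U \<in> borel_measurable lebesgue" "\<And>x. \<bar>U x\<bar> \<le> CU" "\<forall>x. R \<le> \<bar>x\<bar> \<longrightarrow> U x = 0"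
    and \<alpha>: "\<alpha> = (\<integral>x. U x \<partial>lebesgue)" "\<alpha> < 0" and f: "f_fun W \<alpha> < 0"
  shows "(\<exists>!\<mu>. \<mu> < 0 \<and> eigenvalue (S_op W \<alpha>) \<mu>) \<and>
    (\<exists>\<Lambda> :: real \<Rightarrow> real.
       (\<forall>\<^sub>F \<epsilon> in at_right 0.
          \<Lambda> \<epsilon> < 0 \<and> eigenvalue (H_op W U \<epsilon>) (\<Lambda> \<epsilon>) \<and>
          (\<forall>\<nu> < 0. eigenvalue (H_op W U \<epsilon>) \<nu> \<longrightarrow> \<nu> = \<Lambda> \<epsilon>)) \<and>
       (\<forall>(\<mu>::real) (\<psi> :: real \<Rightarrow> real).
          \<mu> < 0 \<and> eigenfunction (S_op W \<alpha>) \<mu> (\<lambda>x. complex_of_real (\<psi> x)) \<and> L2_norm \<psi> = 1 \<longrightarrow>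
          (\<lambda>\<epsilon>. \<Lambda> \<epsilon> - (\<mu> + \<epsilon> *
              (1 / 2 * (right_limit0 \<psi>)\<^sup>2 *
                 (\<integral>t. (\<integral>\<tau>. U t * \<bar>t - \<tau>\<bar> * U \<tau> \<partial>lebesgue) \<partial>lebesgue)
               + right_limit0 \<psi> *
                 (left_limit0 (weak_deriv (- {0}) 1 \<psi>) + right_limit0 (weak_deriv (- {0}) 1 \<psi>)) *
                 (\<integral>t. t * U t \<partial>lebesgue))))
            \<in> O[at_right 0](\<lambda>\<epsilon>. \<epsilon>\<^sup>2) \<and>
          (\<exists>\<psi>\<^sub>\<epsilon> :: real \<Rightarrow> real \<Rightarrow> complex.
             (\<forall>\<^sub>F \<epsilon> in at_right 0.
                eigenfunction (H_op W U \<epsilon>) (\<Lambda> \<epsilon>) (\<psi>\<^sub>\<epsilon> \<epsilon>) \<and> L2_norm (\<psi>\<^sub>\<epsilon> \<epsilon>) = 1) \<and>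
             ((\<lambda>\<epsilon>. L2_norm (\<lambda>x. \<psi>\<^sub>\<epsilon> \<epsilon> x - complex_of_real (\<psi> x))) \<longlongrightarrow> 0) (at_right 0))))"
proof -
  let ?W' = "\<lambda>x. W (- x)" and ?U' = "\<lambda>x. U (- x)"
  have R0: "0 \<le> R" using R by simp
  have W'm: "?W' \<in> borel_measurable lebesgue" and U'm: "?U' \<in> borel_measurable lebesgue"
    using borel_measurable_affine[OF W(1), of "-1" 0] borel_measurable_affine[OF U(1), of "-1" 0] by auto
  have Wp: "potential R W" using W R by (auto simp: potential_def)
  have W'p: "potential R ?W'" using W W'm R unfolding potential_def by (intro conjI exI[of _ CW]) auto
  have W'nn: "0 \<le> ?W' x" for x by (rule W(3))
  have U'C: "\<bar>?U' x\<bar> \<le> CU" for x by (rule U(2))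
  have U0: "\<forall>t\<ge>R. U t = 0" and U'0: "\<forall>t\<ge>R. ?U' t = 0" using U(3)[rule_format] R by auto
  have O: "oscillation_free R W" by (rule nonneg_oscillation_free[OF Wp R0 W(3)])
  have O': "oscillation_free R ?W'" by (rule nonneg_oscillation_free[OF W'p R0 W'nn])
  note mom = full_line_moments[OF U(1,2) R0 U(3)[rule_format], simplified]
  define M where "M = secular R W \<alpha>"

  define \<gamma> where "\<gamma> = - \<alpha> / 2"
  have \<gamma>: "0 < \<gamma>" using \<alpha>(2) by (simp add: \<gamma>_def)
  have WI: "X absolutely_integrable_on {0..R}" if p: "potential R X" for X
  proof -
    obtain B where "\<And>x. \<bar>X x\<bar> \<le> B" using potential_bound[OF p] by blast
    then show ?thesis using bounded_measurable_integrable[of X B] p by (auto simp: potential_def)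
  qed
  have We: "(\<lambda>x. X x * exp (\<alpha> * x)) absolutely_integrable_on {0..R}" if "potential R X" for X
    using absolutely_integrable_continuous_scaleR[of 0 R "\<lambda>x. exp (\<alpha> * x)" X] WI[OF that]
    by (simp add: mult.commute continuous_intros)
  have "(\<integral>x. W x * exp (\<alpha> * \<bar>x\<bar>) \<partial>lebesgue)
      = integral {0..R} (\<lambda>x. W x * exp (\<alpha> * x)) + integral {0..R} (\<lambda>x. W (- x) * exp (\<alpha> * x))"
  proof (rule integral_supported_folded[where R = R])
    show "(\<lambda>x. W x * exp (\<alpha> * x)) absolutely_integrable_on {0..R}" by (rule We[OF Wp])
    then show "((\<lambda>x. W x * exp (\<alpha> * x)) has_integral integral {0..R} (\<lambda>x. W x * exp (\<alpha> * x))) {0..R}"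
      by (intro integrable_integral set_lebesgue_integral_eq_integral)
    show "(\<lambda>x. W (- x) * exp (\<alpha> * x)) absolutely_integrable_on {0..R}" by (rule We[OF W'p])
    then show "((\<lambda>x. W (- x) * exp (\<alpha> * x)) has_integral integral {0..R} (\<lambda>x. W (- x) * exp (\<alpha> * x))) {0..R}"
      by (intro integrable_integral set_lebesgue_integral_eq_integral)
  qed (use W(4)[rule_format] R in auto)
  then have f2: "\<alpha> / 2 + (integral {0..R} (\<lambda>x. W x * exp (\<alpha> * x)) + integral {0..R} (\<lambda>x. W (- x) * exp (\<alpha> * x)))
      = f_fun W \<alpha> / 2"
    by (simp add: f_fun_def)
  have M_upper: "M \<kappa> \<le> f_fun W \<alpha> / 2 + 2 * \<kappa> + \<kappa>\<^sup>2 / \<gamma>" if "0 < \<kappa>" for \<kappa>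
  proof -
    have g: "- (2 * \<gamma>) = \<alpha>" by (simp add: \<gamma>_def)
    have q: "\<kappa>\<^sup>2 / (2 * \<gamma>) + \<kappa>\<^sup>2 / (2 * \<gamma>) = \<kappa>\<^sup>2 / \<gamma>" using \<gamma> by (simp add: field_simps)
    have "\<gamma> = - \<alpha> / 2" by (simp add: \<gamma>_def)
    then show ?thesis
      using mfun_upper_bound[OF Wp R0 W(3) that \<gamma>] mfun_upper_bound[OF W'p R0 W'nn that \<gamma>] f2 q
      unfolding M_def secular_def g by linarith
  qed
  \<comment> \<open>The upper bound is at most \<open>f_fun W \<alpha> / 2 + 3 * \<kappa>\<close> for \<open>\<kappa> \<le> \<gamma>\<close>, hence negative here.\<close>
  define \<kappa>s where "\<kappa>s = min \<gamma> (- f_fun W \<alpha> / 12)"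
  have \<kappa>s: "0 < \<kappa>s" "\<kappa>s \<le> \<gamma>" "\<kappa>s \<le> - f_fun W \<alpha> / 12" using \<gamma> f by (auto simp: \<kappa>s_def)
  have "\<kappa>s\<^sup>2 / \<gamma> \<le> \<kappa>s" using \<kappa>s \<gamma> by (simp add: power2_eq_square divide_le_eq mult_left_mono)
  then have Ms: "M \<kappa>s < 0" using M_upper[OF \<kappa>s(1)] \<kappa>s f by linarith
  \<comment> \<open>Each m-function is at least \<open>2 * \<gamma> = - \<alpha>\<close> at \<open>2 * \<gamma>\<close>.\<close>
  have Ml: "0 < M (2 * \<gamma>)"
    using mfun_lower_bound[OF Wp R0 W(3), of "2 * \<gamma>"] mfun_lower_bound[OF W'p R0 W'nn, of "2 * \<gamma>"] \<gamma>
    by (simp add: M_def secular_def \<gamma>_def)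
  have "\<exists>x\<ge>\<kappa>s. x \<le> 2 * \<gamma> \<and> M x = 0"
    using Ms Ml \<kappa>s \<gamma> unfolding M_def by (intro IVT' secular_continuous[OF O O' \<kappa>s(1)]) auto
  then obtain \<kappa>0 where "\<kappa>s \<le> \<kappa>0" "M \<kappa>0 = 0" by blast
  then have \<kappa>0: "0 < \<kappa>0" "M \<kappa>0 = 0" using \<kappa>s(1) by simp_all

  have S_ev: "\<mu> = - \<kappa>0\<^sup>2" if "\<mu> < 0" "eigenvalue (S_op W \<alpha>) \<mu>" for \<mu>
  proof -
    have \<mu>: "\<mu> = - (sqrt (- \<mu>))\<^sup>2" "0 < sqrt (- \<mu>)" using that(1) by auto
    have "secular R W \<alpha> (sqrt (- \<mu>)) = 0"
      by (rule S_op_eigenvalue_secular[OF O O' \<mu>(2)]) (use that(2) \<mu>(1) in simp)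
    then have "\<kappa>0 = sqrt (- \<mu>)"
      using secular_root_unique[OF O O' \<mu>(2) \<kappa>0(1)] \<kappa>0(2) by (simp add: M_def)
    then show ?thesis using \<mu>(1) by simp
  qed
  have S_ev0: "eigenvalue (S_op W \<alpha>) (- \<kappa>0\<^sup>2)"
  proof -
    have "secular R W \<alpha> \<kappa>0 = 0" using \<kappa>0(2) by (simp add: M_def)
    from eigenfunction_of_secular(1)[OF O O' \<kappa>0(1) this one_neq_zero]
    show ?thesis by (rule eigenvalueI)
  qed
  have unique: "\<exists>!\<mu>. \<mu> < 0 \<and> eigenvalue (S_op W \<alpha>) \<mu>"
    using S_ev S_ev0 \<kappa>0(1) by (intro ex1I[of _ "- \<kappa>0\<^sup>2"]) auto

  \<comment> \<open>A compact neighbourhood of the root, on which all estimates are uniform; the perturbed root is found inside.\<close>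
  define a where "a = \<kappa>0 / 2"
  define b where "b = 2 * \<kappa>0"
  have ab: "0 < a" "a \<le> b" "a < \<kappa>0" "\<kappa>0 < b" "0 < b" using \<kappa>0 by (auto simp: a_def b_def)
  have \<kappa>0i: "\<kappa>0 \<in> {a..b}" using ab by simp
  define V where "V = scaled_potential W U"
  define V' where "V' = scaled_potential ?W' ?U'"
  have refl: "(\<lambda>x. V \<epsilon> (- x)) = V' \<epsilon>" for \<epsilon>
    by (auto simp: V_def V'_def scaled_potential_def)
  obtain E1 \<epsilon>1 where X1: "0 < \<epsilon>1" "\<epsilon>1 \<le> 1" "0 \<le> E1"
    and O1: "\<And>\<epsilon>. 0 < \<epsilon> \<Longrightarrow> \<epsilon> < \<epsilon>1 \<Longrightarrow> oscillation_free R (V \<epsilon>)"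
    and m1: "\<And>\<epsilon> \<kappa>. 0 < \<epsilon> \<Longrightarrow> \<epsilon> < \<epsilon>1 \<Longrightarrow> \<kappa> \<in> {a..b} \<Longrightarrow>
      \<bar>mfun R (V \<epsilon>) \<kappa> - mfun R W \<kappa> - mass R U
        + \<epsilon> * (tail_energy R U + 2 * mfun R W \<kappa> * moment R U)\<bar> \<le> E1 * \<epsilon>\<^sup>2"
    and i1: "\<And>\<epsilon> \<kappa> x. 0 < \<epsilon> \<Longrightarrow> \<epsilon> < \<epsilon>1 \<Longrightarrow> \<kappa> \<in> {a..b} \<Longrightarrow> 0 \<le> x \<Longrightarrow> x \<le> \<epsilon> * R \<Longrightarrow>
      \<bar>jost_u R (V \<epsilon>) \<kappa> x\<bar> \<le> E1"
    and j1: "\<And>\<epsilon> \<kappa>. 0 < \<epsilon> \<Longrightarrow> \<epsilon> < \<epsilon>1 \<Longrightarrow> \<kappa> \<in> {a..b} \<Longrightarrow>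
      \<bar>jost_u R (V \<epsilon>) \<kappa> 0 - jost_u R W \<kappa> 0\<bar> \<le> E1 * \<epsilon>"
    and l1: "\<And>\<epsilon> \<kappa>. 0 < \<epsilon> \<Longrightarrow> \<epsilon> < \<epsilon>1 \<Longrightarrow> \<kappa> \<in> {a..b} \<Longrightarrow> exp (- b * R) / 2 \<le> jost_u R (V \<epsilon>) \<kappa> 0"
    by (rule half_line_expansion[OF Wp W(3) R U(1,2) U0 ab(1,2), folded V_def]) (rule that)
  obtain E2 \<epsilon>2 where X2: "0 < \<epsilon>2" "\<epsilon>2 \<le> 1" "0 \<le> E2"
    and O2: "\<And>\<epsilon>. 0 < \<epsilon> \<Longrightarrow> \<epsilon> < \<epsilon>2 \<Longrightarrow> oscillation_free R (V' \<epsilon>)"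
    and m2: "\<And>\<epsilon> \<kappa>. 0 < \<epsilon> \<Longrightarrow> \<epsilon> < \<epsilon>2 \<Longrightarrow> \<kappa> \<in> {a..b} \<Longrightarrow>
      \<bar>mfun R (V' \<epsilon>) \<kappa> - mfun R ?W' \<kappa> - mass R ?U'
        + \<epsilon> * (tail_energy R ?U' + 2 * mfun R ?W' \<kappa> * moment R ?U')\<bar> \<le> E2 * \<epsilon>\<^sup>2"
    and i2: "\<And>\<epsilon> \<kappa> x. 0 < \<epsilon> \<Longrightarrow> \<epsilon> < \<epsilon>2 \<Longrightarrow> \<kappa> \<in> {a..b} \<Longrightarrow> 0 \<le> x \<Longrightarrow> x \<le> \<epsilon> * R \<Longrightarrow>
      \<bar>jost_u R (V' \<epsilon>) \<kappa> x\<bar> \<le> E2"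
    and j2: "\<And>\<epsilon> \<kappa>. 0 < \<epsilon> \<Longrightarrow> \<epsilon> < \<epsilon>2 \<Longrightarrow> \<kappa> \<in> {a..b} \<Longrightarrow>
      \<bar>jost_u R (V' \<epsilon>) \<kappa> 0 - jost_u R ?W' \<kappa> 0\<bar> \<le> E2 * \<epsilon>"
    and l2: "\<And>\<epsilon> \<kappa>. 0 < \<epsilon> \<Longrightarrow> \<epsilon> < \<epsilon>2 \<Longrightarrow> \<kappa> \<in> {a..b} \<Longrightarrow> exp (- b * R) / 2 \<le> jost_u R (V' \<epsilon>) \<kappa> 0"
    by (rule half_line_expansion[OF W'p W'nn R U'm U'C U'0 ab(1,2), folded V'_def]) (rule that)
  define E where "E = E1 + E2"
  have E0: "0 \<le> E" using X1 X2 by (simp add: E_def)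

  define S where "S = (\<lambda>\<kappa>. (tail_energy R U + 2 * mfun R W \<kappa> * moment R U)
      + (tail_energy R ?U' + 2 * mfun R ?W' \<kappa> * moment R ?U'))"
  have M_exp: "\<bar>secular R (V \<epsilon>) 0 \<kappa> - M \<kappa> + \<epsilon> * S \<kappa>\<bar> \<le> E * \<epsilon>\<^sup>2"
    if "0 < \<epsilon>" "\<epsilon> < \<epsilon>1" "\<epsilon> < \<epsilon>2" "\<kappa> \<in> {a..b}" for \<epsilon> \<kappa>
  proof -
    have "secular R (V \<epsilon>) 0 \<kappa> - M \<kappa> + \<epsilon> * S \<kappa>
        = (mfun R (V \<epsilon>) \<kappa> - mfun R W \<kappa> - mass R U + \<epsilon> * (tail_energy R U + 2 * mfun R W \<kappa> * moment R U))
        + (mfun R (V' \<epsilon>) \<kappa> - mfun R ?W' \<kappa> - mass R ?U' + \<epsilon> * (tail_energy R ?U' + 2 * mfun R ?W' \<kappa> * moment R ?U'))"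
      using mom(1) \<alpha>(1) by (simp add: secular_def refl M_def S_def distrib_left)
    moreover have "E * \<epsilon>\<^sup>2 = E1 * \<epsilon>\<^sup>2 + E2 * \<epsilon>\<^sup>2" by (simp add: E_def distrib_right)
    ultimately show ?thesis using m1[OF that(1,2,4)] m2[OF that(1,3,4)] by linarith
  qed

  obtain L1 n1 where N1: "0 < n1"
    "\<And>\<kappa> \<kappa>'. \<kappa> \<in> {a..b} \<Longrightarrow> \<kappa>' \<in> {a..b} \<Longrightarrow> n1 \<le> normalized_overlap R W \<kappa> \<kappa>'"
    "\<And>\<kappa> \<kappa>'. \<kappa> \<in> {a..b} \<Longrightarrow> \<kappa>' \<in> {a..b} \<Longrightarrow> normalized_overlap R W \<kappa> \<kappa>' \<le> L1"
    "\<And>\<kappa> \<kappa>'. \<kappa> \<in> {a..b} \<Longrightarrow> \<kappa>' \<in> {a..b} \<Longrightarrow>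
      \<bar>normalized_overlap R W \<kappa> \<kappa>' - normalized_overlap R W \<kappa>' \<kappa>'\<bar> \<le> L1 * \<bar>\<kappa> - \<kappa>'\<bar>"
    "\<And>\<kappa> \<kappa>'. \<kappa> \<in> {a..b} \<Longrightarrow> \<kappa>' \<in> {a..b} \<Longrightarrow>
      mfun R W \<kappa> - mfun R W \<kappa>' = (\<kappa>\<^sup>2 - \<kappa>'\<^sup>2) * normalized_overlap R W \<kappa> \<kappa>'"
    by (rule normalized_overlap_estimates[OF Wp W(3) R0 ab(1,2)]) (rule that)
  obtain L2 n2 where N2: "0 < n2"
    "\<And>\<kappa> \<kappa>'. \<kappa> \<in> {a..b} \<Longrightarrow> \<kappa>' \<in> {a..b} \<Longrightarrow> n2 \<le> normalized_overlap R ?W' \<kappa> \<kappa>'"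
    "\<And>\<kappa> \<kappa>'. \<kappa> \<in> {a..b} \<Longrightarrow> \<kappa>' \<in> {a..b} \<Longrightarrow> normalized_overlap R ?W' \<kappa> \<kappa>' \<le> L2"
    "\<And>\<kappa> \<kappa>'. \<kappa> \<in> {a..b} \<Longrightarrow> \<kappa>' \<in> {a..b} \<Longrightarrow>
      \<bar>normalized_overlap R ?W' \<kappa> \<kappa>' - normalized_overlap R ?W' \<kappa>' \<kappa>'\<bar> \<le> L2 * \<bar>\<kappa> - \<kappa>'\<bar>"
    "\<And>\<kappa> \<kappa>'. \<kappa> \<in> {a..b} \<Longrightarrow> \<kappa>' \<in> {a..b} \<Longrightarrow>
      mfun R ?W' \<kappa> - mfun R ?W' \<kappa>' = (\<kappa>\<^sup>2 - \<kappa>'\<^sup>2) * normalized_overlap R ?W' \<kappa> \<kappa>'"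
    by (rule normalized_overlap_estimates[OF W'p W'nn R0 ab(1,2)]) (rule that)
  define N where "N = (\<lambda>\<kappa>. normalized_overlap R W \<kappa> \<kappa>0 + normalized_overlap R ?W' \<kappa> \<kappa>0)"
  define n0 where "n0 = n1 + n2"
  define L where "L = L1 + L2"
  have L12: "0 \<le> L1" "0 \<le> L2"
    using N1(1) N1(2,3)[OF \<kappa>0i \<kappa>0i] N2(1) N2(2,3)[OF \<kappa>0i \<kappa>0i] by linarith+
  have Nb: "n0 \<le> N \<kappa>" "\<bar>N \<kappa> - N \<kappa>0\<bar> \<le> L * \<bar>\<kappa> - \<kappa>0\<bar>" "M \<kappa> = (\<kappa>\<^sup>2 - \<kappa>0\<^sup>2) * N \<kappa>" if k: "\<kappa> \<in> {a..b}" for \<kappa>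
  proof -
    show "n0 \<le> N \<kappa>" using N1(2)[OF k \<kappa>0i] N2(2)[OF k \<kappa>0i] by (simp add: N_def n0_def)
    show "\<bar>N \<kappa> - N \<kappa>0\<bar> \<le> L * \<bar>\<kappa> - \<kappa>0\<bar>"
      using N1(4)[OF k \<kappa>0i] N2(4)[OF k \<kappa>0i] unfolding N_def L_def distrib_right by linarith
    have "M \<kappa> = M \<kappa> - M \<kappa>0" using \<kappa>0(2) by simp
    also have "\<dots> = (mfun R W \<kappa> - mfun R W \<kappa>0) + (mfun R ?W' \<kappa> - mfun R ?W' \<kappa>0)"
      by (simp add: M_def secular_def)
    also have "\<dots> = (\<kappa>\<^sup>2 - \<kappa>0\<^sup>2) * N \<kappa>"
      unfolding N1(5)[OF k \<kappa>0i] N2(5)[OF k \<kappa>0i] by (simp add: N_def distrib_left)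
    finally show "M \<kappa> = (\<kappa>\<^sup>2 - \<kappa>0\<^sup>2) * N \<kappa>" .
  qed
  have n0: "0 < n0" using N1(1) N2(1) by (simp add: n0_def)
  have lip: "\<bar>(\<kappa>\<^sup>2 - \<kappa>0\<^sup>2) * n\<bar> \<le> (2 * b * l) * \<bar>\<kappa> - \<kappa>0\<bar>"
    if k: "\<kappa> \<in> {a..b}" and n: "0 \<le> n" "n \<le> l" for \<kappa> n l
  proof -
    have "\<kappa>\<^sup>2 - \<kappa>0\<^sup>2 = (\<kappa> - \<kappa>0) * (\<kappa> + \<kappa>0)" by (simp add: power2_eq_square algebra_simps)
    then have "\<bar>(\<kappa>\<^sup>2 - \<kappa>0\<^sup>2) * n\<bar> = \<bar>\<kappa> - \<kappa>0\<bar> * ((\<kappa> + \<kappa>0) * n)"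
      using k ab n \<kappa>0 by (simp add: abs_mult)
    also have "\<dots> \<le> \<bar>\<kappa> - \<kappa>0\<bar> * ((2 * b) * l)"
      using k ab n \<kappa>0i by (intro mult_left_mono mult_mono) auto
    finally show ?thesis by (simp add: mult_ac)
  qed
  define LS where "LS = 2 * (2 * b * L1) * \<bar>moment R U\<bar> + 2 * (2 * b * L2) * \<bar>moment R ?U'\<bar>"
  have LS0: "0 \<le> LS" using L12 ab by (simp add: LS_def)
  have SL: "\<bar>S \<kappa> - S \<kappa>0\<bar> \<le> LS * \<bar>\<kappa> - \<kappa>0\<bar>" if k: "\<kappa> \<in> {a..b}" for \<kappa>
  proof -
    let ?d = "\<kappa>\<^sup>2 - \<kappa>0\<^sup>2"
    let ?p = "?d * normalized_overlap R W \<kappa> \<kappa>0" and ?q = "?d * normalized_overlap R ?W' \<kappa> \<kappa>0"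
    have "S \<kappa> - S \<kappa>0 = 2 * (mfun R W \<kappa> - mfun R W \<kappa>0) * moment R U
        + 2 * (mfun R ?W' \<kappa> - mfun R ?W' \<kappa>0) * moment R ?U'"
      by (simp add: S_def algebra_simps)
    then have "\<bar>S \<kappa> - S \<kappa>0\<bar> \<le> 2 * \<bar>?p\<bar> * \<bar>moment R U\<bar> + 2 * \<bar>?q\<bar> * \<bar>moment R ?U'\<bar>"
      unfolding N1(5)[OF k \<kappa>0i] N2(5)[OF k \<kappa>0i]
      using abs_triangle_ineq[of "2 * ?p * moment R U" "2 * ?q * moment R ?U'"]
      by (simp only: abs_mult abs_numeral)
    also have "\<dots> \<le> 2 * ((2 * b * L1) * \<bar>\<kappa> - \<kappa>0\<bar>) * \<bar>moment R U\<bar> + 2 * ((2 * b * L2) * \<bar>\<kappa> - \<kappa>0\<bar>) * \<bar>moment R ?U'\<bar>"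
      using lip[OF k _ N1(3)[OF k \<kappa>0i]] lip[OF k _ N2(3)[OF k \<kappa>0i]]
        N1(1) N1(2)[OF k \<kappa>0i] N2(1) N2(2)[OF k \<kappa>0i]
      by (intro add_mono mult_right_mono mult_left_mono) auto
    finally show ?thesis by (simp add: LS_def algebra_simps)
  qed
  define Sm where "Sm = \<bar>S \<kappa>0\<bar> + LS * b"
  have Sm0: "0 \<le> Sm" using LS0 ab by (simp add: Sm_def)
  have Sb: "\<bar>S \<kappa>\<bar> \<le> Sm" if k: "\<kappa> \<in> {a..b}" for \<kappa>
  proof -
    have "\<bar>\<kappa> - \<kappa>0\<bar> \<le> b" using k \<kappa>0i ab by auto
    then have "LS * \<bar>\<kappa> - \<kappa>0\<bar> \<le> LS * b" using LS0 by (intro mult_left_mono)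
    then show ?thesis using SL[OF k] by (simp add: Sm_def)
  qed

  have Ma: "M a < 0" using secular_strict_mono[OF O O' ab(1,3)] \<kappa>0 by (metis M_def)
  have Mb: "0 < M b" using secular_strict_mono[OF O O' \<kappa>0(1) ab(4)] \<kappa>0 by (metis M_def)
  define \<epsilon>3 where "\<epsilon>3 = min (min \<epsilon>1 \<epsilon>2) (min (- M a) (M b) / (Sm + E + 1))"
  have SE: "0 < Sm + E + 1" using Sm0 E0 by simp
  have \<epsilon>3: "0 < \<epsilon>3" "\<epsilon>3 \<le> \<epsilon>1" "\<epsilon>3 \<le> \<epsilon>2" "\<epsilon>3 \<le> 1" using X1 X2 Ma Mb SE by (auto simp: \<epsilon>3_def)
  have \<epsilon>3': "\<epsilon> * (Sm + E + 1) < - M a" "\<epsilon> * (Sm + E + 1) < M b" if "\<epsilon> < \<epsilon>3" for \<epsilon>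
  proof -
    have "\<epsilon> < min (- M a) (M b) / (Sm + E + 1)" using that by (simp add: \<epsilon>3_def)
    then have "\<epsilon> * (Sm + E + 1) < min (- M a) (M b)" using SE by (simp add: pos_less_divide_eq)
    then show "\<epsilon> * (Sm + E + 1) < - M a" "\<epsilon> * (Sm + E + 1) < M b" by auto
  qed
  have OV: "oscillation_free R (V \<epsilon>)" "oscillation_free R (\<lambda>x. V \<epsilon> (- x))" if "0 < \<epsilon>" "\<epsilon> < \<epsilon>3" for \<epsilon>
    using O1[of \<epsilon>] O2[of \<epsilon>] that \<epsilon>3 by (auto simp: refl)
  have "\<exists>\<kappa>. \<kappa> \<in> {a..b} \<and> secular R (V \<epsilon>) 0 \<kappa> = 0" if e: "0 < \<epsilon>" "\<epsilon> < \<epsilon>3" for \<epsilon>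
  proof -
    have e12: "\<epsilon> < \<epsilon>1" "\<epsilon> < \<epsilon>2" "\<epsilon> \<le> 1" using e \<epsilon>3 by auto
    have e2: "E * \<epsilon>\<^sup>2 \<le> E * \<epsilon>" using E0 e e12 by (intro mult_left_mono) (auto simp: power2_eq_square mult_left_le)
    have close: "\<bar>secular R (V \<epsilon>) 0 \<kappa> - M \<kappa>\<bar> \<le> \<epsilon> * (Sm + E + 1)" if k: "\<kappa> \<in> {a..b}" for \<kappa>
    proof -
      have "\<bar>\<epsilon> * S \<kappa>\<bar> \<le> \<epsilon> * Sm" using Sb[OF k] e by (simp add: abs_mult)
      moreover have "\<epsilon> * (Sm + E + 1) = \<epsilon> * Sm + E * \<epsilon> + \<epsilon>" by (simp add: algebra_simps)
      ultimately show ?thesis using M_exp[OF e(1) e12(1,2) k] e2 e(1) by linarith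
    qed
    have i: "a \<in> {a..b}" "b \<in> {a..b}" using ab by auto
    have "secular R (V \<epsilon>) 0 a \<le> 0" "0 \<le> secular R (V \<epsilon>) 0 b"
      using close[OF i(1)] close[OF i(2)] \<epsilon>3'[OF e(2)] by linarith+
    then have "\<exists>x\<ge>a. x \<le> b \<and> secular R (V \<epsilon>) 0 x = 0"
      using ab by (intro IVT' secular_continuous[OF OV[OF e]]) auto
    then show ?thesis by auto
  qed
  then obtain k where k: "\<And>\<epsilon>. 0 < \<epsilon> \<Longrightarrow> \<epsilon> < \<epsilon>3 \<Longrightarrow> k \<epsilon> \<in> {a..b}"
    and kr: "\<And>\<epsilon>. 0 < \<epsilon> \<Longrightarrow> \<epsilon> < \<epsilon>3 \<Longrightarrow> secular R (V \<epsilon>) 0 (k \<epsilon>) = 0"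
    by metis
  have k_pos: "0 < k \<epsilon>" if "0 < \<epsilon>" "\<epsilon> < \<epsilon>3" for \<epsilon> using k[OF that] ab by auto
  define Y where "Y = (Sm + E) / n0 / a"
  define Z where "Z = (E + (Sm + E) / n0 * L * ((Sm + E) / n0 / a) + LS * ((Sm + E) / n0 / a)) / n0"
  have asym: "\<bar>k \<epsilon> - \<kappa>0\<bar> \<le> Y * \<epsilon>" "\<bar>(\<kappa>0\<^sup>2 - (k \<epsilon>)\<^sup>2) + \<epsilon> * (S \<kappa>0 / N \<kappa>0)\<bar> \<le> Z * \<epsilon>\<^sup>2"
    if e: "0 < \<epsilon>" "\<epsilon> < \<epsilon>3" for \<epsilon>
  proof -
    have e12: "\<epsilon> < \<epsilon>1" "\<epsilon> < \<epsilon>2" "\<epsilon> \<le> 1" using e \<epsilon>3 by auto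
    have root: "\<bar>M (k \<epsilon>) - \<epsilon> * S (k \<epsilon>)\<bar> \<le> E * \<epsilon>\<^sup>2"
      using M_exp[OF e(1) e12(1,2) k[OF e]] kr[OF e] by (simp add: abs_minus_commute)
    have L0: "0 \<le> L" using L12 by (simp add: L_def)
    note P = perturbed_root_asymptotics[where M = M and S = S and N = N, OF ab(1) k[OF e] \<kappa>0i e(1) e12(3) root Nb(3)[OF k[OF e]] n0
        Nb(1)[OF k[OF e]] Nb(1)[OF \<kappa>0i] Nb(2)[OF k[OF e]] SL[OF k[OF e]] Sb[OF k[OF e]] L0 LS0 E0 Sm0]
    show "\<bar>k \<epsilon> - \<kappa>0\<bar> \<le> Y * \<epsilon>" using P(1) unfolding Y_def .
    show "\<bar>(\<kappa>0\<^sup>2 - (k \<epsilon>)\<^sup>2) + \<epsilon> * (S \<kappa>0 / N \<kappa>0)\<bar> \<le> Z * \<epsilon>\<^sup>2" using P(2) unfolding Z_def .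
  qed
  have ev: "\<forall>\<^sub>F \<epsilon> in at_right (0::real). 0 < \<epsilon> \<and> \<epsilon> < \<epsilon>3"
    using \<epsilon>3(1) by (auto simp: eventually_at_right_field)

  define \<Lambda> where "\<Lambda> = (\<lambda>\<epsilon>. - (k \<epsilon>)\<^sup>2)"
  have H_ef: "eigenfunction (H_op W U \<epsilon>) (\<Lambda> \<epsilon>) (\<lambda>x. complex_of_real (c * ground R (V \<epsilon>) (k \<epsilon>) x))"
    if e: "0 < \<epsilon>" "\<epsilon> < \<epsilon>3" and "c \<noteq> 0" for \<epsilon> c
    unfolding \<Lambda>_def
    by (rule eigenfunction_of_secular(2)[OF OV[OF e] k_pos[OF e] kr[OF e] that(3)]) (auto simp: V_def)
  have H_ev: "\<Lambda> \<epsilon> < 0 \<and> eigenvalue (H_op W U \<epsilon>) (\<Lambda> \<epsilon>) \<and>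
      (\<forall>\<nu> < 0. eigenvalue (H_op W U \<epsilon>) \<nu> \<longrightarrow> \<nu> = \<Lambda> \<epsilon>)" if e: "0 < \<epsilon>" "\<epsilon> < \<epsilon>3" for \<epsilon>
  proof (intro conjI allI impI)
    show "\<Lambda> \<epsilon> < 0" using k_pos[OF e] by (simp add: \<Lambda>_def)
    show "eigenvalue (H_op W U \<epsilon>) (\<Lambda> \<epsilon>)" by (rule eigenvalueI[OF H_ef[OF e one_neq_zero]])
    fix \<nu> :: real assume \<nu>: "\<nu> < 0" "eigenvalue (H_op W U \<epsilon>) \<nu>"
    have s: "\<nu> = - (sqrt (- \<nu>))\<^sup>2" "0 < sqrt (- \<nu>)" using \<nu>(1) by auto
    have "secular R (V \<epsilon>) 0 (sqrt (- \<nu>)) = 0"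
      unfolding V_def
      by (rule H_op_eigenvalue_secular[OF _ _ s(2)]) (use OV[OF e] \<nu>(2) s(1) in \<open>auto simp: V_def\<close>)
    then have "k \<epsilon> = sqrt (- \<nu>)"
      using secular_root_unique[OF OV[OF e] s(2) k_pos[OF e]] kr[OF e] by simp
    then show "\<nu> = \<Lambda> \<epsilon>" using s(1) by (simp add: \<Lambda>_def)
  qed

  define g0 where "g0 = ground R W \<kappa>0"
  \<comment> \<open>For other values of \<open>\<epsilon>\<close> a harmless default, so that measurability and the majorant hold for every \<open>\<epsilon>\<close>.\<close>
  define g where "g = (\<lambda>\<epsilon>. if 0 < \<epsilon> \<and> \<epsilon> < \<epsilon>3 then ground R (V \<epsilon>) (k \<epsilon>) else g0)"
  have g0m: "g0 \<in> borel_measurable lebesgue" unfolding g0_def by (rule ground_measurable[OF O O'])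
  have gm: "g \<epsilon> \<in> borel_measurable lebesgue" for \<epsilon>
    using g0m ground_measurable[OF OV] by (auto simp: g_def)
  have g_in: "g \<epsilon> = ground R (V \<epsilon>) (k \<epsilon>)" if "0 < \<epsilon>" "\<epsilon> < \<epsilon>3" for \<epsilon> using that by (simp add: g_def)
  obtain D0 where D0: "\<And>x. \<bar>g0 x\<bar> \<le> D0 * exp (- a * \<bar>x\<bar>)"
    by (rule ground_exp_bound[OF O O' ab(1) less_imp_le[OF ab(3)], folded g0_def]) (rule that)
  have below1: "\<bar>jost_u R (V \<epsilon>) \<kappa> 0 - jost_u R W \<kappa> 0\<bar> \<le> E1 * \<epsilon>"
      "0 \<le> x \<Longrightarrow> x \<le> \<epsilon> * R \<Longrightarrow> \<bar>jost_u R (V \<epsilon>) \<kappa> x\<bar> \<le> E1"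
      "exp (- b * R) / 2 \<le> jost_u R (V \<epsilon>) \<kappa> 0"
    if "0 < \<epsilon>" "\<epsilon> < \<epsilon>3" "\<kappa> \<in> {a..b}" for \<epsilon> \<kappa> x
    using j1[of \<epsilon> \<kappa>] i1[of \<epsilon> \<kappa> x] l1[of \<epsilon> \<kappa>] that \<epsilon>3 by auto
  obtain D1 where D1: "\<And>\<epsilon> x. 0 < \<epsilon> \<Longrightarrow> \<epsilon> < \<epsilon>3 \<Longrightarrow> 0 \<le> x \<Longrightarrow>
      \<bar>jost_u R (V \<epsilon>) (k \<epsilon>) x / jost_u R (V \<epsilon>) (k \<epsilon>) 0\<bar> \<le> D1 * exp (- a * x)"
    and c1: "\<And>x. 0 < x \<Longrightarrow> ((\<lambda>\<epsilon>. jost_u R (V \<epsilon>) (k \<epsilon>) x / jost_u R (V \<epsilon>) (k \<epsilon>) 0)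
      \<longlongrightarrow> jost_u R W \<kappa>0 x / jost_u R W \<kappa>0 0) (at_right 0)"
    by (rule half_ground_convergence[OF Wp W(3) R U(1,2) U0 ab(1,2) \<epsilon>3(1,4), of E1 k \<kappa>0 Y, folded V_def];
        (rule below1 k \<kappa>0i asym(1); assumption)?) (rule that)
  have below2: "\<bar>jost_u R (V' \<epsilon>) \<kappa> 0 - jost_u R ?W' \<kappa> 0\<bar> \<le> E2 * \<epsilon>"
      "0 \<le> x \<Longrightarrow> x \<le> \<epsilon> * R \<Longrightarrow> \<bar>jost_u R (V' \<epsilon>) \<kappa> x\<bar> \<le> E2"
      "exp (- b * R) / 2 \<le> jost_u R (V' \<epsilon>) \<kappa> 0"
    if "0 < \<epsilon>" "\<epsilon> < \<epsilon>3" "\<kappa> \<in> {a..b}" for \<epsilon> \<kappa> x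
    using j2[of \<epsilon> \<kappa>] i2[of \<epsilon> \<kappa> x] l2[of \<epsilon> \<kappa>] that \<epsilon>3 by auto
  obtain D2 where D2: "\<And>\<epsilon> x. 0 < \<epsilon> \<Longrightarrow> \<epsilon> < \<epsilon>3 \<Longrightarrow> 0 \<le> x \<Longrightarrow>
      \<bar>jost_u R (V' \<epsilon>) (k \<epsilon>) x / jost_u R (V' \<epsilon>) (k \<epsilon>) 0\<bar> \<le> D2 * exp (- a * x)"
    and c2: "\<And>x. 0 < x \<Longrightarrow> ((\<lambda>\<epsilon>. jost_u R (V' \<epsilon>) (k \<epsilon>) x / jost_u R (V' \<epsilon>) (k \<epsilon>) 0)
      \<longlongrightarrow> jost_u R ?W' \<kappa>0 x / jost_u R ?W' \<kappa>0 0) (at_right 0)"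
    by (rule half_ground_convergence[OF W'p W'nn R U'm U'C U'0 ab(1,2) \<epsilon>3(1,4), of E2 k \<kappa>0 Y, folded V'_def];
        (rule below2 k \<kappa>0i asym(1); assumption)?) (rule that)
  define D where "D = max D0 (max D1 D2)"
  have DD: "z \<le> D * exp (- a * x)" if "z \<le> d * exp (- a * x)" "d \<le> D" for z d x
    using that(1) mult_right_mono[OF that(2) exp_ge_zero[of "- a * x"]] by (rule order_trans)
  have gb: "\<bar>g \<epsilon> x\<bar> \<le> D * exp (- a * \<bar>x\<bar>)" for \<epsilon> x
  proof (cases "0 < \<epsilon> \<and> \<epsilon> < \<epsilon>3")
    case True
    then have e: "0 < \<epsilon>" "\<epsilon> < \<epsilon>3" by auto
    show ?thesis
    proof (cases "0 < x")
      case True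
      then show ?thesis using DD[OF D1[OF e, of x]] by (simp add: g_in[OF e] ground_def D_def)
    next
      case False
      then show ?thesis using DD[OF D2[OF e, of "- x"]] by (simp add: g_in[OF e] ground_def D_def refl)
    qed
  next
    case False
    then have "g \<epsilon> = g0" by (simp only: g_def if_False)
    moreover have "\<bar>g0 x\<bar> \<le> D * exp (- a * \<bar>x\<bar>)" by (rule DD[OF D0]) (simp add: D_def)
    ultimately show ?thesis by simp
  qed
  have g0b: "\<bar>g0 x\<bar> \<le> D * exp (- a * \<bar>x\<bar>)" for x by (rule DD[OF D0]) (simp add: D_def)
  have g_lim: "((\<lambda>\<epsilon>. g \<epsilon> x) \<longlongrightarrow> g0 x) (at_right 0)" if "x \<noteq> 0" for x
  proof (cases "0 < x")
    case True
    then have "((\<lambda>\<epsilon>. jost_u R (V \<epsilon>) (k \<epsilon>) x / jost_u R (V \<epsilon>) (k \<epsilon>) 0) \<longlongrightarrow> g0 x) (at_right 0)"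
      using c1[OF True] by (simp add: g0_def ground_def)
    then show ?thesis
      by (rule Lim_transform_eventually) (use ev True in \<open>auto elim!: eventually_mono simp: g_in ground_def\<close>)
  next
    case False
    then have "0 < - x" using that by simp
    then have "((\<lambda>\<epsilon>. jost_u R (V' \<epsilon>) (k \<epsilon>) (- x) / jost_u R (V' \<epsilon>) (k \<epsilon>) 0) \<longlongrightarrow> g0 x) (at_right 0)"
      using c2[of "- x"] by (simp add: g0_def ground_def)
    then show ?thesis
      by (rule Lim_transform_eventually) (use ev False in \<open>auto elim!: eventually_mono simp: g_in ground_def refl\<close>)
  qed
  define w where "w = (\<lambda>x. D\<^sup>2 * exp (- (2 * a) * \<bar>x\<bar>))"
  have wi: "integrable lebesgue w" unfolding w_def using exp_abs_integrable[of "2 * a"] ab by simp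
  have wb: "\<bar>p * q\<bar> \<le> w x" if "\<bar>p\<bar> \<le> D * exp (- a * \<bar>x\<bar>)" "\<bar>q\<bar> \<le> D * exp (- a * \<bar>x\<bar>)" for p q x
  proof -
    have "\<bar>p\<bar> * \<bar>q\<bar> \<le> (D * exp (- a * \<bar>x\<bar>)) * (D * exp (- a * \<bar>x\<bar>))"
      using that by (intro mult_mono) auto
    also have "\<dots> = w x" by (simp add: w_def power2_eq_square flip: exp_add)
    finally show ?thesis by (simp add: abs_mult)
  qed
  define n where "n = (\<integral>x. g0 x * g0 x \<partial>lebesgue)"
  define Q where "Q = (\<lambda>\<epsilon>. \<integral>x. g \<epsilon> x * g \<epsilon> x \<partial>lebesgue)"
  define P where "P = (\<lambda>\<epsilon>. \<integral>x. g \<epsilon> x * g0 x \<partial>lebesgue)"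
  have Q_lim: "(Q \<longlongrightarrow> n) (at_right 0)" unfolding Q_def n_def
  proof (rule dominated_convergence_at_right_0[OF _ _ _ _ wi])
    show "AE x in lebesgue. ((\<lambda>\<epsilon>. g \<epsilon> x * g \<epsilon> x) \<longlongrightarrow> g0 x * g0 x) (at_right 0)"
      using AE_nonzero by eventually_elim (intro tendsto_mult g_lim)
    show "\<forall>\<^sub>F \<epsilon> in at_right 0. \<forall>x. \<bar>g \<epsilon> x * g \<epsilon> x\<bar> \<le> w x"
      by (intro always_eventually allI wb gb)
  qed (use gm g0m in auto)
  have P_lim: "(P \<longlongrightarrow> n) (at_right 0)" unfolding P_def n_def
  proof (rule dominated_convergence_at_right_0[OF _ _ _ _ wi])
    show "AE x in lebesgue. ((\<lambda>\<epsilon>. g \<epsilon> x * g0 x) \<longlongrightarrow> g0 x * g0 x) (at_right 0)"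
      using AE_nonzero by eventually_elim (intro tendsto_mult tendsto_const g_lim)
    show "\<forall>\<^sub>F \<epsilon> in at_right 0. \<forall>x. \<bar>g \<epsilon> x * g0 x\<bar> \<le> w x"
      by (intro always_eventually allI wb gb g0b)
  qed (use gm g0m in auto)
  have int: "integrable lebesgue (\<lambda>x. p x * q x)"
    if "p \<in> borel_measurable lebesgue" "q \<in> borel_measurable lebesgue"
      "\<And>x. \<bar>p x\<bar> \<le> D * exp (- a * \<bar>x\<bar>)" "\<And>x. \<bar>q x\<bar> \<le> D * exp (- a * \<bar>x\<bar>)" for p q
    by (rule Bochner_Integration.integrable_bound[OF wi])
      (use that wb in \<open>auto intro!: AE_I2 order_trans[OF _ abs_ge_self]\<close>)
  have nN: "n = N \<kappa>0"
    using ground_norm(1)[OF O O' \<kappa>0(1)] by (simp add: n_def g0_def N_def normalized_overlap_def power2_eq_square)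
  have n_pos: "0 < n" using Nb(1)[OF \<kappa>0i] n0 by (simp add: nN)
  have Q_pos: "0 < Q \<epsilon>" if e: "0 < \<epsilon>" "\<epsilon> < \<epsilon>3" for \<epsilon>
  proof -
    have "Q \<epsilon> = overlap R (V \<epsilon>) (k \<epsilon>) (k \<epsilon>) / (jost_u R (V \<epsilon>) (k \<epsilon>) 0)\<^sup>2
        + overlap R (\<lambda>x. V \<epsilon> (- x)) (k \<epsilon>) (k \<epsilon>) / (jost_u R (\<lambda>x. V \<epsilon> (- x)) (k \<epsilon>) 0)\<^sup>2"
      using ground_norm(1)[OF OV[OF e] k_pos[OF e]] by (simp add: Q_def g_in[OF e] power2_eq_square)
    moreover have "0 < overlap R (V \<epsilon>) (k \<epsilon>) (k \<epsilon>) / (jost_u R (V \<epsilon>) (k \<epsilon>) 0)\<^sup>2"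
      using overlap_pos(2)[OF OV(1)[OF e] k_pos[OF e] k_pos[OF e]] oscillation_freeD(3)[OF OV(1)[OF e] k_pos[OF e], of 0]
      by simp
    moreover have "0 < overlap R (\<lambda>x. V \<epsilon> (- x)) (k \<epsilon>) (k \<epsilon>) / (jost_u R (\<lambda>x. V \<epsilon> (- x)) (k \<epsilon>) 0)\<^sup>2"
      using overlap_pos(2)[OF OV(2)[OF e] k_pos[OF e] k_pos[OF e]] oscillation_freeD(3)[OF OV(2)[OF e] k_pos[OF e], of 0]
      by simp
    ultimately show ?thesis by linarith
  qed

  have final: "(\<lambda>\<epsilon>. \<Lambda> \<epsilon> - (\<mu> + \<epsilon> *
              (1 / 2 * (right_limit0 \<psi>)\<^sup>2 *
                 (\<integral>t. (\<integral>\<tau>. U t * \<bar>t - \<tau>\<bar> * U \<tau> \<partial>lebesgue) \<partial>lebesgue)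
               + right_limit0 \<psi> *
                 (left_limit0 (weak_deriv (- {0}) 1 \<psi>) + right_limit0 (weak_deriv (- {0}) 1 \<psi>)) *
                 (\<integral>t. t * U t \<partial>lebesgue))))
            \<in> O[at_right 0](\<lambda>\<epsilon>. \<epsilon>\<^sup>2) \<and>
          (\<exists>\<psi>\<^sub>\<epsilon> :: real \<Rightarrow> real \<Rightarrow> complex.
             (\<forall>\<^sub>F \<epsilon> in at_right 0.
                eigenfunction (H_op W U \<epsilon>) (\<Lambda> \<epsilon>) (\<psi>\<^sub>\<epsilon> \<epsilon>) \<and> L2_norm (\<psi>\<^sub>\<epsilon> \<epsilon>) = 1) \<and>
             ((\<lambda>\<epsilon>. L2_norm (\<lambda>x. \<psi>\<^sub>\<epsilon> \<epsilon> x - complex_of_real (\<psi> x))) \<longlongrightarrow> 0) (at_right 0))"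
    if \<mu>: "\<mu> < 0" and ef: "eigenfunction (S_op W \<alpha>) \<mu> (\<lambda>x. complex_of_real (\<psi> x))" and norm1: "L2_norm \<psi> = 1"
    for \<mu> \<psi>
  proof -
    have \<mu>_eq: "\<mu> = - \<kappa>0\<^sup>2" using S_ev[OF \<mu>] ef by (auto simp: eigenvalue_def)
    obtain q where q: "AE x in lebesgue. \<psi> x = q * g0 x" "right_limit0 \<psi> = q"
      "right_limit0 (weak_deriv (- {0}) 1 \<psi>) = - (q * mfun R W \<kappa>0)"
      "left_limit0 (weak_deriv (- {0}) 1 \<psi>) = q * mfun R ?W' \<kappa>0"
      by (rule S_op_real_eigenfunction[OF O O' \<kappa>0(1) ef[unfolded \<mu>_eq], folded g0_def]) (rule that)
    have \<psi>m: "\<psi> \<in> borel_measurable lebesgue"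
      by (rule borel_measurable_AE[of "\<lambda>x. q * g0 x"]) (use g0m q(1) in \<open>auto elim: eventually_mono\<close>)
    have "(\<integral>x. (\<psi> x)\<^sup>2 \<partial>lebesgue) = (\<integral>x. q\<^sup>2 * (g0 x * g0 x) \<partial>lebesgue)"
      by (rule integral_cong_AE)
        (use \<psi>m g0m q(1) in \<open>auto elim!: eventually_mono simp: power2_eq_square\<close>)
    then have qn: "q\<^sup>2 * n = 1" using norm1 by (simp add: L2_norm_def n_def)
    have q0: "q \<noteq> 0" using qn by auto
    have coeff: "1 / 2 * (right_limit0 \<psi>)\<^sup>2 *
                 (\<integral>t. (\<integral>\<tau>. U t * \<bar>t - \<tau>\<bar> * U \<tau> \<partial>lebesgue) \<partial>lebesgue)
               + right_limit0 \<psi> *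
                 (left_limit0 (weak_deriv (- {0}) 1 \<psi>) + right_limit0 (weak_deriv (- {0}) 1 \<psi>)) *
                 (\<integral>t. t * U t \<partial>lebesgue) = - (S \<kappa>0 / N \<kappa>0)"
    proof -
      define A where "A = mass R U + mass R ?U'"
      have "A = \<alpha>" using mom(1) \<alpha>(1) by (simp add: A_def)
      also have "\<alpha> = - (mfun R W \<kappa>0 + mfun R ?W' \<kappa>0)" using \<kappa>0(2) by (simp add: M_def secular_def)
      finally have A: "A = - (mfun R W \<kappa>0 + mfun R ?W' \<kappa>0)" .
      have "q\<^sup>2 = 1 / N \<kappa>0" using qn n_pos by (simp add: nN field_simps)
      moreover have "1 / 2 * q\<^sup>2 * (2 * (A * (moment R U + moment R ?U') - tail_energy R U - tail_energy R ?U'))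
          + q * (q * mfun R ?W' \<kappa>0 + - (q * mfun R W \<kappa>0)) * (moment R U - moment R ?U') = - (q\<^sup>2 * S \<kappa>0)"
        unfolding A by (simp add: S_def algebra_simps power2_eq_square)
      ultimately show ?thesis
        unfolding q(2,3,4) mom(2,3) A_def by simp
    qed
    have "(\<lambda>\<epsilon>. \<Lambda> \<epsilon> - (\<mu> + \<epsilon> * - (S \<kappa>0 / N \<kappa>0))) \<in> O[at_right 0](\<lambda>\<epsilon>. \<epsilon>\<^sup>2)"
    proof (rule bigoI[of _ Z])
      show "\<forall>\<^sub>F \<epsilon> in at_right 0. norm (\<Lambda> \<epsilon> - (\<mu> + \<epsilon> * - (S \<kappa>0 / N \<kappa>0))) \<le> Z * norm (\<epsilon>\<^sup>2)"
        using ev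
      proof eventually_elim
        case (elim \<epsilon>)
        have "\<Lambda> \<epsilon> - (\<mu> + \<epsilon> * - (S \<kappa>0 / N \<kappa>0)) = (\<kappa>0\<^sup>2 - (k \<epsilon>)\<^sup>2) + \<epsilon> * (S \<kappa>0 / N \<kappa>0)"
          by (simp add: \<Lambda>_def \<mu>_eq)
        then show ?case using asym(2)[of \<epsilon>] elim by simp
      qed
    qed
    moreover
    \<comment> \<open>The sign of the eigenfunction is determined only up to a choice; it is fixed by the sign of \<open>\<psi>\<close> at the origin.\<close>
    define c where "c = (\<lambda>\<epsilon>. sgn q / sqrt (Q \<epsilon>))"
    define \<psi>\<^sub>\<epsilon> where "\<psi>\<^sub>\<epsilon> = (\<lambda>\<epsilon> x. complex_of_real (c \<epsilon> * g \<epsilon> x))"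
    have c2: "c \<epsilon> * c \<epsilon> = 1 / Q \<epsilon>" "c \<epsilon> \<noteq> 0" if "0 < \<epsilon>" "\<epsilon> < \<epsilon>3" for \<epsilon>
      using Q_pos[OF that] q0 by (auto simp: c_def sgn_if)
    have "\<forall>\<^sub>F \<epsilon> in at_right 0. eigenfunction (H_op W U \<epsilon>) (\<Lambda> \<epsilon>) (\<psi>\<^sub>\<epsilon> \<epsilon>) \<and> L2_norm (\<psi>\<^sub>\<epsilon> \<epsilon>) = 1"
      using ev
    proof eventually_elim
      case (elim \<epsilon>)
      then have e: "0 < \<epsilon>" "\<epsilon> < \<epsilon>3" by auto
      have "eigenfunction (H_op W U \<epsilon>) (\<Lambda> \<epsilon>) (\<psi>\<^sub>\<epsilon> \<epsilon>)"
        unfolding \<psi>\<^sub>\<epsilon>_def g_in[OF e] by (rule H_ef[OF e c2(2)[OF e]])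
      moreover have "L2_norm (\<psi>\<^sub>\<epsilon> \<epsilon>) = 1"
      proof -
        have "(\<integral>x. (norm (\<psi>\<^sub>\<epsilon> \<epsilon> x))\<^sup>2 \<partial>lebesgue) = (\<integral>x. (c \<epsilon> * c \<epsilon>) * (g \<epsilon> x * g \<epsilon> x) \<partial>lebesgue)"
          by (rule Bochner_Integration.integral_cong) (simp_all add: \<psi>\<^sub>\<epsilon>_def norm_mult power_mult_distrib, simp_all add: power2_eq_square)
        also have "\<dots> = (c \<epsilon> * c \<epsilon>) * Q \<epsilon>" by (simp add: Q_def)
        also have "\<dots> = 1" using c2(1)[OF e] Q_pos[OF e] by simp
        finally show ?thesis by (simp add: L2_norm_def)
      qed
      ultimately show ?case by blast
    qed
    moreover have "((\<lambda>\<epsilon>. L2_norm (\<lambda>x. \<psi>\<^sub>\<epsilon> \<epsilon> x - complex_of_real (\<psi> x))) \<longlongrightarrow> 0) (at_right 0)"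
    proof -
      have "((\<lambda>\<epsilon>. sqrt (2 - 2 * (\<bar>q\<bar> / sqrt (Q \<epsilon>)) * P \<epsilon>)) \<longlongrightarrow> sqrt (2 - 2 * (\<bar>q\<bar> / sqrt n) * n)) (at_right 0)"
        using n_pos by (intro tendsto_intros Q_lim P_lim) auto
      moreover have "2 - 2 * (\<bar>q\<bar> / sqrt n) * n = 0"
      proof -
        have "(\<bar>q\<bar> / sqrt n) * n = \<bar>q\<bar> * sqrt n"
          using real_div_sqrt[of n] n_pos by (simp flip: times_divide_eq_right)
        also have "\<dots> = sqrt (q\<^sup>2 * n)" by (simp add: real_sqrt_mult)
        finally have 1: "(\<bar>q\<bar> / sqrt n) * n = 1" using qn by (simp only: real_sqrt_one)
        show ?thesis by (subst mult.assoc) (simp only: 1 mult_1_right diff_self)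
      qed
      ultimately have "((\<lambda>\<epsilon>. sqrt (2 - 2 * (\<bar>q\<bar> / sqrt (Q \<epsilon>)) * P \<epsilon>)) \<longlongrightarrow> 0) (at_right 0)" by simp
      then show ?thesis
      proof (rule Lim_transform_eventually)
        show "\<forall>\<^sub>F \<epsilon> in at_right 0. sqrt (2 - 2 * (\<bar>q\<bar> / sqrt (Q \<epsilon>)) * P \<epsilon>)
            = L2_norm (\<lambda>x. \<psi>\<^sub>\<epsilon> \<epsilon> x - complex_of_real (\<psi> x))"
          using ev
        proof eventually_elim
          case (elim \<epsilon>)
          then have e: "0 < \<epsilon>" "\<epsilon> < \<epsilon>3" by auto
          have "(\<integral>x. (norm (\<psi>\<^sub>\<epsilon> \<epsilon> x - complex_of_real (\<psi> x)))\<^sup>2 \<partial>lebesgue) = (\<integral>x. (c \<epsilon> * g \<epsilon> x - \<psi> x)\<^sup>2 \<partial>lebesgue)"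
            by (rule Bochner_Integration.integral_cong)
              (auto simp: \<psi>\<^sub>\<epsilon>_def power2_abs simp flip: of_real_mult of_real_diff)
          also have "\<dots> = (\<integral>x. (c \<epsilon> * c \<epsilon>) * (g \<epsilon> x * g \<epsilon> x) - (2 * c \<epsilon> * q) * (g \<epsilon> x * g0 x)
              + q\<^sup>2 * (g0 x * g0 x) \<partial>lebesgue)"
            by (rule integral_cong_AE)
              (use \<psi>m g0m gm q(1) in \<open>auto elim!: eventually_mono simp: power2_eq_square algebra_simps\<close>)
          also have "\<dots> = (c \<epsilon> * c \<epsilon>) * Q \<epsilon> - (2 * c \<epsilon> * q) * P \<epsilon> + q\<^sup>2 * n"
            using int[OF gm gm gb gb] int[OF gm g0m gb g0b] int[OF g0m g0m g0b g0b]
            by (simp add: Q_def P_def n_def)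
          also have "\<dots> = 2 - 2 * (\<bar>q\<bar> / sqrt (Q \<epsilon>)) * P \<epsilon>"
            using c2(1)[OF e] Q_pos[OF e] qn by (simp add: c_def abs_sgn mult.commute)
          finally show ?case by (simp add: L2_norm_def)
        qed
      qed
    qed
    ultimately show ?thesis unfolding coeff by blast
  qed
  show ?thesis
    using unique H_ev final ev
    by (intro conjI exI[of _ \<Lambda>] allI impI) (auto elim: eventually_mono)
qed

section \<open>From bounded to essentially bounded potentials\<close>

text \<open>Completeness of the measure makes measurability pass between the two functions, and for nonmeasurable ones both integrals
  have the default value \<open>0\<close>.\<close>

lemma integral_cong_AE_lebesgue:
  fixes f g :: "real \<Rightarrow> real"
  assumes ae: "AE x in lebesgue. f x = g x"
  shows "(\<integral>x. f x \<partial>lebesgue) = (\<integral>x. g x \<partial>lebesgue)"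
proof (cases "f \<in> borel_measurable lebesgue")
  case True
  then show ?thesis by (intro integral_cong_AE borel_measurable_AE[OF True ae] ae)
next
  case False
  have "AE x in lebesgue. g x = f x" using ae by eventually_elim simp
  then have "g \<notin> borel_measurable lebesgue" using False borel_measurable_AE by blast
  then show ?thesis using False by (metis borel_measurable_integrable not_integrable_integral_eq)
qed

text \<open>Eigenfunctions and all integrals are insensitive to null sets, while the pointwise estimates for Jost
  solutions call for bounds that hold everywhere.\<close>

lemma bounded_representative:
  assumes "Linf_compact_support V"
  obtains V' R C where "0 < R" "V' \<in> borel_measurable lebesgue" "AE x in lebesgue. V x = V' x"
    "\<And>x. \<bar>V' x\<bar> \<le> C" "\<And>x. R \<le> \<bar>x\<bar> \<Longrightarrow> V' x = 0"
proof -
  obtain C K where V: "V \<in> borel_measurable lebesgue" and C: "AE x in lebesgue. \<bar>V x\<bar> \<le> C"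
    and K: "compact K" "AE x in lebesgue. x \<notin> K \<longrightarrow> V x = 0"
    using assms unfolding Linf_compact_support_def by blast
  obtain R where R: "0 < R" "\<forall>x\<in>K. norm x < R"
    using compact_imp_bounded[OF K(1)] bounded_pos_less by blast
  define V' where "V' = (\<lambda>x. if \<bar>x\<bar> < R \<and> \<bar>V x\<bar> \<le> C then V x else 0)"
  have ae: "AE x in lebesgue. V x = V' x"
    using C K(2) by eventually_elim (use R(2) in \<open>auto simp: V'_def\<close>)
  show thesis
  proof
    show "V' \<in> borel_measurable lebesgue" by (rule borel_measurable_AE[OF V ae])
    show "\<bar>V' x\<bar> \<le> \<bar>C\<bar>" for x by (auto simp: V'_def)
    show "V' x = 0" if "R \<le> \<bar>x\<bar>" for x using that by (simp add: V'_def)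
  qed (fact R(1) ae)+
qed

lemma integrable_bounded_support:
  fixes h :: "real \<Rightarrow> real"
  assumes h: "h \<in> borel_measurable lebesgue" "\<And>x. \<bar>h x\<bar> \<le> C" "\<And>x. R \<le> \<bar>x\<bar> \<Longrightarrow> h x = 0"
  shows "integrable lebesgue h"
proof (rule Bochner_Integration.integrable_bound)
  have "integrable lebesgue (indicator (cbox (- R) R) :: real \<Rightarrow> real)"
    using lmeasurable_cbox by (simp only: lmeasurable_iff_integrable)
  then show "integrable lebesgue (\<lambda>x. C * indicator (cbox (- R) R) x :: real)" by simp
  have C0: "0 \<le> C" using order_trans[OF abs_ge_zero h(2)] .
  show "AE x in lebesgue. norm (h x) \<le> norm (C * indicator (cbox (- R) R) x)"
    using h(2,3) C0 by (intro AE_I2) (auto simp: indicator_def abs_le_iff not_le)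
qed (rule h(1))

text \<open>Strictness comes from the linear term, the exponential weight being nondecreasing in the parameter. Thus \<open>\<alpha> < \<alpha>\<^sub>0\<close> means that \<open>f_fun\<close> is
  negative at \<open>\<alpha>\<close>.\<close>

lemma f_fun_mono:
  assumes W: "W \<in> borel_measurable lebesgue" "\<And>x. \<bar>W x\<bar> \<le> C" "\<And>x. 0 \<le> W x"
    "\<forall>x. R \<le> \<bar>x\<bar> \<longrightarrow> W x = 0" and \<alpha>: "\<alpha> < \<alpha>'" "\<alpha>' \<le> 0"
  shows "f_fun W \<alpha> < f_fun W \<alpha>'"
proof -
  have int: "integrable lebesgue (\<lambda>x. W x * exp (s * \<bar>x\<bar>))" if "s \<le> 0" for s
  proof (rule integrable_bounded_support)
    have "(\<lambda>x. exp (s * \<bar>x\<bar>)) \<in> borel_measurable lebesgue"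
      by (intro measurable_completion) simp
    with W(1) show "(\<lambda>x. W x * exp (s * \<bar>x\<bar>)) \<in> borel_measurable lebesgue" by (rule borel_measurable_times)
    show "\<bar>W x * exp (s * \<bar>x\<bar>)\<bar> \<le> C" for x
    proof -
      have "\<bar>W x\<bar> * exp (s * \<bar>x\<bar>) \<le> \<bar>W x\<bar> * 1"
        using that by (intro mult_left_mono) (auto simp: mult_nonpos_nonneg)
      then show ?thesis using W(2)[of x] by (simp add: abs_mult)
    qed
    show "W x * exp (s * \<bar>x\<bar>) = 0" if "R \<le> \<bar>x\<bar>" for x using W(4) that by simp
  qed
  have "(\<integral>x. W x * exp (\<alpha> * \<bar>x\<bar>) \<partial>lebesgue) \<le> (\<integral>x. W x * exp (\<alpha>' * \<bar>x\<bar>) \<partial>lebesgue)"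
  proof (rule integral_mono)
    show "W x * exp (\<alpha> * \<bar>x\<bar>) \<le> W x * exp (\<alpha>' * \<bar>x\<bar>)" for x
      using \<alpha>(1) W(3) by (intro mult_left_mono) (auto intro: mult_right_mono)
  qed (use int \<alpha> in auto)
  then show ?thesis using \<alpha>(1) by (simp add: f_fun_def)
qed

theorem theorem4:
  fixes W U :: "real \<Rightarrow> real" and \<alpha>\<^sub>0 \<alpha> :: real
  assumes W: "Linf_compact_support W"
    and U: "Linf_compact_support U"
    and W_nonneg: "AE x in lebesgue. W x \<ge> 0"
    and \<alpha>\<^sub>0: "\<alpha>\<^sub>0 \<le> 0" "f_fun W \<alpha>\<^sub>0 = 0"
    and \<alpha>: "\<alpha> = (\<integral>x. U x \<partial>lebesgue)"
    and less: "\<alpha> < \<alpha>\<^sub>0"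
  shows "(\<exists>!\<mu>. \<mu> < 0 \<and> eigenvalue (S_op W \<alpha>) \<mu>) \<and>
    (\<exists>\<Lambda> :: real \<Rightarrow> real.
       (\<forall>\<^sub>F \<epsilon> in at_right 0.
          \<Lambda> \<epsilon> < 0 \<and> eigenvalue (H_op W U \<epsilon>) (\<Lambda> \<epsilon>) \<and>
          (\<forall>\<nu> < 0. eigenvalue (H_op W U \<epsilon>) \<nu> \<longrightarrow> \<nu> = \<Lambda> \<epsilon>)) \<and>
       (\<forall>(\<mu>::real) (\<psi> :: real \<Rightarrow> real).
          \<mu> < 0 \<and> eigenfunction (S_op W \<alpha>) \<mu> (\<lambda>x. complex_of_real (\<psi> x)) \<and> L2_norm \<psi> = 1 \<longrightarrow>
          (\<lambda>\<epsilon>. \<Lambda> \<epsilon> - (\<mu> + \<epsilon> *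
              (1 / 2 * (right_limit0 \<psi>)\<^sup>2 *
                 (\<integral>t. (\<integral>\<tau>. U t * \<bar>t - \<tau>\<bar> * U \<tau> \<partial>lebesgue) \<partial>lebesgue)
               + right_limit0 \<psi> *
                 (left_limit0 (weak_deriv (- {0}) 1 \<psi>) + right_limit0 (weak_deriv (- {0}) 1 \<psi>)) *
                 (\<integral>t. t * U t \<partial>lebesgue))))
            \<in> O[at_right 0](\<lambda>\<epsilon>. \<epsilon>\<^sup>2) \<and>
          (\<exists>\<psi>\<^sub>\<epsilon> :: real \<Rightarrow> real \<Rightarrow> complex.
             (\<forall>\<^sub>F \<epsilon> in at_right 0.
                eigenfunction (H_op W U \<epsilon>) (\<Lambda> \<epsilon>) (\<psi>\<^sub>\<epsilon> \<epsilon>) \<and> L2_norm (\<psi>\<^sub>\<epsilon> \<epsilon>) = 1) \<and>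
             ((\<lambda>\<epsilon>. L2_norm (\<lambda>x. \<psi>\<^sub>\<epsilon> \<epsilon> x - complex_of_real (\<psi> x))) \<longlongrightarrow> 0) (at_right 0))))"
proof -
  obtain W1 R1 CW where R1: "0 < R1" and W1: "W1 \<in> borel_measurable lebesgue"
      "AE x in lebesgue. W x = W1 x" "\<And>x. \<bar>W1 x\<bar> \<le> CW" "\<And>x. R1 \<le> \<bar>x\<bar> \<Longrightarrow> W1 x = 0"
    by (rule bounded_representative[OF W]) (rule that)
  obtain U' R2 CU where R2: "0 < R2" and U': "U' \<in> borel_measurable lebesgue"
      "AE x in lebesgue. U x = U' x" "\<And>x. \<bar>U' x\<bar> \<le> CU" "\<And>x. R2 \<le> \<bar>x\<bar> \<Longrightarrow> U' x = 0"
    by (rule bounded_representative[OF U]) (rule that)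
  define R where "R = max R1 R2"
  \<comment> \<open>The absolute value makes the representative nonnegative at every point.\<close>
  define W' where "W' = (\<lambda>x. \<bar>W1 x\<bar>)"
  have R: "0 < R" using R1 by (simp add: R_def)
  have W': "W' \<in> borel_measurable lebesgue" "\<And>x. \<bar>W' x\<bar> \<le> CW" "\<And>x. 0 \<le> W' x"
      "\<forall>x. R \<le> \<bar>x\<bar> \<longrightarrow> W' x = 0"
    using W1 by (auto simp: W'_def R_def)
  have U'R: "\<forall>x. R \<le> \<bar>x\<bar> \<longrightarrow> U' x = 0" using U'(4) by (simp add: R_def)
  have WW': "AE x in lebesgue. W x = W' x"
    using W1(2) W_nonneg by eventually_elim (simp add: W'_def)
  have W'W: "AE x in lebesgue. W' x = W x" using WW' by eventually_elim simp
  have UU': "AE x in lebesgue. U x = U' x" by (rule U'(2))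
  have U'U: "AE x in lebesgue. U' x = U x" using UU' by eventually_elim simp

  have \<alpha>': "\<alpha> = (\<integral>x. U' x \<partial>lebesgue)" unfolding \<alpha> by (rule integral_cong_AE_lebesgue[OF UU'])
  have "(\<integral>x. W x * exp (\<alpha>\<^sub>0 * \<bar>x\<bar>) \<partial>lebesgue) = (\<integral>x. W' x * exp (\<alpha>\<^sub>0 * \<bar>x\<bar>) \<partial>lebesgue)"
    by (rule integral_cong_AE_lebesgue) (use WW' in eventually_elim, simp)
  then have "f_fun W' \<alpha>\<^sub>0 = 0" using \<alpha>\<^sub>0(2) by (simp add: f_fun_def)
  then have f: "f_fun W' \<alpha> < 0" using f_fun_mono[OF W' less \<alpha>\<^sub>0(1)] by simp
  have neg: "\<alpha> < 0" using less \<alpha>\<^sub>0(1) by simp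

  have S_eq: "eigenfunction (S_op W \<alpha>) \<mu> y = eigenfunction (S_op W' \<alpha>) \<mu> y" for \<mu> y
    using eigenfunction_S_op_cong[OF WW'] eigenfunction_S_op_cong[OF W'W] by blast
  have H_eq: "eigenfunction (H_op W U \<epsilon>) \<mu> y = eigenfunction (H_op W' U' \<epsilon>) \<mu> y" if "0 < \<epsilon>" for \<epsilon> \<mu> y
    using eigenfunction_H_op_cong[OF WW' UU'] eigenfunction_H_op_cong[OF W'W U'U] less_imp_neq[OF that]
    by (intro iffI) auto
  have Hv_eq: "eigenvalue (H_op W U \<epsilon>) \<mu> = eigenvalue (H_op W' U' \<epsilon>) \<mu>" if "0 < \<epsilon>" for \<epsilon> \<mu>
    using H_eq[OF that] by (simp add: eigenvalue_def)
  have inner: "(\<integral>\<tau>. U t * \<bar>t - \<tau>\<bar> * U \<tau> \<partial>lebesgue) = (\<integral>\<tau>. U t * \<bar>t - \<tau>\<bar> * U' \<tau> \<partial>lebesgue)" for t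
    by (rule integral_cong_AE_lebesgue) (use UU' in eventually_elim, simp)
  have double: "(\<integral>t. (\<integral>\<tau>. U t * \<bar>t - \<tau>\<bar> * U \<tau> \<partial>lebesgue) \<partial>lebesgue)
      = (\<integral>t. (\<integral>\<tau>. U' t * \<bar>t - \<tau>\<bar> * U' \<tau> \<partial>lebesgue) \<partial>lebesgue)"
    unfolding inner by (rule integral_cong_AE_lebesgue) (use UU' in eventually_elim, simp)
  have first: "(\<integral>t. t * U t \<partial>lebesgue) = (\<integral>t. t * U' t \<partial>lebesgue)"
    by (rule integral_cong_AE_lebesgue) (use UU' in eventually_elim, simp)

  note B = spectral_asymptotics_bounded[OF R W' U'(1,3) U'R \<alpha>' neg f]
  from B obtain \<Lambda> where
    1: "\<forall>\<^sub>F \<epsilon> in at_right 0. \<Lambda> \<epsilon> < 0 \<and> eigenvalue (H_op W' U' \<epsilon>) (\<Lambda> \<epsilon>) \<and>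
          (\<forall>\<nu> < 0. eigenvalue (H_op W' U' \<epsilon>) \<nu> \<longrightarrow> \<nu> = \<Lambda> \<epsilon>)"
    and 2: "\<And>\<mu> \<psi>. \<mu> < 0 \<and> eigenfunction (S_op W' \<alpha>) \<mu> (\<lambda>x. complex_of_real (\<psi> x)) \<and> L2_norm \<psi> = 1 \<Longrightarrow>
          (\<lambda>\<epsilon>. \<Lambda> \<epsilon> - (\<mu> + \<epsilon> *
              (1 / 2 * (right_limit0 \<psi>)\<^sup>2 *
                 (\<integral>t. (\<integral>\<tau>. U' t * \<bar>t - \<tau>\<bar> * U' \<tau> \<partial>lebesgue) \<partial>lebesgue)
               + right_limit0 \<psi> *
                 (left_limit0 (weak_deriv (- {0}) 1 \<psi>) + right_limit0 (weak_deriv (- {0}) 1 \<psi>)) *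
                 (\<integral>t. t * U' t \<partial>lebesgue))))
            \<in> O[at_right 0](\<lambda>\<epsilon>. \<epsilon>\<^sup>2) \<and>
          (\<exists>\<psi>\<^sub>\<epsilon> :: real \<Rightarrow> real \<Rightarrow> complex.
             (\<forall>\<^sub>F \<epsilon> in at_right 0.
                eigenfunction (H_op W' U' \<epsilon>) (\<Lambda> \<epsilon>) (\<psi>\<^sub>\<epsilon> \<epsilon>) \<and> L2_norm (\<psi>\<^sub>\<epsilon> \<epsilon>) = 1) \<and>
             ((\<lambda>\<epsilon>. L2_norm (\<lambda>x. \<psi>\<^sub>\<epsilon> \<epsilon> x - complex_of_real (\<psi> x))) \<longlongrightarrow> 0) (at_right 0))"
    by (elim conjE exE) blast
  have pos: "\<forall>\<^sub>F \<epsilon> in at_right (0::real). 0 < \<epsilon>" by (rule eventually_at_right_less)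
  have Hef: "\<forall>\<^sub>F \<epsilon> in at_right 0. eigenfunction (H_op W U \<epsilon>) (\<Lambda> \<epsilon>) (\<phi> \<epsilon>) \<and> L2_norm (\<phi> \<epsilon>) = 1"
    if "\<forall>\<^sub>F \<epsilon> in at_right 0. eigenfunction (H_op W' U' \<epsilon>) (\<Lambda> \<epsilon>) (\<phi> \<epsilon>) \<and> L2_norm (\<phi> \<epsilon>) = 1" for \<phi>
    using that pos by eventually_elim (simp add: H_eq)
  show ?thesis
  proof (intro conjI exI[of _ \<Lambda>] allI impI)
    show "\<exists>!\<mu>. \<mu> < 0 \<and> eigenvalue (S_op W \<alpha>) \<mu>"
      using B unfolding eigenvalue_def S_eq by (rule conjunct1)
    show "\<forall>\<^sub>F \<epsilon> in at_right 0. \<Lambda> \<epsilon> < 0 \<and> eigenvalue (H_op W U \<epsilon>) (\<Lambda> \<epsilon>) \<and>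
          (\<forall>\<nu> < 0. eigenvalue (H_op W U \<epsilon>) \<nu> \<longrightarrow> \<nu> = \<Lambda> \<epsilon>)"
      using 1 pos by eventually_elim (simp add: Hv_eq)
  next
    fix \<mu> :: real and \<psi> :: "real \<Rightarrow> real"
    assume "\<mu> < 0 \<and> eigenfunction (S_op W \<alpha>) \<mu> (\<lambda>x. complex_of_real (\<psi> x)) \<and> L2_norm \<psi> = 1"
    note 3 = 2[OF this[unfolded S_eq]]
    show "(\<lambda>\<epsilon>. \<Lambda> \<epsilon> - (\<mu> + \<epsilon> *
              (1 / 2 * (right_limit0 \<psi>)\<^sup>2 *
                 (\<integral>t. (\<integral>\<tau>. U t * \<bar>t - \<tau>\<bar> * U \<tau> \<partial>lebesgue) \<partial>lebesgue)
               + right_limit0 \<psi> *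
                 (left_limit0 (weak_deriv (- {0}) 1 \<psi>) + right_limit0 (weak_deriv (- {0}) 1 \<psi>)) *
                 (\<integral>t. t * U t \<partial>lebesgue))))
            \<in> O[at_right 0](\<lambda>\<epsilon>. \<epsilon>\<^sup>2)"
      unfolding double first using 3 by (rule conjunct1)
    show "\<exists>\<psi>\<^sub>\<epsilon> :: real \<Rightarrow> real \<Rightarrow> complex.
             (\<forall>\<^sub>F \<epsilon> in at_right 0.
                eigenfunction (H_op W U \<epsilon>) (\<Lambda> \<epsilon>) (\<psi>\<^sub>\<epsilon> \<epsilon>) \<and> L2_norm (\<psi>\<^sub>\<epsilon> \<epsilon>) = 1) \<and>
             ((\<lambda>\<epsilon>. L2_norm (\<lambda>x. \<psi>\<^sub>\<epsilon> \<epsilon> x - complex_of_real (\<psi> x))) \<longlongrightarrow> 0) (at_right 0)"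
      using conjunct2[OF 3] Hef by blast
  qed
qed

end
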